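(* Let $X$ be a connected CW-complex with finite $k$-skeleton ($k\ge 1$), let $G=\pi_1(X)$, and let $\Bbbk$ be a field. (1) Let $\rho\colon G\to\Bbbk^\times$ be a homomorphism such that $\rho\in\bigcup_{i\le q}\mathcal{V}^i_1(X,\Bbbk)$, for some $q\le k$, and let $v\colon\Bbbk^\times\to\mathbb{R}$ be a valuation on $\Bbbk$ such that $v\circ\rho\neq 0$. Then $v\circ\rho\notin\Sigma^q(X,\mathbb{Z})$. (2) Let $\chi\colon G\to\mathbb{R}$ be an additive character such that $-\chi\in\Sigma^q(X,\mathbb{Z})$, for some $q\le k$, and factor $\chi=\iota\circ\xi$, where $\Gamma=\mathrm{im}(\chi)$, $\xi\colon G\twoheadrightarrow\Gamma$ is the corestriction of $\chi$ and $\iota\colon\Gamma\hookrightarrow\mathbb{R}$ is the inclusion. Let $\rho\colon\Gamma\to\Bbbk^\times$ be a character which is not an algebraic integer. Then $\rho\circ\xi\notin\bigcup_{i\le q}\mathcal{V}^i_1(X,\Bbbk)$.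
   Context: Homology with coefficients: let $\widetilde X$ be the universal cover of $X$, with $G=\pi_1(X)$ acting by deck transformations, so that the cellular chain complex $C_\bullet(\widetilde X,\mathbb{Z})$ consists of free left $\mathbb{Z}G$-modules. For a right $\mathbb{Z}G$-module $A$, $H_i(X,A):=H_i(A\otimes_{\mathbb{Z}G}C_\bullet(\widetilde X,\mathbb{Z}))$. Characteristic varieties: for $\rho\colon G\to\Bbbk^\times$, $\Bbbk_\rho$ is $\Bbbk$ with $G$ acting through $\rho$, and $\mathcal{V}^i_1(X,\Bbbk)=\{\rho\in\mathrm{Hom}(G,\Bbbk^\times)\mid H_i(X,\Bbbk_\rho)\ne 0\}$, for $0\le i\le k$. $\Sigma$-invariants: for $\chi\in\mathrm{Hom}(G,\mathbb{R})$, the Novikov–Sikorav completion $\widehat{\mathbb{Z}G}_{\chi}$ is the ring of formal sums $\sum_i n_ig_i$ ($n_i\in\mathbb{Z}$, $g_i\in G$) such that for each $c\in\mathbb{R}$ the set of $i$ with $n_i\ne0$ and $\chi(g_i)\ge c$ is finite; it contains $\mathbb{Z}G$ as a subring. $\Sigma^q(X,\mathbb{Z})=\{\chi\in\mathrm{Hom}(G,\mathbb{R})\setminus\{0\}\mid H_i(X,\widehat{\mathbb{Z}G}_{-\chi})=0\text{ for all }i\le q\}$. A valuation on $\Bbbk$ is a real-valued (rank one, not necessarily discrete) valuation: a homomorphism $v\colon\Bbbk^\times\to\mathbb{R}$ with $v(a+b)\ge\min(v(a),v(b))$ whenever $a,b,a+b\neq0$. Algebraic integers: a character $\rho\colon\Gamma\to\Bbbk^\times$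 is called an algebraic integer (with respect to $\iota\colon\Gamma\hookrightarrow\mathbb{R}$) if there is $\Delta=\sum_\gamma n_\gamma\gamma\in\mathbb{Z}\Gamma$ with $\Delta(\rho):=\sum_\gamma n_\gamma\rho(\gamma)=0$ in $\Bbbk$, and such that $n_{\gamma_0}=1$, where $\gamma_0$ is the element of $\mathrm{supp}(\Delta)=\{\gamma\mid n_\gamma\ne0\}$ for which $\iota(\gamma_0)$ is greatest. *)

theory Defs
  imports "HOL-Homology.Homology"
begin

text \<open>
  Abelian groups (chain groups, tensor products, homology) are written multiplicatively, as
  monoid records, following HOL-Homology.  Spaces are abstract topologies.
\<close>

section \<open>CW-complexes\<close>

definition disc :: "nat \<Rightarrow> (nat \<Rightarrow> real) topology" where
  "disc n = subtopology (Euclidean_space n) {x. (\<Sum>i<n. (x i)\<^sup>2) \<le> 1}"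

definition disc_interior :: "nat \<Rightarrow> (nat \<Rightarrow> real) set" where
  "disc_interior n = {x \<in> topspace (disc n). (\<Sum>i<n. (x i)\<^sup>2) < 1}"

definition disc_boundary :: "nat \<Rightarrow> (nat \<Rightarrow> real) set" where
  "disc_boundary n = {x \<in> topspace (disc n). (\<Sum>i<n. (x i)\<^sup>2) = 1}"

record ('a, 'i) cell_structure =
  cw_space :: "'a topology"
  cells :: "nat \<Rightarrow> 'i set"
  char_map :: "nat \<Rightarrow> 'i \<Rightarrow> (nat \<Rightarrow> real) \<Rightarrow> 'a"

definition open_cell :: "('a, 'i) cell_structure \<Rightarrow> nat \<Rightarrow> 'i \<Rightarrow> 'a set" where
  "open_cell K n i = char_map K n i ` disc_interior n"

text \<open>Skeleta are indexed by integers, so that the skeleta of negative index are empty.\<close>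

definition skeleton :: "('a, 'i) cell_structure \<Rightarrow> int \<Rightarrow> 'a set" where
  "skeleton K m = (\<Union>n \<in> {n. int n \<le> m}. \<Union>i \<in> cells K n. open_cell K n i)"

text \<open>Whitehead's definition, in terms of characteristic maps: the open cells partition a
  Hausdorff space, the closure is finite (C) and the topology is the weak one (W).\<close>

locale cw_complex =
  fixes K :: "('a, 'i) cell_structure"
  assumes Hausdorff: "Hausdorff_space (cw_space K)"
    and char_map_continuous:
      "\<And>n i. i \<in> cells K n \<Longrightarrow> continuous_map (disc n) (cw_space K) (char_map K n i)"
    and char_map_embedding:
      "\<And>n i. i \<in> cells K n \<Longrightarrow>
         embedding_map (subtopology (disc n) (disc_interior n)) (cw_space K) (char_map K n i)"
    and cells_disjoint:
      "\<And>m n i j. i \<in> cells K m \<Longrightarrow> j \<in> cells K n \<Longrightarrow> (m, i) \<noteq> (n, j) \<Longrightarrow>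
         open_cell K m i \<inter> open_cell K n j = {}"
    and cells_cover:
      "topspace (cw_space K) = (\<Union>n. \<Union>i \<in> cells K n. open_cell K n i)"
    and closure_finite:
      "\<And>n i. i \<in> cells K n \<Longrightarrow>
         \<exists>F. finite F \<and> F \<subseteq> {(m, j). m < n \<and> j \<in> cells K m} \<and>
             char_map K n i ` disc_boundary n \<subseteq> (\<Union>(m, j) \<in> F. open_cell K m j)"
    and weak_topology:
      "\<And>A. A \<subseteq> topspace (cw_space K) \<Longrightarrow>
         closedin (cw_space K) A \<longleftrightarrow>
         (\<forall>n. \<forall>i \<in> cells K n. closedin (disc n) {x \<in> topspace (disc n). char_map K n i x \<in> A})"

section \<open>Fundamental group and universal cover\<close>

definition loopin :: "'a topology \<Rightarrow> 'a \<Rightarrow> (real \<Rightarrow> 'a) \<Rightarrow> bool" where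
  "loopin X x f \<longleftrightarrow> pathin X f \<and> f 0 = x \<and> f 1 = x"

text \<open>Homotopy relative to the end points.\<close>

definition path_homotopic :: "'a topology \<Rightarrow> (real \<Rightarrow> 'a) \<Rightarrow> (real \<Rightarrow> 'a) \<Rightarrow> bool" where
  "path_homotopic X f g \<longleftrightarrow>
     homotopic_with (\<lambda>h. h 0 = f 0 \<and> h 1 = f 1) (subtopology euclideanreal {0..1}) X f g"

definition path_concat :: "(real \<Rightarrow> 'a) \<Rightarrow> (real \<Rightarrow> 'a) \<Rightarrow> real \<Rightarrow> 'a" where
  "path_concat f g = (\<lambda>t. if t \<le> 1/2 then f (2 * t) else g (2 * t - 1))"

definition fundamental_group :: "'a topology \<Rightarrow> 'a \<Rightarrow> (real \<Rightarrow> 'a) set monoid" where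
  "fundamental_group X x =
     \<lparr>carrier = {{g. path_homotopic X f g} | f. loopin X x f},
      mult = (\<lambda>A B. {h. \<exists>f \<in> A. \<exists>g \<in> B. path_homotopic X (path_concat f g) h}),
      one = {g. path_homotopic X (\<lambda>t. x) g}\<rparr>"

definition simply_connected_space :: "'a topology \<Rightarrow> bool" where
  "simply_connected_space X \<longleftrightarrow>
     path_connected_space X \<and> (\<forall>x \<in> topspace X. trivial_group (fundamental_group X x))"

definition covering_map :: "'b topology \<Rightarrow> 'a topology \<Rightarrow> ('b \<Rightarrow> 'a) \<Rightarrow> bool" where
  "covering_map E X p \<longleftrightarrow>
     continuous_map E X p \<and> p ` topspace E = topspace X \<and>
     (\<forall>x \<in> topspace X. \<exists>U. openin X U \<and> x \<in> U \<and>
        (\<exists>\<V>. \<Union>\<V> = {e \<in> topspace E. p e \<in> U} \<and> pairwise disjnt \<V> \<and>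
             (\<forall>V \<in> \<V>. openin E V \<and> homeomorphic_map (subtopology E V) (subtopology X U) p)))"

text \<open>A pointed space over \<open>X\<close>; the base point of \<open>X\<close> is the image of the chosen point.\<close>

record ('a, 'b) pointed_cover =
  cover_space :: "'b topology"
  cover_map :: "'b \<Rightarrow> 'a"
  cover_base :: 'b

definition universal_cover :: "'a topology \<Rightarrow> ('a, 'b) pointed_cover \<Rightarrow> bool" where
  "universal_cover X U \<longleftrightarrow>
     covering_map (cover_space U) X (cover_map U) \<and> simply_connected_space (cover_space U) \<and>
     cover_base U \<in> topspace (cover_space U)"

definition cw_pi1 :: "('a, 'i) cell_structure \<Rightarrow> ('a, 'b) pointed_cover \<Rightarrow> (real \<Rightarrow> 'a) set monoid"
  where "cw_pi1 K U = fundamental_group (cw_space K) (cover_map U (cover_base U))"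

definition deck_transformations :: "('a, 'b) pointed_cover \<Rightarrow> ('b \<Rightarrow> 'b) set" where
  "deck_transformations U =
     {f \<in> extensional (topspace (cover_space U)).
        homeomorphic_map (cover_space U) (cover_space U) f \<and>
        (\<forall>e \<in> topspace (cover_space U). cover_map U (f e) = cover_map U e)}"

text \<open>The class of a loop \<open>f\<close> acts by the deck transformation moving the base point to the end
  point of the lift of \<open>f\<close> that starts at the base point.  As \<open>path_concat f g\<close> runs through
  \<open>f\<close> first, this is a left action.\<close>

definition deck_action :: "('a, 'b) pointed_cover \<Rightarrow> (real \<Rightarrow> 'a) set \<Rightarrow> 'b \<Rightarrow> 'b" where
  "deck_action U g =
     (THE D. D \<in> deck_transformations U \<and>
        (\<exists>f \<in> g. \<exists>l. pathin (cover_space U) l \<and> l 0 = cover_base U \<and>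
           (\<forall>t \<in> {0..1}. cover_map U (l t) = f t) \<and> D (cover_base U) = l 1))"

section \<open>Group rings and Novikov--Sikorav completions\<close>

text \<open>A formal sum of elements of \<open>G\<close> is the function of its coefficients.  The sum defining the
  product is finite for elements of either of the two rings below.\<close>

definition formal_sums :: "('g, 'z) monoid_scheme \<Rightarrow> ('g \<Rightarrow> int) set" where
  "formal_sums G = {a. \<forall>g. g \<notin> carrier G \<longrightarrow> a g = 0}"

definition conv :: "('g, 'z) monoid_scheme \<Rightarrow> ('g \<Rightarrow> int) \<Rightarrow> ('g \<Rightarrow> int) \<Rightarrow> 'g \<Rightarrow> int" where
  "conv G a b =
     (\<lambda>g. if g \<in> carrier G
          then \<Sum>h \<in> {h \<in> carrier G. a h \<noteq> 0 \<and> b (inv\<^bsub>G\<^esub> h \<otimes>\<^bsub>G\<^esub> g) \<noteq> 0}. a h * b (inv\<^bsub>G\<^esub> h \<otimes>\<^bsub>G\<^esub> g)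
          else 0)"

definition formal_sum_ring ::
    "('g, 'z) monoid_scheme \<Rightarrow> ('g \<Rightarrow> int) set \<Rightarrow> ('g \<Rightarrow> int) ring" where
  "formal_sum_ring G S =
     \<lparr>carrier = S, mult = conv G, one = (\<lambda>g. if g = \<one>\<^bsub>G\<^esub> then 1 else 0),
      zero = (\<lambda>g. 0), add = (\<lambda>a b g. a g + b g)\<rparr>"

definition group_ring :: "('g, 'z) monoid_scheme \<Rightarrow> ('g \<Rightarrow> int) ring" where
  "group_ring G = formal_sum_ring G {a \<in> formal_sums G. finite {g. a g \<noteq> 0}}"

definition novikov_ring :: "('g, 'z) monoid_scheme \<Rightarrow> ('g \<Rightarrow> real) \<Rightarrow> ('g \<Rightarrow> int) ring" where
  "novikov_ring G chi =
     formal_sum_ring G {a \<in> formal_sums G. \<forall>c::real. finite {g. a g \<noteq> 0 \<and> chi g \<ge> c}}"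

section \<open>Tensor products and homology of chain complexes\<close>

text \<open>\<open>ract a r\<close> is the right action of \<open>r \<in> R\<close> on \<open>a \<in> A\<close>, and \<open>lact r b\<close> the left action on
  \<open>b \<in> B\<close>.\<close>

definition tensor_relations ::
    "('r, 'z) ring_scheme \<Rightarrow> ('a, 'x) monoid_scheme \<Rightarrow> ('a \<Rightarrow> 'r \<Rightarrow> 'a) \<Rightarrow>
     ('b, 'y) monoid_scheme \<Rightarrow> ('r \<Rightarrow> 'b \<Rightarrow> 'b) \<Rightarrow> ('a \<times> 'b \<Rightarrow>\<^sub>0 int) set" where
  "tensor_relations R A ract B lact =
     {frag_of (a \<otimes>\<^bsub>A\<^esub> a', b) - frag_of (a, b) - frag_of (a', b) | a a' b.
        a \<in> carrier A \<and> a' \<in> carrier A \<and> b \<in> carrier B} \<union>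
     {frag_of (a, b \<otimes>\<^bsub>B\<^esub> b') - frag_of (a, b) - frag_of (a, b') | a b b'.
        a \<in> carrier A \<and> b \<in> carrier B \<and> b' \<in> carrier B} \<union>
     {frag_of (ract a r, b) - frag_of (a, lact r b) | a r b.
        a \<in> carrier A \<and> r \<in> carrier R \<and> b \<in> carrier B}"

definition tensor_kernel ::
    "('r, 'z) ring_scheme \<Rightarrow> ('a, 'x) monoid_scheme \<Rightarrow> ('a \<Rightarrow> 'r \<Rightarrow> 'a) \<Rightarrow>
     ('b, 'y) monoid_scheme \<Rightarrow> ('r \<Rightarrow> 'b \<Rightarrow> 'b) \<Rightarrow> ('a \<times> 'b \<Rightarrow>\<^sub>0 int) set" where
  "tensor_kernel R A ract B lact =
     generate (free_Abelian_group (carrier A \<times> carrier B)) (tensor_relations R A ract B lact)"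

definition tensor_product ::
    "('r, 'z) ring_scheme \<Rightarrow> ('a, 'x) monoid_scheme \<Rightarrow> ('a \<Rightarrow> 'r \<Rightarrow> 'a) \<Rightarrow>
     ('b, 'y) monoid_scheme \<Rightarrow> ('r \<Rightarrow> 'b \<Rightarrow> 'b) \<Rightarrow> ('a \<times> 'b \<Rightarrow>\<^sub>0 int) set monoid" where
  "tensor_product R A ract B lact =
     free_Abelian_group (carrier A \<times> carrier B) Mod tensor_kernel R A ract B lact"

text \<open>For an \<open>R\<close>-linear map \<open>f\<close> from \<open>B\<close> to \<open>B'\<close>, the map \<open>id \<otimes> f\<close> sending the coset of a
  representative \<open>\<Sum> n (a, b)\<close> to the coset of \<open>\<Sum> n (a, f b)\<close>.\<close>

definition tensor_map ::
    "('r, 'z) ring_scheme \<Rightarrow> ('a, 'x) monoid_scheme \<Rightarrow> ('a \<Rightarrow> 'r \<Rightarrow> 'a) \<Rightarrow>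
     ('b, 'y) monoid_scheme \<Rightarrow> ('r \<Rightarrow> 'b \<Rightarrow> 'b) \<Rightarrow> ('c \<Rightarrow> 'b) \<Rightarrow>
     ('a \<times> 'c \<Rightarrow>\<^sub>0 int) set \<Rightarrow> ('a \<times> 'b \<Rightarrow>\<^sub>0 int) set" where
  "tensor_map R A ract B' lact' f T =
     the_elem ((\<lambda>x. tensor_kernel R A ract B' lact'
                    #>\<^bsub>free_Abelian_group (carrier A \<times> carrier B')\<^esub>
                    frag_extend (\<lambda>(a, b). frag_of (a, f b)) x) ` T)"

definition chain_homology ::
    "(int \<Rightarrow> ('a, 'z) monoid_scheme) \<Rightarrow> (int \<Rightarrow> 'a \<Rightarrow> 'a) \<Rightarrow> int \<Rightarrow> 'a set monoid" where
  "chain_homology C d m =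
     (C m)\<lparr>carrier := kernel (C m) (C (m - 1)) (d m)\<rparr> Mod (d (m + 1) ` carrier (C (m + 1)))"

section \<open>The equivariant cellular chain complex\<close>

text \<open>The skeleta of the universal cover are the preimages of those of the base.\<close>

definition cover_skeleton ::
    "('a, 'i) cell_structure \<Rightarrow> ('a, 'b) pointed_cover \<Rightarrow> int \<Rightarrow> 'b set" where
  "cover_skeleton K U m = {e \<in> topspace (cover_space U). cover_map U e \<in> skeleton K m}"

abbreviation cover_skeleton_space ::
    "('a, 'i) cell_structure \<Rightarrow> ('a, 'b) pointed_cover \<Rightarrow> int \<Rightarrow> 'b topology" where
  "cover_skeleton_space K U m \<equiv> subtopology (cover_space U) (cover_skeleton K U m)"

definition cellular_group ::
    "('a, 'i) cell_structure \<Rightarrow> ('a, 'b) pointed_cover \<Rightarrow> int \<Rightarrow> 'b chain set monoid" where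
  "cellular_group K U m =
     relative_homology_group m (cover_skeleton_space K U m) (cover_skeleton K U (m - 1))"

definition cellular_boundary ::
    "('a, 'i) cell_structure \<Rightarrow> ('a, 'b) pointed_cover \<Rightarrow> int \<Rightarrow> 'b chain set \<Rightarrow> 'b chain set" where
  "cellular_boundary K U m =
     hom_relboundary m (cover_skeleton_space K U m)
       (cover_skeleton K U (m - 1)) (cover_skeleton K U (m - 2))"

definition cellular_group_act ::
    "('a, 'i) cell_structure \<Rightarrow> ('a, 'b) pointed_cover \<Rightarrow> int \<Rightarrow>
     (real \<Rightarrow> 'a) set \<Rightarrow> 'b chain set \<Rightarrow> 'b chain set" where
  "cellular_group_act K U m g =
     hom_induced m (cover_skeleton_space K U m) (cover_skeleton K U (m - 1))
       (cover_skeleton_space K U m) (cover_skeleton K U (m - 1)) (deck_action U g)"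

text \<open>The extension to the group ring: \<open>r\<close> takes \<open>c\<close> to the sum of the \<open>r g\<close>-fold multiples of
  \<open>g c\<close>.\<close>

definition cellular_act ::
    "('a, 'i) cell_structure \<Rightarrow> ('a, 'b) pointed_cover \<Rightarrow> int \<Rightarrow>
     ((real \<Rightarrow> 'a) set \<Rightarrow> int) \<Rightarrow> 'b chain set \<Rightarrow> 'b chain set" where
  "cellular_act K U m r c =
     finprod (cellular_group K U m)
       (\<lambda>g. cellular_group_act K U m g c [^]\<^bsub>cellular_group K U m\<^esub> r g) {g. r g \<noteq> 0}"

text \<open>Homology of \<open>X\<close> with coefficients in the right \<open>\<int>G\<close>-module \<open>A\<close>, with action \<open>ract\<close>.\<close>

definition twisted_homology ::
    "('a, 'i) cell_structure \<Rightarrow> ('a, 'b) pointed_cover \<Rightarrow> ('m, 'z) monoid_scheme \<Rightarrow>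
     ('m \<Rightarrow> ((real \<Rightarrow> 'a) set \<Rightarrow> int) \<Rightarrow> 'm) \<Rightarrow> int \<Rightarrow>
     ('m \<times> 'b chain set \<Rightarrow>\<^sub>0 int) set set monoid" where
  "twisted_homology K U A ract =
     chain_homology
       (\<lambda>m. tensor_product (group_ring (cw_pi1 K U)) A ract
              (cellular_group K U m) (cellular_act K U m))
       (\<lambda>m. tensor_map (group_ring (cw_pi1 K U)) A ract
              (cellular_group K U (m - 1)) (cellular_act K U (m - 1)) (cellular_boundary K U m))"

section \<open>Characteristic varieties, Sigma-invariants, valuations, algebraic integers\<close>

definition additive_group :: "'k::ab_group_add monoid" where
  "additive_group = \<lparr>carrier = UNIV, mult = (+), one = 0\<rparr>"

definition unit_group :: "'k::field monoid" where
  "unit_group = \<lparr>carrier = UNIV - {0}, mult = (*), one = 1\<rparr>"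

definition eval_character :: "('g \<Rightarrow> 'k::field) \<Rightarrow> ('g \<Rightarrow> int) \<Rightarrow> 'k" where
  "eval_character \<rho> r = (\<Sum>g \<in> {g. r g \<noteq> 0}. of_int (r g) * \<rho> g)"

definition char_variety ::
    "('a, 'i) cell_structure \<Rightarrow> ('a, 'b) pointed_cover \<Rightarrow> nat \<Rightarrow>
     ((real \<Rightarrow> 'a) set \<Rightarrow> 'k::field) set" where
  "char_variety K U i =
     {\<rho> \<in> hom (cw_pi1 K U) unit_group.
        \<not> trivial_group (twisted_homology K U (additive_group :: 'k monoid)
                           (\<lambda>a r. a * eval_character \<rho> r) (int i))}"

text \<open>The completion is a right \<open>\<int>G\<close>-module by right multiplication; note the sign of the
  character.\<close>

definition Sigma_inv ::
    "('a, 'i) cell_structure \<Rightarrow> ('a, 'b) pointed_cover \<Rightarrow> nat \<Rightarrow>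
     ((real \<Rightarrow> 'a) set \<Rightarrow> real) set" where
  "Sigma_inv K U q =
     {chi \<in> hom (cw_pi1 K U) additive_group.
        (\<exists>g \<in> carrier (cw_pi1 K U). chi g \<noteq> 0) \<and>
        (\<forall>i \<le> q. trivial_group
           (twisted_homology K U
              (add_monoid (novikov_ring (cw_pi1 K U) (\<lambda>g. - chi g)))
              (mult (novikov_ring (cw_pi1 K U) (\<lambda>g. - chi g))) (int i)))}"

text \<open>The value at \<open>0\<close> is irrelevant.\<close>

definition valuation :: "('k::field \<Rightarrow> real) \<Rightarrow> bool" where
  "valuation v \<longleftrightarrow>
     v \<in> hom unit_group additive_group \<and>
     (\<forall>a b. a \<noteq> 0 \<longrightarrow> b \<noteq> 0 \<longrightarrow> a + b \<noteq> 0 \<longrightarrow> v (a + b) \<ge> min (v a) (v b))"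

text \<open>The group \<open>\<Gamma> = im chi\<close>, as a subgroup of the reals.\<close>

definition image_group :: "('g, 'z) monoid_scheme \<Rightarrow> ('g \<Rightarrow> real) \<Rightarrow> real monoid" where
  "image_group G chi = additive_group\<lparr>carrier := chi ` carrier G\<rparr>"

definition algebraic_integer ::
    "('g, 'z) monoid_scheme \<Rightarrow> ('g \<Rightarrow> real) \<Rightarrow> ('g \<Rightarrow> 'k::field) \<Rightarrow> bool" where
  "algebraic_integer \<Gamma> \<iota> \<rho> \<longleftrightarrow>
     (\<exists>\<Delta> \<in> carrier (group_ring \<Gamma>). eval_character \<rho> \<Delta> = 0 \<and>
        (\<exists>\<gamma>\<^sub>0. \<Delta> \<gamma>\<^sub>0 \<noteq> 0 \<and> (\<forall>\<gamma>. \<Delta> \<gamma> \<noteq> 0 \<longrightarrow> \<iota> \<gamma> \<le> \<iota> \<gamma>\<^sub>0) \<and> \<Delta> \<gamma>\<^sub>0 = 1))"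

end

theory Submission
  imports Defs "HOL-Library.Function_Algebras"
begin

text \<open>
  In degrees at most \<open>k\<close> the cellular chain modules are free over the group ring, with one basis
  element for each cell.  Hence homology with coefficients in \<open>A\<close> vanishes in such a degree iff every
  row vector over \<open>A\<close> that is killed by the boundary matrix \<open>D\<close> is an \<open>A\<close>-combination of the
  coordinate vectors of boundaries.

  Let \<open>\<psi>\<close> be \<open>- v \<circ> \<rho>\<close> in part (1) and \<open>\<chi>\<close> in part (2).  Vanishing over the Novikov ring of \<open>\<psi>\<close> in
  degrees at most \<open>q\<close> gives, degree by degree, a matrix \<open>S\<close> over that ring for which the rows of
  \<open>1 - D S\<close> are combinations of boundaries.  Truncating \<open>S\<close>, one obtains the same over the group ring
  up to an error \<open>\<epsilon>\<close> whose entries are supported where \<open>\<psi> < 0\<close>.  The values under \<open>\<rho>\<close> of all such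
  elements form a ring without unit which does not contain \<open>1\<close>: in part (1) its elements have
  positive valuation, and in part (2) an element \<open>r\<close> of value \<open>1\<close> would show, by way of
  \<open>\<Delta> = 1 - r\<close>, that \<open>\<rho>\<close> is an algebraic integer.  So over the field the map \<open>1 - \<rho>(\<epsilon>)\<close> is
  injective and takes cycles to boundaries, and every cycle is a boundary.
\<close>

section \<open>Covering maps of abstract topologies\<close>

text \<open>Two obstacles shape the proof. First, \<rho> need not extend to the Novikov ring, since
  the field carries no completion in which infinite sums converge; only group ring elements can be
  evaluated. This forces the truncation of S, and the error is harmless because det(1 -
  \<rho>(\<epsilon>)) is 1 minus an element of a ring that misses 1. Such a map sends the
  finite-dimensional space of cycles injectively, hence onto, into itself, and its values there are
  boundaries.

  Secondly, for q = k there may be infinitely many (k + 1)-cells, so no finite basis is available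
  one degree above. The boundaries in each degree are therefore kept as a bare module of coordinate
  rows. Only below degree q must they be spanned by the rows of the next boundary matrix, which is
  just what the passage from one degree to the next in the construction of S requires.

  Freeness rests on covering theory: the deck group permutes the lifts of a cell simply
  transitively, and excision at the lifted centres isolates one lifted cell at a time.\<close>

abbreviation unit_interval :: "real topology" where
  "unit_interval \<equiv> top_of_set {0..1}"

lemma covering_map_continuous: "covering_map E X p \<Longrightarrow> continuous_map E X p"
  by (simp add: covering_map_def)

lemma evenly_covered_neighbourhood:
  assumes "covering_map E X p" "x \<in> topspace X"
  obtains U \<V> where "openin X U" "x \<in> U" "\<Union>\<V> = {e \<in> topspace E. p e \<in> U}" "pairwise disjnt \<V>"
    "\<And>V. V \<in> \<V> \<Longrightarrow> openin E V"
    "\<And>V. V \<in> \<V> \<Longrightarrow> \<exists>q. homeomorphic_maps (subtopology E V) (subtopology X U) p q"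
proof -
  obtain U \<V> where UV: "openin X U" "x \<in> U" "\<Union>\<V> = {e \<in> topspace E. p e \<in> U}" "pairwise disjnt \<V>"
    "\<forall>V \<in> \<V>. openin E V \<and> homeomorphic_map (subtopology E V) (subtopology X U) p"
    using assms unfolding covering_map_def by blast
  show ?thesis
    by (rule that [of U \<V>]) (use UV in \<open>simp_all add: homeomorphic_map_maps\<close>)
qed

text \<open>Near a point the two lifts stay in two sheets over an evenly covered set. They agree
  throughout if the sheets coincide, since \<open>p\<close> is injective on a sheet, and nowhere if
  the sheets are disjoint.\<close>

lemma lifts_agreement_openin:
  assumes cov: "covering_map E X p" and f: "continuous_map Y E f" and g: "continuous_map Y E g"
    and eq: "\<And>y. y \<in> topspace Y \<Longrightarrow> p (f y) = p (g y)"
  shows "openin Y {y \<in> topspace Y. f y = g y}" "openin Y {y \<in> topspace Y. f y \<noteq> g y}"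
proof -
  have fE: "f y \<in> topspace E" and gE: "g y \<in> topspace E" if "y \<in> topspace Y" for y
    using f g that by (auto dest: continuous_map_image_subset_topspace)
  have *: "\<exists>T. openin Y T \<and> y \<in> T \<and> ((\<forall>z\<in>T. f z = g z) \<or> (\<forall>z\<in>T. f z \<noteq> g z))"
    if y: "y \<in> topspace Y" for y
  proof -
    have "p (f y) \<in> topspace X"
      using covering_map_continuous [OF cov] fE [OF y] continuous_map_image_subset_topspace by fastforce
    then obtain U \<V> where U: "openin X U" "p (f y) \<in> U" "\<Union>\<V> = {e \<in> topspace E. p e \<in> U}" "pairwise disjnt \<V>"
      "\<And>V. V \<in> \<V> \<Longrightarrow> openin E V"
      "\<And>V. V \<in> \<V> \<Longrightarrow> \<exists>q. homeomorphic_maps (subtopology E V) (subtopology X U) p q"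
      by (rule evenly_covered_neighbourhood [OF cov]) (rule that)
    have "f y \<in> \<Union>\<V>" "g y \<in> \<Union>\<V>"
      using U(2) fE [OF y] gE [OF y] eq [OF y] by (auto simp: U(3))
    then obtain V W where V: "V \<in> \<V>" "f y \<in> V" and W: "W \<in> \<V>" "g y \<in> W" by auto
    let ?T = "{z \<in> topspace Y. f z \<in> V} \<inter> {z \<in> topspace Y. g z \<in> W}"
    have T: "openin Y ?T" "y \<in> ?T"
      using openin_continuous_map_preimage [OF f U(5) [OF V(1)]]
        openin_continuous_map_preimage [OF g U(5) [OF W(1)]] V W y by auto
    show ?thesis
    proof (cases "V = W")
      case True
      obtain q where q: "homeomorphic_maps (subtopology E V) (subtopology X U) p q"
        using U(6) [OF V(1)] by blast
      have "q (p e) = e" if "e \<in> V" for e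
        using q that openin_subset [OF U(5) [OF V(1)]] by (auto simp: homeomorphic_maps_def)
      then have "\<forall>z\<in>?T. f z = g z"
        using True eq by (metis (mono_tags, lifting) IntE mem_Collect_eq)
      with T show ?thesis by blast
    next
      case False
      then have "disjnt V W" using U(4) V(1) W(1) by (meson pairwiseD)
      then have "\<forall>z\<in>?T. f z \<noteq> g z" by (auto simp: disjnt_iff)
      with T show ?thesis by blast
    qed
  qed
  show "openin Y {y \<in> topspace Y. f y = g y}"
  proof (subst openin_subopen, intro ballI)
    fix y assume y: "y \<in> {y \<in> topspace Y. f y = g y}"
    with * obtain T where T: "openin Y T" "y \<in> T" "(\<forall>z\<in>T. f z = g z) \<or> (\<forall>z\<in>T. f z \<noteq> g z)"
      by blast
    with y have "\<forall>z\<in>T. f z = g z" by auto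
    with T openin_subset show "\<exists>T. openin Y T \<and> y \<in> T \<and> T \<subseteq> {y \<in> topspace Y. f y = g y}"
      by (intro exI [of _ T]) blast
  qed
  show "openin Y {y \<in> topspace Y. f y \<noteq> g y}"
  proof (subst openin_subopen, intro ballI)
    fix y assume y: "y \<in> {y \<in> topspace Y. f y \<noteq> g y}"
    with * obtain T where T: "openin Y T" "y \<in> T" "(\<forall>z\<in>T. f z = g z) \<or> (\<forall>z\<in>T. f z \<noteq> g z)"
      by blast
    with y have "\<forall>z\<in>T. f z \<noteq> g z" by auto
    with T openin_subset show "\<exists>T. openin Y T \<and> y \<in> T \<and> T \<subseteq> {y \<in> topspace Y. f y \<noteq> g y}"
      by (intro exI [of _ T]) blast
  qed
qed

text \<open>The set of agreement and its complement are open, and the former contains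
  \<open>a\<close>.\<close>

lemma lift_unique:
  assumes cov: "covering_map E X p" and f: "continuous_map Y E f" and g: "continuous_map Y E g"
    and eq: "\<And>y. y \<in> topspace Y \<Longrightarrow> p (f y) = p (g y)"
    and con: "connected_space Y" and a: "a \<in> topspace Y" "f a = g a" and y: "y \<in> topspace Y"
  shows "f y = g y"
proof -
  let ?A = "{y \<in> topspace Y. f y = g y}" and ?B = "{y \<in> topspace Y. f y \<noteq> g y}"
  have "openin Y ?A" "openin Y ?B"
    using lifts_agreement_openin [OF cov f g eq] by auto
  moreover have "topspace Y \<subseteq> ?A \<union> ?B" "?A \<inter> ?B = {}" "?A \<noteq> {}"
    using a by auto
  ultimately have "?B = {}"
    using con unfolding connected_space_def by blast
  with y show ?thesis by blast
qed

lemma lift_path_unique: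
  assumes "covering_map E X p" "pathin E f" "pathin E g" "\<And>t. t \<in> {0..1} \<Longrightarrow> p (f t) = p (g t)"
    "f 0 = g 0" "t \<in> {0..1}"
  shows "f t = g t"
  using lift_unique [OF assms(1), of unit_interval f g 0 t] assms
  by (simp add: pathin_def connected_space_subtopology connectedin_def [symmetric] is_interval_1)

text \<open>Time is subdivided by the bisection principle \<open>Bolzano\<close>: the property
  propagated from a to b is that every lift given at time a extends up to time b after the
  neighbourhood of \<open>y0\<close> has been shrunk.\<close>

lemma homotopy_lifting_local:
  assumes cov: "covering_map E X p"
    and H: "continuous_map (prod_topology unit_interval Y) X H"
    and f: "continuous_map Y E f" and f0: "\<And>y. y \<in> topspace Y \<Longrightarrow> p (f y) = H (0, y)"
    and y0: "y0 \<in> topspace Y"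
  obtains N L where "openin Y N" "y0 \<in> N"
    "continuous_map (prod_topology unit_interval (subtopology Y N)) E L"
    "\<And>y. y \<in> N \<Longrightarrow> L (0, y) = f y" "\<And>t y. t \<in> {0..1} \<Longrightarrow> y \<in> N \<Longrightarrow> p (L (t, y)) = H (t, y)"
proof -
  \<comment> \<open>The start \<open>g\<close> and its domain \<open>M\<close> are quantified inside
    \<open>P\<close>, so that the end of one lift can serve as the start of the next.\<close>
  define P where "P = (\<lambda>a b::real. 0 \<le> a \<longrightarrow> a \<le> b \<longrightarrow> b \<le> 1 \<longrightarrow>
    (\<forall>M g. openin Y M \<and> y0 \<in> M \<and> continuous_map (subtopology Y M) E g \<and> (\<forall>y\<in>M. p (g y) = H (a, y)) \<longrightarrow>
      (\<exists>N L. openin Y N \<and> y0 \<in> N \<and> N \<subseteq> M \<and>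
        continuous_map (prod_topology (top_of_set {a..b}) (subtopology Y N)) E L \<and>
        (\<forall>y\<in>N. L (a, y) = g y) \<and> (\<forall>t\<in>{a..b}. \<forall>y\<in>N. p (L (t, y)) = H (t, y)))))"
  have "P 0 1"
  proof (rule Bolzano)
    show "(0::real) \<le> 1" by simp
    fix a b c :: real
    assume ab: "P a b" and bc: "P b c" and abc: "a \<le> b" "b \<le> c"
    show "P a c"
      unfolding P_def
    proof (intro allI impI, elim conjE)
      fix M g
      assume ac: "0 \<le> a" "a \<le> c" "c \<le> 1" and M: "openin Y M" "y0 \<in> M"
        and g: "continuous_map (subtopology Y M) E g" "\<forall>y\<in>M. p (g y) = H (a, y)"
      obtain N1 L1 where 1: "openin Y N1" "y0 \<in> N1" "N1 \<subseteq> M"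
        "continuous_map (prod_topology (top_of_set {a..b}) (subtopology Y N1)) E L1"
        "\<forall>y\<in>N1. L1 (a, y) = g y" "\<forall>t\<in>{a..b}. \<forall>y\<in>N1. p (L1 (t, y)) = H (t, y)"
        using ab ac abc M g unfolding P_def by (smt (verit))
      have "continuous_map (subtopology Y N1) E (\<lambda>y. L1 (b, y))"
        using abc by (intro continuous_map_compose [OF _ 1(4), unfolded o_def])
          (auto simp: continuous_map_pairwise o_def)
      then obtain N2 L2 where 2: "openin Y N2" "y0 \<in> N2" "N2 \<subseteq> N1"
        "continuous_map (prod_topology (top_of_set {b..c}) (subtopology Y N2)) E L2"
        "\<forall>y\<in>N2. L2 (b, y) = L1 (b, y)" "\<forall>t\<in>{b..c}. \<forall>y\<in>N2. p (L2 (t, y)) = H (t, y)"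
        using bc ac abc 1(1,2,6) unfolding P_def
        by (smt (verit) atLeastAtMost_iff)
      define L where "L = (\<lambda>z. if fst z \<le> b then L1 z else L2 z)"
      have "continuous_map (prod_topology (top_of_set {a..c}) (subtopology Y N2)) E L"
        unfolding L_def
      proof (rule continuous_map_cases_le)
        let ?Z = "prod_topology (top_of_set {a..c}) (subtopology Y N2)"
        show "continuous_map ?Z euclideanreal fst"
          using continuous_map_fst continuous_map_in_subtopology by (metis continuous_map_into_fulltopology)
        show "continuous_map ?Z euclideanreal (\<lambda>x. b)" by simp
        have "subtopology ?Z {x \<in> topspace ?Z. fst x \<le> b}
            = subtopology (prod_topology (top_of_set {a..b}) (subtopology Y N1)) ({a..b} \<times> N2)"
          using abc 2(3)
          by (auto simp: subtopology_Times [symmetric] subtopology_subtopology prod_topology_subtopology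
              intro!: arg_cong2 [where f = subtopology])
        then show "continuous_map (subtopology ?Z {x \<in> topspace ?Z. fst x \<le> b}) E L1"
          using 1(4) by (simp add: continuous_map_from_subtopology)
        have "subtopology ?Z {x \<in> topspace ?Z. b \<le> fst x}
            = prod_topology (top_of_set {b..c}) (subtopology Y N2)"
          using abc openin_subset [OF 2(1)]
          by (auto simp: subtopology_Times [symmetric] subtopology_subtopology prod_topology_subtopology
              intro!: arg_cong2 [where f = subtopology])
        then show "continuous_map (subtopology ?Z {x \<in> topspace ?Z. b \<le> fst x}) E L2"
          using 2(4) by simp
        show "L1 x = L2 x" if "x \<in> topspace ?Z" "fst x = b" for x
          using that 2(5) by (cases x) auto
      qed
      moreover have "\<forall>y\<in>N2. L (a, y) = g y"
        using 1 2 abc by (auto simp: L_def)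
      moreover have "\<forall>t\<in>{a..c}. \<forall>y\<in>N2. p (L (t, y)) = H (t, y)"
        using 1 2 abc by (auto simp: L_def)
      ultimately show "\<exists>N L. openin Y N \<and> y0 \<in> N \<and> N \<subseteq> M \<and>
        continuous_map (prod_topology (top_of_set {a..c}) (subtopology Y N)) E L \<and>
        (\<forall>y\<in>N. L (a, y) = g y) \<and> (\<forall>t\<in>{a..c}. \<forall>y\<in>N. p (L (t, y)) = H (t, y))"
        using 1(3) 2(1-3) by (intro exI [of _ N2] exI [of _ L]) auto
    qed
  next
    fix x :: real
    assume x: "0 \<le> x" "x \<le> 1"
    let ?Z = "prod_topology unit_interval Y"
    have "H (x, y0) \<in> topspace X"
      using continuous_map_image_subset_topspace [OF H] x y0 by auto
    then obtain U \<V> where U: "openin X U" "H (x, y0) \<in> U" "\<Union>\<V> = {e \<in> topspace E. p e \<in> U}"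
      "pairwise disjnt \<V>" "\<And>V. V \<in> \<V> \<Longrightarrow> openin E V"
      "\<And>V. V \<in> \<V> \<Longrightarrow> \<exists>q. homeomorphic_maps (subtopology E V) (subtopology X U) p q"
      by (rule evenly_covered_neighbourhood [OF cov]) (rule that)
    have o: "openin ?Z {z \<in> topspace ?Z. H z \<in> U}"
      using openin_continuous_map_preimage [OF H U(1)] .
    have i: "(x, y0) \<in> {z \<in> topspace ?Z. H z \<in> U}"
      using x y0 U by auto
    obtain T N' where TN: "openin unit_interval T" "openin Y N'" "x \<in> T" "y0 \<in> N'"
      "T \<times> N' \<subseteq> {z \<in> topspace ?Z. H z \<in> U}"
      using openin_prod_topology_alt [THEN iffD1, rule_format, OF o i] by (elim exE conjE) (rule that)
    obtain d where d: "d > 0" "\<And>t. t \<in> {0..1} \<Longrightarrow> dist t x < d \<Longrightarrow> t \<in> T"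
      using TN(1,3) unfolding openin_euclidean_subtopology_iff by blast
    show "\<exists>d>0. \<forall>a b. a \<le> x \<and> x \<le> b \<and> b - a < d \<longrightarrow> P a b"
    proof (intro exI conjI allI impI, rule d(1), elim conjE)
      fix a b assume ab: "a \<le> x" "x \<le> b" "b - a < d"
      show "P a b"
        unfolding P_def
      proof (intro allI impI, elim conjE)
        fix M g
        assume ac: "0 \<le> a" "a \<le> b" "b \<le> 1" and M: "openin Y M" "y0 \<in> M"
          and g: "continuous_map (subtopology Y M) E g" "\<forall>y\<in>M. p (g y) = H (a, y)"
        have T: "{a..b} \<subseteq> T"
          using ab ac by (auto intro!: d(2) simp: dist_real_def)
        have MY: "topspace (subtopology Y M) = M"
          using openin_subset [OF M(1)] by auto
        have gE: "g y \<in> topspace E" if "y \<in> M" for y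
          using continuous_map_image_subset_topspace [OF g(1)] MY that by blast
        have HU: "H (t, y) \<in> U" if "t \<in> {a..b}" "y \<in> N'" for t y
          using TN(5) T that by blast
        have "g y0 \<in> \<Union>\<V>"
          unfolding U(3) using g(2) M(2) HU [of a y0] ac TN(4) gE by auto
        then obtain V where V: "V \<in> \<V>" "g y0 \<in> V" by auto
        obtain q where q: "homeomorphic_maps (subtopology E V) (subtopology X U) p q"
          using U(6) [OF V(1)] by blast
        have VE: "V \<subseteq> topspace E" and UX: "U \<subseteq> topspace X"
          using U(5) [OF V(1)] U(1) by (auto dest: openin_subset)
        have qp: "q (p e) = e" if "e \<in> V" for e
          using q that VE by (auto simp: homeomorphic_maps_def)
        have pq: "p (q u) = u" if "u \<in> U" for u
          using q that UX by (auto simp: homeomorphic_maps_def)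
        have qc: "continuous_map (subtopology X U) E q"
          using q by (auto simp: homeomorphic_maps_def continuous_map_in_subtopology)
        \<comment> \<open>Shrinking to points whose start lies in \<open>V\<close> lets a single
          local inverse \<open>q\<close> of \<open>p\<close> define the lift on the whole
          tube.\<close>
        define N where "N = {y \<in> M. g y \<in> V} \<inter> N'"
        have "openin (subtopology Y M) {y \<in> M. g y \<in> V}"
          using openin_continuous_map_preimage [OF g(1) U(5) [OF V(1)]] unfolding MY .
        then have N: "openin Y N" "y0 \<in> N" "N \<subseteq> M" "N \<subseteq> N'"
          using M V TN(2,4) unfolding N_def by (auto intro: openin_trans_full)
        define L where "L = (\<lambda>z. q (H z))"
        have "continuous_map (prod_topology (top_of_set {a..b}) (subtopology Y N)) (subtopology X U) H"
        proof -
          have "subtopology ?Z ({a..b} \<times> N) = prod_topology (top_of_set {a..b}) (subtopology Y N)"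
            using ac by (auto simp: subtopology_Times subtopology_subtopology Int_absorb1)
          moreover have "continuous_map (subtopology ?Z ({a..b} \<times> N)) (subtopology X U) H"
            using H HU N(4) by (auto simp: continuous_map_in_subtopology continuous_map_from_subtopology)
          ultimately show ?thesis by simp
        qed
        then have "continuous_map (prod_topology (top_of_set {a..b}) (subtopology Y N)) E L"
          unfolding L_def using continuous_map_compose [OF _ qc] by (auto simp: o_def)
        moreover have "\<forall>y\<in>N. L (a, y) = g y"
          using g(2) qp by (auto simp: L_def N_def) metis
        moreover have "\<forall>t\<in>{a..b}. \<forall>y\<in>N. p (L (t, y)) = H (t, y)"
          using HU N(4) by (auto simp: L_def intro!: pq)
        ultimately show "\<exists>N L. openin Y N \<and> y0 \<in> N \<and> N \<subseteq> M \<and>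
          continuous_map (prod_topology (top_of_set {a..b}) (subtopology Y N)) E L \<and>
          (\<forall>y\<in>N. L (a, y) = g y) \<and> (\<forall>t\<in>{a..b}. \<forall>y\<in>N. p (L (t, y)) = H (t, y))"
          using N by blast
      qed
    qed
  qed
  then have "\<exists>N L. openin Y N \<and> y0 \<in> N \<and> N \<subseteq> topspace Y \<and>
      continuous_map (prod_topology unit_interval (subtopology Y N)) E L \<and>
      (\<forall>y\<in>N. L (0, y) = f y) \<and> (\<forall>t\<in>{0..1}. \<forall>y\<in>N. p (L (t, y)) = H (t, y))"
    unfolding P_def using y0 f f0 by (auto dest!: spec [of _ "topspace Y"] spec [of _ f])
  then show ?thesis using that by blast
qed

text \<open>The local lifts can be glued: over a common point they are lifts of one path with one
  starting value, so they coincide.\<close>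

theorem homotopy_lifting:
  assumes cov: "covering_map E X p"
    and H: "continuous_map (prod_topology unit_interval Y) X H"
    and f: "continuous_map Y E f" and f0: "\<And>y. y \<in> topspace Y \<Longrightarrow> p (f y) = H (0, y)"
  obtains L where "continuous_map (prod_topology unit_interval Y) E L"
    "\<And>y. y \<in> topspace Y \<Longrightarrow> L (0, y) = f y"
    "\<And>t y. t \<in> {0..1} \<Longrightarrow> y \<in> topspace Y \<Longrightarrow> p (L (t, y)) = H (t, y)"
proof -
  have "\<exists>N L. openin Y N \<and> y0 \<in> N \<and>
      continuous_map (prod_topology unit_interval (subtopology Y N)) E L \<and>
      (\<forall>y\<in>N. L (0, y) = f y) \<and> (\<forall>t\<in>{0..1}. \<forall>y\<in>N. p (L (t, y)) = H (t, y))"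
    if "y0 \<in> topspace Y" for y0
    using homotopy_lifting_local [OF cov H f f0 that] by metis
  then obtain N L where NL: "\<And>y. y \<in> topspace Y \<Longrightarrow> openin Y (N y) \<and> y \<in> N y \<and>
      continuous_map (prod_topology unit_interval (subtopology Y (N y))) E (L y) \<and>
      (\<forall>z\<in>N y. L y (0, z) = f z) \<and> (\<forall>t\<in>{0..1}. \<forall>z\<in>N y. p (L y (t, z)) = H (t, z))"
    by metis
  have No: "openin Y (N y)" "y \<in> N y"
      and Lc: "continuous_map (prod_topology unit_interval (subtopology Y (N y))) E (L y)"
      and L0: "\<And>z. z \<in> N y \<Longrightarrow> L y (0, z) = f z"
      and LH: "\<And>t z. t \<in> {0..1} \<Longrightarrow> z \<in> N y \<Longrightarrow> p (L y (t, z)) = H (t, z)"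
      if "y \<in> topspace Y" for y
    using NL [OF that] by blast+
  have path: "pathin E (\<lambda>t. L i (t, y))" if "i \<in> topspace Y" "y \<in> N i" for i y
  proof -
    have "continuous_map unit_interval (prod_topology unit_interval (subtopology Y (N i))) (\<lambda>t. (t, y))"
      using openin_subset [OF No(1) [OF that(1)]] that(2) by (auto simp: continuous_map_pairwise o_def)
    from continuous_map_compose [OF this Lc [OF that(1)]] show ?thesis
      by (simp add: pathin_def o_def)
  qed
  have agree: "L i (t, y) = L j (t, y)"
    if "i \<in> topspace Y" "j \<in> topspace Y" "t \<in> {0..1}" "y \<in> N i" "y \<in> N j" for i j t y
    using lift_path_unique [OF cov path [OF that(1,4)] path [OF that(2,5)], of t] L0 LH that by simp
  \<comment> \<open>At (t, y) the value is taken from the local lift chosen for y itself.\<close>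
  have cont: "continuous_map (prod_topology unit_interval Y) E (\<lambda>z. L (snd z) z)"
  proof (rule pasting_lemma [of "topspace Y" _ "\<lambda>i. {0..1} \<times> N i" _ L])
    show "openin (prod_topology unit_interval Y) ({0..1} \<times> N i)" if "i \<in> topspace Y" for i
      using No [OF that] by (simp add: openin_prod_Times_iff)
    show "continuous_map (subtopology (prod_topology unit_interval Y) ({0..1} \<times> N i)) E (L i)"
      if "i \<in> topspace Y" for i
      using Lc [OF that] by (simp add: subtopology_Times subtopology_subtopology)
    show "L i x = L j x"
      if "i \<in> topspace Y" "j \<in> topspace Y"
        "x \<in> topspace (prod_topology unit_interval Y) \<inter> {0..1} \<times> N i \<inter> {0..1} \<times> N j" for i j x
    proof -
      have "fst x \<in> {0..1}" "snd x \<in> N i" "snd x \<in> N j"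
        using that(3) by (simp_all add: mem_Times_iff)
      then show ?thesis
        using agree [OF that(1,2), of "fst x" "snd x"] by simp
    qed
    show "\<exists>j. j \<in> topspace Y \<and> x \<in> {0..1} \<times> N j \<and> L (snd x) x = L j x"
      if "x \<in> topspace (prod_topology unit_interval Y)" for x
      using No(2) [of "snd x"] that by (intro exI [of _ "snd x"]) (simp add: mem_Times_iff)
  qed
  show ?thesis
    using L0 LH No(2) by (intro that [OF cont]) simp_all
qed

text \<open>A path is a homotopy between maps of a one-point space.\<close>

lemma path_lifting:
  assumes cov: "covering_map E X p" and g: "pathin X g" and e: "e \<in> topspace E" "p e = g 0"
  obtains l where "pathin E l" "l 0 = e" "\<And>t. t \<in> {0..1} \<Longrightarrow> p (l t) = g t"
proof -
  have H: "continuous_map (prod_topology unit_interval (discrete_topology {()})) X (\<lambda>z. g (fst z))"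
    using continuous_map_compose [OF continuous_map_fst g [unfolded pathin_def]] by (simp add: o_def)
  obtain L where L: "continuous_map (prod_topology unit_interval (discrete_topology {()})) E L"
    "L (0, ()) = e" "\<And>t. t \<in> {0..1} \<Longrightarrow> p (L (t, ())) = g t"
    using homotopy_lifting [OF cov H, of "\<lambda>_. e"] e by auto
  have "pathin E (\<lambda>t. L (t, ()))"
    unfolding pathin_def
    by (intro continuous_map_compose [OF _ L(1), unfolded o_def]) (auto simp: continuous_map_pairwise o_def)
  with L show ?thesis using that by blast
qed

section \<open>Lifts of paths and the fundamental group\<close>

lemma pathin_path_concat:
  assumes "pathin X f" "pathin X g" "f 1 = g 0"
  shows "pathin X (path_concat f g)"
  unfolding pathin_def path_concat_def
proof (rule continuous_map_cases_le)
  show "continuous_map (subtopology unit_interval {x \<in> topspace unit_interval. x \<le> 1 / 2}) X (\<lambda>t. f (2 * t))"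
    unfolding subtopology_subtopology
    by (intro continuous_map_compose [OF _ assms(1) [unfolded pathin_def], unfolded o_def])
      (auto intro!: continuous_intros)
  show "continuous_map (subtopology unit_interval {x \<in> topspace unit_interval. 1 / 2 \<le> x}) X (\<lambda>t. g (2 * t - 1))"
    unfolding subtopology_subtopology
    by (intro continuous_map_compose [OF _ assms(2) [unfolded pathin_def], unfolded o_def])
      (auto intro!: continuous_intros)
  show "f (2 * t) = g (2 * t - 1)" if "t = 1 / 2" for t :: real
  proof -
    have "2 * t = 1" using that by simp
    then show ?thesis using assms(3) by (simp only: diff_self)
  qed
qed (auto intro!: continuous_intros)

lemma path_homotopic_iff:
  "path_homotopic X f g \<longleftrightarrow>
     (\<exists>F. continuous_map (prod_topology unit_interval unit_interval) X F \<and>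
       (\<forall>s\<in>{0..1}. F (0, s) = f s) \<and> (\<forall>s\<in>{0..1}. F (1, s) = g s) \<and>
       (\<forall>t\<in>{0..1}. F (t, 0) = f 0 \<and> F (t, 1) = f 1))"
  unfolding path_homotopic_def by (subst homotopic_with) auto

lemma path_homotopic_imp_pathin:
  assumes "path_homotopic X f g"
  shows "pathin X f" "pathin X g" "g 0 = f 0" "g 1 = f 1"
proof -
  obtain F where F: "continuous_map (prod_topology unit_interval unit_interval) X F"
    "\<And>s. s\<in>{0..1} \<Longrightarrow> F (0, s) = f s" "\<And>s. s\<in>{0..1} \<Longrightarrow> F (1, s) = g s"
    "\<And>t. t\<in>{0..1} \<Longrightarrow> F (t, 0) = f 0 \<and> F (t, 1) = f 1"
    using assms unfolding path_homotopic_iff by blast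
  have "continuous_map unit_interval X (\<lambda>s. F (t, s))" if "t \<in> {0..1}" for t
    by (rule continuous_map_compose [OF _ F(1), unfolded o_def])
      (use that in \<open>auto simp: continuous_map_pairwise o_def intro!: continuous_intros\<close>)
  from this [of 0] this [of 1] show "pathin X f" "pathin X g"
    unfolding pathin_def using F(2,3) by (auto elim: continuous_map_eq)
  show "g 0 = f 0" "g 1 = f 1"
    using F(3) [of 0] F(3) [of 1] F(4) [of 1] by auto
qed

lemma path_homotopic_refl: "pathin X f \<Longrightarrow> path_homotopic X f f"
  unfolding path_homotopic_def pathin_def by (simp add: homotopic_with_refl)

text \<open>Paths are functions on all reals but count only on the unit interval; hence the separate
  names \<open>f'\<close> and \<open>g'\<close> for the images.\<close>

lemma path_homotopic_map:
  assumes "path_homotopic E f g" "continuous_map E X p"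
    "\<And>t. t \<in> {0..1} \<Longrightarrow> p (f t) = f' t" "\<And>t. t \<in> {0..1} \<Longrightarrow> p (g t) = g' t"
  shows "path_homotopic X f' g'"
proof -
  obtain F where F: "continuous_map (prod_topology unit_interval unit_interval) E F"
    "\<And>s. s\<in>{0..1} \<Longrightarrow> F (0, s) = f s" "\<And>s. s\<in>{0..1} \<Longrightarrow> F (1, s) = g s"
    "\<And>t. t\<in>{0..1} \<Longrightarrow> F (t, 0) = f 0 \<and> F (t, 1) = f 1"
    using assms(1) unfolding path_homotopic_iff by blast
  show ?thesis
    unfolding path_homotopic_iff
    using continuous_map_compose [OF F(1) assms(2)] F(2-4) assms(3,4)
    by (intro exI [of _ "p \<circ> F"]) auto
qed

text \<open>A null homotopy \<open>F\<close> of the loop \<open>f\<close> followed by the reverse of \<open>g\<close> is constant on three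
  sides of the square.  The segments from the points of these sides to the middle of
  the fourth one sweep out a homotopy from \<open>f\<close> to \<open>g\<close>.\<close>

lemma simply_connected_path_homotopic:
  assumes sc: "simply_connected_space Y" and f: "pathin Y f" and g: "pathin Y g"
    and fg: "f 0 = g 0" "f 1 = g 1"
  shows "path_homotopic Y f g"
proof -
  define h where "h = path_concat f (\<lambda>t. g (1 - t))"
  have gr: "pathin Y (\<lambda>t. g (1 - t))"
    unfolding pathin_def
    by (intro continuous_map_compose [OF _ g [unfolded pathin_def], unfolded o_def])
      (auto intro!: continuous_intros)
  then have h: "pathin Y h"
    unfolding h_def using f fg by (intro pathin_path_concat) auto
  have h01: "h 0 = f 0" "h 1 = f 0"
    using fg by (auto simp: h_def path_concat_def)
  have x0: "f 0 \<in> topspace Y"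
    using f by (rule path_start_in_topspace)
  have "trivial_group (fundamental_group Y (f 0))"
    using sc x0 by (simp add: simply_connected_space_def)
  then have "carrier (fundamental_group Y (f 0)) = {\<one>\<^bsub>fundamental_group Y (f 0)\<^esub>}"
    by (simp add: trivial_group_def)
  moreover have "{k. path_homotopic Y h k} \<in> carrier (fundamental_group Y (f 0))"
    using h h01 by (auto simp: fundamental_group_def loopin_def)
  ultimately have "{k. path_homotopic Y h k} = {k. path_homotopic Y (\<lambda>t. f 0) k}"
    by (simp add: fundamental_group_def)
  moreover have "path_homotopic Y (\<lambda>t. f 0) (\<lambda>t. f 0)"
    using x0 by (simp add: path_homotopic_refl)
  ultimately have "path_homotopic Y h (\<lambda>t. f 0)"
    by blast
  then obtain F where F: "continuous_map (prod_topology unit_interval unit_interval) Y F"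
    "\<And>s. s\<in>{0..1} \<Longrightarrow> F (0, s) = h s" "\<And>s. s\<in>{0..1} \<Longrightarrow> F (1, s) = f 0"
    "\<And>t. t\<in>{0..1} \<Longrightarrow> F (t, 0) = f 0" "\<And>t. t\<in>{0..1} \<Longrightarrow> F (t, 1) = f 0"
    unfolding path_homotopic_iff using h01 by auto
  \<comment> \<open>\<open>(c1, c2)\<close> runs from (0, 0) through (1, 0) and (1, 1) to (0, 1), a
    third of the time on each side.\<close>
  define c1 where "c1 = (\<lambda>t::real. min 1 (min (3 * t) (3 - 3 * t)))"
  define c2 where "c2 = (\<lambda>t::real. max 0 (min 1 (3 * t - 1)))"
  \<comment> \<open>All segments end at (0, 1/2). Those for t = 0 and t = 1 lie in the fourth side
    and start at its corners, which yields \<open>f\<close> and \<open>g\<close>.\<close>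
  define k where "k = (\<lambda>z. ((1 - snd z) * c1 (fst z), (1 - snd z) * c2 (fst z) + snd z / 2))"
  have c: "c1 t \<in> {0..1}" "c2 t \<in> {0..1}" if "t \<in> {0..1}" for t
    using that by (auto simp: c1_def c2_def)
  have Fc: "F (c1 t, c2 t) = f 0" if t: "t \<in> {0..1}" for t
  proof -
    consider "t \<le> 1/3" | "1/3 \<le> t" "t \<le> 2/3" | "2/3 \<le> t" by linarith
    then show ?thesis
    proof cases
      case 1
      then have "c2 t = 0" by (simp add: c2_def)
      then show ?thesis using F(4) [OF c(1) [OF t]] by simp
    next
      case 2
      then have "c1 t = 1" by (simp add: c1_def)
      then show ?thesis using F(3) [OF c(2) [OF t]] by simp
    next
      case 3
      then have "c2 t = 1" by (simp add: c2_def)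
      then show ?thesis using F(5) [OF c(1) [OF t]] by simp
    qed
  qed
  have "k z \<in> {0..1} \<times> {0..1}" if z: "z \<in> {0..1} \<times> {0..1}" for z
  proof -
    have s: "0 \<le> snd z" "snd z \<le> 1" and 12: "0 \<le> c1 (fst z)" "c1 (fst z) \<le> 1" "0 \<le> c2 (fst z)" "c2 (fst z) \<le> 1"
      using z c [of "fst z"] by auto
    have "(1 - snd z) * c1 (fst z) \<le> (1 - snd z) * 1" "(1 - snd z) * c2 (fst z) \<le> (1 - snd z) * 1"
      using s 12 by (intro mult_left_mono; simp)+
    moreover have "0 \<le> (1 - snd z) * c1 (fst z)" "0 \<le> (1 - snd z) * c2 (fst z)"
      using s 12 by simp_all
    ultimately show ?thesis
      using s by (auto simp: k_def)
  qed
  moreover have "continuous_on ({0..1} \<times> {0..1}) k"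
    unfolding k_def c1_def c2_def by (intro continuous_intros) auto
  ultimately have "continuous_map (prod_topology unit_interval unit_interval)
      (prod_topology unit_interval unit_interval) k"
    by (simp add: prod_topology_subtopology_eu image_subset_iff_funcset [symmetric] image_subset_iff del: mem_Times_iff)
  then have Fk: "continuous_map (prod_topology unit_interval unit_interval) Y (F \<circ> k)"
    using F(1) continuous_map_compose by blast
  have "(F \<circ> k) (0, s) = f s" if "s \<in> {0..1}" for s
    using F(2) [of "s/2"] that by (simp add: k_def c1_def c2_def h_def path_concat_def)
  moreover have "(F \<circ> k) (1, s) = g s" if "s \<in> {0..1}" for s
    using F(2) [of "1 - s/2"] that fg by (auto simp: k_def c1_def c2_def h_def path_concat_def field_simps)
  moreover have "(F \<circ> k) (t, 0) = f 0" if "t \<in> {0..1}" for t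
    using Fc [OF that] by (simp add: k_def)
  moreover have "(F \<circ> k) (t, 1) = f 1" if "t \<in> {0..1}" for t
    using F(2) [of "1/2"] by (simp add: k_def h_def path_concat_def)
  ultimately show ?thesis
    unfolding path_homotopic_iff using Fk by blast
qed

definition lifts_path :: "'b topology \<Rightarrow> ('b \<Rightarrow> 'a) \<Rightarrow> 'b \<Rightarrow> (real \<Rightarrow> 'a) \<Rightarrow> (real \<Rightarrow> 'b) \<Rightarrow> bool" where
  "lifts_path E p e g l \<longleftrightarrow> pathin E l \<and> l 0 = e \<and> (\<forall>t\<in>{0..1}. p (l t) = g t)"

definition lift_end :: "'b topology \<Rightarrow> ('b \<Rightarrow> 'a) \<Rightarrow> 'b \<Rightarrow> (real \<Rightarrow> 'a) \<Rightarrow> 'b" where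
  "lift_end E p e g = (THE y. \<exists>l. lifts_path E p e g l \<and> y = l 1)"

lemma lift_end_eq:
  assumes cov: "covering_map E X p" and l: "lifts_path E p e g l"
  shows "lift_end E p e g = l 1"
  unfolding lift_end_def
proof (rule the_equality)
  fix y assume "\<exists>l. lifts_path E p e g l \<and> y = l 1"
  then obtain l' where l': "lifts_path E p e g l'" "y = l' 1" by blast
  have "l' 1 = l 1"
    using lift_path_unique [OF cov, of l' l 1] l l' by (simp add: lifts_path_def)
  then show "y = l 1" using l' by simp
qed (use l in blast)

text \<open>With the path parameter as time, the homotopy is lifted from the constant start
  \<open>e\<close>. The end points of the lifted paths form a path over the constant
  \<open>f 1\<close>, and such a path is constant.\<close>

lemma path_homotopic_lift_end:
  assumes cov: "covering_map E X p" and h: "path_homotopic X f g" and e: "e \<in> topspace E" "p e = f 0"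
  shows "lift_end E p e f = lift_end E p e g"
proof -
  obtain F where F: "continuous_map (prod_topology unit_interval unit_interval) X F"
    "\<And>s. s\<in>{0..1} \<Longrightarrow> F (0, s) = f s" "\<And>s. s\<in>{0..1} \<Longrightarrow> F (1, s) = g s"
    "\<And>t. t\<in>{0..1} \<Longrightarrow> F (t, 0) = f 0" "\<And>t. t\<in>{0..1} \<Longrightarrow> F (t, 1) = f 1"
    using h unfolding path_homotopic_iff by blast
  \<comment> \<open>The coordinates are exchanged because \<open>homotopy_lifting\<close> expects
    its time, here the path parameter, in the first one.\<close>
  have "continuous_map (prod_topology unit_interval unit_interval)
      (prod_topology unit_interval unit_interval) (\<lambda>z. (snd z, fst z))"
    by (auto intro!: continuous_intros)
  from continuous_map_compose [OF this F(1)]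
  have H: "continuous_map (prod_topology unit_interval unit_interval) X (\<lambda>z. F (snd z, fst z))"
    by (simp add: o_def)
  obtain L where L: "continuous_map (prod_topology unit_interval unit_interval) E L"
    "\<And>t. t \<in> topspace unit_interval \<Longrightarrow> L (0, t) = e"
    "\<And>s t. s \<in> {0..1} \<Longrightarrow> t \<in> topspace unit_interval \<Longrightarrow> p (L (s, t)) = F (snd (s, t), fst (s, t))"
    by (rule homotopy_lifting [OF cov H, of "\<lambda>t. e"]) (use e F(4) in auto)
  have path: "pathin E (\<lambda>s. L (s, t))" if "t \<in> {0..1}" for t
    unfolding pathin_def by (rule continuous_map_compose [OF _ L(1), unfolded o_def])
      (use that in \<open>auto simp: continuous_map_pairwise o_def intro!: continuous_intros\<close>)
  have path': "pathin E (\<lambda>t. L (1, t))"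
    unfolding pathin_def by (rule continuous_map_compose [OF _ L(1), unfolded o_def])
      (auto simp: continuous_map_pairwise o_def intro!: continuous_intros)
  have "lift_end E p e f = L (1, 0)"
    using path [of 0] L F(2) by (intro lift_end_eq [OF cov]) (simp add: lifts_path_def)
  moreover have "lift_end E p e g = L (1, 1)"
    using path [of 1] L F(3) by (intro lift_end_eq [OF cov]) (simp add: lifts_path_def)
  moreover have "L (1, 1) = L (1, 0)"
    using lift_path_unique [OF cov path', of "\<lambda>t. L (1, 0)" 1] path_start_in_topspace [OF path'] L(3) F(5)
    by simp
  ultimately show ?thesis by simp
qed

locale universal_covering =
  fixes X :: "'a topology" and U :: "('a, 'b) pointed_cover"
  assumes universal: "universal_cover X U"
begin

abbreviation "E \<equiv> cover_space U"
abbreviation "p \<equiv> cover_map U"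
abbreviation "b \<equiv> cover_base U"

lemma covering: "covering_map E X p"
  and simply_connected: "simply_connected_space E"
  and base: "b \<in> topspace E"
  using universal by (auto simp: universal_cover_def)

lemma continuous_p: "continuous_map E X p"
  using covering by (rule covering_map_continuous)

lemma p_in_X: "e \<in> topspace E \<Longrightarrow> p e \<in> topspace X"
  using continuous_p continuous_map_image_subset_topspace by fastforce

lemma connected_E: "connected_space E"
  using simply_connected by (simp add: simply_connected_space_def path_connected_imp_connected_space)

lemma path_in_E:
  assumes "x \<in> topspace E" "y \<in> topspace E"
  obtains l where "pathin E l" "l 0 = x" "l 1 = y"
  using simply_connected assms unfolding simply_connected_space_def path_connected_space_def by meson

lemma lift_ex:
  assumes "pathin X g" "e \<in> topspace E" "p e = g 0"
  obtains l where "lifts_path E p e g l" "lift_end E p e g = l 1"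
proof -
  obtain l where "pathin E l" "l 0 = e" "\<And>t. t \<in> {0..1} \<Longrightarrow> p (l t) = g t"
    using path_lifting [OF covering assms] by blast
  then have "lifts_path E p e g l" by (simp add: lifts_path_def)
  then show ?thesis using that lift_end_eq [OF covering] by blast
qed

lemma lift_end_in:
  assumes "pathin X g" "e \<in> topspace E" "p e = g 0"
  shows "lift_end E p e g \<in> topspace E" "p (lift_end E p e g) = g 1"
proof -
  obtain l where "lifts_path E p e g l" "lift_end E p e g = l 1"
    using lift_ex [OF assms] by blast
  then show "lift_end E p e g \<in> topspace E" "p (lift_end E p e g) = g 1"
    by (auto simp: lifts_path_def path_finish_in_topspace)
qed

text \<open>The converse uses simple connectedness: lifts with equal end points are homotopic, and
  the homotopy is projected.\<close>

lemma path_homotopic_iff_lift_end: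
  assumes f: "pathin X f" "f 0 = p e" and g: "pathin X g" "g 0 = p e" and e: "e \<in> topspace E"
  shows "path_homotopic X f g \<longleftrightarrow> lift_end E p e f = lift_end E p e g"
proof
  show "lift_end E p e f = lift_end E p e g" if "path_homotopic X f g"
    using path_homotopic_lift_end [OF covering that e] f by simp
  assume eq: "lift_end E p e f = lift_end E p e g"
  obtain l where l: "lifts_path E p e f l" "lift_end E p e f = l 1"
    using lift_ex [OF f(1) e] f(2) by metis
  obtain l' where l': "lifts_path E p e g l'" "lift_end E p e g = l' 1"
    using lift_ex [OF g(1) e] g(2) by metis
  have "path_homotopic E l l'"
    using l l' eq by (intro simply_connected_path_homotopic [OF simply_connected]) (auto simp: lifts_path_def)
  then show "path_homotopic X f g"
    by (rule path_homotopic_map [OF _ continuous_p]) (use l l' in \<open>auto simp: lifts_path_def\<close>)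
qed

lemma lift_end_concat:
  assumes "lifts_path E p e f l" "lifts_path E p (l 1) g l'"
  shows "lift_end E p e (path_concat f g) = l' 1"
proof -
  have "lifts_path E p e (path_concat f g) (path_concat l l')"
    using assms pathin_path_concat [of E l l'] by (auto simp: lifts_path_def path_concat_def)
  from lift_end_eq [OF covering this] show ?thesis
    by (simp add: path_concat_def)
qed

end

section \<open>Deck transformations\<close>

text \<open>Presents the disc as a subspace of a function type with its product topology, so that
  coordinatewise \<open>continuous_on\<close> arguments apply.\<close>

lemma disc_eq: "disc n = top_of_set {x. (\<forall>i\<ge>n. x i = 0) \<and> L2_set x {..<n} \<le> 1}"
proof -
  have "{x. \<forall>i\<ge>n. x i = 0} \<inter> {x. (\<Sum>i<n. (x i)\<^sup>2) \<le> 1} = {x. (\<forall>i\<ge>n. x i = 0) \<and> L2_set x {..<n} \<le> (1::real)}"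
    by (auto simp: L2_set_def)
  then show ?thesis
    by (simp add: disc_def Euclidean_space_def subtopology_subtopology euclidean_product_topology)
qed

lemma topspace_disc: "topspace (disc n) = {x. (\<forall>i\<ge>n. x i = 0) \<and> L2_set x {..<n} \<le> 1}"
  by (simp add: disc_eq)

lemma disc_interior_eq: "disc_interior n = {x. (\<forall>i\<ge>n. x i = 0) \<and> L2_set x {..<n} < 1}"
  by (auto simp: disc_interior_def topspace_disc) (auto simp: L2_set_def)

lemma disc_boundary_eq: "disc_boundary n = {x. (\<forall>i\<ge>n. x i = 0) \<and> L2_set x {..<n} = 1}"
  by (auto simp: disc_boundary_def topspace_disc) (auto simp: L2_set_def)

lemma zero_in_disc: "(\<lambda>i. 0) \<in> topspace (disc n)"
  by (simp add: topspace_disc L2_set_0')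

lemma disc_convex:
  assumes "x \<in> topspace (disc n)" "y \<in> topspace (disc n)" "t \<in> {0..1}"
  shows "(\<lambda>i. (1 - t) * x i + t * y i) \<in> topspace (disc n)"
proof -
  have "L2_set (\<lambda>i. (1 - t) * x i + t * y i) {..<n} \<le> L2_set (\<lambda>i. (1 - t) * x i) {..<n} + L2_set (\<lambda>i. t * y i) {..<n}"
    by (rule L2_set_triangle_ineq)
  also have "\<dots> = (1 - t) * L2_set x {..<n} + t * L2_set y {..<n}"
    using assms(3) by (simp add: L2_set_right_distrib)
  also have "\<dots> \<le> (1 - t) * 1 + t * 1"
    using assms by (intro add_mono mult_left_mono) (auto simp: topspace_disc)
  finally show ?thesis
    using assms by (simp add: topspace_disc)
qed

lemma continuous_map_disc_segment:
  assumes "y \<in> topspace (disc n)"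
  shows "continuous_map (prod_topology unit_interval (disc n)) (disc n)
     (\<lambda>z i. (1 - fst z) * y i + fst z * snd z i)"
proof -
  have "continuous_on ({0..1} \<times> topspace (disc n)) (\<lambda>z. snd z i)" for i
    by (rule continuous_on_product_then_coordinatewise [OF continuous_on_snd [OF continuous_on_id]])
  then have "continuous_on ({0..1} \<times> topspace (disc n)) (\<lambda>z i. (1 - fst z) * y i + fst z * snd z i)"
    by (intro continuous_on_coordinatewise_then_product continuous_intros)
  moreover have "(\<lambda>i. (1 - fst z) * y i + fst z * snd z i) \<in> topspace (disc n)"
    if "z \<in> {0..1} \<times> topspace (disc n)" for z
    using disc_convex [OF assms, of "snd z" "fst z"] that by (simp add: mem_Times_iff)
  ultimately show ?thesis
    by (simp add: disc_eq Pi_iff)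
qed

section \<open>Lifts of discs, and deck transformations of the cover of a CW-complex\<close>

context universal_covering
begin

text \<open>The disc is contracted to \<open>y\<close> along segments. Lifting this homotopy from
  the constant map \<open>e\<close> gives a lift of \<Phi> at time 1.\<close>

lemma disc_lift:
  assumes \<Phi>: "continuous_map (disc n) X \<Phi>" and y: "y \<in> topspace (disc n)"
    and e: "e \<in> topspace E" "p e = \<Phi> y"
  obtains \<phi> where "continuous_map (disc n) E \<phi>" "\<phi> y = e" "\<And>z. z \<in> topspace (disc n) \<Longrightarrow> p (\<phi> z) = \<Phi> z"
proof -
  let ?s = "\<lambda>z i. (1 - fst z) * y i + fst z * snd z i"
  have H: "continuous_map (prod_topology unit_interval (disc n)) X (\<Phi> \<circ> ?s)"
    using continuous_map_compose [OF continuous_map_disc_segment [OF y] \<Phi>] .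
  obtain L where L: "continuous_map (prod_topology unit_interval (disc n)) E L"
    "\<And>z. z \<in> topspace (disc n) \<Longrightarrow> L (0, z) = e"
    "\<And>t z. t \<in> {0..1} \<Longrightarrow> z \<in> topspace (disc n) \<Longrightarrow> p (L (t, z)) = (\<Phi> \<circ> ?s) (t, z)"
    by (rule homotopy_lifting [OF covering H, of "\<lambda>z. e"]) (use e in auto)
  have "continuous_map (disc n) E (\<lambda>z. L (1, z))"
    by (rule continuous_map_compose [OF _ L(1), unfolded o_def])
      (auto simp: continuous_map_pairwise o_def)
  \<comment> \<open>The segment from \<open>y\<close> to \<open>y\<close> is constant, so its lift
    does not move.\<close>
  moreover have "L (1, y) = e"
  proof -
    have path: "pathin E (\<lambda>t. L (t, y))"
      unfolding pathin_def by (rule continuous_map_compose [OF _ L(1), unfolded o_def])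
        (use y in \<open>auto simp: continuous_map_pairwise o_def\<close>)
    have "p (L (t, y)) = p e" if "t \<in> {0..1}" for t
      using L(3) [OF that y] e by (simp add: algebra_simps)
    then show ?thesis
      using lift_path_unique [OF covering path, of "\<lambda>t. e" 1] L(2) [OF y] e(1) by simp
  qed
  moreover have "p (L (1, z)) = \<Phi> z" if "z \<in> topspace (disc n)" for z
    using L(3) [of 1 z] that by simp
  ultimately show ?thesis using that by blast
qed

text \<open>Both maps are lifts of \<open>p\<close> on a connected space.\<close>

lemma deck_transformation_unique:
  assumes "D \<in> deck_transformations U" "D' \<in> deck_transformations U" "e \<in> topspace E" "D e = D' e"
  shows "D = D'"
proof (rule extensionalityI)
  show "D \<in> extensional (topspace E)" "D' \<in> extensional (topspace E)"
    using assms by (auto simp: deck_transformations_def)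
  fix x assume x: "x \<in> topspace E"
  show "D x = D' x"
    by (rule lift_unique [OF covering, where Y = E and f = D and g = D' and a = e])
      (use assms x connected_E in \<open>auto simp: deck_transformations_def homeomorphic_imp_continuous_map\<close>)
qed

end

locale cw_covering = cw_complex K + universal_covering "cw_space K" U
  for K :: "('a, 'i) cell_structure" and U :: "('a, 'b) pointed_cover"
begin

abbreviation "X \<equiv> cw_space K"

text \<open>This takes the place of local path connectedness of CW-complexes when maps on the cover
  are to be shown continuous. Within a sheet \<open>V\<close> the question is moved down to the
  image \<open>B\<close> of \<open>A \<inter> V\<close>, where the weak topology of the base
  applies.\<close>

lemma cover_weak_topology:
  assumes AE: "A \<subseteq> topspace E"
    and A: "\<And>n i \<phi>. i \<in> cells K n \<Longrightarrow> continuous_map (disc n) E \<phi> \<Longrightarrow>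
        (\<And>y. y \<in> topspace (disc n) \<Longrightarrow> p (\<phi> y) = char_map K n i y) \<Longrightarrow>
        openin (disc n) {y \<in> topspace (disc n). \<phi> y \<in> A}"
  shows "openin E A"
proof (subst openin_subopen, intro ballI)
  fix a assume a: "a \<in> A"
  obtain U0 \<V> where UV: "openin X U0" "p a \<in> U0" "\<Union>\<V> = {e \<in> topspace E. p e \<in> U0}" "pairwise disjnt \<V>"
      "\<And>V. V \<in> \<V> \<Longrightarrow> openin E V"
      "\<And>V. V \<in> \<V> \<Longrightarrow> \<exists>q. homeomorphic_maps (subtopology E V) (subtopology X U0) p q"
    by (rule evenly_covered_neighbourhood [OF covering p_in_X [OF subsetD [OF AE a]]]) (rule that)
  have "a \<in> \<Union>\<V>" using UV(2) a AE by (auto simp: UV(3))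
  then obtain V where V: "V \<in> \<V>" "a \<in> V" by blast
  obtain q where q: "homeomorphic_maps (subtopology E V) (subtopology X U0) p q"
    using UV(6) [OF V(1)] by blast
  have VE: "openin E V" using UV(5) V(1) by blast
  have qp: "q (p e) = e" if "e \<in> V" for e
    using q that openin_subset [OF VE] by (auto simp: homeomorphic_maps_def)
  define B where "B = p ` (A \<inter> V)"
  have BX: "B \<subseteq> topspace X"
    using AE p_in_X by (auto simp: B_def)
  have "closedin X (topspace X - B)"
  proof (subst weak_topology, blast, intro allI ballI)
    fix n i assume i: "i \<in> cells K n"
    let ?D = "topspace (disc n)" and ?\<Phi> = "char_map K n i"
    have \<Phi>: "continuous_map (disc n) X ?\<Phi>"
      using i by (rule char_map_continuous)
    have "openin (disc n) {x \<in> ?D. ?\<Phi> x \<in> B}"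
    proof (subst openin_subopen, intro ballI)
      fix x assume "x \<in> {x \<in> ?D. ?\<Phi> x \<in> B}"
      then have x: "x \<in> ?D" and "?\<Phi> x \<in> B" by auto
      then obtain a' where a': "a' \<in> A" "a' \<in> V" "p a' = ?\<Phi> x"
        unfolding B_def by auto
      \<comment> \<open>The lift has to pass through \<open>a'\<close>, so it depends on
        \<open>x\<close> and not only on the cell.\<close>
      obtain \<phi> where \<phi>: "continuous_map (disc n) E \<phi>" "\<phi> x = a'" "\<And>z. z \<in> ?D \<Longrightarrow> p (\<phi> z) = ?\<Phi> z"
        by (rule disc_lift [OF \<Phi> x _ a'(3)]) (use a' AE in auto)
      let ?T = "{y \<in> ?D. \<phi> y \<in> A} \<inter> {y \<in> ?D. \<phi> y \<in> V}"
      have "openin (disc n) ?T"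
        using A [OF i \<phi>(1,3)] openin_continuous_map_preimage [OF \<phi>(1) VE] by blast
      moreover have "x \<in> ?T"
        using x \<phi>(2) a' by simp
      moreover have "?T \<subseteq> {x \<in> ?D. ?\<Phi> x \<in> B}"
        using \<phi>(3) by (force simp: B_def)
      ultimately show "\<exists>T. openin (disc n) T \<and> x \<in> T \<and> T \<subseteq> {x \<in> ?D. ?\<Phi> x \<in> B}"
        by blast
    qed
    moreover have "{x \<in> ?D. ?\<Phi> x \<in> topspace X - B} = ?D - {x \<in> ?D. ?\<Phi> x \<in> B}"
      using continuous_map_image_subset_topspace [OF \<Phi>] by auto
    ultimately show "closedin (disc n) {x \<in> ?D. ?\<Phi> x \<in> topspace X - B}"
      by (simp only: closedin_diff closedin_topspace)
  qed
  then have "openin X B"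
    using BX by (metis openin_closedin_eq)
  then have "openin E ({e \<in> topspace E. p e \<in> B} \<inter> V)"
    using openin_continuous_map_preimage [OF continuous_p] VE by blast
  moreover have "a \<in> {e \<in> topspace E. p e \<in> B} \<inter> V"
    using a V AE by (auto simp: B_def)
  moreover have "{e \<in> topspace E. p e \<in> B} \<inter> V \<subseteq> A"
  proof
    fix e assume "e \<in> {e \<in> topspace E. p e \<in> B} \<inter> V"
    then obtain a' where "e \<in> V" "p e = p a'" "a' \<in> A" "a' \<in> V"
      by (auto simp: B_def)
    then show "e \<in> A" using qp by metis
  qed
  ultimately show "\<exists>T. openin E T \<and> a \<in> T \<and> T \<subseteq> A" by blast
qed

text \<open>This is the lifting criterion for \<open>p\<close> itself: a path from \<open>e\<close>
  to \<open>x\<close> is projected and lifted again from \<open>e'\<close>, and \<open>D x\<close>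
  is the end of that lift.\<close>

lemma lift_of_projection:
  assumes e: "e \<in> topspace E" "e' \<in> topspace E" "p e = p e'"
  obtains D where "continuous_map E E D" "D e = e'" "\<And>x. x \<in> topspace E \<Longrightarrow> p (D x) = p x"
proof -
  define D where "D = (\<lambda>x. lift_end E p e' (p \<circ> (SOME \<gamma>. pathin E \<gamma> \<and> \<gamma> 0 = e \<and> \<gamma> 1 = x)))"
  have pp: "pathin X (p \<circ> \<gamma>)" if "pathin E \<gamma>" for \<gamma>
    using pathin_compose [OF that continuous_p] .
  \<comment> \<open>Independence of the chosen path, by simple connectedness.\<close>
  have D: "D (\<gamma> 1) = lift_end E p e' (p \<circ> \<gamma>)" if "pathin E \<gamma>" "\<gamma> 0 = e" for \<gamma>
  proof -
    let ?\<delta> = "SOME \<gamma>'. pathin E \<gamma>' \<and> \<gamma>' 0 = e \<and> \<gamma>' 1 = \<gamma> 1"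
    have \<delta>: "pathin E ?\<delta> \<and> ?\<delta> 0 = e \<and> ?\<delta> 1 = \<gamma> 1"
      by (rule someI [of _ \<gamma>]) (use that in auto)
    then have "path_homotopic E ?\<delta> \<gamma>"
      using that by (intro simply_connected_path_homotopic [OF simply_connected]) auto
    then have "path_homotopic X (p \<circ> ?\<delta>) (p \<circ> \<gamma>)"
      by (rule path_homotopic_map [OF _ continuous_p]) auto
    then show ?thesis
      unfolding D_def using path_homotopic_lift_end [OF covering _ e(2)] e(3) \<delta> by simp
  qed
  have pD: "D x \<in> topspace E \<and> p (D x) = p x" if x: "x \<in> topspace E" for x
  proof -
    obtain \<gamma> where \<gamma>: "pathin E \<gamma>" "\<gamma> 0 = e" "\<gamma> 1 = x"
      by (rule path_in_E [OF e(1) x]) (rule that)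
    show ?thesis
      using D [OF \<gamma>(1,2)] lift_end_in [OF pp [OF \<gamma>(1)] e(2)] \<gamma> e(3) by simp
  qed
  have "continuous_map E E D"
    unfolding continuous_map
  proof (intro conjI allI impI)
    show "D ` topspace E \<subseteq> topspace E" using pD by auto
    fix W assume W: "openin E W"
    show "openin E {x \<in> topspace E. D x \<in> W}"
    proof (rule cover_weak_topology)
      fix n i \<phi>
      let ?D = "topspace (disc n)" and ?\<Phi> = "char_map K n i"
      assume i: "i \<in> cells K n" and \<phi>: "continuous_map (disc n) E \<phi>"
        and p\<phi>: "\<And>y. y \<in> ?D \<Longrightarrow> p (\<phi> y) = ?\<Phi> y"
      have \<Phi>: "continuous_map (disc n) X ?\<Phi>"
        using i by (rule char_map_continuous)
      have \<phi>E: "\<phi> y \<in> topspace E" if "y \<in> ?D" for y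
        using continuous_map_image_subset_topspace [OF \<phi>] that by blast
      let ?z = "(\<lambda>i. 0) :: nat \<Rightarrow> real"
      \<comment> \<open>On a lifted disc, \<open>D \<circ> \<phi>\<close> should be the lift of the
        same disc that starts at the centre with the value of \<open>D\<close> there; lifts of discs
        are continuous.\<close>
      obtain \<phi>' where \<phi>': "continuous_map (disc n) E \<phi>'" "\<phi>' ?z = D (\<phi> ?z)" "\<And>y. y \<in> ?D \<Longrightarrow> p (\<phi>' y) = ?\<Phi> y"
        by (rule disc_lift [OF \<Phi> zero_in_disc, of "D (\<phi> ?z)"]) (use pD \<phi>E p\<phi> zero_in_disc in auto)
      have "D (\<phi> y) = \<phi>' y" if y: "y \<in> ?D" for y
      proof -
        obtain \<gamma> where \<gamma>: "pathin E \<gamma>" "\<gamma> 0 = e" "\<gamma> 1 = \<phi> ?z"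
          by (rule path_in_E [OF e(1) \<phi>E [OF zero_in_disc]]) (rule that)
        obtain l where l: "lifts_path E p e' (p \<circ> \<gamma>) l" "lift_end E p e' (p \<circ> \<gamma>) = l 1"
          using lift_ex [OF pp [OF \<gamma>(1)] e(2)] \<gamma>(2) e(3) by auto
        have l1: "l 1 = \<phi>' ?z"
          using D [OF \<gamma>(1,2)] \<gamma>(3) l(2) \<phi>'(2) by simp
        \<comment> \<open>The radius from the centre to \<open>y\<close> prolongs the path from
          \<open>e\<close> to the centre; its lift from \<open>l 1\<close> runs in the disc
          \<phi>'.\<close>
        define s where "s = (\<lambda>t i. (1 - t) * ?z i + t * y i :: real)"
        have sD: "s t \<in> ?D" if "t \<in> {0..1}" for t
          unfolding s_def using disc_convex [OF zero_in_disc y that] by simp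
        have "continuous_on {0..1} s"
          unfolding s_def by (intro continuous_on_coordinatewise_then_product continuous_intros)
        then have s: "pathin (disc n) s"
          using sD by (auto simp: pathin_def disc_eq)
        have s01: "s 0 = ?z" "s 1 = y" by (auto simp: s_def)
        have c: "pathin E (path_concat \<gamma> (\<phi> \<circ> s))"
          using \<gamma> s01 by (intro pathin_path_concat pathin_compose [OF s \<phi>]) auto
        have "lifts_path E p (l 1) (p \<circ> (\<phi> \<circ> s)) (\<phi>' \<circ> s)"
          using pathin_compose [OF s \<phi>'(1)] s01 l1 sD p\<phi> \<phi>'(3) by (simp add: lifts_path_def)
        from lift_end_concat [OF l(1) this]
        have "lift_end E p e' (path_concat (p \<circ> \<gamma>) (p \<circ> (\<phi> \<circ> s))) = \<phi>' y"
          by (simp add: s01 o_def)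
        moreover have "path_concat (p \<circ> \<gamma>) (p \<circ> (\<phi> \<circ> s)) = p \<circ> path_concat \<gamma> (\<phi> \<circ> s)"
          by (auto simp: path_concat_def)
        moreover have "path_concat \<gamma> (\<phi> \<circ> s) 0 = e" "path_concat \<gamma> (\<phi> \<circ> s) 1 = \<phi> y"
          using \<gamma>(2) s01 by (auto simp: path_concat_def)
        ultimately show ?thesis
          using D [OF c] by simp
      qed
      then have "{y \<in> ?D. \<phi> y \<in> {x \<in> topspace E. D x \<in> W}} = {y \<in> ?D. \<phi>' y \<in> W}"
        using \<phi>E by auto
      then show "openin (disc n) {y \<in> ?D. \<phi> y \<in> {x \<in> topspace E. D x \<in> W}}"
        using openin_continuous_map_preimage [OF \<phi>'(1) W] by simp
    qed auto
  qed
  moreover have "D e = e'"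
  proof -
    have "lifts_path E p e' (p \<circ> (\<lambda>t. e)) (\<lambda>t. e')"
      using e by (simp add: lifts_path_def)
    then show ?thesis
      using D [of "\<lambda>t. e"] e lift_end_eq [OF covering] by force
  qed
  ultimately show ?thesis using that pD by blast
qed

text \<open>The lifts of \<open>p\<close> taking \<open>e\<close> to \<open>e'\<close> and back are
  mutually inverse, since both composites are lifts of \<open>p\<close> with a fixed point.\<close>

lemma deck_transformation_exists:
  assumes e: "e \<in> topspace E" "e' \<in> topspace E" "p e = p e'"
  obtains D where "D \<in> deck_transformations U" "D e = e'"
proof -
  obtain D where D: "continuous_map E E D" "D e = e'" "\<And>x. x \<in> topspace E \<Longrightarrow> p (D x) = p x"
    by (rule lift_of_projection [OF e]) (rule that)
  obtain D' where D': "continuous_map E E D'" "D' e' = e" "\<And>x. x \<in> topspace E \<Longrightarrow> p (D' x) = p x"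
    by (rule lift_of_projection [OF e(2,1) e(3) [symmetric]]) (rule that)
  have inE: "D x \<in> topspace E" "D' x \<in> topspace E" if "x \<in> topspace E" for x
    using D(1) D'(1) that continuous_map_image_subset_topspace by blast+
  have "(D' \<circ> D) x = id x" if "x \<in> topspace E" for x
    by (rule lift_unique [OF covering continuous_map_compose [OF D(1) D'(1)], where a = e])
      (use D D' inE e that connected_E in auto)
  moreover have "(D \<circ> D') x = id x" if "x \<in> topspace E" for x
    by (rule lift_unique [OF covering continuous_map_compose [OF D'(1) D(1)], where a = e'])
      (use D D' inE e that connected_E in auto)
  ultimately have "homeomorphic_maps E E D D'"
    using D D' by (simp add: homeomorphic_maps_def)
  then have "homeomorphic_map E E D"
    by (rule homeomorphic_maps_map [THEN iffD1, THEN conjunct1])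
  \<comment> \<open>Deck transformations are extensional functions, hence the restriction.\<close>
  then have "homeomorphic_map E E (restrict D (topspace E))"
    by (rule homeomorphic_map_eq) simp
  then have "restrict D (topspace E) \<in> deck_transformations U"
    using D(3) by (simp add: deck_transformations_def)
  then show ?thesis using that D(2) e(1) by simp
qed

end

section \<open>The fundamental group and its simply transitive action on the fibres\<close>

context cw_covering
begin

abbreviation "G \<equiv> cw_pi1 K U"

lemma carrier_G: "A \<in> carrier G \<longleftrightarrow> (\<exists>f. A = {h. path_homotopic X f h} \<and> loopin X (p b) f)"
  by (auto simp: cw_pi1_def fundamental_group_def)

text \<open>Homotopy classes become sets cut out by an end point, so that computations in the group
  become computations in the fibre over the base point.\<close>

lemma loop_class:
  assumes f: "loopin X (p b) f"
  shows "{h. path_homotopic X f h} = {h. loopin X (p b) h \<and> lift_end E p b h = lift_end E p b f}"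
proof -
  have "loopin X (p b) h" if "path_homotopic X f h" for h
    using path_homotopic_imp_pathin [OF that] f by (simp add: loopin_def)
  moreover have "path_homotopic X f h \<longleftrightarrow> lift_end E p b f = lift_end E p b h" if "loopin X (p b) h" for h
    using that f base by (intro path_homotopic_iff_lift_end) (auto simp: loopin_def)
  ultimately show ?thesis by (auto; metis)
qed

lemma deck_transformationD:
  assumes "D \<in> deck_transformations U"
  shows "continuous_map E E D" "\<And>x. x \<in> topspace E \<Longrightarrow> D x \<in> topspace E"
    "\<And>x. x \<in> topspace E \<Longrightarrow> p (D x) = p x"
proof -
  show c: "continuous_map E E D"
    using assms by (simp add: deck_transformations_def homeomorphic_imp_continuous_map)
  show "\<And>x. x \<in> topspace E \<Longrightarrow> D x \<in> topspace E"
    using continuous_map_image_subset_topspace [OF c] by blast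
  show "\<And>x. x \<in> topspace E \<Longrightarrow> p (D x) = p x"
    using assms by (simp add: deck_transformations_def)
qed

text \<open>The description in \<open>deck_action\<close> determines exactly one map: homotopic
  loops have lifts with the same end, and a deck transformation is decided by its value at the base
  point.\<close>

lemma deck_action_class:
  assumes f: "loopin X (p b) f"
  shows "deck_action U {h. path_homotopic X f h} \<in> deck_transformations U"
    "deck_action U {h. path_homotopic X f h} b = lift_end E p b f"
proof -
  let ?A = "{h. path_homotopic X f h}"
  let ?P = "\<lambda>D. D \<in> deck_transformations U \<and>
        (\<exists>f \<in> ?A. \<exists>l. pathin E l \<and> l 0 = b \<and> (\<forall>t \<in> {0..1}. p (l t) = f t) \<and> D b = l 1)"
  have fp: "pathin X f" "p b = f 0" "f 1 = p b"
    using f by (auto simp: loopin_def)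
  obtain l where l: "lifts_path E p b f l" "lift_end E p b f = l 1"
    by (rule lift_ex [OF fp(1) base fp(2)]) (rule that)
  obtain D where D: "D \<in> deck_transformations U" "D b = lift_end E p b f"
    by (rule deck_transformation_exists [OF base lift_end_in(1) [OF fp(1) base fp(2)]])
      (use lift_end_in(2) [OF fp(1) base fp(2)] fp in auto)
  have "?P D"
    using l D path_homotopic_refl [OF fp(1)] by (auto simp: lifts_path_def)
  moreover have "D' = D" if D': "?P D'" for D'
  proof -
    obtain f' l' where *: "f' \<in> ?A" "pathin E l'" "l' 0 = b" "\<forall>t \<in> {0..1}. p (l' t) = f' t" "D' b = l' 1"
      using D' by blast
    have "lift_end E p b f' = l' 1"
      using * by (intro lift_end_eq [OF covering]) (simp add: lifts_path_def)
    moreover have "lift_end E p b f' = lift_end E p b f"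
      using *(1) loop_class [OF f] by auto
    ultimately have "D' b = D b"
      using *(5) D(2) by simp
    then show ?thesis
      using deck_transformation_unique [OF _ D(1) base] D' by blast
  qed
  ultimately have "deck_action U ?A = D"
    unfolding deck_action_def by (rule the_equality)
  with D show "deck_action U ?A \<in> deck_transformations U" "deck_action U ?A b = lift_end E p b f"
    by auto
qed

lemma deck_action_in: "g \<in> carrier G \<Longrightarrow> deck_action U g \<in> deck_transformations U"
  using deck_action_class carrier_G by auto

lemmas deck_action_continuous = deck_transformationD(1) [OF deck_action_in]
  and deck_action_in_E = deck_transformationD(2) [OF deck_action_in]
  and deck_action_p = deck_transformationD(3) [OF deck_action_in]

lemma carrier_G_eq:
  assumes "A \<in> carrier G"
  shows "A = {h. loopin X (p b) h \<and> lift_end E p b h = deck_action U A b}"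
proof -
  obtain f where f: "A = {h. path_homotopic X f h}" "loopin X (p b) f"
    using assms carrier_G by auto
  show ?thesis
    unfolding deck_action_class(2) [OF f(2), folded f(1)] unfolding f(1) by (rule loop_class [OF f(2)])
qed

lemma in_carrier_G:
  assumes "A \<in> carrier G" "f \<in> A"
  shows "pathin X f" "p b = f 0" "f 1 = p b" "lift_end E p b f = deck_action U A b"
proof -
  have "loopin X (p b) f \<and> lift_end E p b f = deck_action U A b"
    using assms(2) by (subst (asm) carrier_G_eq [OF assms(1)]) simp
  then show "pathin X f" "p b = f 0" "f 1 = p b" "lift_end E p b f = deck_action U A b"
    by (simp_all add: loopin_def)
qed

lemma deck_action_inj:
  "A \<in> carrier G \<Longrightarrow> B \<in> carrier G \<Longrightarrow> deck_action U A b = deck_action U B b \<Longrightarrow> A = B"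
  by (subst carrier_G_eq, assumption, subst (2) carrier_G_eq) simp_all

lemma deck_action_fibre:
  assumes e: "e \<in> topspace E" "p e = p b"
  obtains A where "A \<in> carrier G" "deck_action U A b = e"
proof -
  obtain l where l: "pathin E l" "l 0 = b" "l 1 = e"
    by (rule path_in_E [OF base e(1)]) (rule that)
  have f: "loopin X (p b) (p \<circ> l)"
    using pathin_compose [OF l(1) continuous_p] l e by (simp add: loopin_def)
  have "lift_end E p b (p \<circ> l) = l 1"
    using l by (intro lift_end_eq [OF covering]) (simp add: lifts_path_def)
  with f l show ?thesis
    by (intro that [of "{h. path_homotopic X (p \<circ> l) h}"])
      (auto simp: carrier_G deck_action_class(2))
qed

text \<open>A product of classes is a union over representatives and has to be recognised as a
  single class. The lift of \<open>path_concat f g\<close> is the lift of \<open>f\<close> followed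
  by the translate under \<open>A\<close> of the lift of \<open>g\<close>; this order makes the
  action a left action.\<close>

lemma mult_G:
  assumes A: "A \<in> carrier G" and B: "B \<in> carrier G"
  shows "A \<otimes>\<^bsub>G\<^esub> B \<in> carrier G"
    "deck_action U (A \<otimes>\<^bsub>G\<^esub> B) b = deck_action U A (deck_action U B b)"
proof -
  let ?D = "deck_action U A"
  have end_eq: "loopin X (p b) (path_concat f g)" "lift_end E p b (path_concat f g) = ?D (deck_action U B b)"
    if f: "f \<in> A" and g: "g \<in> B" for f g
  proof -
    note f' = in_carrier_G [OF A f] and g' = in_carrier_G [OF B g]
    show "loopin X (p b) (path_concat f g)"
      using f' g' pathin_path_concat [OF f'(1) g'(1)] by (simp add: loopin_def path_concat_def)
    obtain l where l: "lifts_path E p b f l" "lift_end E p b f = l 1"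
      by (rule lift_ex [OF f'(1) base f'(2)]) (rule that)
    obtain l' where l': "lifts_path E p b g l'" "lift_end E p b g = l' 1"
      by (rule lift_ex [OF g'(1) base g'(2)]) (rule that)
    have l'E: "l' t \<in> topspace E" if "t \<in> {0..1}" for t
      using l'(1) that path_image_subset_topspace [of E l'] by (auto simp: lifts_path_def)
    have "lifts_path E p (l 1) g (?D \<circ> l')"
      using l' l f'(4) l'E pathin_compose [OF _ deck_action_continuous [OF A], of l'] deck_action_p [OF A]
      by (auto simp: lifts_path_def)
    from lift_end_concat [OF l(1) this]
    show "lift_end E p b (path_concat f g) = ?D (deck_action U B b)"
      using l'(2) g'(4) by simp
  qed
  obtain f g where f: "A = {h. path_homotopic X f h}" "loopin X (p b) f"
    and g: "B = {h. path_homotopic X g h}" "loopin X (p b) g"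
    using A B carrier_G by auto
  have fg: "f \<in> A" "g \<in> B"
    using f g by (auto simp: loopin_def path_homotopic_refl)
  have "A \<otimes>\<^bsub>G\<^esub> B = (\<Union>f\<in>A. \<Union>g\<in>B. {h. path_homotopic X (path_concat f g) h})"
    by (auto simp: cw_pi1_def fundamental_group_def)
  also have "\<dots> = (\<Union>f\<in>A. \<Union>g\<in>B. {h. loopin X (p b) h \<and> lift_end E p b h = ?D (deck_action U B b)})"
    using loop_class end_eq by simp
  also have "\<dots> = {h. loopin X (p b) h \<and> lift_end E p b h = ?D (deck_action U B b)}"
    using fg by auto
  also have "\<dots> = {h. path_homotopic X (path_concat f g) h}"
    using loop_class end_eq fg by simp
  finally have eq: "A \<otimes>\<^bsub>G\<^esub> B = {h. path_homotopic X (path_concat f g) h}" .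
  show "A \<otimes>\<^bsub>G\<^esub> B \<in> carrier G"
    unfolding carrier_G eq using end_eq [OF fg] by blast
  show "deck_action U (A \<otimes>\<^bsub>G\<^esub> B) b = ?D (deck_action U B b)"
    unfolding eq using deck_action_class(2) end_eq [OF fg] by simp
qed

lemma deck_action_mult:
  assumes A: "A \<in> carrier G" and B: "B \<in> carrier G" and x: "x \<in> topspace E"
  shows "deck_action U (A \<otimes>\<^bsub>G\<^esub> B) x = deck_action U A (deck_action U B x)"
  by (rule lift_unique [OF covering deck_action_continuous [OF mult_G(1) [OF A B]]
        continuous_map_compose [OF deck_action_continuous [OF B] deck_action_continuous [OF A]],
        where a = b, unfolded o_apply])
    (use A B x base connected_E mult_G deck_action_p deck_action_in_E in auto)

lemma one_G:
  shows "\<one>\<^bsub>G\<^esub> \<in> carrier G" "x \<in> topspace E \<Longrightarrow> deck_action U \<one>\<^bsub>G\<^esub> x = x"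
proof -
  have c: "loopin X (p b) (\<lambda>t. p b)"
    using p_in_X [OF base] by (simp add: loopin_def)
  have eq: "\<one>\<^bsub>G\<^esub> = {h. path_homotopic X (\<lambda>t. p b) h}"
    by (simp add: cw_pi1_def fundamental_group_def)
  show 1: "\<one>\<^bsub>G\<^esub> \<in> carrier G"
    unfolding carrier_G eq using c by blast
  have "lift_end E p b (\<lambda>t. p b) = b"
    using lift_end_eq [OF covering, of b "\<lambda>t. p b" "\<lambda>t. b"] base by (simp add: lifts_path_def)
  then have "deck_action U \<one>\<^bsub>G\<^esub> b = b"
    unfolding eq using deck_action_class(2) [OF c] by simp
  then show "x \<in> topspace E \<Longrightarrow> deck_action U \<one>\<^bsub>G\<^esub> x = x"
    using lift_unique [OF covering deck_action_continuous [OF 1] continuous_map_id, where a = b and y = x]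
      connected_E base deck_action_p [OF 1] by auto
qed

lemma deck_action_transitive:
  assumes e: "e \<in> topspace E" "e' \<in> topspace E" "p e = p e'"
  obtains g where "g \<in> carrier G" "deck_action U g e = e'"
proof -
  obtain D where D: "D \<in> deck_transformations U" "D e = e'"
    by (rule deck_transformation_exists [OF e]) (rule that)
  obtain g where g: "g \<in> carrier G" "deck_action U g b = D b"
    by (rule deck_action_fibre [of "D b"]) (use deck_transformationD [OF D(1)] base that in auto)
  have "deck_action U g = D"
    by (rule deck_transformation_unique [OF deck_action_in [OF g(1)] D(1) base g(2)])
  with g D show ?thesis using that by blast
qed

lemma deck_action_free:
  assumes "g \<in> carrier G" "h \<in> carrier G" "e \<in> topspace E" "deck_action U g e = deck_action U h e"
  shows "g = h"
  using deck_transformation_unique [OF deck_action_in deck_action_in assms(3,4)] assms(1,2)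
    deck_action_inj by metis

text \<open>A group element is determined by where it sends the base point, so each group law is
  checked in the fibre.\<close>

lemma group_G: "group G"
proof (rule groupI)
  show "x \<otimes>\<^bsub>G\<^esub> y \<in> carrier G" if "x \<in> carrier G" "y \<in> carrier G" for x y
    using mult_G that by blast
  show "\<one>\<^bsub>G\<^esub> \<in> carrier G" by (rule one_G)
  show "x \<otimes>\<^bsub>G\<^esub> y \<otimes>\<^bsub>G\<^esub> z = x \<otimes>\<^bsub>G\<^esub> (y \<otimes>\<^bsub>G\<^esub> z)"
    if "x \<in> carrier G" "y \<in> carrier G" "z \<in> carrier G" for x y z
    using that base by (intro deck_action_inj) (simp_all add: mult_G deck_action_mult deck_action_in_E)
  show "\<one>\<^bsub>G\<^esub> \<otimes>\<^bsub>G\<^esub> x = x" if "x \<in> carrier G" for x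
    using that base by (intro deck_action_inj) (simp_all add: mult_G one_G deck_action_in_E)
  show "\<exists>y\<in>carrier G. y \<otimes>\<^bsub>G\<^esub> x = \<one>\<^bsub>G\<^esub>" if x: "x \<in> carrier G" for x
  proof -
    obtain y where y: "y \<in> carrier G" "deck_action U y (deck_action U x b) = b"
      by (rule deck_action_transitive [of "deck_action U x b" b])
        (use deck_action_in_E [OF x base] deck_action_p [OF x base] base that in auto)
    have "y \<otimes>\<^bsub>G\<^esub> x = \<one>\<^bsub>G\<^esub>"
      using x y base by (intro deck_action_inj) (simp_all add: mult_G one_G)
    with y show ?thesis by blast
  qed
qed

end

section \<open>Homology of discs\<close>

text \<open>The two vanishing groups are the outer terms of a stretch of the exact sequence of the
  triple.\<close>

lemma hom_induced_iso_triple: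
  assumes "T \<subseteq> S"
    and "trivial_group (relative_homology_group p (subtopology X S) T)"
    and "trivial_group (relative_homology_group (p - 1) (subtopology X S) T)"
  shows "hom_induced p X T X S id \<in> iso (relative_homology_group p X T) (relative_homology_group p X S)"
proof (rule very_short_exact_sequence [OF _ assms(2,3)])
  show "exact_seq
         ([relative_homology_group(p - 1) (subtopology X S) T, relative_homology_group p X S, relative_homology_group p X T, relative_homology_group p (subtopology X S) T],
          [hom_relboundary p X S T, hom_induced p X T X S id, hom_induced p (subtopology X S) T X T id])"
    using homology_exactness_triple_1 [OF \<open>T \<subseteq> S\<close>] homology_exactness_triple_3 [OF \<open>T \<subseteq> S\<close>]
    by fastforce
qed

lemma continuous_on_L2_set: "continuous_on A (\<lambda>x::nat \<Rightarrow> real. L2_set x {..<n})"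
  unfolding L2_set_def
  by (intro continuous_intros continuous_on_product_then_coordinatewise [OF continuous_on_id])

lemma L2_set_scale: "0 \<le> r \<Longrightarrow> L2_set (\<lambda>i. x i * r) {..<n} = L2_set x {..<n} * r"
  by (simp add: L2_set_left_distrib)

lemma L2_set_disc_eq_0: "x \<in> topspace (disc n) \<Longrightarrow> L2_set x {..<n} = 0 \<longleftrightarrow> x = (\<lambda>i. 0)"
  by (auto simp: topspace_disc L2_set_eq_0_iff fun_eq_iff) (meson lessThan_iff not_le)

lemma disc_interior_subset: "disc_interior n \<subseteq> topspace (disc n)"
  and disc_boundary_subset: "disc_boundary n \<subseteq> topspace (disc n)"
  and topspace_disc_Un: "topspace (disc n) = disc_interior n \<union> disc_boundary n"
  and disc_interior_boundary: "disc_interior n \<inter> disc_boundary n = {}"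
  by (auto simp: topspace_disc disc_interior_eq disc_boundary_eq)

lemma zero_in_disc_interior: "(\<lambda>i. 0) \<in> disc_interior n"
  by (simp add: disc_interior_eq L2_set_0')

lemma closed_topspace_disc: "closed (topspace (disc n))"
proof -
  have "closed {x::nat\<Rightarrow>real. x i = 0}" for i
    by (intro closed_Collect_eq continuous_on_product_then_coordinatewise [OF continuous_on_id] continuous_intros)
  then have "closed (\<Inter>i\<in>{n..}. {x::nat\<Rightarrow>real. x i = 0})"
    by blast
  moreover have "closed {x::nat\<Rightarrow>real. L2_set x {..<n} \<le> 1}"
    by (intro closed_Collect_le continuous_on_L2_set continuous_intros)
  moreover have "topspace (disc n) = (\<Inter>i\<in>{n..}. {x. x i = 0}) \<inter> {x. L2_set x {..<n} \<le> 1}"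
    by (auto simp: topspace_disc)
  ultimately show ?thesis by (simp add: closed_Int)
qed

lemma compact_disc: "compact_space (disc n)"
proof -
  have "compactin (powertop_real UNIV) (UNIV \<rightarrow>\<^sub>E {-1..1})"
    by (simp add: compactin_PiE)
  moreover have "topspace (disc n) \<subseteq> (UNIV \<rightarrow>\<^sub>E {-1..1})"
  proof
    fix x assume x: "x \<in> topspace (disc n)"
    have "x i \<in> {-1..1}" for i
    proof (cases "i < n")
      case True
      have "\<bar>x i\<bar> \<le> L2_set (\<lambda>i. \<bar>x i\<bar>) {..<n}"
        using True by (intro member_le_L2_set) auto
      then have "\<bar>x i\<bar> \<le> L2_set x {..<n}"
        by (simp add: L2_set_def)
      also have "\<dots> \<le> 1" using x by (simp add: topspace_disc)
      finally show ?thesis by auto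
    qed (use x in \<open>auto simp: topspace_disc\<close>)
    then show "x \<in> (UNIV \<rightarrow>\<^sub>E {-1..1})" by (simp only: PiE_UNIV_domain Pi_iff) blast
  qed
  ultimately have "compactin (powertop_real UNIV) (topspace (disc n))"
    using closed_topspace_disc by (metis closed_compactin closed_closedin euclidean_product_topology)
  then have "compact_space (subtopology euclidean (topspace (disc n)))"
    by (simp add: compact_space_subtopology euclidean_product_topology)
  then show ?thesis by (simp add: disc_eq)
qed

lemma contractible_disc: "contractible_space (disc n)"
proof -
  let ?z = "(\<lambda>i. 0) :: nat \<Rightarrow> real"
  have "homotopic_with (\<lambda>h. True) (disc n) (disc n) (\<lambda>x. ?z) id"
    by (subst homotopic_with, simp)
      (intro exI conjI, rule continuous_map_disc_segment [OF zero_in_disc], auto)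
  then show ?thesis
    unfolding contractible_space_def using homotopic_with_symD by blast
qed

text \<open>At time \<open>fst z\<close>, the point on the segment from x to its radial projection x
  / |x| on the boundary sphere.\<close>

definition radial :: "nat \<Rightarrow> real \<times> (nat \<Rightarrow> real) \<Rightarrow> nat \<Rightarrow> real" where
  "radial n z = (\<lambda>i. snd z i * ((1 - fst z) + fst z / L2_set (snd z) {..<n}))"

abbreviation punctured_disc :: "nat \<Rightarrow> (nat \<Rightarrow> real) set" where
  "punctured_disc n \<equiv> topspace (disc n) - {\<lambda>i. 0}"

lemma radial_norm:
  assumes "x \<in> punctured_disc n" "t \<in> {0..1}"
  shows "L2_set (radial n (t, x)) {..<n} = (1 - t) * L2_set x {..<n} + t"
proof -
  have x: "L2_set x {..<n} > 0"
    using assms L2_set_disc_eq_0 by (metis Diff_iff L2_set_nonneg less_eq_real_def singletonI)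
  then have "0 \<le> (1 - t) + t / L2_set x {..<n}"
    using assms(2) by simp
  then have "L2_set (radial n (t, x)) {..<n} = L2_set x {..<n} * ((1 - t) + t / L2_set x {..<n})"
    unfolding radial_def by (simp add: L2_set_scale)
  also have "\<dots> = (1 - t) * L2_set x {..<n} + t"
    using x by (simp add: field_simps)
  finally show ?thesis .
qed

lemma radial_in:
  assumes "x \<in> punctured_disc n" "t \<in> {0..1}"
  shows "radial n (t, x) \<in> punctured_disc n"
proof -
  have x: "L2_set x {..<n} > 0" "L2_set x {..<n} \<le> 1"
    using assms L2_set_disc_eq_0 [of x n] L2_set_nonneg [of x "{..<n}"]
    by (auto simp: topspace_disc simp del: L2_set_nonneg)
  have "(1 - t) * L2_set x {..<n} \<le> (1 - t) * 1"
    using x assms(2) by (intro mult_left_mono) auto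
  then have "L2_set (radial n (t, x)) {..<n} \<le> 1"
    using radial_norm [OF assms] by simp
  moreover have "0 < (1 - t) * L2_set x {..<n} + t"
  proof (cases "t = 0")
    case False
    then show ?thesis
      using x assms(2) by (intro add_nonneg_pos mult_nonneg_nonneg) auto
  qed (use x in simp)
  then have "L2_set (radial n (t, x)) {..<n} \<noteq> 0"
    using radial_norm [OF assms] by simp
  moreover have "\<forall>i\<ge>n. radial n (t, x) i = 0"
    using assms by (simp add: radial_def topspace_disc)
  ultimately show ?thesis
    by (auto simp: topspace_disc L2_set_0')
qed

lemma radial_0: "radial n (0, x) = x"
  by (simp add: radial_def)

lemma radial_1: "x \<in> punctured_disc n \<Longrightarrow> radial n (1, x) \<in> disc_boundary n"
  using radial_norm [of x n 1] radial_in [of x n 1] by (simp add: disc_boundary_eq topspace_disc)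

lemma radial_boundary: "x \<in> disc_boundary n \<Longrightarrow> radial n (t, x) = x"
  by (simp add: radial_def disc_boundary_eq)

lemma continuous_radial:
  "continuous_map (prod_topology unit_interval (subtopology (disc n) (punctured_disc n)))
     (subtopology (disc n) (punctured_disc n)) (radial n)"
proof -
  have eq: "subtopology (disc n) (punctured_disc n) = top_of_set (punctured_disc n)"
    by (simp add: disc_eq subtopology_subtopology inf.absorb2 Int_absorb1)
  have nz: "\<forall>z \<in> {0..1} \<times> punctured_disc n. L2_set (snd z) {..<n} \<noteq> 0"
    using L2_set_disc_eq_0 by (auto simp del: L2_set_eq_0_iff)
  have "continuous_on ({0..1} \<times> punctured_disc n) (\<lambda>z. snd z i)" for i
    by (rule continuous_on_product_then_coordinatewise [OF continuous_on_snd [OF continuous_on_id]])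
  moreover have "continuous_on ({0..1} \<times> punctured_disc n) (\<lambda>z. L2_set (snd z) {..<n})"
    by (rule continuous_on_compose2 [OF continuous_on_L2_set [of UNIV] continuous_on_snd [OF continuous_on_id]]) auto
  ultimately have "continuous_on ({0..1} \<times> punctured_disc n) (radial n)"
    unfolding radial_def by (intro continuous_on_coordinatewise_then_product continuous_intros nz)
  then show ?thesis
    unfolding eq using radial_in by auto
qed

text \<open>The radial flow deforms the punctured disc into the boundary and leaves the boundary
  fixed.\<close>

lemma trivial_homology_punctured_disc:
  "trivial_group (relative_homology_group p (subtopology (disc n) (punctured_disc n)) (disc_boundary n))"
proof (rule trivial_relative_homology_group_alt)
  let ?Y = "subtopology (disc n) (punctured_disc n)"
  have "continuous_map ?Y (prod_topology unit_interval ?Y) (\<lambda>x. (1, x))"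
    by (auto simp: continuous_map_pairwise o_def)
  from continuous_map_compose [OF this continuous_radial]
  have "continuous_map ?Y ?Y (\<lambda>x. radial n (1, x))" by (simp add: o_def)
  then show "continuous_map ?Y (subtopology ?Y (disc_boundary n)) (\<lambda>x. radial n (1, x))"
    using radial_1 by (auto simp: continuous_map_in_subtopology)
  have "homotopic_with (\<lambda>k. k ` disc_boundary n \<subseteq> disc_boundary n) ?Y ?Y id (\<lambda>x. radial n (1, x))"
    unfolding homotopic_with_def
    by (intro exI [of _ "radial n"] conjI continuous_radial) (auto simp: radial_0 radial_boundary)
  then show "homotopic_with (\<lambda>k. k ` disc_boundary n \<subseteq> disc_boundary n) ?Y ?Y (\<lambda>x. radial n (1, x)) id"
    by (rule homotopic_with_symD)
qed

lemma boundary_subset_punctured: "disc_boundary n \<subseteq> punctured_disc n"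
  using zero_in_disc_interior disc_interior_boundary disc_boundary_subset by blast

text \<open>The boundary is thickened to the open punctured disc because excision requires the
  closure of the excised set to lie in the interior of the subspace.\<close>

lemma disc_boundary_punctured_iso:
  "hom_induced p (disc n) (disc_boundary n) (disc n) (punctured_disc n) id
    \<in> iso (relative_homology_group p (disc n) (disc_boundary n)) (relative_homology_group p (disc n) (punctured_disc n))"
  by (intro hom_induced_iso_triple boundary_subset_punctured trivial_homology_punctured_disc)

lemma closedin_disc_boundary: "closedin (disc n) (disc_boundary n)"
proof -
  have "closed {x::nat\<Rightarrow>real. L2_set x {..<n} = 1}"
    by (intro closed_Collect_eq continuous_on_L2_set continuous_intros)
  moreover have "disc_boundary n = topspace (disc n) \<inter> {x. L2_set x {..<n} = 1}"
    by (auto simp: topspace_disc disc_boundary_eq)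
  ultimately show ?thesis
    by (simp add: disc_eq closedin_closed_Int)
qed

lemma openin_punctured_disc: "openin (disc n) (punctured_disc n)"
proof -
  have "closed {x::nat\<Rightarrow>real. L2_set x {..<n} = 0}"
    by (intro closed_Collect_eq continuous_on_L2_set continuous_intros)
  then have "open (- {x::nat\<Rightarrow>real. L2_set x {..<n} = 0})"
    by (rule open_Compl)
  moreover have "punctured_disc n = topspace (disc n) \<inter> - {x. L2_set x {..<n} = 0}"
    using L2_set_disc_eq_0 by blast
  ultimately show ?thesis
    by (metis disc_eq openin_open_Int topspace_disc)
qed

lemma disc_interior_excision_iso:
  "hom_induced p (subtopology (disc n) (disc_interior n)) (disc_interior n - {\<lambda>i. 0}) (disc n) (punctured_disc n) id
    \<in> iso (relative_homology_group p (subtopology (disc n) (disc_interior n)) (disc_interior n - {\<lambda>i. 0}))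
        (relative_homology_group p (disc n) (punctured_disc n))"
proof -
  have "disc n closure_of disc_boundary n \<subseteq> disc n interior_of punctured_disc n"
    using closedin_disc_boundary openin_punctured_disc boundary_subset_punctured
    by (simp add: closure_of_closedin interior_of_openin)
  from homology_excision_axiom [OF this, of "topspace (disc n)" p]
  have "hom_induced p (subtopology (disc n) (topspace (disc n) - disc_boundary n)) (punctured_disc n - disc_boundary n)
      (disc n) (punctured_disc n) id
    \<in> iso (relative_homology_group p (subtopology (disc n) (topspace (disc n) - disc_boundary n)) (punctured_disc n - disc_boundary n))
        (relative_homology_group p (disc n) (punctured_disc n))"
    by simp
  moreover have "topspace (disc n) - disc_boundary n = disc_interior n"
    using topspace_disc_Un disc_interior_boundary by blast
  moreover have "punctured_disc n - disc_boundary n = disc_interior n - {\<lambda>i. 0}"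
    using topspace_disc_Un disc_interior_boundary by blast
  ultimately show ?thesis by simp
qed

text \<open>The disc is contractible, so the exact sequence of the pair leads to the reduced
  homology of the boundary sphere.\<close>

lemma relative_homology_disc:
  "relative_homology_group (int n) (disc n) (disc_boundary n) \<cong> integer_group"
proof (cases n)
  case 0
  \<comment> \<open>The 0-disc is a point with empty boundary, so absolute homology remains.\<close>
  have "topspace (disc 0) = {\<lambda>i. 0}" by (auto simp: topspace_disc)
  then have "homology_group 0 (disc 0) \<cong> integer_group"
    by (rule homology_coefficients)
  moreover have "disc_boundary 0 = {}" by (auto simp: disc_boundary_eq)
  ultimately show ?thesis using 0 by simp
next
  case (Suc m)
  have eq: "subtopology (disc n) (disc_boundary n) = nsphere m"
  proof -
    have "{x::nat\<Rightarrow>real. \<forall>i\<ge>n. x i = 0} \<inter> ({x. (\<Sum>i<n. (x i)\<^sup>2) \<le> 1} \<inter> disc_boundary n)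
        = {x. (\<Sum>i\<le>m. x i ^ 2) = 1 \<and> (\<forall>i>m. x i = 0)}"
      using Suc by (auto simp: disc_boundary_eq L2_set_def lessThan_Suc_atMost Suc_le_eq)
    then show ?thesis
      by (simp add: disc_def Euclidean_space_def subtopology_subtopology nsphere Int_assoc)
  qed
  have "topspace (disc n) \<inter> disc_boundary n \<noteq> {}"
  proof -
    have "topspace (nsphere m) \<noteq> {}" using in_topspace_nsphere by blast
    then show ?thesis using eq by (metis topspace_subtopology)
  qed
  then have "relative_homology_group (int n) (disc n) (disc_boundary n) \<cong> reduced_homology_group (int n - 1) (nsphere m)"
    using isomorphic_group_relative_homology_of_contractible [OF contractible_disc] eq by metis
  also have "reduced_homology_group (int n - 1) (nsphere m) \<cong> integer_group"
    using reduced_homology_group_nsphere(1) [of m] Suc by simp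
  finally show ?thesis
    by (simp add: iso_trans)
qed

section \<open>Skeleta\<close>

context cw_complex
begin

abbreviation (input) "centre n i \<equiv> char_map K n i (\<lambda>i. 0)"

lemma char_map_in: "i \<in> cells K n \<Longrightarrow> x \<in> topspace (disc n) \<Longrightarrow> char_map K n i x \<in> topspace (cw_space K)"
  using continuous_map_image_subset_topspace [OF char_map_continuous] by blast

lemma char_map_inj:
  assumes "i \<in> cells K n" "x \<in> disc_interior n" "y \<in> disc_interior n" "char_map K n i x = char_map K n i y"
  shows "x = y"
proof -
  have "inj_on (char_map K n i) (topspace (subtopology (disc n) (disc_interior n)))"
    using char_map_embedding [OF assms(1)] homeomorphic_imp_injective_map unfolding embedding_map_def by blast
  then have "inj_on (char_map K n i) (disc_interior n)"
    using disc_interior_subset by (simp add: Int_absorb1)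
  then show ?thesis using assms by (auto dest: inj_onD)
qed

lemma skeleton_mono: "m \<le> n \<Longrightarrow> skeleton K m \<subseteq> skeleton K n"
  unfolding skeleton_def by (rule UN_mono) auto

lemma skeleton_Un: "skeleton K (int n) = skeleton K (int n - 1) \<union> (\<Union>i\<in>cells K n. open_cell K n i)"
proof -
  have "{m. int m \<le> int n} = insert n {m. int m \<le> int n - 1}" by auto
  then show ?thesis by (auto simp: skeleton_def)
qed

lemma skeleton_subset: "skeleton K m \<subseteq> topspace (cw_space K)"
  unfolding skeleton_def cells_cover by blast

lemma open_cell_disjoint_skeleton:
  assumes "i \<in> cells K n" shows "open_cell K n i \<inter> skeleton K (int n - 1) = {}"
proof -
  have "open_cell K n i \<inter> open_cell K m j = {}" if "int m \<le> int n - 1" "j \<in> cells K m" for m j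
    using cells_disjoint [OF assms that(2)] that(1) by fastforce
  then show ?thesis by (auto simp: skeleton_def)
qed

lemma open_cell_unique:
  "i \<in> cells K n \<Longrightarrow> j \<in> cells K n \<Longrightarrow> x \<in> open_cell K n i \<Longrightarrow> x \<in> open_cell K n j \<Longrightarrow> i = j"
  using cells_disjoint [of i n j n] by blast

lemma boundary_in_skeleton:
  assumes "i \<in> cells K n" "x \<in> disc_boundary n"
  shows "char_map K n i x \<in> skeleton K (int n - 1)"
proof -
  obtain F where "F \<subseteq> {(m, j). m < n \<and> j \<in> cells K m}"
    "char_map K n i ` disc_boundary n \<subseteq> (\<Union>(m, j) \<in> F. open_cell K m j)"
    using closure_finite [OF assms(1)] by blast
  with assms(2) obtain m j where "m < n" "j \<in> cells K m" "char_map K n i x \<in> open_cell K m j" by blast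
  then show ?thesis by (force simp: skeleton_def)
qed

lemma disc_image:
  assumes "i \<in> cells K n"
  shows "open_cell K n i \<subseteq> char_map K n i ` topspace (disc n)"
    "char_map K n i ` topspace (disc n) \<subseteq> open_cell K n i \<union> skeleton K (int n - 1)"
    "char_map K n i ` topspace (disc n) \<subseteq> skeleton K (int n)"
proof -
  show 1: "open_cell K n i \<subseteq> char_map K n i ` topspace (disc n)"
    using disc_interior_subset by (auto simp: open_cell_def)
  show 2: "char_map K n i ` topspace (disc n) \<subseteq> open_cell K n i \<union> skeleton K (int n - 1)"
    using boundary_in_skeleton [OF assms] topspace_disc_Un by (fastforce simp: open_cell_def)
  show "char_map K n i ` topspace (disc n) \<subseteq> skeleton K (int n)"
    using 2 assms skeleton_Un [of n] by blast
qed

lemma interior_iff_open_cell: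
  assumes "i \<in> cells K n" "x \<in> topspace (disc n)"
  shows "char_map K n i x \<in> open_cell K n i \<longleftrightarrow> x \<in> disc_interior n"
    "char_map K n i x \<in> skeleton K (int n - 1) \<longleftrightarrow> x \<in> disc_boundary n"
  using boundary_in_skeleton [OF assms(1)] open_cell_disjoint_skeleton [OF assms(1)] assms(2)
    topspace_disc_Un [of n] disc_interior_boundary [of n] by (auto simp: open_cell_def)

lemma centre_eq_iff:
  assumes "i \<in> cells K n" "x \<in> topspace (disc n)"
  shows "char_map K n i x = centre n i \<longleftrightarrow> x = (\<lambda>i. 0)"
proof
  assume eq: "char_map K n i x = centre n i"
  then have "x \<in> disc_interior n"
    using interior_iff_open_cell(1) [OF assms] zero_in_disc_interior by (auto simp: open_cell_def)
  then show "x = (\<lambda>i. 0)"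
    using char_map_inj [OF assms(1) _ zero_in_disc_interior eq] by blast
qed simp

lemma compactin_closed_cell:
  "i \<in> cells K n \<Longrightarrow> compactin (cw_space K) (char_map K n i ` topspace (disc n))"
  using image_compactin [OF _ char_map_continuous] compact_disc by (simp add: compact_space_def)

text \<open>Closed cells are compact, so in this form a skeleton with finitely many cells is seen to
  be compact.\<close>

lemma skeleton_eq_closed_cells:
  "skeleton K m = (\<Union>n \<in> {n. int n \<le> m}. \<Union>i \<in> cells K n. char_map K n i ` topspace (disc n))"
proof
  show "skeleton K m \<subseteq> (\<Union>n \<in> {n. int n \<le> m}. \<Union>i \<in> cells K n. char_map K n i ` topspace (disc n))"
    unfolding skeleton_def using disc_image(1) by (intro UN_mono) auto
  show "(\<Union>n \<in> {n. int n \<le> m}. \<Union>i \<in> cells K n. char_map K n i ` topspace (disc n)) \<subseteq> skeleton K m"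
    using disc_image(3) skeleton_mono by (intro UN_least) blast
qed

lemma closedin_skeleton:
  assumes "\<And>n. int n \<le> m \<Longrightarrow> finite (cells K n)"
  shows "closedin (cw_space K) (skeleton K m)"
proof -
  have fin: "finite {n. int n \<le> m}"
    by (rule finite_subset [of _ "{..nat m}"]) auto
  have "compactin (cw_space K) (skeleton K m)"
    unfolding skeleton_eq_closed_cells
    by (intro compactin_Union finite_imageI fin) (use assms fin compactin_closed_cell in \<open>auto intro!: compactin_Union\<close>)
  then show ?thesis by (rule compactin_imp_closedin [OF Hausdorff])
qed

lemma closedin_closed_cell:
  "i \<in> cells K n \<Longrightarrow> closedin (cw_space K) (char_map K n i ` topspace (disc n))"
  using compactin_closed_cell compactin_imp_closedin [OF Hausdorff] by blast

text \<open>Its complement in the n-skeleton consists of the lower skeleton and the other closed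
  n-cells, which are finitely many closed sets.\<close>

lemma openin_open_cell:
  assumes fin: "\<And>m. m \<le> n \<Longrightarrow> finite (cells K m)" and i: "i \<in> cells K n"
  shows "openin (subtopology (cw_space K) (skeleton K (int n))) (open_cell K n i)"
proof -
  let ?C = "skeleton K (int n - 1) \<union> (\<Union>j\<in>cells K n - {i}. char_map K n j ` topspace (disc n))"
  have "closedin (cw_space K) (skeleton K (int n - 1))"
    using fin by (intro closedin_skeleton) simp
  then have "closedin (cw_space K) ?C"
    by (intro closedin_Un closedin_Union) (use fin closedin_closed_cell in auto)
  moreover have "open_cell K n i = skeleton K (int n) - ?C"
  proof
    show "open_cell K n i \<subseteq> skeleton K (int n) - ?C"
    proof
      fix x assume x: "x \<in> open_cell K n i"
      have "x \<notin> char_map K n j ` topspace (disc n)" if "j \<in> cells K n - {i}" for j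
        using disc_image(2) [of j n] open_cell_unique [OF i _ x, of j] open_cell_disjoint_skeleton [OF i] x that
        by auto
      moreover have "x \<in> skeleton K (int n)" using x i skeleton_Un [of n] by auto
      moreover have "x \<notin> skeleton K (int n - 1)" using open_cell_disjoint_skeleton [OF i] x by auto
      ultimately show "x \<in> skeleton K (int n) - ?C" by auto
    qed
    show "skeleton K (int n) - ?C \<subseteq> open_cell K n i"
    proof
      fix x assume x: "x \<in> skeleton K (int n) - ?C"
      then have "x \<in> skeleton K (int n)" "x \<notin> skeleton K (int n - 1)" by simp_all
      then obtain j where j: "j \<in> cells K n" "x \<in> open_cell K n j"
        using skeleton_Un [of n] by auto
      have "j = i"
      proof (rule ccontr)
        assume "j \<noteq> i"
        then have "x \<in> ?C" using j disc_image(1) [OF j(1)] by blast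
        with x show False by simp
      qed
      with j show "x \<in> open_cell K n i" by simp
    qed
  qed
  moreover have "openin (subtopology (cw_space K) (skeleton K (int n))) (skeleton K (int n) \<inter> (topspace (cw_space K) - ?C))"
    using calculation(1) by (intro openin_subtopology_Int2) auto
  moreover have "skeleton K (int n) \<inter> (topspace (cw_space K) - ?C) = skeleton K (int n) - ?C"
    using skeleton_subset by blast
  ultimately show ?thesis by simp
qed

section \<open>Pushing a skeleton off the centres of its top cells\<close>

definition centres :: "nat \<Rightarrow> 'a set" where
  "centres n = (\<lambda>i. centre n i) ` cells K n"

lemma closed_cell_minus_centres:
  assumes i: "i \<in> cells K n"
  shows "char_map K n i ` topspace (disc n) - centres n = char_map K n i ` punctured_disc n"
proof -
  have "centre n j \<noteq> char_map K n i x" if "j \<in> cells K n" "x \<in> punctured_disc n" for j x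
  proof
    assume eq: "centre n j = char_map K n i x"
    have j: "centre n j \<in> open_cell K n j"
      using zero_in_disc_interior by (auto simp: open_cell_def)
    then have "centre n j \<notin> skeleton K (int n - 1)"
      using open_cell_disjoint_skeleton [OF that(1)] by blast
    then have "centre n j \<in> open_cell K n i"
      using disc_image(2) [OF i] that(2) eq by auto
    then have "i = j" using open_cell_unique [OF i that(1)] j by blast
    then show False using centre_eq_iff [OF i, of x] eq that(2) by auto
  qed
  then have "centres n \<inter> char_map K n i ` punctured_disc n = {}"
    by (auto simp: centres_def)
  moreover have "char_map K n i ` topspace (disc n) = insert (centre n i) (char_map K n i ` punctured_disc n)"
    using zero_in_disc by blast
  ultimately show ?thesis
    using i by (auto simp: centres_def)
qed

text \<open>The time interval times the disc is compact and its target Hausdorff, so the map between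
  them is closed, and over the punctured part it is a quotient map. The radial flow descends because
  it fixes the boundary, the only place where the characteristic map may identify points.\<close>

lemma continuous_map_radial_cell:
  assumes i: "i \<in> cells K n"
  obtains g where
    "continuous_map (prod_topology unit_interval (subtopology (cw_space K) (char_map K n i ` punctured_disc n))) (cw_space K) g"
    "\<And>t x. t \<in> {0..1} \<Longrightarrow> x \<in> punctured_disc n \<Longrightarrow> g (t, char_map K n i x) = char_map K n i (radial n (t, x))"
proof -
  let ?X = "cw_space K" and ?\<Phi> = "char_map K n i" and ?I = unit_interval
  let ?f = "\<lambda>z. (fst z, ?\<Phi> (snd z))"
  have cf: "continuous_map (prod_topology ?I (disc n)) (prod_topology ?I ?X) ?f"
    by (simp add: continuous_map_pairwise o_def continuous_map_fst)
      (intro continuous_map_compose [OF continuous_map_snd char_map_continuous [OF i], unfolded o_def])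
  have "compact_space ?I" by (simp add: compact_space_subtopology)
  then have "closed_map (prod_topology ?I (disc n)) (prod_topology ?I ?X) ?f"
    using compact_disc Hausdorff
    by (intro continuous_imp_closed_map [OF cf]) (auto simp: compact_space_prod_topology Hausdorff_space_prod_topology Hausdorff_space_subtopology)
  then have clo: "closed_map (subtopology (prod_topology ?I (disc n)) ({0..1} \<times> punctured_disc n))
      (subtopology (prod_topology ?I ?X) ({0..1} \<times> ?\<Phi> ` punctured_disc n)) ?f"
  proof (rule closed_map_restriction)
    \<comment> \<open>A closed map may be restricted to a full preimage; so the centre must not be
      sent into the image of the punctured disc.\<close>
    have "x \<in> punctured_disc n" if "x \<in> topspace (disc n)" "?\<Phi> x \<in> ?\<Phi> ` punctured_disc n" for x
    proof -
      obtain y where "y \<in> punctured_disc n" "?\<Phi> x = ?\<Phi> y" using \<open>?\<Phi> x \<in> _\<close> by blast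
      then have "?\<Phi> x \<noteq> centre n i" using centre_eq_iff [OF i, of y] by auto
      then show ?thesis using \<open>x \<in> topspace (disc n)\<close> by blast
    qed
    then have "x \<in> topspace (disc n) \<and> ?\<Phi> x \<in> ?\<Phi> ` punctured_disc n \<longleftrightarrow> x \<in> punctured_disc n" for x
      by blast
    then show "{z \<in> topspace (prod_topology ?I (disc n)). ?f z \<in> {0..1} \<times> ?\<Phi> ` punctured_disc n} = {0..1} \<times> punctured_disc n"
      unfolding set_eq_iff mem_Collect_eq topspace_prod_topology mem_Times_iff fst_conv snd_conv topspace_euclidean_subtopology
      by metis
  qed
  have eqs: "subtopology (prod_topology ?I (disc n)) ({0..1} \<times> punctured_disc n)
      = prod_topology ?I (subtopology (disc n) (punctured_disc n))"
    "subtopology (prod_topology ?I ?X) ({0..1} \<times> ?\<Phi> ` punctured_disc n)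
      = prod_topology ?I (subtopology ?X (?\<Phi> ` punctured_disc n))"
    by (simp_all add: subtopology_Times subtopology_subtopology)
  have sub: "?\<Phi> ` punctured_disc n \<subseteq> topspace ?X"
    using char_map_in [OF i] by blast
  have q: "quotient_map (prod_topology ?I (subtopology (disc n) (punctured_disc n)))
      (prod_topology ?I (subtopology ?X (?\<Phi> ` punctured_disc n))) ?f"
  proof (rule continuous_closed_imp_quotient_map)
    show "closed_map (prod_topology ?I (subtopology (disc n) (punctured_disc n)))
      (prod_topology ?I (subtopology ?X (?\<Phi> ` punctured_disc n))) ?f"
      using clo by (simp only: eqs)
    show "continuous_map (prod_topology ?I (subtopology (disc n) (punctured_disc n)))
      (prod_topology ?I (subtopology ?X (?\<Phi> ` punctured_disc n))) ?f"
      unfolding eqs [symmetric] using cf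
      by (auto simp: continuous_map_in_subtopology continuous_map_from_subtopology)
    show "?f ` topspace (prod_topology ?I (subtopology (disc n) (punctured_disc n)))
        = topspace (prod_topology ?I (subtopology ?X (?\<Phi> ` punctured_disc n)))"
      using sub by (force simp: image_iff)
  qed
  have c: "continuous_map (prod_topology ?I (subtopology (disc n) (punctured_disc n))) ?X (\<lambda>z. ?\<Phi> (radial n z))"
    using continuous_map_compose [OF continuous_radial continuous_map_from_subtopology [OF char_map_continuous [OF i]]]
    by (simp add: o_def)
  have w: "?\<Phi> (radial n z) = ?\<Phi> (radial n w)"
    if "z \<in> topspace (prod_topology ?I (subtopology (disc n) (punctured_disc n)))"
      "w \<in> topspace (prod_topology ?I (subtopology (disc n) (punctured_disc n)))" "?f z = ?f w" for z w
  proof (cases "snd z \<in> disc_interior n")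
    case True
    have "snd w \<in> topspace (disc n)" using that by auto
    moreover have "char_map K n i (snd w) \<in> open_cell K n i"
      using imageI [OF True, of ?\<Phi>] that(3) by (simp add: open_cell_def)
    ultimately have "snd w \<in> disc_interior n"
      using interior_iff_open_cell(1) [OF i] by blast
    then have "z = w"
      using char_map_inj [OF i True] that(3) by (auto intro: prod_eqI)
    then show ?thesis by simp
  next
    case False
    have zw: "snd z \<in> topspace (disc n)" "snd w \<in> topspace (disc n)" using that by auto
    then have "snd z \<in> disc_boundary n" using False topspace_disc_Un by blast
    moreover from this have "?\<Phi> (snd w) \<in> skeleton K (int n - 1)"
      using boundary_in_skeleton [OF i, of "snd z"] that(3) by simp
    then have "snd w \<in> disc_boundary n"
      using interior_iff_open_cell(2) [OF i] zw by blast
    ultimately have "radial n z = snd z" "radial n w = snd w"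
      using radial_boundary by (metis prod.collapse)+
    then show ?thesis using that(3) by simp
  qed
  obtain g where
    g: "continuous_map (prod_topology ?I (subtopology ?X (?\<Phi> ` punctured_disc n))) ?X g"
    "\<And>z. z \<in> topspace (prod_topology ?I (subtopology (disc n) (punctured_disc n))) \<Longrightarrow> g (?f z) = ?\<Phi> (radial n z)"
    by (rule quotient_map_lift_exists [OF q c w]) (assumption+, rule that, assumption+)
  show ?thesis
    using g(2) by (intro that [OF g(1)]) force
qed

text \<open>The radial flows of the cells and the constant homotopy of the lower skeleton are pasted
  along a finite closed cover.\<close>

lemma skeleton_deformation:
  assumes fin: "\<And>m. m \<le> n \<Longrightarrow> finite (cells K m)"
  obtains h where
    "continuous_map (prod_topology unit_interval (subtopology (cw_space K) (skeleton K (int n) - centres n))) (cw_space K) h"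
    "\<And>x. x \<in> skeleton K (int n) - centres n \<Longrightarrow> h (0, x) = x"
    "\<And>x. x \<in> skeleton K (int n) - centres n \<Longrightarrow> h (1, x) \<in> skeleton K (int n - 1)"
    "\<And>t x. t \<in> {0..1} \<Longrightarrow> x \<in> skeleton K (int n) - centres n \<Longrightarrow> h (t, x) \<in> skeleton K (int n) - centres n"
    "\<And>t x. t \<in> {0..1} \<Longrightarrow> x \<in> skeleton K (int n - 1) \<Longrightarrow> h (t, x) = x"
proof -
  let ?X = "cw_space K" and ?I = unit_interval
  let ?Y = "skeleton K (int n) - centres n" and ?A = "skeleton K (int n - 1)"
  let ?C = "\<lambda>i. char_map K n i ` punctured_disc n"
  let ?Z = "prod_topology ?I (subtopology ?X ?Y)"
  have "\<exists>g. continuous_map (prod_topology ?I (subtopology ?X (?C i))) ?X g \<and>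
    (\<forall>t\<in>{0..1}. \<forall>x\<in>punctured_disc n. g (t, char_map K n i x) = char_map K n i (radial n (t, x)))"
    if "i \<in> cells K n" for i
    using continuous_map_radial_cell [OF that] by metis
  then obtain g where g: "\<And>i. i \<in> cells K n \<Longrightarrow> continuous_map (prod_topology ?I (subtopology ?X (?C i))) ?X (g i)"
    "\<And>i t x. i \<in> cells K n \<Longrightarrow> t \<in> {0..1} \<Longrightarrow> x \<in> punctured_disc n \<Longrightarrow> g i (t, char_map K n i x) = char_map K n i (radial n (t, x))"
    by metis
  have AM: "?A \<inter> centres n = {}"
    using open_cell_disjoint_skeleton zero_in_disc_interior by (fastforce simp: centres_def open_cell_def)
  have AY: "?A \<subseteq> ?Y" using skeleton_mono [of "int n - 1" "int n"] AM by auto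
  have CY: "?C i \<subseteq> ?Y" if "i \<in> cells K n" for i
    using closed_cell_minus_centres [OF that] disc_image(3) [OF that] by blast
  have Ycover: "?Y \<subseteq> ?A \<union> (\<Union>i\<in>cells K n. ?C i)"
  proof
    fix x assume x: "x \<in> ?Y"
    then consider "x \<in> ?A" | i where "i \<in> cells K n" "x \<in> open_cell K n i"
      using skeleton_Un [of n] by blast
    then show "x \<in> ?A \<union> (\<Union>i\<in>cells K n. ?C i)"
    proof cases
      case 2
      then have "x \<in> char_map K n i ` topspace (disc n) - centres n"
        using disc_image(1) [OF 2(1)] x by blast
      then show ?thesis using closed_cell_minus_centres [OF 2(1)] 2(1) by blast
    qed simp
  qed
  have gA: "g i (t, x) = x" if "i \<in> cells K n" "t \<in> {0..1}" "x \<in> ?C i" "x \<in> ?A" for i t x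
  proof -
    obtain y where y: "y \<in> punctured_disc n" "x = char_map K n i y" using \<open>x \<in> ?C i\<close> by blast
    then have "y \<in> disc_boundary n" using interior_iff_open_cell(2) [OF that(1)] that(4) by auto
    then show ?thesis using g(2) [OF that(1,2) y(1)] y(2) by (simp add: radial_boundary)
  qed
  \<comment> \<open>Two different closed cells meet only in the lower skeleton, where all the flows
    stand still.\<close>
  have inA: "x \<in> ?A" if "i \<in> cells K n" "j \<in> cells K n" "x \<in> ?C i" "x \<in> ?C j" "i \<noteq> j" for i j x
    using that disc_image(2) [OF that(1)] disc_image(2) [OF that(2)] open_cell_unique [OF that(1,2)] by blast
  \<comment> \<open>In the index set of the cover, \<open>None\<close> stands for the lower skeleton
    and \<open>Some i\<close> for the closed cell \<open>i\<close> without its centre.\<close>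
  let ?T = "\<lambda>w. {0..1::real} \<times> (case w of None \<Rightarrow> ?A | Some i \<Rightarrow> ?C i)"
  let ?g = "\<lambda>w. (case w of None \<Rightarrow> snd | Some i \<Rightarrow> g i)"
  have closub: "closedin (subtopology ?X ?Y) ?A" "\<And>i. i \<in> cells K n \<Longrightarrow> closedin (subtopology ?X ?Y) (?C i)"
  proof -
    have "closedin ?X ?A" using fin by (intro closedin_skeleton) simp
    then show "closedin (subtopology ?X ?Y) ?A" using AY by (rule closedin_subset_topspace)
    fix i assume i: "i \<in> cells K n"
    have "?C i = ?Y \<inter> char_map K n i ` topspace (disc n)"
      using closed_cell_minus_centres [OF i] disc_image(3) [OF i] by blast
    then show "closedin (subtopology ?X ?Y) (?C i)"
      using closedin_closed_cell [OF i] by (metis closedin_subtopology_Int_closed inf_commute)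
  qed
  obtain h where h: "continuous_map ?Z ?X h"
    "\<And>x i. \<lbrakk>i \<in> insert None (Some ` cells K n); x \<in> topspace ?Z \<inter> ?T i\<rbrakk> \<Longrightarrow> h x = ?g i x"
  proof (rule pasting_lemma_exists_closed [of "insert None (Some ` cells K n)" ?Z ?T ?X ?g])
    show "finite (insert None (Some ` cells K n))" using fin by simp
    show "topspace ?Z \<subseteq> \<Union> (?T ` insert None (Some ` cells K n))"
      using Ycover by auto
    show "closedin ?Z (?T i)" if "i \<in> insert None (Some ` cells K n)" for i
      using that closub by (auto simp: closedin_prod_Times_iff)
    show "continuous_map (subtopology ?Z (?T i)) ?X (?g i)" if "i \<in> insert None (Some ` cells K n)" for i
    proof -
      consider "i = None" | j where "j \<in> cells K n" "i = Some j"
        using \<open>i \<in> insert None (Some ` cells K n)\<close> by blast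
      then show ?thesis
      proof cases
        case 1
        have "continuous_map ?Z ?X snd"
          using continuous_map_snd continuous_map_into_fulltopology by blast
        then show ?thesis using 1 by (simp add: continuous_map_from_subtopology)
      next
        case 2
        have "subtopology ?Z (?T i) = prod_topology ?I (subtopology ?X (?C j))"
          using 2 CY [OF 2(1)] by (simp add: subtopology_Times subtopology_subtopology Int_absorb1)
        then show ?thesis using g(1) 2 by simp
      qed
    qed
    show "?g i x = ?g j x"
      if "i \<in> insert None (Some ` cells K n)" "j \<in> insert None (Some ` cells K n)" "x \<in> topspace ?Z \<inter> ?T i \<inter> ?T j" for i j x
    proof -
      obtain t y where x: "x = (t, y)" by (cases x)
      have t: "t \<in> {0..1}" using that(3) x by auto
      have *: "?g i x = y" if "i \<in> insert None (Some ` cells K n)" "x \<in> ?T i" "y \<in> ?A" for i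
        using that gA t x by (cases i) auto
      show ?thesis
      proof (cases "i = j \<or> y \<in> ?A")
        case True
        moreover have "x \<in> ?T i" "x \<in> ?T j" using that(3) by blast+
        ultimately show ?thesis
          using * [OF that(1)] * [OF that(2)] by metis
      next
        case False
        have xi: "x \<in> ?T i" and xj: "x \<in> ?T j" using that(3) by blast+
        obtain i' where "i = Some i'" "i' \<in> cells K n" "y \<in> ?C i'"
          using False \<open>i \<in> _\<close> xi x by auto
        moreover obtain j' where "j = Some j'" "j' \<in> cells K n" "y \<in> ?C j'"
          using False \<open>j \<in> _\<close> xj x by auto
        ultimately show ?thesis using False inA [of i' j' y] by auto
      qed
    qed
  qed (rule that)
  have hA: "h (t, x) = x" if "t \<in> {0..1}" "x \<in> ?A" for t x
  proof -
    have "(t, x) \<in> topspace ?Z \<inter> ?T None"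
      using that AY skeleton_subset [of "int n"] by auto
    then show ?thesis using h(2) [of None "(t, x)"] by simp
  qed
  have hC: "h (t, char_map K n i y) = char_map K n i (radial n (t, y))"
    if "t \<in> {0..1}" "i \<in> cells K n" "y \<in> punctured_disc n" for t i y
  proof -
    have "(t, char_map K n i y) \<in> topspace ?Z \<inter> ?T (Some i)"
      using that CY [OF that(2)] skeleton_subset [of "int n"] by auto
    then show ?thesis using h(2) [of "Some i"] that g(2) by simp
  qed
  have cases: "x \<in> ?A \<or> (\<exists>i y. i \<in> cells K n \<and> y \<in> punctured_disc n \<and> x = char_map K n i y)" if "x \<in> ?Y" for x
    using Ycover that by blast
  show ?thesis
  proof (rule that [OF h(1)])
    show "h (0, x) = x" if "x \<in> ?Y" for x
      using cases [OF that]
    proof (elim disjE exE conjE)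
      assume "x \<in> ?A" then show ?thesis using hA by simp
    next
      fix i y assume *: "i \<in> cells K n" "y \<in> punctured_disc n" "x = char_map K n i y"
      then have "h (0, x) = char_map K n i (radial n (0, y))" using hC by simp
      then show ?thesis using * by (simp add: radial_0)
    qed
    show "h (1, x) \<in> ?A" if "x \<in> ?Y" for x
      using cases [OF that]
    proof (elim disjE exE conjE)
      assume "x \<in> ?A" then show ?thesis using hA by simp
    next
      fix i y assume *: "i \<in> cells K n" "y \<in> punctured_disc n" "x = char_map K n i y"
      then have "h (1, x) = char_map K n i (radial n (1, y))" using hC by simp
      then show ?thesis using boundary_in_skeleton [OF *(1) radial_1 [OF *(2)]] by simp
    qed
    show "h (t, x) \<in> ?Y" if "t \<in> {0..1}" "x \<in> ?Y" for t x
      using cases [OF that(2)]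
    proof (elim disjE exE conjE)
      assume "x \<in> ?A" then show ?thesis using hA that by simp
    next
      fix i y assume *: "i \<in> cells K n" "y \<in> punctured_disc n" "x = char_map K n i y"
      then have "h (t, x) \<in> ?C i" using hC that(1) radial_in by auto
      then show ?thesis using CY * by blast
    qed
    show "h (t, x) = x" if "t \<in> {0..1}" "x \<in> ?A" for t x
      by (rule hA [OF that])
  qed
qed

end

section \<open>Relative homology of a disjoint union\<close>

lemma homologous_rel_set_hom:
  "homologous_rel_set n X S \<in> hom (relcycle_group n X S) (relative_homology_group (int n) X S)"
  unfolding nontrivial_relative_homology_group
  using normal.r_coset_hom_Mod [OF normal_subgroup_singular_relboundary_relcycle]
  by (simp add: right_coset_singular_relboundary)

definition chain_part :: "nat \<Rightarrow> 'a set \<Rightarrow> 'a chain \<Rightarrow> 'a chain" where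
  "chain_part n V = frag_extend (\<lambda>\<sigma>. if \<sigma> ` standard_simplex n \<subseteq> V then frag_of \<sigma> else 0)"

lemma singular_face_image:
  assumes "1 \<le> n" "k \<le> n"
  shows "singular_face n k \<sigma> ` standard_simplex (n - Suc 0) \<subseteq> \<sigma> ` standard_simplex n"
  using simplical_face_in_standard_simplex [OF assms] by (auto simp: singular_face_def)

lemma singular_chain_chain_part:
  assumes "singular_chain n X c"
  shows "singular_chain n (subtopology X V) (chain_part n V c)"
  unfolding chain_part_def
proof (rule singular_chain_extend)
  fix \<sigma> assume "\<sigma> \<in> Poly_Mapping.keys c"
  then have "singular_simplex n X \<sigma>" using assms by (auto simp: singular_chain_def)
  then show "singular_chain n (subtopology X V) (if \<sigma> ` standard_simplex n \<subseteq> V then frag_of \<sigma> else 0)"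
    by (simp add: singular_chain_of singular_simplex_subtopology)
qed

text \<open>The faces of a simplex inside \<open>V\<close> stay inside. The faces of a simplex that
  misses \<open>V\<close> are nonempty and miss it as well, so they contribute to neither
  side.\<close>

lemma chain_boundary_chain_part:
  assumes c: "singular_chain n X c"
    and sep: "\<And>\<sigma>. singular_simplex n X \<sigma> \<Longrightarrow> \<sigma> ` standard_simplex n \<subseteq> V \<or> \<sigma> ` standard_simplex n \<inter> V = {}"
  shows "chain_boundary n (chain_part n V c) = chain_part (n - Suc 0) V (chain_boundary n c)"
proof (cases "n = 0")
  case False
  have "Poly_Mapping.keys c \<subseteq> singular_simplex_set n X"
    using c by (simp add: singular_chain_def)
  then show ?thesis
  proof (induction c rule: frag_induction)
    case zero
    then show ?case by (simp add: chain_part_def)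
  next
    case (one \<sigma>)
    have cp: "chain_part (n - Suc 0) V (chain_boundary n (frag_of \<sigma>))
      = (\<Sum>k\<le>n. frag_cmul ((-1) ^ k) (chain_part (n - Suc 0) V (frag_of (singular_face n k \<sigma>))))"
      using False by (simp add: chain_boundary_of chain_part_def frag_extend_sum frag_extend_cmul o_def)
    show ?case
    proof (cases "\<sigma> ` standard_simplex n \<subseteq> V")
      case True
      then have "singular_face n k \<sigma> ` standard_simplex (n - Suc 0) \<subseteq> V" if "k \<le> n" for k
        using singular_face_image [of n k \<sigma>] False that by auto
      then show ?thesis
        using True False unfolding cp by (simp add: chain_part_def chain_boundary_of)
    next
      case False2: False
      then have "\<sigma> ` standard_simplex n \<inter> V = {}" using sep one by blast
      then have "\<not> singular_face n k \<sigma> ` standard_simplex (n - Suc 0) \<subseteq> V" if "k \<le> n" for k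
      proof -
        obtain x where "x \<in> standard_simplex (n - Suc 0)" using nonempty_standard_simplex by blast
        then have "singular_face n k \<sigma> x \<in> \<sigma> ` standard_simplex n"
          using singular_face_image [of n k \<sigma>] False that by auto
        then show ?thesis
          using \<open>x \<in> _\<close> \<open>\<sigma> ` standard_simplex n \<inter> V = {}\<close> by blast
      qed
      then show ?thesis
        using False2 unfolding cp by (simp add: chain_part_def)
    qed
  next
    case (diff a b)
    then show ?case by (simp add: chain_part_def frag_extend_diff chain_boundary_diff)
  qed
qed (simp add: chain_boundary_def chain_part_def)

text \<open>Singular simplices are connected, so each lies in one member of the family, and a
  relative cycle is the sum of finitely many relative cycles, one for each member that it meets.
  Independence of the summands is established separately, by coordinate functionals.\<close>

lemma relative_homology_generated_by_components:
  assumes ope: "\<And>V. V \<in> \<V> \<Longrightarrow> openin X V" and cov: "\<Union>\<V> = topspace X" and disj: "pairwise disjnt \<V>"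
    and N: "subgroup N (relative_homology_group (int n) X S)"
    and VN: "\<And>V x. V \<in> \<V> \<Longrightarrow> x \<in> carrier (relative_homology_group (int n) (subtopology X V) (S \<inter> V)) \<Longrightarrow>
      hom_induced (int n) (subtopology X V) (S \<inter> V) X S id x \<in> N"
  shows "carrier (relative_homology_group (int n) X S) \<subseteq> N"
proof
  fix x assume "x \<in> carrier (relative_homology_group (int n) X S)"
  then obtain z where z: "x = homologous_rel_set n X S z" "singular_relcycle n X S z"
    by (auto simp: carrier_relative_homology_group)
  have zc: "singular_chain n X z" and zb: "singular_chain (n - 1) (subtopology X S) (chain_boundary n z)"
    using z(2) by (auto simp: singular_relcycle)
  \<comment> \<open>Stated for every dimension and every simplex: a connected image that meets
    \<open>V\<close> cannot also meet the open union of the other members.\<close>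
  have comp: "\<sigma> ` standard_simplex m \<subseteq> V" if "singular_simplex m X \<sigma>" "V \<in> \<V>" "\<sigma> ` standard_simplex m \<inter> V \<noteq> {}" for m \<sigma> V
  proof -
    have con: "connectedin X (\<sigma> ` standard_simplex m)"
      using that(1) connectedin_standard_simplex connectedin_continuous_map_image
      unfolding singular_simplex_def
      by (metis connectedin_absolute subtopology_topspace topspace_standard_simplex)
    have "openin X (\<Union>(\<V> - {V}))" using ope by blast
    moreover have "V \<inter> \<Union>(\<V> - {V}) = {}"
      using disj that(2) by (auto simp: pairwise_def disjnt_iff)
    moreover have "\<sigma> ` standard_simplex m \<subseteq> V \<union> \<Union>(\<V> - {V})"
      using connectedin_subset_topspace [OF con] cov by auto
    ultimately have "\<Union>(\<V> - {V}) \<inter> \<sigma> ` standard_simplex m = {}"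
      using con that(3) ope [OF that(2)] unfolding connectedin by (metis inf_bot_left inf_commute)
    then show ?thesis
      using \<open>\<sigma> ` standard_simplex m \<subseteq> V \<union> \<Union>(\<V> - {V})\<close> by blast
  qed
  have part: "singular_relcycle n (subtopology X V) (S \<inter> V) (chain_part n V z)" if "V \<in> \<V>" for V
  proof -
    have "chain_boundary n (chain_part n V z) = chain_part (n - Suc 0) V (chain_boundary n z)"
      using comp [OF _ that] by (intro chain_boundary_chain_part [OF zc]) blast
    then show ?thesis
      using singular_chain_chain_part [OF zc, of V] singular_chain_chain_part [OF zb, of V]
      by (simp add: singular_relcycle subtopology_subtopology Int_commute Int_assoc Int_left_commute)
  qed
  have partX: "singular_relcycle n X S (chain_part n V z)" and partN: "homologous_rel_set n X S (chain_part n V z) \<in> N"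
    if "V \<in> \<V>" for V
  proof -
    have id: "continuous_map (subtopology X V) X id" "id \<in> S \<inter> V \<rightarrow> S"
      by auto
    have cm: "chain_map n id (chain_part n V z) = chain_part n V z"
      using part [OF that] by (auto simp: singular_relcycle intro: chain_map_ident)
    have "hom_induced (int n) (subtopology X V) (S \<inter> V) X S id (homologous_rel_set n (subtopology X V) (S \<inter> V) (chain_part n V z))
       = homologous_rel_set n X S (chain_part n V z)"
      using hom_induced_chain_map [OF id part [OF that]] cm by simp
    moreover have "homologous_rel_set n (subtopology X V) (S \<inter> V) (chain_part n V z)
        \<in> carrier (relative_homology_group (int n) (subtopology X V) (S \<inter> V))"
      using part [OF that] by (auto simp: carrier_relative_homology_group)
    ultimately show "homologous_rel_set n X S (chain_part n V z) \<in> N"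
      using VN [OF that] by metis
    show "singular_relcycle n X S (chain_part n V z)"
      using hom_chain_map [OF id] part [OF that] cm unfolding hom_def by force
  qed
  have sums: "singular_relcycle n X S (\<Sum>V\<in>F. chain_part n V z) \<and> homologous_rel_set n X S (\<Sum>V\<in>F. chain_part n V z) \<in> N"
    if "finite F" "F \<subseteq> \<V>" for F
    using that
  proof (induction F rule: finite_induct)
    case empty
    have "homologous_rel_set n X S 0 = \<one>\<^bsub>relative_homology_group (int n) X S\<^esub>"
      using homologous_rel_set_eq_relboundary [of n X S 0] by simp
    then show ?case using subgroup.one_closed [OF N] by simp
  next
    case (insert V F)
    let ?a = "chain_part n V z" and ?b = "\<Sum>V\<in>F. chain_part n V z"
    have ab: "singular_relcycle n X S ?a" "singular_relcycle n X S ?b"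
      "homologous_rel_set n X S ?a \<in> N" "homologous_rel_set n X S ?b \<in> N"
      using insert partX partN by auto
    have "homologous_rel_set n X S (?a + ?b)
      = homologous_rel_set n X S ?a \<otimes>\<^bsub>relative_homology_group (int n) X S\<^esub> homologous_rel_set n X S ?b"
      using hom_mult [OF homologous_rel_set_hom [of n X S], of ?a ?b] ab by simp
    then show ?case
      using insert(1,2) ab singular_relcycle_add subgroup.m_closed [OF N] by simp
  qed
  let ?F = "{V \<in> \<V>. \<exists>\<sigma>\<in>Poly_Mapping.keys z. \<sigma> ` standard_simplex n \<subseteq> V}"
  have uniq: "V = V'" if "V \<in> \<V>" "V' \<in> \<V>" "\<sigma> ` standard_simplex n \<subseteq> V" "\<sigma> ` standard_simplex n \<subseteq> V'"
    for \<sigma> :: "(nat \<Rightarrow> real) \<Rightarrow> 'a" and V V'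
    using that disj nonempty_standard_simplex [of n] by (fastforce simp: pairwise_def disjnt_iff)
  have ex: "\<exists>V\<in>\<V>. \<sigma> ` standard_simplex n \<subseteq> V" if "singular_simplex n X \<sigma>" for \<sigma>
  proof -
    have "\<sigma> ` standard_simplex n \<subseteq> topspace X"
      using that by (auto simp: singular_simplex_def continuous_map_def)
    moreover obtain t where "t \<in> standard_simplex n" using nonempty_standard_simplex by blast
    ultimately obtain V where "V \<in> \<V>" "\<sigma> t \<in> V" using cov by blast
    then show ?thesis using comp [OF that] \<open>t \<in> _\<close> by blast
  qed
  \<comment> \<open>The members of \<open>?F\<close> are indexed by simplices of \<open>z\<close>,
    each of which lies in only one of them; hence there are finitely many.\<close>
  have "?F \<subseteq> (\<lambda>\<sigma>. THE V. V \<in> \<V> \<and> \<sigma> ` standard_simplex n \<subseteq> V) ` Poly_Mapping.keys z"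
  proof
    fix V assume "V \<in> ?F"
    then obtain \<sigma> where s: "\<sigma> \<in> Poly_Mapping.keys z" "V \<in> \<V>" "\<sigma> ` standard_simplex n \<subseteq> V" by blast
    then have "(THE V. V \<in> \<V> \<and> \<sigma> ` standard_simplex n \<subseteq> V) = V"
      by (intro the_equality conjI) (use uniq s in blast)+
    then show "V \<in> (\<lambda>\<sigma>. THE V. V \<in> \<V> \<and> \<sigma> ` standard_simplex n \<subseteq> V) ` Poly_Mapping.keys z"
      using imageI [OF s(1), of "\<lambda>\<sigma>. THE V. V \<in> \<V> \<and> \<sigma> ` standard_simplex n \<subseteq> V"] by simp
  qed
  then have fin: "finite ?F" by (rule finite_subset) simp
  \<comment> \<open>The finite family is fixed and the chain is varied, as the induction on chains
    demands.\<close>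
  have total: "(\<Sum>V\<in>F. chain_part n V c) = c"
    if "finite F" "F \<subseteq> \<V>" "Poly_Mapping.keys c \<subseteq> {\<sigma>. \<exists>V\<in>F. \<sigma> ` standard_simplex n \<subseteq> V}" for F c
    using that(3)
  proof (induction c rule: frag_induction)
    case zero
    then show ?case by (simp add: chain_part_def)
  next
    case (one \<sigma>)
    then obtain V where V: "V \<in> F" "\<sigma> ` standard_simplex n \<subseteq> V" by blast
    have "chain_part n W (frag_of \<sigma>) = (if W = V then frag_of \<sigma> else 0)" if "W \<in> F" for W
      using V that uniq [of V W \<sigma>] \<open>F \<subseteq> \<V>\<close> by (auto simp: chain_part_def)
    then show ?case using V(1) \<open>finite F\<close> by simp
  next
    case (diff a b)
    then show ?case by (simp add: chain_part_def frag_extend_diff sum_subtractf)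
  qed
  have "Poly_Mapping.keys z \<subseteq> {\<sigma>. \<exists>V\<in>?F. \<sigma> ` standard_simplex n \<subseteq> V}"
  proof
    fix \<sigma> assume s: "\<sigma> \<in> Poly_Mapping.keys z"
    then have "singular_simplex n X \<sigma>" using zc by (auto simp: singular_chain_def)
    from ex [OF this] obtain V where "V \<in> \<V>" "\<sigma> ` standard_simplex n \<subseteq> V" by blast
    with s show "\<sigma> \<in> {\<sigma>. \<exists>V\<in>?F. \<sigma> ` standard_simplex n \<subseteq> V}" by blast
  qed
  then have "(\<Sum>V\<in>?F. chain_part n V z) = z"
    by (intro total [OF fin]) blast
  moreover have "homologous_rel_set n X S (\<Sum>V\<in>?F. chain_part n V z) \<in> N"
    by (rule sums [OF fin, THEN conjunct2]) blast
  ultimately show "x \<in> N"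
    using z(1) by simp
qed

section \<open>The cellular chain groups of the universal cover\<close>

lemma iso_cancel_left:
  assumes f: "f \<in> iso A B" and gf: "g \<circ> f \<in> iso A C" and g: "g \<in> hom B C"
  shows "g \<in> iso B C"
  using assms bij_betw_comp_iff [of f "carrier A" "carrier B" g "carrier C"]
  by (auto simp: iso_def)

lemma (in cw_covering) in_cover_skeleton: "e \<in> cover_skeleton K U m \<longleftrightarrow> e \<in> topspace E \<and> p e \<in> skeleton K m"
  by (simp add: cover_skeleton_def)

locale skeleton_covering = cw_covering K U
  for K :: "('a, 'i) cell_structure" and U :: "('a, 'b) pointed_cover" +
  fixes n :: nat
  assumes finite_cells: "\<And>m. m \<le> n \<Longrightarrow> finite (cells K m)"
begin

abbreviation "Sn \<equiv> cover_skeleton K U (int n)"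
abbreviation "Am \<equiv> cover_skeleton K U (int n - 1)"
abbreviation "En \<equiv> cover_skeleton_space K U (int n)"
abbreviation "Pn \<equiv> {e \<in> topspace E. p e \<in> centres n}"

lemma topspace_En: "topspace En = Sn"
  by (auto simp: cover_skeleton_def)

lemma centres_disjoint: "centres n \<inter> skeleton K (int n - 1) = {}"
  using open_cell_disjoint_skeleton zero_in_disc_interior by (fastforce simp: centres_def open_cell_def)

lemma centres_subset: "centres n \<subseteq> skeleton K (int n)"
proof
  fix x assume "x \<in> centres n"
  then obtain i where i: "i \<in> cells K n" "x = char_map K n i (\<lambda>i. 0)" by (auto simp: centres_def)
  then have "x \<in> char_map K n i ` topspace (disc n)" using zero_in_disc by blast
  then show "x \<in> skeleton K (int n)" using disc_image(3) [OF i(1)] by blast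
qed

lemma Am_subset: "Am \<subseteq> Sn - Pn"
  using centres_disjoint skeleton_mono [of "int n - 1" "int n"] by (auto simp: in_cover_skeleton)

text \<open>The deformation of the punctured skeleton downstairs is lifted through \<open>p\<close>,
  starting from the inclusion; the lift retracts the preimage onto that of the lower
  skeleton.\<close>

lemma trivial_homology_retract:
  "trivial_group (relative_homology_group q (subtopology En (Sn - Pn)) Am)"
proof -
  let ?Y = "subtopology E (Sn - Pn)"
  obtain h where h:
    "continuous_map (prod_topology unit_interval (subtopology (cw_space K) (skeleton K (int n) - centres n))) (cw_space K) h"
    "\<And>x. x \<in> skeleton K (int n) - centres n \<Longrightarrow> h (0, x) = x"
    "\<And>x. x \<in> skeleton K (int n) - centres n \<Longrightarrow> h (1, x) \<in> skeleton K (int n - 1)"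
    "\<And>t x. t \<in> {0..1} \<Longrightarrow> x \<in> skeleton K (int n) - centres n \<Longrightarrow> h (t, x) \<in> skeleton K (int n) - centres n"
    "\<And>t x. t \<in> {0..1} \<Longrightarrow> x \<in> skeleton K (int n - 1) \<Longrightarrow> h (t, x) = x"
    by (rule skeleton_deformation [OF finite_cells]) (assumption, rule that)
  have Y: "topspace ?Y = Sn - Pn" by (auto simp: in_cover_skeleton)
  have pY: "p e \<in> skeleton K (int n) - centres n" if "e \<in> Sn - Pn" for e
    using that by (auto simp: in_cover_skeleton)
  have cp: "continuous_map ?Y (subtopology (cw_space K) (skeleton K (int n) - centres n)) p"
    using continuous_p pY Y by (auto simp: continuous_map_in_subtopology continuous_map_from_subtopology)
  have "continuous_map (prod_topology unit_interval ?Y)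
      (prod_topology unit_interval (subtopology (cw_space K) (skeleton K (int n) - centres n))) (\<lambda>z. (fst z, p (snd z)))"
    by (simp add: continuous_map_pairwise o_def continuous_map_fst)
      (intro continuous_map_compose [OF continuous_map_snd cp, unfolded o_def])
  from continuous_map_compose [OF this h(1)]
  have H: "continuous_map (prod_topology unit_interval ?Y) X (\<lambda>z. h (fst z, p (snd z)))"
    by (simp add: o_def)
  have id: "continuous_map ?Y E (\<lambda>e. e)" by simp
  have start: "p e = h (fst (0, e), p (snd (0::real, e)))" if "e \<in> topspace ?Y" for e
    using h(2) [OF pY, of e] that unfolding Y by simp
  obtain L where L: "continuous_map (prod_topology unit_interval ?Y) E L"
    "\<And>e. e \<in> topspace ?Y \<Longrightarrow> L (0, e) = e"
    "\<And>t e. t \<in> {0..1} \<Longrightarrow> e \<in> topspace ?Y \<Longrightarrow> p (L (t, e)) = h (fst (t, e), p (snd (t, e)))"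
    by (rule homotopy_lifting [OF covering H id start]) (assumption, rule that)
  have pL: "p (L (t, e)) = h (t, p e)" if "t \<in> {0..1}" "e \<in> Sn - Pn" for t e
    using L(3) [OF that(1), of e] that(2) unfolding Y fst_conv snd_conv by blast
  have LE: "L (t, e) \<in> topspace E" if "t \<in> {0..1}" "e \<in> Sn - Pn" for t e
    using continuous_map_image_subset_topspace [OF L(1)] that unfolding topspace_prod_topology Y by auto
  have LY: "L (t, e) \<in> Sn - Pn" if "t \<in> {0..1}" "e \<in> Sn - Pn" for t e
  proof -
    have "p (L (t, e)) \<in> skeleton K (int n) - centres n"
      using pL [OF that] h(4) [OF that(1) pY [OF that(2)]] by simp
    then show ?thesis using LE [OF that] by (auto simp: in_cover_skeleton)
  qed
  have path: "pathin E (\<lambda>t. L (t, e))" if "e \<in> Sn - Pn" for e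
    unfolding pathin_def by (rule continuous_map_compose [OF _ L(1), unfolded o_def])
      (use that Y in \<open>auto simp: continuous_map_pairwise o_def\<close>)
  \<comment> \<open>The deformation is constant on the lower skeleton, so by uniqueness of path
    lifts its lift is constant above it.\<close>
  have LA: "L (t, e) = e" if "t \<in> {0..1}" "e \<in> Am" for t e
  proof -
    have e: "e \<in> Sn - Pn" "e \<in> topspace E" using that Am_subset by (auto simp: in_cover_skeleton)
    have "p (L (s, e)) = p e" if "s \<in> {0..1}" for s
      using pL [OF that e(1)] h(5) [OF that] \<open>e \<in> Am\<close> by (simp add: in_cover_skeleton)
    then show ?thesis
      using lift_path_unique [OF covering path [OF e(1)], of "\<lambda>t. e" t] e(2) L(2) [of e] that(1) e(1) unfolding Y by simp
  qed
  have LYc: "continuous_map (prod_topology unit_interval ?Y) ?Y L"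
    using L(1) LY Y by (auto simp: continuous_map_in_subtopology)
  have "trivial_group (relative_homology_group q ?Y Am)"
  proof (rule trivial_relative_homology_group_alt)
    have "continuous_map ?Y ?Y (\<lambda>e. L (1, e))"
      by (rule continuous_map_compose [OF _ LYc, unfolded o_def]) (auto simp: continuous_map_pairwise o_def)
    moreover have "L (1, e) \<in> Am" if "e \<in> Sn - Pn" for e
      using LE [of 1 e] pL [of 1 e] h(3) [OF pY] that by (simp add: in_cover_skeleton)
    ultimately show "continuous_map ?Y (subtopology ?Y Am) (\<lambda>e. L (1, e))"
      using Y by (auto simp: continuous_map_in_subtopology)
    have "homotopic_with (\<lambda>k. k ` Am \<subseteq> Am) ?Y ?Y id (\<lambda>e. L (1, e))"
    proof (subst homotopic_with)
      have "Am \<subseteq> topspace ?Y" using Am_subset Y by simp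
      then show "f ` Am \<subseteq> Am \<longleftrightarrow> g ` Am \<subseteq> Am" if "\<And>x. x \<in> topspace ?Y \<Longrightarrow> f x = g x" for f g :: "'b \<Rightarrow> 'b"
        using that by (auto simp: subset_eq image_iff; metis)
      show "\<exists>h. continuous_map (prod_topology unit_interval ?Y) ?Y h \<and> (\<forall>x\<in>topspace ?Y. h (0, x) = id x) \<and>
          (\<forall>x\<in>topspace ?Y. h (1, x) = L (1, x)) \<and> (\<forall>t\<in>{0..1}. (\<lambda>x. h (t, x)) ` Am \<subseteq> Am)"
        using LYc L(2) LA by (intro exI [of _ L]) auto
    qed
    then show "homotopic_with (\<lambda>k. k ` Am \<subseteq> Am) ?Y ?Y (\<lambda>e. L (1, e)) id"
      by (rule homotopic_with_symD)
  qed
  moreover have "subtopology En (Sn - Pn) = ?Y"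
    by (simp add: subtopology_subtopology Int_absorb1 Diff_subset)
  ultimately show ?thesis by simp
qed

lemma skeleton_punctured_iso:
  "hom_induced q En Am En (Sn - Pn) id \<in> iso (relative_homology_group q En Am) (relative_homology_group q En (Sn - Pn))"
  by (rule hom_induced_iso_triple [OF Am_subset trivial_homology_retract trivial_homology_retract])

text \<open>One lift of each n-cell, chosen once and for all. Its translates,
  \<open>cell_lift g j\<close>, are the other lifts.\<close>

definition lift_cell :: "'i \<Rightarrow> (nat \<Rightarrow> real) \<Rightarrow> 'b" where
  "lift_cell j = (SOME \<phi>. continuous_map (disc n) E \<phi> \<and> (\<forall>y\<in>topspace (disc n). p (\<phi> y) = char_map K n j y))"

definition cell_lift :: "(real \<Rightarrow> 'a) set \<Rightarrow> 'i \<Rightarrow> (nat \<Rightarrow> real) \<Rightarrow> 'b" where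
  "cell_lift g j = deck_action U g \<circ> lift_cell j"

lemma lift_cell:
  assumes j: "j \<in> cells K n"
  shows "continuous_map (disc n) E (lift_cell j)" "y \<in> topspace (disc n) \<Longrightarrow> p (lift_cell j y) = char_map K n j y"
proof -
  have "char_map K n j (\<lambda>i. 0) \<in> p ` topspace E"
    using char_map_in [OF j zero_in_disc] covering by (simp add: covering_map_def)
  then obtain e where e: "e \<in> topspace E" "p e = char_map K n j (\<lambda>i. 0)" by auto
  obtain \<phi> where "continuous_map (disc n) E \<phi>" "\<And>z. z \<in> topspace (disc n) \<Longrightarrow> p (\<phi> z) = char_map K n j z"
    by (rule disc_lift [OF char_map_continuous [OF j] zero_in_disc e]) (rule that)
  then have "continuous_map (disc n) E \<phi> \<and> (\<forall>y\<in>topspace (disc n). p (\<phi> y) = char_map K n j y)"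
    by simp
  then have "continuous_map (disc n) E (lift_cell j) \<and> (\<forall>y\<in>topspace (disc n). p (lift_cell j y) = char_map K n j y)"
    unfolding lift_cell_def
    by (rule someI [where P = "\<lambda>\<phi>. continuous_map (disc n) E \<phi> \<and> (\<forall>y\<in>topspace (disc n). p (\<phi> y) = char_map K n j y)"])
  then show "continuous_map (disc n) E (lift_cell j)" "y \<in> topspace (disc n) \<Longrightarrow> p (lift_cell j y) = char_map K n j y"
    by auto
qed

lemma lift_cell_in: "j \<in> cells K n \<Longrightarrow> y \<in> topspace (disc n) \<Longrightarrow> lift_cell j y \<in> topspace E"
  using continuous_map_image_subset_topspace [OF lift_cell(1)] by blast

context
  fixes g j assumes g: "g \<in> carrier G" and j: "j \<in> cells K n"
begin

lemma cell_lift_p: "y \<in> topspace (disc n) \<Longrightarrow> p (cell_lift g j y) = char_map K n j y"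
  by (simp add: cell_lift_def deck_action_p [OF g] lift_cell [OF j] lift_cell_in [OF j])

lemma cell_lift_in_E: "y \<in> topspace (disc n) \<Longrightarrow> cell_lift g j y \<in> topspace E"
  by (simp add: cell_lift_def deck_action_in_E [OF g] lift_cell_in [OF j])

lemma cell_lift_in_Sn: "y \<in> topspace (disc n) \<Longrightarrow> cell_lift g j y \<in> Sn"
  using disc_image(3) [OF j] by (simp add: in_cover_skeleton cell_lift_in_E cell_lift_p image_subset_iff)

lemma cell_lift_continuous: "continuous_map (disc n) En (cell_lift g j)"
  unfolding continuous_map_in_subtopology cell_lift_def
  using continuous_map_compose [OF lift_cell(1) [OF j] deck_action_continuous [OF g]] cell_lift_in_Sn
  by (auto simp: cell_lift_def)

lemma cell_lift_in_Am_iff: "y \<in> topspace (disc n) \<Longrightarrow> cell_lift g j y \<in> Am \<longleftrightarrow> y \<in> disc_boundary n"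
  using interior_iff_open_cell(2) [OF j] by (simp add: in_cover_skeleton cell_lift_in_E cell_lift_p)

lemma cell_lift_in_Pn_iff: "y \<in> topspace (disc n) \<Longrightarrow> cell_lift g j y \<in> Pn \<longleftrightarrow> y = (\<lambda>i. 0)"
proof -
  assume y: "y \<in> topspace (disc n)"
  have "char_map K n j y \<in> centres n \<longleftrightarrow> y = (\<lambda>i. 0)"
  proof
    show "y = (\<lambda>i. 0)" if "char_map K n j y \<in> centres n"
    proof (rule ccontr)
      assume "y \<noteq> (\<lambda>i. 0)"
      then have "char_map K n j y \<in> char_map K n j ` punctured_disc n" using y by blast
      then show False using closed_cell_minus_centres [OF j] that by blast
    qed
    show "char_map K n j y \<in> centres n" if "y = (\<lambda>i. 0)"
      using that j by (simp add: centres_def)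
  qed
  then show ?thesis
    using y by (simp add: cell_lift_in_E cell_lift_p)
qed

end

text \<open>Projection identifies the cell and the point of the disc, and freeness of the action the
  group element. Only \<open>y\<close> is interior: the point \<open>z\<close> may lie on the
  boundary, so that whole closed cells can be seen to avoid the centre of another one.\<close>

lemma cell_lift_unique:
  assumes g: "g \<in> carrier G" "i \<in> cells K n" and h: "h \<in> carrier G" "j \<in> cells K n"
    and y: "y \<in> disc_interior n" and z: "z \<in> topspace (disc n)" and eq: "cell_lift g i y = cell_lift h j z"
  shows "g = h" "i = j" "y = z"
proof -
  have yD: "y \<in> topspace (disc n)" using y disc_interior_subset by blast
  have peq: "char_map K n i y = char_map K n j z"
    using cell_lift_p [OF g yD] cell_lift_p [OF h z] eq by simp
  have yi: "char_map K n i y \<in> open_cell K n i" using y by (auto simp: open_cell_def)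
  then have "char_map K n j z \<notin> skeleton K (int n - 1)"
    using open_cell_disjoint_skeleton [OF g(2)] peq by auto
  then have zB: "z \<in> disc_interior n"
    using boundary_in_skeleton [OF h(2)] z topspace_disc_Un by blast
  then have "char_map K n i y \<in> open_cell K n j" using peq by (auto simp: open_cell_def)
  then show ij: "i = j" using open_cell_unique [OF g(2) h(2) yi] by blast
  then show yz: "y = z" using char_map_inj [OF h(2) _ zB] y peq by blast
  show "g = h"
    using deck_action_free [OF g(1) h(1) lift_cell_in [OF h(2) z]] eq ij yz by (simp add: cell_lift_def)
qed

lemma cell_lift_exists:
  assumes e: "e \<in> topspace E" "p e \<in> open_cell K n j" and j: "j \<in> cells K n"
  obtains g y where "g \<in> carrier G" "y \<in> disc_interior n" "e = cell_lift g j y"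
proof -
  obtain y where y: "y \<in> disc_interior n" "p e = char_map K n j y"
    using e(2) by (auto simp: open_cell_def)
  have yD: "y \<in> topspace (disc n)" using y disc_interior_subset by blast
  obtain g where "g \<in> carrier G" "deck_action U g (lift_cell j y) = e"
    by (rule deck_action_transitive [OF lift_cell_in [OF j yD] e(1)])
      (use lift_cell(2) [OF j yD] y that in auto)
  then show ?thesis using that y by (simp add: cell_lift_def)
qed

end

section \<open>Lifted open cells and excision around their centres\<close>

context skeleton_covering
begin

abbreviation "cell_sheet g j \<equiv> cell_lift g j ` disc_interior n"

lemma closedin_Am: "closedin En Am"
proof -
  have "closedin X (skeleton K (int n - 1))"
    using finite_cells by (intro closedin_skeleton) simp
  then have "closedin E {e \<in> topspace E. p e \<in> skeleton K (int n - 1)}"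
    by (rule closedin_continuous_map_preimage [OF continuous_p])
  then have "closedin E Am" by (simp add: cover_skeleton_def)
  moreover have "Am \<subseteq> Sn" using Am_subset by blast
  ultimately show ?thesis by (rule closedin_subset_topspace)
qed

lemma openin_minus_Pn: "openin En (Sn - Pn)"
proof -
  have "closedin X (centres n)"
    using centres_subset skeleton_subset finite_cells [of n]
    by (intro closedin_Hausdorff_finite [OF Hausdorff]) (auto simp: centres_def)
  then have "closedin E Pn"
    by (rule closedin_continuous_map_preimage [OF continuous_p])
  then have "openin E (topspace E - Pn)" by blast
  then have "openin En (Sn \<inter> (topspace E - Pn))" by (rule openin_subtopology_Int2)
  moreover have "Sn \<inter> (topspace E - Pn) = Sn - Pn" by (auto simp: in_cover_skeleton)
  ultimately show ?thesis by simp
qed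

lemma cell_inverse:
  assumes j: "j \<in> cells K n"
  obtains r where "continuous_map (subtopology X (open_cell K n j)) (subtopology (disc n) (disc_interior n)) r"
    "\<And>y. y \<in> disc_interior n \<Longrightarrow> r (char_map K n j y) = y"
proof -
  let ?B = "subtopology (disc n) (disc_interior n)"
  have B: "topspace ?B = disc_interior n"
    using disc_interior_subset by auto
  have "homeomorphic_map ?B (subtopology X (open_cell K n j)) (char_map K n j)"
    using char_map_embedding [OF j] unfolding embedding_map_def B open_cell_def .
  then obtain r where "homeomorphic_maps ?B (subtopology X (open_cell K n j)) (char_map K n j) r"
    using homeomorphic_map_maps by blast
  then show ?thesis
    using that B by (auto simp: homeomorphic_maps_def)
qed

context
  fixes g j assumes g: "g \<in> carrier G" and j: "j \<in> cells K n"
begin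

lemma cell_sheet_subset: "cell_sheet g j \<subseteq> Sn"
  using cell_lift_in_Sn [OF g j] disc_interior_subset by blast

text \<open>Over the open cell, the inverse of the characteristic map followed by the lifted one
  gives a lift of \<open>p\<close>. The sheet is the locus where it agrees with the identity,
  another lift of \<open>p\<close>.\<close>

lemma openin_cell_sheet: "openin En (cell_sheet g j)"
proof -
  obtain r where r: "continuous_map (subtopology X (open_cell K n j)) (subtopology (disc n) (disc_interior n)) r"
    "\<And>y. y \<in> disc_interior n \<Longrightarrow> r (char_map K n j y) = y"
    by (rule cell_inverse [OF j]) (rule that)
  let ?W = "{e \<in> Sn. p e \<in> open_cell K n j}"
  let ?Y = "subtopology E ?W"
  have YW: "topspace ?Y = ?W" by (auto simp: in_cover_skeleton)
  have sub: "subtopology En ?W = ?Y"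
    by (simp add: subtopology_subtopology Int_absorb1)
  have pn: "continuous_map En (subtopology X (skeleton K (int n))) p"
    using continuous_p by (auto simp: continuous_map_in_subtopology continuous_map_from_subtopology in_cover_skeleton)
  have W: "openin En ?W"
    using openin_continuous_map_preimage [OF pn openin_open_cell [OF finite_cells j]] unfolding topspace_En .
  have cp: "continuous_map ?Y (subtopology X (open_cell K n j)) p"
    using continuous_p by (auto simp: continuous_map_in_subtopology continuous_map_from_subtopology)
  have cl: "continuous_map (subtopology (disc n) (disc_interior n)) E (cell_lift g j)"
    using cell_lift_continuous [OF g j] by (simp add: continuous_map_from_subtopology continuous_map_in_subtopology)
  have s: "continuous_map ?Y E (cell_lift g j \<circ> r \<circ> p)"
    using continuous_map_compose [OF cp continuous_map_compose [OF r(1) cl]] by (simp add: o_assoc)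
  have ps: "p ((cell_lift g j \<circ> r \<circ> p) e) = p e" if "e \<in> topspace ?Y" for e
  proof -
    have "p e \<in> open_cell K n j" using that YW by blast
    then obtain y where y: "y \<in> disc_interior n" "p e = char_map K n j y" by (auto simp: open_cell_def)
    then have "y \<in> topspace (disc n)" using disc_interior_subset by blast
    then show ?thesis using y r(2) cell_lift_p [OF g j] by simp
  qed
  have "openin ?Y {e \<in> topspace ?Y. (cell_lift g j \<circ> r \<circ> p) e = id e}"
    by (rule lifts_agreement_openin(1) [OF covering s]) (use ps in auto)
  moreover have "{e \<in> topspace ?Y. (cell_lift g j \<circ> r \<circ> p) e = id e} = cell_sheet g j"
  proof (intro equalityI subsetI)
    fix e assume "e \<in> {e \<in> topspace ?Y. (cell_lift g j \<circ> r \<circ> p) e = id e}"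
    then have e: "e \<in> ?W" "cell_lift g j (r (p e)) = e" unfolding YW by auto
    then obtain y where "y \<in> disc_interior n" "p e = char_map K n j y" by (auto simp: open_cell_def)
    then show "e \<in> cell_sheet g j" using e(2) r(2) by force
  next
    fix e assume "e \<in> cell_sheet g j"
    then obtain y where y: "y \<in> disc_interior n" "e = cell_lift g j y" by blast
    then have yD: "y \<in> topspace (disc n)" using disc_interior_subset by blast
    have "p e = char_map K n j y" using y yD cell_lift_p [OF g j] by simp
    moreover from this have "e \<in> ?W"
      using y cell_lift_in_Sn [OF g j yD] by (auto simp: open_cell_def)
    ultimately show "e \<in> {e \<in> topspace ?Y. (cell_lift g j \<circ> r \<circ> p) e = id e}"
      unfolding YW using y r(2) by simp
  qed
  ultimately have "openin (subtopology En ?W) (cell_sheet g j)" unfolding sub by simp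
  then show ?thesis using W openin_trans_full by blast
qed

lemma cell_sheet_centre: "cell_sheet g j - {cell_lift g j (\<lambda>i. 0)} = cell_lift g j ` (disc_interior n - {\<lambda>i. 0})"
proof -
  have "y = (\<lambda>i. 0)" if "y \<in> disc_interior n" "cell_lift g j y = cell_lift g j (\<lambda>i. 0)" for y
    using cell_lift_unique(3) [OF g j g j that(1) zero_in_disc that(2)] .
  then show ?thesis by (auto simp: image_iff)
qed

lemma cell_sheet_Pn: "cell_sheet g j \<inter> Pn = {cell_lift g j (\<lambda>i. 0)}"
proof (intro equalityI subsetI)
  fix e assume e: "e \<in> cell_sheet g j \<inter> Pn"
  then obtain y where y: "y \<in> disc_interior n" "e = cell_lift g j y" by (elim IntE imageE)
  moreover have "y \<in> topspace (disc n)" using y(1) by (rule disc_interior_subset [THEN subsetD])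
  ultimately have "y = (\<lambda>i. 0)" using cell_lift_in_Pn_iff [OF g j] e by simp
  with y show "e \<in> {cell_lift g j (\<lambda>i. 0)}" by simp
next
  fix e assume "e \<in> {cell_lift g j (\<lambda>i. 0)}"
  moreover have "cell_lift g j (\<lambda>i. 0) \<in> Pn"
    using cell_lift_in_Pn_iff [OF g j zero_in_disc] by simp
  moreover have "cell_lift g j (\<lambda>i. 0) \<in> cell_sheet g j"
    by (rule imageI) (rule zero_in_disc_interior)
  ultimately show "e \<in> cell_sheet g j \<inter> Pn" by simp
qed

text \<open>The inverse homeomorphism is \<open>p\<close> followed by the inverse \<open>r\<close>
  of the characteristic map on the open cell.\<close>

lemma cell_sheet_homeomorphic:
  "hom_induced q (subtopology (disc n) (disc_interior n)) (disc_interior n - {\<lambda>i. 0})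
      (subtopology En (cell_sheet g j)) (cell_sheet g j - {cell_lift g j (\<lambda>i. 0)}) (cell_lift g j)
    \<in> iso (relative_homology_group q (subtopology (disc n) (disc_interior n)) (disc_interior n - {\<lambda>i. 0}))
        (relative_homology_group q (subtopology En (cell_sheet g j)) (cell_sheet g j - {cell_lift g j (\<lambda>i. 0)}))"
proof (rule homeomorphic_map_relative_homology_iso)
  let ?B = "subtopology (disc n) (disc_interior n)" and ?V = "subtopology En (cell_sheet g j)"
  have B: "topspace ?B = disc_interior n"
    using disc_interior_subset by auto
  have V: "topspace ?V = cell_sheet g j"
    using openin_subset [OF openin_cell_sheet] by auto
  show "disc_interior n - {\<lambda>i. 0} \<subseteq> topspace ?B" unfolding B by blast
  show "cell_lift g j ` (disc_interior n - {\<lambda>i. 0}) = cell_sheet g j - {cell_lift g j (\<lambda>i. 0)}"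
    by (rule cell_sheet_centre [symmetric])
  obtain r where r: "continuous_map (subtopology X (open_cell K n j)) ?B r"
    "\<And>y. y \<in> disc_interior n \<Longrightarrow> r (char_map K n j y) = y"
    by (rule cell_inverse [OF j]) (rule that)
  have py: "p (cell_lift g j y) = char_map K n j y" if "y \<in> disc_interior n" for y
    using cell_lift_p [OF g j] that disc_interior_subset by blast
  have "continuous_map ?V X p"
    using continuous_p by (simp add: continuous_map_from_subtopology)
  then have "continuous_map ?V (subtopology X (open_cell K n j)) p"
    unfolding continuous_map_in_subtopology V using py by (auto simp: open_cell_def)
  from continuous_map_compose [OF this r(1)] have "continuous_map ?V ?B (r \<circ> p)" .
  moreover have "continuous_map ?B En (cell_lift g j)"
    using cell_lift_continuous [OF g j] by (rule continuous_map_from_subtopology)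
  then have "continuous_map ?B ?V (cell_lift g j)"
    unfolding continuous_map_in_subtopology [of _ En] B by auto
  ultimately have "homeomorphic_maps ?B ?V (cell_lift g j) (r \<circ> p)"
    unfolding homeomorphic_maps_def B V using py r(2) by auto
  then show "homeomorphic_map ?B ?V (cell_lift g j)"
    using homeomorphic_map_maps by blast
qed

end

lemma cell_sheet_disjoint:
  assumes "g \<in> carrier G" "i \<in> cells K n" "h \<in> carrier G" "j \<in> cells K n" "(g, i) \<noteq> (h, j)"
  shows "cell_sheet g i \<inter> cell_sheet h j = {}"
proof (rule ccontr)
  assume "cell_sheet g i \<inter> cell_sheet h j \<noteq> {}"
  then obtain y z where yz: "y \<in> disc_interior n" "z \<in> disc_interior n" "cell_lift g i y = cell_lift h j z"
    by blast
  have "z \<in> topspace (disc n)" using yz disc_interior_subset by blast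
  from cell_lift_unique(1,2) [OF assms(1-4) yz(1) this yz(3)] show False using assms(5) by simp
qed

lemma Sn_minus_Am: "Sn - Am = (\<Union>(g, j) \<in> carrier G \<times> cells K n. cell_sheet g j)"
proof (intro equalityI subsetI)
  fix e assume "e \<in> Sn - Am"
  then have e: "e \<in> topspace E" "p e \<in> skeleton K (int n)" "p e \<notin> skeleton K (int n - 1)"
    by (auto simp: in_cover_skeleton)
  then obtain j where j: "j \<in> cells K n" "p e \<in> open_cell K n j"
    using skeleton_Un [of n] by auto
  obtain g y where "g \<in> carrier G" "y \<in> disc_interior n" "e = cell_lift g j y"
    by (rule cell_lift_exists [OF e(1) j(2,1)]) (rule that)
  then show "e \<in> (\<Union>(g, j) \<in> carrier G \<times> cells K n. cell_sheet g j)"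
    using j by auto
next
  fix e assume "e \<in> (\<Union>(g, j) \<in> carrier G \<times> cells K n. cell_sheet g j)"
  then obtain g j y where gj: "g \<in> carrier G" "j \<in> cells K n" and y: "y \<in> disc_interior n" "e = cell_lift g j y"
    by auto
  have yD: "y \<in> topspace (disc n)" using y disc_interior_subset by blast
  have "y \<notin> disc_boundary n" using y(1) disc_interior_boundary by blast
  then show "e \<in> Sn - Am"
    using cell_lift_in_Sn [OF gj yD] cell_lift_in_Am_iff [OF gj yD] y(2) by simp
qed

text \<open>All other lifted centres are put back together with the sheets around them, which are
  open and miss this centre.\<close>

lemma openin_minus_centre:
  assumes gj: "g \<in> carrier G" "j \<in> cells K n"
  shows "openin En (Sn - {cell_lift g j (\<lambda>i. 0)})"
proof -
  let ?c = "cell_lift g j (\<lambda>i. 0)"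
  have c: "?c \<in> cell_sheet g j" "?c \<in> Pn"
    using zero_in_disc_interior cell_lift_in_Pn_iff [OF gj zero_in_disc] by auto
  have "Sn - {?c} = (Sn - Pn) \<union> (\<Union>(h, i) \<in> carrier G \<times> cells K n - {(g, j)}. cell_sheet h i)" (is "_ = ?R")
  proof (intro equalityI subsetI)
    fix e assume e: "e \<in> Sn - {?c}"
    show "e \<in> ?R"
    proof (cases "e \<in> Pn")
      case True
      then have "e \<in> Sn - Am" using e Am_subset by blast
      then obtain h i where hi: "(h, i) \<in> carrier G \<times> cells K n" "e \<in> cell_sheet h i"
        unfolding Sn_minus_Am by blast
      have "(h, i) \<noteq> (g, j)"
        using cell_sheet_Pn [OF gj] hi(2) True e by blast
      then show ?thesis using hi by blast
    qed (use e in blast)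
  next
    fix e assume "e \<in> ?R"
    then consider "e \<in> Sn - Pn" | h i where "h \<in> carrier G" "i \<in> cells K n" "(h, i) \<noteq> (g, j)" "e \<in> cell_sheet h i"
      by blast
    then show "e \<in> Sn - {?c}"
    proof cases
      case 1
      then show ?thesis using c by blast
    next
      case 2
      then show ?thesis
        using cell_sheet_disjoint [OF 2(1,2) gj 2(3)] cell_sheet_subset [OF 2(1,2)] c by blast
    qed
  qed
  moreover have "openin En ?R"
    using openin_minus_Pn openin_cell_sheet by (intro openin_Un openin_Union) auto
  ultimately show ?thesis by simp
qed

text \<open>Relative to the complement of one lifted centre, the skeleton only sees the cell around
  it. The comparison runs from the disc through its interior to the sheet by excision on both
  ends.\<close>

lemma cell_lift_iso:
  assumes gj: "g \<in> carrier G" "j \<in> cells K n"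
  shows "hom_induced q (disc n) (disc_boundary n) En (Sn - {cell_lift g j (\<lambda>i. 0)}) (cell_lift g j)
    \<in> iso (relative_homology_group q (disc n) (disc_boundary n))
        (relative_homology_group q En (Sn - {cell_lift g j (\<lambda>i. 0)}))"
proof -
  let ?c = "cell_lift g j (\<lambda>i. 0)" and ?\<psi> = "cell_lift g j"
  let ?B = "subtopology (disc n) (disc_interior n)" and ?V = "subtopology En (cell_sheet g j)"
  let ?b = "disc_interior n - {\<lambda>i. 0}" and ?v = "cell_sheet g j - {?c}"
  have \<psi>c: "continuous_map (disc n) En ?\<psi>" by (rule cell_lift_continuous [OF gj])
  have \<psi>p: "?\<psi> y \<in> Sn - {?c}" if "y \<in> punctured_disc n" for y
  proof -
    have "y \<in> topspace (disc n)" "y \<noteq> (\<lambda>i. 0)" using that by auto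
    moreover have "?\<psi> y \<noteq> ?c"
      using cell_lift_unique(3) [OF gj gj zero_in_disc_interior \<open>y \<in> topspace (disc n)\<close>] \<open>y \<noteq> _\<close> by metis
    ultimately show ?thesis using cell_lift_in_Sn [OF gj] by blast
  qed
  \<comment> \<open>The closed complement of the open sheet is excised; it lies in the open
    complement of the centre.\<close>
  have exc: "hom_induced q ?V ?v En (Sn - {?c}) id \<in> iso (relative_homology_group q ?V ?v) (relative_homology_group q En (Sn - {?c}))"
  proof -
    have clo: "closedin En (Sn - cell_sheet g j)"
      using openin_cell_sheet [OF gj] topspace_En by (metis closedin_diff closedin_topspace)
    have cV: "?c \<in> cell_sheet g j" using zero_in_disc_interior by blast
    have "En closure_of (Sn - cell_sheet g j) \<subseteq> En interior_of (Sn - {?c})"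
      unfolding closure_of_closedin [OF clo] interior_of_openin [OF openin_minus_centre [OF gj]] using cV by blast
    from homology_excision_axiom [OF this, of Sn q]
    have "hom_induced q (subtopology En (Sn - (Sn - cell_sheet g j))) (Sn - {?c} - (Sn - cell_sheet g j)) (subtopology En Sn) (Sn - {?c}) id
      \<in> iso (relative_homology_group q (subtopology En (Sn - (Sn - cell_sheet g j))) (Sn - {?c} - (Sn - cell_sheet g j)))
          (relative_homology_group q (subtopology En Sn) (Sn - {?c}))"
      by blast
    moreover have "Sn - (Sn - cell_sheet g j) = cell_sheet g j" "Sn - {?c} - (Sn - cell_sheet g j) = ?v"
      using cell_sheet_subset [OF gj] by blast+
    moreover have "subtopology En Sn = En"
      by (simp add: subtopology_subtopology)
    ultimately show ?thesis by simp
  qed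
  have "hom_induced q (disc n) (punctured_disc n) En (Sn - {?c}) ?\<psi>
    \<in> iso (relative_homology_group q (disc n) (punctured_disc n)) (relative_homology_group q En (Sn - {?c}))"
  \<comment> \<open>Both routes from the pair of the open disc to the pair of the skeleton are
    induced by the same map; the route through the sheet is an isomorphism.\<close>
  proof (rule iso_cancel_left [OF disc_interior_excision_iso])
    have 1: "hom_induced q (disc n) (punctured_disc n) En (Sn - {?c}) ?\<psi> \<circ> hom_induced q ?B ?b (disc n) (punctured_disc n) id
      = hom_induced q ?B ?b En (Sn - {?c}) (?\<psi> \<circ> id)"
      by (rule hom_induced_compose [symmetric])
        (use \<psi>p \<psi>c disc_interior_subset [of n, THEN subsetD] in auto)
    have "continuous_map ?B En ?\<psi>"
      using \<psi>c by (rule continuous_map_from_subtopology)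
    then have "continuous_map ?B ?V ?\<psi>"
      unfolding continuous_map_in_subtopology [of _ En] by auto
    moreover have "?\<psi> \<in> ?b \<rightarrow> ?v"
      using cell_sheet_centre [OF gj] by blast
    moreover have "id \<in> ?v \<rightarrow> Sn - {?c}"
      using cell_sheet_subset [OF gj] by auto
    ultimately have 2: "hom_induced q ?V ?v En (Sn - {?c}) id \<circ> hom_induced q ?B ?b ?V ?v ?\<psi>
      = hom_induced q ?B ?b En (Sn - {?c}) (id \<circ> ?\<psi>)"
      by (intro hom_induced_compose [symmetric]) auto
    have "hom_induced q ?V ?v En (Sn - {?c}) id \<circ> hom_induced q ?B ?b ?V ?v ?\<psi>
      \<in> iso (relative_homology_group q ?B ?b) (relative_homology_group q En (Sn - {?c}))"
      by (rule iso_set_trans [OF cell_sheet_homeomorphic [OF gj] exc])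
    then show "hom_induced q (disc n) (punctured_disc n) En (Sn - {?c}) ?\<psi> \<circ> hom_induced q ?B ?b (disc n) (punctured_disc n) id
      \<in> iso (relative_homology_group q ?B ?b) (relative_homology_group q En (Sn - {?c}))"
      unfolding 1 2 by simp
  qed (rule hom_induced_hom)
  then have "hom_induced q (disc n) (punctured_disc n) En (Sn - {?c}) ?\<psi> \<circ>
      hom_induced q (disc n) (disc_boundary n) (disc n) (punctured_disc n) id
      \<in> iso (relative_homology_group q (disc n) (disc_boundary n)) (relative_homology_group q En (Sn - {?c}))"
    using iso_set_trans [OF disc_boundary_punctured_iso] by blast
  moreover have "hom_induced q (disc n) (punctured_disc n) En (Sn - {?c}) ?\<psi> \<circ>
      hom_induced q (disc n) (disc_boundary n) (disc n) (punctured_disc n) id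
    = hom_induced q (disc n) (disc_boundary n) En (Sn - {?c}) (?\<psi> \<circ> id)"
    by (rule hom_induced_compose [symmetric])
      (use \<psi>p \<psi>c boundary_subset_punctured [of n, THEN subsetD] in auto)
  ultimately show ?thesis by simp
qed

end

lemma (in group) subgroup_preimage:
  assumes f: "f \<in> hom H G" and H: "group H" and N: "subgroup N G"
  shows "subgroup {x \<in> carrier H. f x \<in> N} H"
proof (rule group.subgroupI [OF H])
  show "{x \<in> carrier H. f x \<in> N} \<noteq> {}"
    using group.is_monoid [OF H] monoid.one_closed hom_one [OF f H is_group] subgroup.one_closed [OF N] by fastforce
  fix a assume a: "a \<in> {x \<in> carrier H. f x \<in> N}"
  interpret fh: group_hom H G f
    using f H is_group by (simp add: group_hom_def group_hom_axioms_def)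
  show "inv\<^bsub>H\<^esub> a \<in> {x \<in> carrier H. f x \<in> N}"
    using a subgroup.m_inv_closed [OF N] by simp
  fix b assume "b \<in> {x \<in> carrier H. f x \<in> N}"
  then show "a \<otimes>\<^bsub>H\<^esub> b \<in> {x \<in> carrier H. f x \<in> N}"
    using a subgroup.m_closed [OF N] by simp
qed auto

lemma iso_preimage: "h \<in> iso A B \<Longrightarrow> y \<in> carrier B \<Longrightarrow> \<exists>x \<in> carrier A. y = h x"
  by (auto simp: iso_def bij_betw_def)

text \<open>Fixes the class \<omega> whose images under lifted characteristic maps are the cell
  classes, together with the isomorphism \<theta> that reads off multiplicities.\<close>

lemma disc_generator:
  obtains \<theta> \<omega> where "\<theta> \<in> iso (relative_homology_group (int n) (disc n) (disc_boundary n)) integer_group"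
    "\<omega> \<in> carrier (relative_homology_group (int n) (disc n) (disc_boundary n))" "\<theta> \<omega> = 1"
    "\<And>a. a \<in> carrier (relative_homology_group (int n) (disc n) (disc_boundary n)) \<Longrightarrow>
      \<exists>m::int. a = \<omega> [^]\<^bsub>relative_homology_group (int n) (disc n) (disc_boundary n)\<^esub> m"
proof -
  let ?H = "relative_homology_group (int n) (disc n) (disc_boundary n)"
  obtain \<theta> where \<theta>: "\<theta> \<in> iso ?H integer_group"
    using relative_homology_disc unfolding is_iso_def by blast
  then have bij: "bij_betw \<theta> (carrier ?H) UNIV" and hom: "\<theta> \<in> hom ?H integer_group"
    by (auto simp: iso_def)
  obtain \<omega> where \<omega>: "\<omega> \<in> carrier ?H" "\<theta> \<omega> = 1"
    using bij by (metis UNIV_I bij_betw_def imageE)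
  have "\<exists>m::int. a = \<omega> [^]\<^bsub>?H\<^esub> m" if a: "a \<in> carrier ?H" for a
  proof
    have "\<theta> (\<omega> [^]\<^bsub>?H\<^esub> \<theta> a) = \<theta> a"
      using hom_int_pow [OF hom \<omega>(1), of "\<theta> a"] \<omega>(2) by simp
    then show "a = \<omega> [^]\<^bsub>?H\<^esub> \<theta> a"
      using bij a \<omega>(1) by (metis bij_betw_def group.int_pow_closed group_relative_homology_group inj_onD)
  qed
  then show ?thesis using that \<theta> \<omega> by blast
qed

lemma (in cw_covering) deck_action_skeleton:
  assumes g: "g \<in> carrier G"
  shows "continuous_map (cover_skeleton_space K U m) (cover_skeleton_space K U m) (deck_action U g)"
    "deck_action U g \<in> cover_skeleton K U m \<rightarrow> cover_skeleton K U m"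
proof -
  show 1: "deck_action U g \<in> cover_skeleton K U m \<rightarrow> cover_skeleton K U m"
    using deck_action_in_E [OF g] deck_action_p [OF g] by (auto simp: in_cover_skeleton)
  show "continuous_map (cover_skeleton_space K U m) (cover_skeleton_space K U m) (deck_action U g)"
    using deck_action_continuous [OF g] 1
    by (auto simp: continuous_map_in_subtopology continuous_map_from_subtopology)
qed

section \<open>Cell classes: coordinate functionals and generation\<close>

context skeleton_covering
begin

abbreviation "Hn \<equiv> relative_homology_group (int n) En Am"
abbreviation "Hd \<equiv> relative_homology_group (int n) (disc n) (disc_boundary n)"

definition cell_class :: "(nat \<Rightarrow> real) chain set \<Rightarrow> (real \<Rightarrow> 'a) set \<Rightarrow> 'i \<Rightarrow> 'b chain set" where
  "cell_class \<omega> g j = hom_induced (int n) (disc n) (disc_boundary n) En Am (cell_lift g j) \<omega>"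

text \<open>No condition on \<omega> is imposed, because \<open>hom_induced\<close> sends everything
  outside the carrier to the identity.\<close>

lemma cell_class_in: "cell_class \<omega> g j \<in> carrier Hn"
proof (cases "\<omega> \<in> carrier Hd")
  case True
  then show ?thesis
    unfolding cell_class_def by (rule hom_in_carrier [OF hom_induced_hom])
next
  case False
  then have "cell_class \<omega> g j = \<one>\<^bsub>Hn\<^esub>"
    unfolding cell_class_def by (intro hom_induced_default) simp
  then show ?thesis
    by (metis group.is_monoid group_relative_homology_group monoid.one_closed)
qed

lemma cell_lift_boundary:
  "g \<in> carrier G \<Longrightarrow> j \<in> cells K n \<Longrightarrow> cell_lift g j \<in> disc_boundary n \<rightarrow> Am"
  using cell_lift_in_Am_iff disc_boundary_subset by blast

lemma act_cell_class:
  assumes g: "g \<in> carrier G" and h: "h \<in> carrier G" and j: "j \<in> cells K n"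
  shows "cellular_group_act K U (int n) g (cell_class \<omega> h j) = cell_class \<omega> (g \<otimes>\<^bsub>G\<^esub> h) j"
proof -
  have "cellular_group_act K U (int n) g (cell_class \<omega> h j)
    = hom_induced (int n) (disc n) (disc_boundary n) En Am (deck_action U g \<circ> cell_lift h j) \<omega>"
    unfolding cellular_group_act_def cell_class_def
    by (rule hom_induced_compose' [OF cell_lift_continuous [OF h j] cell_lift_boundary [OF h j] deck_action_skeleton [OF g]])
  also have "hom_induced (int n) (disc n) (disc_boundary n) En Am (deck_action U g \<circ> cell_lift h j)
    = hom_induced (int n) (disc n) (disc_boundary n) En Am (cell_lift (g \<otimes>\<^bsub>G\<^esub> h) j)"
    by (rule hom_induced_eq) (simp add: cell_lift_def deck_action_mult [OF g h] lift_cell_in [OF j])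
  finally show ?thesis by (simp add: cell_class_def)
qed

text \<open>The functional passes to homology relative to the complement of the centre of the cell
  \<open>(\<one>, j)\<close>, which is a copy of the homology of the disc. There all other lifted
  cells become trivial.\<close>

lemma cell_class_dual:
  assumes \<theta>: "\<theta> \<in> iso Hd integer_group" and \<omega>: "\<omega> \<in> carrier Hd" "\<theta> \<omega> = 1" and j: "j \<in> cells K n"
  obtains \<kappa> where "\<kappa> \<in> hom Hn integer_group"
    "\<And>g i. g \<in> carrier G \<Longrightarrow> i \<in> cells K n \<Longrightarrow> \<kappa> (cell_class \<omega> g i) = (if g = \<one>\<^bsub>G\<^esub> \<and> i = j then 1 else 0)"
proof -
  let ?c = "cell_lift \<one>\<^bsub>G\<^esub> j (\<lambda>i. 0)"
  let ?H' = "relative_homology_group (int n) En (Sn - {?c})"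
  let ?\<alpha> = "hom_induced (int n) En Am En (Sn - {?c}) id"
  let ?\<beta> = "hom_induced (int n) (disc n) (disc_boundary n) En (Sn - {?c}) (cell_lift \<one>\<^bsub>G\<^esub> j)"
  have \<beta>: "?\<beta> \<in> iso Hd ?H'"
    by (rule cell_lift_iso [OF one_G(1) j])
  have inv: "inv_into (carrier Hd) ?\<beta> \<in> hom ?H' Hd"
    using group.iso_set_sym [OF group_relative_homology_group \<beta>] by (simp add: iso_def)
  define \<kappa> where "\<kappa> = \<theta> \<circ> (inv_into (carrier Hd) ?\<beta> \<circ> ?\<alpha>)"
  have \<theta>h: "\<theta> \<in> hom Hd integer_group" using \<theta> by (simp add: iso_def)
  have 1: "\<kappa> \<in> hom Hn integer_group"
    unfolding \<kappa>_def by (intro hom_compose [OF _ \<theta>h] hom_compose [OF hom_induced_hom inv])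
  have "?c \<notin> Am"
    using cell_lift_in_Am_iff [OF one_G(1) j zero_in_disc] zero_in_disc_interior disc_interior_boundary by blast
  then have idA: "id \<in> Am \<rightarrow> Sn - {?c}"
    using Am_subset by auto
  have \<alpha>: "?\<alpha> (cell_class \<omega> g i) = hom_induced (int n) (disc n) (disc_boundary n) En (Sn - {?c}) (cell_lift g i) \<omega>"
    if gi: "g \<in> carrier G" "i \<in> cells K n" for g i
    unfolding cell_class_def
    using hom_induced_compose' [OF cell_lift_continuous [OF gi] cell_lift_boundary [OF gi] continuous_map_id idA]
    by simp
  have 2: "\<kappa> (cell_class \<omega> g i) = (if g = \<one>\<^bsub>G\<^esub> \<and> i = j then 1 else 0)"
    if gi: "g \<in> carrier G" "i \<in> cells K n" for g i
  proof (cases "g = \<one>\<^bsub>G\<^esub> \<and> i = j")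
    case True
    then have "?\<alpha> (cell_class \<omega> g i) = ?\<beta> \<omega>" using \<alpha> [OF gi] by simp
    moreover have "inv_into (carrier Hd) ?\<beta> (?\<beta> \<omega>) = \<omega>"
      using \<beta> \<omega>(1) by (intro inv_into_f_f) (auto simp: iso_def bij_betw_def)
    ultimately show ?thesis using \<omega>(2) True by (simp add: \<kappa>_def)
  next
    case False
    let ?\<psi> = "cell_lift g i" and ?D = "topspace (disc n)"
    \<comment> \<open>Another lifted closed cell misses the centre \<open>?c\<close> entirely, so
      its class factors through the homology of the disc relative to itself.\<close>
    have "?\<psi> y \<noteq> ?c" if "y \<in> ?D" for y
      using cell_lift_unique(1,2) [OF one_G(1) j gi zero_in_disc_interior that] False by metis
    then have \<psi>: "?\<psi> \<in> ?D \<rightarrow> Sn - {?c}"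
      using cell_lift_in_Sn [OF gi] by blast
    have "id \<in> disc_boundary n \<rightarrow> ?D" using disc_boundary_subset [of n] by auto
    from hom_induced_compose' [OF continuous_map_id this cell_lift_continuous [OF gi] \<psi>]
    have "hom_induced (int n) (disc n) ?D En (Sn - {?c}) ?\<psi> (hom_induced (int n) (disc n) (disc_boundary n) (disc n) ?D id \<omega>)
      = ?\<alpha> (cell_class \<omega> g i)"
      using \<alpha> [OF gi] by simp
    moreover have "hom_induced (int n) (disc n) (disc_boundary n) (disc n) ?D id \<omega> = \<one>\<^bsub>relative_homology_group (int n) (disc n) ?D\<^esub>"
      using hom_in_carrier [OF hom_induced_hom \<omega>(1)] trivial_relative_homology_group_topspace
      unfolding trivial_group_def by blast
    ultimately have "?\<alpha> (cell_class \<omega> g i) = \<one>\<^bsub>?H'\<^esub>"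
      using hom_one [OF hom_induced_hom group_relative_homology_group group_relative_homology_group] by metis
    moreover have "inv_into (carrier Hd) ?\<beta> \<one>\<^bsub>?H'\<^esub> = \<one>\<^bsub>Hd\<^esub>"
      by (rule hom_one [OF inv group_relative_homology_group group_relative_homology_group])
    ultimately show ?thesis
      using False hom_one [OF \<theta>h group_relative_homology_group group_integer_group] by (auto simp: \<kappa>_def)
  qed
  show ?thesis by (rule that [OF 1 2])
qed

text \<open>Removing the lower skeleton by excision leaves the disjoint union of the open sheets,
  relative to their punctured versions. Its homology is generated by that of single sheets, each a
  copy of that of the disc.\<close>

lemma cell_class_generate:
  assumes gen: "\<And>a. a \<in> carrier Hd \<Longrightarrow> \<exists>m::int. a = \<omega> [^]\<^bsub>Hd\<^esub> m" and \<omega>: "\<omega> \<in> carrier Hd"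
  shows "carrier Hn = generate Hn {cell_class \<omega> g j | g j. g \<in> carrier G \<and> j \<in> cells K n}"
proof
  let ?C = "{cell_class \<omega> g j | g j. g \<in> carrier G \<and> j \<in> cells K n}"
  interpret Hn: group Hn by simp
  have CH: "?C \<subseteq> carrier Hn" using cell_class_in by blast
  then show "generate Hn ?C \<subseteq> carrier Hn" by (rule Hn.generate_incl)
  let ?N = "generate Hn ?C"
  have N: "subgroup ?N Hn" using CH by (rule Hn.generate_is_subgroup)
  let ?W = "Sn - Am"
  let ?HP = "relative_homology_group (int n) En (Sn - Pn)"
  let ?HW = "relative_homology_group (int n) (subtopology En ?W) (?W - Pn)"
  let ?\<alpha> = "hom_induced (int n) En Am En (Sn - Pn) id"
  let ?\<iota> = "hom_induced (int n) (subtopology En ?W) (?W - Pn) En (Sn - Pn) id"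
  have \<alpha>: "?\<alpha> \<in> iso Hn ?HP" by (rule skeleton_punctured_iso)
  have \<iota>: "?\<iota> \<in> iso ?HW ?HP"
  proof -
    have "En closure_of Am \<subseteq> En interior_of (Sn - Pn)"
      unfolding closure_of_closedin [OF closedin_Am] interior_of_openin [OF openin_minus_Pn] by (rule Am_subset)
    from homology_excision_axiom [OF this, of Sn "int n"]
    have "hom_induced (int n) (subtopology En ?W) (Sn - Pn - Am) (subtopology En Sn) (Sn - Pn) id
      \<in> iso (relative_homology_group (int n) (subtopology En ?W) (Sn - Pn - Am))
          (relative_homology_group (int n) (subtopology En Sn) (Sn - Pn))"
      by blast
    moreover have "Sn - Pn - Am = ?W - Pn" by blast
    moreover have "subtopology En Sn = En" by (simp add: subtopology_subtopology)
    ultimately show ?thesis by simp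
  qed
  \<comment> \<open>Transports classes from the union of sheets to \<open>Hn\<close>; both meet in
    homology relative to the complement of all lifted centres.\<close>
  define f where "f = inv_into (carrier Hn) ?\<alpha> \<circ> ?\<iota>"
  have "inv_into (carrier Hn) ?\<alpha> \<in> iso ?HP Hn"
    by (rule group.iso_set_sym [OF group_relative_homology_group \<alpha>])
  then have f: "f \<in> iso ?HW Hn"
    unfolding f_def by (rule iso_set_trans [OF \<iota>])
  have f\<alpha>: "f x = y" if "?\<iota> x = ?\<alpha> y" "y \<in> carrier Hn" for x y
    unfolding f_def o_apply that(1) using \<alpha> that(2)
    by (intro inv_into_f_f) (auto simp: iso_def bij_betw_def)
  let ?\<V> = "(\<lambda>(g, j). cell_sheet g j) ` (carrier G \<times> cells K n)"
  have sub: "subgroup {x \<in> carrier ?HW. f x \<in> ?N} ?HW"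
    using f N by (intro Hn.subgroup_preimage) (auto simp: iso_def)
  have "carrier ?HW \<subseteq> {x \<in> carrier ?HW. f x \<in> ?N}"
  proof (rule relative_homology_generated_by_components [OF _ _ _ sub])
    have UW: "\<Union>?\<V> = ?W" using Sn_minus_Am by (simp add: split_def)
    then show "\<Union>?\<V> = topspace (subtopology En ?W)" by (auto simp: in_cover_skeleton)
    have VW: "V \<subseteq> ?W" if "V \<in> ?\<V>" for V using UW that by blast
    show "openin (subtopology En ?W) V" if V: "V \<in> ?\<V>" for V
    proof -
      have "openin En V" using V openin_cell_sheet by auto
      then have "openin (subtopology En ?W) (?W \<inter> V)" by (rule openin_subtopology_Int2)
      then show ?thesis using VW [OF V] by (simp only: Int_absorb1)
    qed
    show "pairwise disjnt ?\<V>"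
    proof (rule pairwiseI)
      fix V V' assume VV: "V \<in> ?\<V>" "V' \<in> ?\<V>" "V \<noteq> V'"
      obtain g j where gj: "g \<in> carrier G" "j \<in> cells K n" "V = cell_sheet g j" using VV(1) by auto
      obtain h i where hi: "h \<in> carrier G" "i \<in> cells K n" "V' = cell_sheet h i" using VV(2) by auto
      have "(g, j) \<noteq> (h, i)" using gj(3) hi(3) VV(3) by blast
      from cell_sheet_disjoint [OF gj(1,2) hi(1,2) this] show "disjnt V V'"
        unfolding disjnt_def gj(3) hi(3) .
    qed
    fix V x assume V: "V \<in> ?\<V>"
      and x: "x \<in> carrier (relative_homology_group (int n) (subtopology (subtopology En ?W) V) ((?W - Pn) \<inter> V))"
    obtain g j where gj: "g \<in> carrier G" "j \<in> cells K n" and Veq: "V = cell_sheet g j" using V by auto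
    let ?c = "cell_lift g j (\<lambda>i. 0)" and ?\<psi> = "cell_lift g j"
    let ?B = "subtopology (disc n) (disc_interior n)" and ?b = "disc_interior n - {\<lambda>i. 0}"
    have top: "subtopology (subtopology En ?W) V = subtopology En V"
    proof -
      have "Sn \<inter> ?W \<inter> V = Sn \<inter> V" using VW [OF V] by blast
      then show ?thesis by (simp only: subtopology_subtopology)
    qed
    have set: "(?W - Pn) \<inter> V = cell_sheet g j - {?c}"
      using cell_sheet_Pn [OF gj] VW [OF V] Veq by blast
    have \<psi>c: "continuous_map (disc n) En ?\<psi>" by (rule cell_lift_continuous [OF gj])
    have \<psi>p: "?\<psi> \<in> punctured_disc n \<rightarrow> Sn - Pn"
    proof
      fix y assume y: "y \<in> punctured_disc n"
      then have yD: "y \<in> topspace (disc n)" by blast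
      show "?\<psi> y \<in> Sn - Pn"
        using cell_lift_in_Sn [OF gj yD] cell_lift_in_Pn_iff [OF gj yD] y by blast
    qed
    obtain z where z: "z \<in> carrier (relative_homology_group (int n) ?B ?b)"
      "x = hom_induced (int n) ?B ?b (subtopology En V) (cell_sheet g j - {?c}) ?\<psi> z"
      using iso_preimage [OF cell_sheet_homeomorphic [OF gj, of "int n"], of x] x unfolding top set
      unfolding Veq by blast
    have "hom_induced (int n) ?B ?b (disc n) (punctured_disc n) id z \<in> carrier (relative_homology_group (int n) (disc n) (punctured_disc n))"
      by (rule hom_in_carrier [OF hom_induced_hom z(1)])
    then obtain a where a: "a \<in> carrier Hd" "hom_induced (int n) ?B ?b (disc n) (punctured_disc n) id z
        = hom_induced (int n) (disc n) (disc_boundary n) (disc n) (punctured_disc n) id a"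
      using iso_preimage [OF disc_boundary_punctured_iso] by blast
    have BEn: "continuous_map ?B En ?\<psi>"
      using \<psi>c by (rule continuous_map_from_subtopology)
    have BV: "continuous_map ?B (subtopology En V) ?\<psi>"
      unfolding continuous_map_in_subtopology [of _ En] using BEn Veq by auto
    have bV: "?\<psi> \<in> ?b \<rightarrow> cell_sheet g j - {?c}"
      using cell_sheet_centre [OF gj] by blast
    have VEn: "continuous_map (subtopology En V) En id" by simp
    have WEn: "continuous_map (subtopology En ?W) En id" by simp
    have VWc: "continuous_map (subtopology En V) (subtopology En ?W) id"
      unfolding continuous_map_in_subtopology [of _ En] using VEn VW [OF V] by auto
    have s1: "cell_sheet g j - {?c} \<subseteq> ?W - Pn" unfolding set [symmetric] by (rule Int_lower1)
    have s2: "?W - Pn \<subseteq> Sn - Pn" by (intro Diff_mono Diff_subset order_refl)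
    have ids: "id \<in> cell_sheet g j - {?c} \<rightarrow> ?W - Pn" "id \<in> ?W - Pn \<rightarrow> Sn - Pn"
        "id \<in> cell_sheet g j - {?c} \<rightarrow> Sn - Pn"
      unfolding Pi_iff id_apply using subsetD [OF s1] subsetD [OF s2] by fast+
    \<comment> \<open>The class \<open>x\<close> of one sheet is traced back to the class
      \<open>a\<close> of the disc, always after mapping to homology relative to
      \<open>Sn - Pn\<close>.\<close>
    have "?\<iota> (hom_induced (int n) (subtopology En V) (cell_sheet g j - {?c}) (subtopology En ?W) (?W - Pn) id x)
      = hom_induced (int n) (subtopology En V) (cell_sheet g j - {?c}) En (Sn - Pn) id x"
      using hom_induced_compose' [OF VWc ids(1) WEn ids(2), of "int n" x] by simp
    also have "\<dots> = hom_induced (int n) ?B ?b En (Sn - Pn) ?\<psi> z"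
      unfolding z(2) using hom_induced_compose' [OF BV bV VEn ids(3), of "int n" z] by simp
    also have "\<dots> = hom_induced (int n) (disc n) (punctured_disc n) En (Sn - Pn) ?\<psi>
        (hom_induced (int n) ?B ?b (disc n) (punctured_disc n) id z)"
    proof -
      have i: "id \<in> ?b \<rightarrow> punctured_disc n" using disc_interior_subset [of n] by auto
      have c: "continuous_map ?B (disc n) id" by simp
      show ?thesis
        using hom_induced_compose' [OF c i \<psi>c \<psi>p, of "int n" z] by simp
    qed
    also have "\<dots> = hom_induced (int n) (disc n) (disc_boundary n) En (Sn - Pn) ?\<psi> a"
    proof -
      have i: "id \<in> disc_boundary n \<rightarrow> punctured_disc n" using boundary_subset_punctured [of n] by auto
      show ?thesis
        unfolding a(2) using hom_induced_compose' [OF continuous_map_id i \<psi>c \<psi>p, of "int n" a] by simp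
    qed
    also have "\<dots> = ?\<alpha> (cell_class a g j)"
    proof -
      have i: "id \<in> Am \<rightarrow> Sn - Pn" unfolding Pi_iff id_apply using subsetD [OF Am_subset] by fast
      show ?thesis
        unfolding cell_class_def
        using hom_induced_compose' [OF \<psi>c cell_lift_boundary [OF gj] continuous_map_id i, of "int n" a] by simp
    qed
    finally have "f (hom_induced (int n) (subtopology En V) (cell_sheet g j - {?c}) (subtopology En ?W) (?W - Pn) id x) = cell_class a g j"
      using f\<alpha> cell_class_in by blast
    moreover obtain m :: int where "a = \<omega> [^]\<^bsub>Hd\<^esub> m" using gen [OF a(1)] by blast
    then have "cell_class a g j = cell_class \<omega> g j [^]\<^bsub>Hn\<^esub> m"
      unfolding cell_class_def using hom_int_pow [OF hom_induced_hom \<omega>] by simp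
    moreover have "cell_class \<omega> g j [^]\<^bsub>Hn\<^esub> m \<in> ?N"
      using gj by (intro Hn.subgroup_int_pow_closed [OF N] generate.incl) blast
    ultimately show "hom_induced (int n) (subtopology (subtopology En ?W) V) ((?W - Pn) \<inter> V) (subtopology En ?W) (?W - Pn) id x
        \<in> {x \<in> carrier ?HW. f x \<in> ?N}"
      unfolding top set using hom_in_carrier [OF hom_induced_hom x [unfolded top set]] by simp
  qed
  then have "f ` carrier ?HW \<subseteq> ?N" by blast
  moreover have "f ` carrier ?HW = carrier Hn" using f by (simp add: iso_def bij_betw_def)
  ultimately show "carrier Hn \<subseteq> ?N" by simp
qed

end

section \<open>Linear algebra over a field\<close>

text \<open>If \<open>1\<close> does not lie in a subring \<open>I\<close> without unit, then \<open>1 - \<epsilon>\<close> is injective for every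
  square matrix \<open>\<epsilon>\<close> over \<open>I\<close>.  The elimination step cross-multiplies by \<open>1 - \<epsilon> n n\<close>, so that the
  entries stay in \<open>I\<close>.\<close>

lemma fixed_vector_zero:
  fixes I :: "'k::field set" and x :: "'i \<Rightarrow> 'k"
  assumes I0: "0 \<in> I" and Idiff: "\<And>a b. a \<in> I \<Longrightarrow> b \<in> I \<Longrightarrow> a - b \<in> I"
    and Imult: "\<And>a b. a \<in> I \<Longrightarrow> b \<in> I \<Longrightarrow> a * b \<in> I" and I1: "1 \<notin> I"
    and "finite L" and "\<And>m l. m \<in> L \<Longrightarrow> l \<in> L \<Longrightarrow> \<epsilon> m l \<in> I"
    and "\<And>m. m \<in> L \<Longrightarrow> x m = (\<Sum>l\<in>L. \<epsilon> m l * x l)"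
  shows "\<forall>m\<in>L. x m = 0"
  using assms(5-)
proof (induction L arbitrary: \<epsilon> rule: finite_induct)
  case (insert n L)
  have Iadd: "a + b \<in> I" if "a \<in> I" "b \<in> I" for a b
    using Idiff [OF that(1) Idiff [OF I0 that(2)]] by simp
  define d where "d = 1 - \<epsilon> n n"
  have d0: "d \<noteq> 0" using insert.prems(1) [of n n] I1 by (auto simp: d_def)
  have n: "d * x n = (\<Sum>j\<in>L. \<epsilon> n j * x j)"
    using insert.prems(2) [of n] insert.hyps by (simp add: d_def algebra_simps)
  \<comment> \<open>The diagonal summand comes from d * x i = x i - \<epsilon> n n * x i, whose
    second term is moved to the other side.\<close>
  define \<delta> where "\<delta> = (\<lambda>i j. \<epsilon> i j - \<epsilon> i j * \<epsilon> n n + \<epsilon> i n * \<epsilon> n j + (if i = j then \<epsilon> n n else 0))"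
  have "\<forall>m\<in>L. x m = 0"
  proof (rule insert.IH [of \<delta>])
    show "\<delta> i j \<in> I" if "i \<in> L" "j \<in> L" for i j
      unfolding \<delta>_def using that insert.prems(1) I0 by (intro Iadd Idiff Imult) auto
    fix i assume i: "i \<in> L"
    have "x i = (\<Sum>j\<in>L. \<epsilon> i j * x j) + \<epsilon> i n * x n"
      using insert.prems(2) [of i] i insert.hyps by (simp add: algebra_simps)
    then have "d * x i = (\<Sum>j\<in>L. d * (\<epsilon> i j * x j)) + \<epsilon> i n * (d * x n)"
      by (simp add: algebra_simps sum_distrib_left)
    also have "\<dots> = (\<Sum>j\<in>L. d * (\<epsilon> i j * x j) + \<epsilon> i n * (\<epsilon> n j * x j))"
      unfolding n by (simp add: sum.distrib sum_distrib_left)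
    finally have "x i = (\<Sum>j\<in>L. d * (\<epsilon> i j * x j) + \<epsilon> i n * (\<epsilon> n j * x j)) + \<epsilon> n n * x i"
      by (simp add: d_def algebra_simps)
    also have "\<epsilon> n n * x i = (\<Sum>j\<in>L. (if i = j then \<epsilon> n n else 0) * x j)"
      using i insert.hyps(1) by (simp add: if_distrib [of "\<lambda>u. u * _"] cong: if_cong)
    finally show "x i = (\<Sum>j\<in>L. \<delta> i j * x j)"
      unfolding sum.distrib [symmetric] \<delta>_def d_def by (simp add: algebra_simps)
  qed
  then show ?case using n d0 by simp
qed simp

text \<open>Gaussian elimination, one coordinate at a time: a vector with nonzero entry at
  \<open>n\<close> serves as pivot and is subtracted from all the others.\<close>

lemma linear_dependence:
  fixes v :: "'j \<Rightarrow> 'i \<Rightarrow> 'k::field"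
  assumes "finite L" "finite J" "card L < card J"
  shows "\<exists>c. (\<exists>j\<in>J. c j \<noteq> 0) \<and> (\<forall>l\<in>L. (\<Sum>j\<in>J. c j * v j l) = 0)"
  using assms
proof (induction L arbitrary: J v rule: finite_induct)
  case empty
  then have "J \<noteq> {}" by auto
  then show ?case by (intro exI [of _ "\<lambda>j. 1"]) auto
next
  case (insert n L)
  show ?case
  proof (cases "\<forall>j\<in>J. v j n = 0")
    case True
    obtain c where "\<exists>j\<in>J. c j \<noteq> 0" "\<forall>l\<in>L. (\<Sum>j\<in>J. c j * v j l) = 0"
      using insert.IH [of J v] insert.prems insert.hyps by auto
    with True show ?thesis by (intro exI [of _ c]) auto
  next
    case False
    then obtain i where i: "i \<in> J" "v i n \<noteq> 0" by blast
    let ?J = "J - {i}"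
    define w where "w = (\<lambda>j l. v j l - v j n / v i n * v i l)"
    have "finite ?J" "card L < card ?J"
      using insert i by (auto simp: card_insert_if)
    then obtain c where c: "\<exists>j\<in>?J. c j \<noteq> 0" "\<And>l. l \<in> L \<Longrightarrow> (\<Sum>j\<in>?J. c j * w j l) = 0"
      using insert.IH [of ?J w] by blast
    \<comment> \<open>The coefficient of the pivot collects the multiples of it that were subtracted
      from the other vectors.\<close>
    define c' where "c' = (\<lambda>j. if j = i then - (\<Sum>j\<in>?J. c j * (v j n / v i n)) else c j)"
    have sum: "(\<Sum>j\<in>J. c' j * v j l) = (\<Sum>j\<in>?J. c j * w j l)" for l
    proof -
      have "(\<Sum>j\<in>J. c' j * v j l) = c' i * v i l + (\<Sum>j\<in>?J. c' j * v j l)"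
        using insert.prems(1) i(1) by (rule sum.remove)
      also have "(\<Sum>j\<in>?J. c' j * v j l) = (\<Sum>j\<in>?J. c j * v j l)"
        by (intro sum.cong) (auto simp: c'_def)
      also have "c' i * v i l = - (\<Sum>j\<in>?J. c j * (v j n / v i n) * v i l)"
        by (simp add: c'_def sum_distrib_right)
      finally show ?thesis
        by (simp add: w_def algebra_simps sum_subtractf)
    qed
    have "(\<Sum>j\<in>J. c' j * v j n) = 0"
      unfolding sum using i(2) by (simp add: w_def)
    moreover have "\<exists>j\<in>J. c' j \<noteq> 0" using c(1) by (auto simp: c'_def)
    ultimately show ?thesis
      using c(2) sum by (intro exI [of _ c']) auto
  qed
qed

text \<open>The iterates of a vector under an injective endomorphism of a finite-dimensional space are
  linearly dependent, so that the vector is a combination of its proper iterates.\<close>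

lemma injective_endomorphism_absorbs:
  fixes T :: "('i \<Rightarrow> 'k::field) \<Rightarrow> 'i \<Rightarrow> 'k"
  assumes fin: "finite L" and Zsupp: "\<And>z l. z \<in> Z \<Longrightarrow> l \<notin> L \<Longrightarrow> z l = 0"
    and B0: "(\<lambda>l. 0) \<in> B" and Badd: "\<And>x y. x \<in> B \<Longrightarrow> y \<in> B \<Longrightarrow> (\<lambda>l. x l + y l) \<in> B"
    and Bscale: "\<And>c x. x \<in> B \<Longrightarrow> (\<lambda>l. c * x l) \<in> B"
    and BZ: "B \<subseteq> Z" and TB: "\<And>z. z \<in> Z \<Longrightarrow> T z \<in> B"
    and Tlin: "\<And>N c v. T (\<lambda>l. \<Sum>n\<le>(N::nat). c n * v n l) = (\<lambda>l. \<Sum>n\<le>N. c n * T (v n) l)"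
    and Tinj: "\<And>x. (\<And>l. l \<notin> L \<Longrightarrow> x l = 0) \<Longrightarrow> T x = (\<lambda>l. 0) \<Longrightarrow> x = (\<lambda>l. 0)"
  shows "Z \<subseteq> B"
proof
  fix z assume z: "z \<in> Z"
  let ?v = "\<lambda>n. (T ^^ n) z"
  have vZ: "?v n \<in> Z" for n
    using z TB BZ by (induction n) auto
  have vB: "?v (Suc n) \<in> B" for n
    using TB [OF vZ [of n]] by simp
  have main: "z \<in> B" if "\<forall>l. (\<Sum>n\<le>N. c n * ?v n l) = 0" "\<exists>n\<le>N. c n \<noteq> 0" for N c
    using that
  proof (induction N arbitrary: c)
    case 0
    then have "z = (\<lambda>l. 0)" by (auto simp: fun_eq_iff)
    then show ?case using B0 by simp
  next
    case (Suc N)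
    have split: "(\<Sum>n\<le>Suc N. c n * ?v n l) = c 0 * z l + (\<Sum>n\<le>N. c (Suc n) * ?v (Suc n) l)" for l
      by (simp only: sum.atMost_Suc_shift funpow_0)
    show ?case
    proof (cases "c 0 = 0")
      case True
      \<comment> \<open>Without a constant term the relation is T applied to a shorter one, and T
        can be cancelled.\<close>
      have "(\<Sum>n\<le>N. c (Suc n) * ?v n l) = 0" if "l \<notin> L" for l
        by (intro sum.neutral ballI) (simp only: Zsupp [OF vZ that] mult_zero_right)
      moreover have "T (\<lambda>l. \<Sum>n\<le>N. c (Suc n) * ?v n l) = (\<lambda>l. 0)"
        unfolding Tlin using Suc.prems(1) unfolding split True by (simp add: fun_eq_iff)
      ultimately have "(\<lambda>l. \<Sum>n\<le>N. c (Suc n) * ?v n l) = (\<lambda>l. 0)"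
        by (rule Tinj)
      then have "\<forall>l. (\<Sum>n\<le>N. c (Suc n) * ?v n l) = 0" by (simp add: fun_eq_iff)
      moreover have "\<exists>n\<le>N. c (Suc n) \<noteq> 0"
        using Suc.prems(2) True by (metis Suc_le_mono not0_implies_Suc)
      ultimately show ?thesis by (rule Suc.IH)
    next
      case False
      \<comment> \<open>All iterates after the first lie in \<open>B\<close>, and the relation can
        be solved for \<open>z\<close>.\<close>
      have sumB: "(\<lambda>l. \<Sum>n\<le>m. c (Suc n) * ?v (Suc n) l) \<in> B" for m
      proof (induction m)
        case 0
        then show ?case using Bscale [OF vB [of 0], of "c (Suc 0)"] by simp
      next
        case (Suc m)
        then show ?case using Badd [OF Suc Bscale [OF vB [of "Suc m"], of "c (Suc (Suc m))"]] by simp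
      qed
      have "z = (\<lambda>l. (- 1 / c 0) * (\<Sum>n\<le>N. c (Suc n) * ?v (Suc n) l))"
      proof
        fix l
        have solve: "x = (- 1 / a) * s" if "a * x + s = 0" "a \<noteq> 0" for a x s :: 'k
          using that by (simp add: field_simps eq_neg_iff_add_eq_0)
        have "c 0 * z l + (\<Sum>n\<le>N. c (Suc n) * ?v (Suc n) l) = 0"
          using Suc.prems(1) [rule_format, of l] unfolding split .
        then show "z l = (- 1 / c 0) * (\<Sum>n\<le>N. c (Suc n) * ?v (Suc n) l)"
          using False by (rule solve)
      qed
      then show ?thesis
        by (rule ssubst) (rule Bscale [OF sumB])
    qed
  qed
  obtain c where c: "\<exists>n\<in>{..card L}. c n \<noteq> 0" "\<forall>l\<in>L. (\<Sum>n\<le>card L. c n * ?v n l) = 0"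
    using linear_dependence [OF fin, of "{..card L}" ?v] by auto
  then have "\<forall>l. (\<Sum>n\<le>card L. c n * ?v n l) = 0"
    by (metis (no_types, lifting) Zsupp [OF vZ] mult_zero_right sum.neutral)
  then show "z \<in> B" using main c(1) by blast
qed

section \<open>Novikov rings\<close>

locale novikov = group G for G :: "('g, 'z) monoid_scheme" (structure) +
  fixes \<psi> :: "'g \<Rightarrow> real"
  assumes psi_mult: "\<And>g h. g \<in> carrier G \<Longrightarrow> h \<in> carrier G \<Longrightarrow> \<psi> (g \<otimes> h) = \<psi> g + \<psi> h"
begin

abbreviation "N \<equiv> carrier (novikov_ring G \<psi>)"
abbreviation "R \<equiv> carrier (group_ring G)"
abbreviation "unit_sum \<equiv> \<one>\<^bsub>group_ring G\<^esub>"

abbreviation conv' (infixl "\<star>" 70) where "a \<star> b \<equiv> conv G a b"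

lemma N_iff: "a \<in> N \<longleftrightarrow> (\<forall>g. a g \<noteq> 0 \<longrightarrow> g \<in> carrier G) \<and> (\<forall>c. finite {g. a g \<noteq> 0 \<and> \<psi> g \<ge> c})"
  by (auto simp: novikov_ring_def formal_sum_ring_def formal_sums_def)

lemma R_iff: "a \<in> R \<longleftrightarrow> (\<forall>g. a g \<noteq> 0 \<longrightarrow> g \<in> carrier G) \<and> finite {g. a g \<noteq> 0}"
  by (auto simp: group_ring_def formal_sum_ring_def formal_sums_def)

lemma unit_sum_eq: "unit_sum = (\<lambda>g. if g = \<one> then 1 else 0)"
  by (simp add: group_ring_def formal_sum_ring_def)

lemma R_subset_N: "R \<subseteq> N"
  unfolding R_iff N_iff subset_iff by (auto elim!: finite_subset [rotated])

lemma N_0 [simp]: "0 \<in> N" and R_0 [simp]: "0 \<in> R"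
  by (simp_all add: N_iff R_iff)

lemma N_diff: "a \<in> N \<Longrightarrow> b \<in> N \<Longrightarrow> a - b \<in> N"
proof -
  assume "a \<in> N" "b \<in> N"
  moreover have "{g. (a - b) g \<noteq> 0 \<and> \<psi> g \<ge> c} \<subseteq> {g. a g \<noteq> 0 \<and> \<psi> g \<ge> c} \<union> {g. b g \<noteq> 0 \<and> \<psi> g \<ge> c}" for c
    by auto
  ultimately show ?thesis
    unfolding N_iff by (metis (no_types, lifting) diff_zero finite_Un finite_subset minus_apply)
qed

lemma R_diff: "a \<in> R \<Longrightarrow> b \<in> R \<Longrightarrow> a - b \<in> R"
proof -
  assume "a \<in> R" "b \<in> R"
  moreover have "{g. (a - b) g \<noteq> 0} \<subseteq> {g. a g \<noteq> 0} \<union> {g. b g \<noteq> 0}"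
    by auto
  ultimately show ?thesis
    unfolding R_iff by (metis (no_types, lifting) diff_zero finite_Un finite_subset minus_apply)
qed

lemma N_uminus: "a \<in> N \<Longrightarrow> - a \<in> N" and R_uminus: "a \<in> R \<Longrightarrow> - a \<in> R"
  using N_diff [OF N_0, of a] R_diff [OF R_0, of a] by simp_all

lemma N_add: "a \<in> N \<Longrightarrow> b \<in> N \<Longrightarrow> a + b \<in> N" and R_add: "a \<in> R \<Longrightarrow> b \<in> R \<Longrightarrow> a + b \<in> R"
  using N_diff [OF _ N_uminus, of a b] R_diff [OF _ R_uminus, of a b] by simp_all

lemma N_sum: "(\<And>i. i \<in> S \<Longrightarrow> f i \<in> N) \<Longrightarrow> sum f S \<in> N"
  by (induction S rule: infinite_finite_induct) (auto intro: N_add)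

lemma R_sum: "(\<And>i. i \<in> S \<Longrightarrow> f i \<in> R) \<Longrightarrow> sum f S \<in> R"
  by (induction S rule: infinite_finite_induct) (auto intro: R_add)

lemma N_bounded:
  assumes "a \<in> N"
  obtains M where "\<And>g. a g \<noteq> 0 \<Longrightarrow> \<psi> g \<le> M"
proof -
  have fin: "finite {g. a g \<noteq> 0 \<and> \<psi> g \<ge> 0}" using assms unfolding N_iff by blast
  have "\<psi> g \<le> Max (insert 0 (\<psi> ` {g. a g \<noteq> 0 \<and> \<psi> g \<ge> 0}))" if "a g \<noteq> 0" for g
  proof (cases "\<psi> g \<ge> 0")
    case True
    then show ?thesis using fin that by (intro Max_ge) auto
  next
    case False
    then have "\<psi> g \<le> 0" by simp
    also have "0 \<le> Max (insert 0 (\<psi> ` {g. a g \<noteq> 0 \<and> \<psi> g \<ge> 0}))" using fin by (intro Max_ge) auto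
    finally show ?thesis .
  qed
  then show ?thesis by (rule that)
qed

lemma psi_inv: "g \<in> carrier G \<Longrightarrow> \<psi> (inv g) = - \<psi> g"
  using psi_mult [of g "inv g"] psi_mult [of \<one> \<one>] by simp

text \<open>The index set in \<open>conv\<close> depends on both factors. This form allows several
  products to be compared over one finite set.\<close>

lemma conv_sum:
  assumes "finite F" "F \<subseteq> carrier G" "g \<in> carrier G"
    and "\<And>h. h \<in> carrier G \<Longrightarrow> a h \<noteq> 0 \<Longrightarrow> b (inv h \<otimes> g) \<noteq> 0 \<Longrightarrow> h \<in> F"
  shows "(a \<star> b) g = (\<Sum>h\<in>F. a h * b (inv h \<otimes> g))"
  unfolding conv_def using assms by (auto intro!: sum.mono_neutral_left)

lemma conv_nonzero:
  assumes "(a \<star> b) g \<noteq> 0"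
  obtains h k where "h \<in> carrier G" "k \<in> carrier G" "g = h \<otimes> k" "a h \<noteq> 0" "b k \<noteq> 0"
proof -
  have g: "g \<in> carrier G" using assms by (auto simp: conv_def split: if_splits)
  have "{h \<in> carrier G. a h \<noteq> 0 \<and> b (inv h \<otimes> g) \<noteq> 0} \<noteq> {}"
  proof
    assume "{h \<in> carrier G. a h \<noteq> 0 \<and> b (inv h \<otimes> g) \<noteq> 0} = {}"
    then have "(a \<star> b) g = 0" unfolding conv_def by (simp only: sum.empty if_cancel)
    with assms show False by simp
  qed
  then obtain h where "h \<in> carrier G" "a h \<noteq> 0" "b (inv h \<otimes> g) \<noteq> 0" by blast
  then show ?thesis using that [of h "inv h \<otimes> g"] g by (simp add: m_assoc [symmetric])
qed

lemma conv_outside: "g \<notin> carrier G \<Longrightarrow> (a \<star> b) g = 0"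
  by (simp add: conv_def)

text \<open>Both supports are bounded above, so a product at level d or higher forces each factor
  above a common level. This makes convolution finite and keeps it in the completion.\<close>

lemma psi_ge:
  assumes "a \<in> N" "b \<in> N"
  obtains c where "\<And>h k. h \<in> carrier G \<Longrightarrow> k \<in> carrier G \<Longrightarrow> a h \<noteq> 0 \<Longrightarrow> b k \<noteq> 0 \<Longrightarrow> \<psi> (h \<otimes> k) \<ge> d \<Longrightarrow> \<psi> h \<ge> c \<and> \<psi> k \<ge> c"
proof -
  obtain Ma where Ma: "\<And>g. a g \<noteq> 0 \<Longrightarrow> \<psi> g \<le> Ma" using N_bounded [OF assms(1)] by metis
  obtain Mb where Mb: "\<And>g. b g \<noteq> 0 \<Longrightarrow> \<psi> g \<le> Mb" using N_bounded [OF assms(2)] by metis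
  show ?thesis
  proof (rule that [of "min (d - Mb) (d - Ma)"])
    fix h k assume *: "h \<in> carrier G" "k \<in> carrier G" "a h \<noteq> 0" "b k \<noteq> 0" "\<psi> (h \<otimes> k) \<ge> d"
    then show "\<psi> h \<ge> min (d - Mb) (d - Ma) \<and> \<psi> k \<ge> min (d - Mb) (d - Ma)"
      using Ma [OF *(3)] Mb [OF *(4)] psi_mult [OF *(1,2)] by linarith
  qed
qed

lemma conv_N:
  assumes a: "a \<in> N" and b: "b \<in> N" shows "a \<star> b \<in> N"
  unfolding N_iff
proof (intro conjI allI impI)
  show "g \<in> carrier G" if "(a \<star> b) g \<noteq> 0" for g using that conv_outside by blast
  fix d
  obtain c where c: "\<And>h k. h \<in> carrier G \<Longrightarrow> k \<in> carrier G \<Longrightarrow> a h \<noteq> 0 \<Longrightarrow> b k \<noteq> 0 \<Longrightarrow> \<psi> (h \<otimes> k) \<ge> d \<Longrightarrow> \<psi> h \<ge> c \<and> \<psi> k \<ge> c"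
    using psi_ge [OF a b] by metis
  let ?A = "{g. a g \<noteq> 0 \<and> \<psi> g \<ge> c}" and ?B = "{g. b g \<noteq> 0 \<and> \<psi> g \<ge> c}"
  have "finite ?A" "finite ?B" using a b unfolding N_iff by blast+
  moreover have "{g. (a \<star> b) g \<noteq> 0 \<and> \<psi> g \<ge> d} \<subseteq> (\<lambda>(h, k). h \<otimes> k) ` (?A \<times> ?B)"
  proof
    fix g assume g: "g \<in> {g. (a \<star> b) g \<noteq> 0 \<and> \<psi> g \<ge> d}"
    then obtain h k where "h \<in> carrier G" "k \<in> carrier G" "g = h \<otimes> k" "a h \<noteq> 0" "b k \<noteq> 0"
      using conv_nonzero by blast
    with g c show "g \<in> (\<lambda>(h, k). h \<otimes> k) ` (?A \<times> ?B)" by force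
  qed
  ultimately show "finite {g. (a \<star> b) g \<noteq> 0 \<and> \<psi> g \<ge> d}"
    by (meson finite_SigmaI finite_imageI finite_subset)
qed

lemma conv_R:
  assumes a: "a \<in> R" and b: "b \<in> R" shows "a \<star> b \<in> R"
  unfolding R_iff
proof (intro conjI allI impI)
  show "g \<in> carrier G" if "(a \<star> b) g \<noteq> 0" for g using that conv_outside by blast
  have "{g. (a \<star> b) g \<noteq> 0} \<subseteq> (\<lambda>(h, k). h \<otimes> k) ` ({g. a g \<noteq> 0} \<times> {g. b g \<noteq> 0})"
    using conv_nonzero by (force elim: conv_nonzero)
  then show "finite {g. (a \<star> b) g \<noteq> 0}"
    using a b unfolding R_iff by (meson finite_SigmaI finite_imageI finite_subset)
qed

text \<open>Guarantees that the sum in \<open>conv\<close> is a genuine one; over an infinite set it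
  would default to 0.\<close>

lemma conv_finite_left:
  assumes a: "a \<in> N" and b: "b \<in> N" and g: "g \<in> carrier G"
  shows "finite {h \<in> carrier G. a h \<noteq> 0 \<and> b (inv h \<otimes> g) \<noteq> 0}"
proof -
  obtain c where c: "\<And>h k. h \<in> carrier G \<Longrightarrow> k \<in> carrier G \<Longrightarrow> a h \<noteq> 0 \<Longrightarrow> b k \<noteq> 0 \<Longrightarrow> \<psi> (h \<otimes> k) \<ge> \<psi> g \<Longrightarrow> \<psi> h \<ge> c \<and> \<psi> k \<ge> c"
    using psi_ge [OF a b] by metis
  have "\<psi> h \<ge> c" if "h \<in> carrier G" "a h \<noteq> 0" "b (inv h \<otimes> g) \<noteq> 0" for h
    using c [of h "inv h \<otimes> g"] that g by (simp add: m_assoc [symmetric])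
  then have "{h \<in> carrier G. a h \<noteq> 0 \<and> b (inv h \<otimes> g) \<noteq> 0} \<subseteq> {h. a h \<noteq> 0 \<and> \<psi> h \<ge> c}" by blast
  moreover have "finite {h. a h \<noteq> 0 \<and> \<psi> h \<ge> c}" using a unfolding N_iff by blast
  ultimately show ?thesis by (rule finite_subset)
qed

lemma conv_diff_left:
  assumes a: "a \<in> N" "a' \<in> N" and b: "b \<in> N" shows "(a - a') \<star> b = a \<star> b - a' \<star> b"
proof
  fix g
  show "((a - a') \<star> b) g = (a \<star> b - a' \<star> b) g"
  proof (cases "g \<in> carrier G")
    case True
    let ?F = "{h \<in> carrier G. a h \<noteq> 0 \<and> b (inv h \<otimes> g) \<noteq> 0} \<union> {h \<in> carrier G. a' h \<noteq> 0 \<and> b (inv h \<otimes> g) \<noteq> 0}"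
    have F: "finite ?F" "?F \<subseteq> carrier G" using conv_finite_left [OF _ b True] a by auto
    have "((a - a') \<star> b) g = (\<Sum>h\<in>?F. (a - a') h * b (inv h \<otimes> g))"
      "(a \<star> b) g = (\<Sum>h\<in>?F. a h * b (inv h \<otimes> g))" "(a' \<star> b) g = (\<Sum>h\<in>?F. a' h * b (inv h \<otimes> g))"
      by (rule conv_sum [OF F True]; auto)+
    then show ?thesis by (simp add: algebra_simps sum_subtractf)
  qed (simp add: conv_outside)
qed

lemma conv_diff_right:
  assumes a: "a \<in> N" and b: "b \<in> N" "b' \<in> N" shows "a \<star> (b - b') = a \<star> b - a \<star> b'"
proof
  fix g
  show "(a \<star> (b - b')) g = (a \<star> b - a \<star> b') g"
  proof (cases "g \<in> carrier G")
    case True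
    let ?F = "{h \<in> carrier G. a h \<noteq> 0 \<and> b (inv h \<otimes> g) \<noteq> 0} \<union> {h \<in> carrier G. a h \<noteq> 0 \<and> b' (inv h \<otimes> g) \<noteq> 0}"
    have F: "finite ?F" "?F \<subseteq> carrier G" using conv_finite_left [OF a _ True] b by auto
    have "(a \<star> (b - b')) g = (\<Sum>h\<in>?F. a h * (b - b') (inv h \<otimes> g))"
      "(a \<star> b) g = (\<Sum>h\<in>?F. a h * b (inv h \<otimes> g))" "(a \<star> b') g = (\<Sum>h\<in>?F. a h * b' (inv h \<otimes> g))"
      by (rule conv_sum [OF F True]; auto)+
    then show ?thesis by (simp add: algebra_simps sum_subtractf)
  qed (simp add: conv_outside)
qed

lemma conv_zero [simp]: "0 \<star> b = 0" "a \<star> 0 = 0"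
  by (auto simp: conv_def fun_eq_iff)

lemma conv_add_left:
  assumes "a \<in> N" "a' \<in> N" "b \<in> N" shows "(a + a') \<star> b = a \<star> b + a' \<star> b"
  using conv_diff_left [OF assms(1) N_uminus [OF assms(2)] assms(3)] conv_diff_left [OF N_0 assms(2,3)] by simp

lemma conv_add_right:
  assumes "a \<in> N" "b \<in> N" "b' \<in> N" shows "a \<star> (b + b') = a \<star> b + a \<star> b'"
  using conv_diff_right [OF assms(1,2) N_uminus [OF assms(3)]] conv_diff_right [OF assms(1) N_0 assms(3)] by simp

lemma conv_sum_left: "(\<And>i. i \<in> S \<Longrightarrow> f i \<in> N) \<Longrightarrow> b \<in> N \<Longrightarrow> (\<Sum>i\<in>S. f i) \<star> b = (\<Sum>i\<in>S. f i \<star> b)"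
  by (induction S rule: infinite_finite_induct) (auto simp: conv_add_left N_sum)

lemma conv_sum_right: "a \<in> N \<Longrightarrow> (\<And>i. i \<in> S \<Longrightarrow> f i \<in> N) \<Longrightarrow> a \<star> (\<Sum>i\<in>S. f i) = (\<Sum>i\<in>S. a \<star> f i)"
  by (induction S rule: infinite_finite_induct) (auto simp: conv_add_right N_sum)

lemma unit_sum_R: "unit_sum \<in> R"
  by (auto simp: unit_sum_eq R_iff)

lemma conv_unit_left: assumes "a \<in> N" shows "unit_sum \<star> a = a"
proof
  fix g
  show "(unit_sum \<star> a) g = a g"
  proof (cases "g \<in> carrier G")
    case True
    then show ?thesis by (subst conv_sum [of "{\<one>}"]) (auto simp: unit_sum_eq split: if_splits)
  next
    case False
    then show ?thesis using assms unfolding N_iff by (auto simp: conv_outside)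
  qed
qed

lemma conv_unit_right: assumes "a \<in> N" shows "a \<star> unit_sum = a"
proof
  fix g
  show "(a \<star> unit_sum) g = a g"
  proof (cases "g \<in> carrier G")
    case True
    have "h = g" if "h \<in> carrier G" "inv h \<otimes> g = \<one>" for h
      using that True by (metis inv_closed inv_equality inv_inv)
    then show ?thesis
      using True by (subst conv_sum [of "{g}"]) (auto simp: unit_sum_eq split: if_splits)
  next
    case False
    then show ?thesis using assms unfolding N_iff by (auto simp: conv_outside)
  qed
qed

text \<open>Both sides are written as one double sum over a finite rectangle, which must contain
  every contributing pair; then the order of summation is exchanged.\<close>

lemma conv_assoc:
  assumes a: "a \<in> N" and b: "b \<in> N" and c: "c \<in> N"
  shows "(a \<star> b) \<star> c = a \<star> (b \<star> c)"
proof
  fix g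
  show "((a \<star> b) \<star> c) g = (a \<star> (b \<star> c)) g"
  proof (cases "g \<in> carrier G")
    case g: True
    obtain Ma where Ma: "\<And>g. a g \<noteq> 0 \<Longrightarrow> \<psi> g \<le> Ma" using N_bounded [OF a] by metis
    obtain Mb where Mb: "\<And>g. b g \<noteq> 0 \<Longrightarrow> \<psi> g \<le> Mb" using N_bounded [OF b] by metis
    obtain Mc where Mc: "\<And>g. c g \<noteq> 0 \<Longrightarrow> \<psi> g \<le> Mc" using N_bounded [OF c] by metis
    \<comment> \<open>If g is a product of elements of the supports of \<open>a\<close>,
      \<open>b\<close> and \<open>c\<close>, upper bounds for \<psi> on two of them bound the third
      from below: this gives the levels in \<open>A\<close>, \<open>B\<close> and
      \<open>H\<close>.\<close>
    define A where "A = {k. a k \<noteq> 0 \<and> \<psi> k \<ge> \<psi> g - Mb - Mc}"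
    define H where "H = {h. (a \<star> b) h \<noteq> 0 \<and> \<psi> h \<ge> \<psi> g - Mc}"
    define B where "B = {l. b l \<noteq> 0 \<and> \<psi> l \<ge> \<psi> g - Ma - Mc}"
    have fin: "finite A" "finite B" "finite H" using a b conv_N [OF a b] unfolding N_iff A_def B_def H_def by blast+
    have sub: "A \<subseteq> carrier G" "B \<subseteq> carrier G" "H \<subseteq> carrier G"
      using a b conv_N [OF a b] unfolding N_iff A_def B_def H_def by blast+
    have Hc: "h \<in> H \<union> (\<lambda>(k, l). k \<otimes> l) ` (A \<times> B)"
      if "h \<in> carrier G" "(a \<star> b) h \<noteq> 0" "c (inv h \<otimes> g) \<noteq> 0" for h
      using Mc [OF that(3)] that psi_mult [of "inv h" g] psi_inv [of h] g by (auto simp: H_def)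
    \<comment> \<open>\<open>H\<close> serves the outer product with \<open>c\<close>. The products
      of \<open>A\<close> and \<open>B\<close> are added so that, for k in \<open>A\<close>, the
      translate of \<open>F\<close> by inv k contains all that \<open>b \<star> c\<close>
      needs.\<close>
    define F where "F = H \<union> (\<lambda>(k, l). k \<otimes> l) ` (A \<times> B)"
    have F: "finite F" "F \<subseteq> carrier G"
      using fin sub by (auto simp: F_def)
    have k_in: "k \<in> A \<and> inv k \<otimes> h \<in> B"
      if "k \<in> carrier G" "h \<in> carrier G" "a k \<noteq> 0" "b (inv k \<otimes> h) \<noteq> 0" "c (inv h \<otimes> g) \<noteq> 0" for k h
      using Ma [OF that(3)] Mb [OF that(4)] Mc [OF that(5)] that g psi_mult [of "inv k" h] psi_mult [of "inv h" g] psi_inv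
      by (auto simp: A_def B_def)
    have "((a \<star> b) \<star> c) g = (\<Sum>h\<in>F. (a \<star> b) h * c (inv h \<otimes> g))"
      by (rule conv_sum [OF F g]) (use Hc in \<open>auto simp: F_def\<close>)
    also have "\<dots> = (\<Sum>h\<in>F. \<Sum>k\<in>A. a k * (b (inv k \<otimes> h) * c (inv h \<otimes> g)))"
    proof (intro sum.cong refl)
      fix h assume "h \<in> F"
      then have h: "h \<in> carrier G" using F by blast
      show "(a \<star> b) h * c (inv h \<otimes> g) = (\<Sum>k\<in>A. a k * (b (inv k \<otimes> h) * c (inv h \<otimes> g)))"
      proof (cases "c (inv h \<otimes> g) = 0")
        case False
        have "(a \<star> b) h = (\<Sum>k\<in>A. a k * b (inv k \<otimes> h))"
          using k_in [OF _ h _ _ False] by (intro conv_sum [OF fin(1) sub(1) h]) blast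
        then show ?thesis by (simp add: sum_distrib_right mult.assoc)
      qed simp
    qed
    also have "\<dots> = (\<Sum>k\<in>A. \<Sum>h\<in>F. a k * (b (inv k \<otimes> h) * c (inv h \<otimes> g)))"
      by (rule sum.swap)
    also have "\<dots> = (\<Sum>k\<in>A. a k * (b \<star> c) (inv k \<otimes> g))"
    proof (intro sum.cong refl)
      fix k assume k: "k \<in> A"
      then have kG: "k \<in> carrier G" and ak: "a k \<noteq> 0" using sub by (auto simp: A_def)
      let ?kF = "(\<lambda>h. inv k \<otimes> h) ` F"
      have inj: "inj_on (\<lambda>h. inv k \<otimes> h) F"
        using F(2) kG by (auto simp: inj_on_def subset_iff)
      have "l \<in> ?kF" if l: "l \<in> carrier G" "b l \<noteq> 0" "c (inv l \<otimes> (inv k \<otimes> g)) \<noteq> 0" for l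
      proof -
        have *: "inv k \<otimes> (k \<otimes> l) = l" using kG l by (simp add: m_assoc [symmetric])
        have "inv (k \<otimes> l) \<otimes> g = inv l \<otimes> (inv k \<otimes> g)"
          using kG l g by (simp add: inv_mult_group m_assoc)
        then have "l \<in> B" using k_in [of k "k \<otimes> l"] kG l ak * by auto
        then have "k \<otimes> l \<in> F" using k by (auto simp: F_def)
        then show ?thesis using * by (metis imageI)
      qed
      then have "(b \<star> c) (inv k \<otimes> g) = (\<Sum>l\<in>?kF. b l * c (inv l \<otimes> (inv k \<otimes> g)))"
        using F kG g by (intro conv_sum) auto
      also have "\<dots> = (\<Sum>h\<in>F. b (inv k \<otimes> h) * c (inv (inv k \<otimes> h) \<otimes> (inv k \<otimes> g)))"
        by (simp add: sum.reindex [OF inj])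
      also have "\<dots> = (\<Sum>h\<in>F. b (inv k \<otimes> h) * c (inv h \<otimes> g))"
      proof (intro sum.cong refl)
        fix h assume "h \<in> F"
        then have h: "h \<in> carrier G" using F by blast
        have "inv (inv k \<otimes> h) \<otimes> (inv k \<otimes> g) = inv h \<otimes> (k \<otimes> (inv k \<otimes> g))"
          using kG h g by (simp add: inv_mult_group m_assoc)
        also have "k \<otimes> (inv k \<otimes> g) = g"
          using kG g by (simp add: m_assoc [symmetric])
        finally show "b (inv k \<otimes> h) * c (inv (inv k \<otimes> h) \<otimes> (inv k \<otimes> g)) = b (inv k \<otimes> h) * c (inv h \<otimes> g)"
          by simp
      qed
      finally show "(\<Sum>h\<in>F. a k * (b (inv k \<otimes> h) * c (inv h \<otimes> g))) = a k * (b \<star> c) (inv k \<otimes> g)"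
        by (simp add: sum_distrib_left)
    qed
    also have "\<dots> = (a \<star> (b \<star> c)) g"
    proof (rule conv_sum [OF fin(1) sub(1) g, symmetric])
      fix k assume k: "k \<in> carrier G" "a k \<noteq> 0" "(b \<star> c) (inv k \<otimes> g) \<noteq> 0"
      obtain l m where lm: "l \<in> carrier G" "m \<in> carrier G" "inv k \<otimes> g = l \<otimes> m" "b l \<noteq> 0" "c m \<noteq> 0"
        using conv_nonzero [OF k(3)] by blast
      have "\<psi> g - \<psi> k = \<psi> l + \<psi> m"
        using psi_mult [of "inv k" g] psi_mult [OF lm(1,2)] lm(3) k(1) g psi_inv by simp
      then show "k \<in> A" using Mb [OF lm(4)] Mc [OF lm(5)] k(2) by (simp add: A_def)
    qed
    finally show ?thesis .
  qed (simp add: conv_outside)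
qed

end

section \<open>Exactness over the Novikov ring and over the field\<close>

text \<open>The subgroup of rows over the coefficient module that is generated by the rows of
  \<open>M\<close> scaled by coefficients; closure under differences yields sums and
  negatives.\<close>

inductive_set row_span :: "'m set \<Rightarrow> ('m \<Rightarrow> 'r \<Rightarrow> 'm) \<Rightarrow> ('i \<Rightarrow> 'r) set \<Rightarrow> ('i \<Rightarrow> 'm::ab_group_add) set"
  for S act M where
  zero: "(\<lambda>l. 0) \<in> row_span S act M"
| gen: "a \<in> S \<Longrightarrow> m \<in> M \<Longrightarrow> (\<lambda>l. act a (m l)) \<in> row_span S act M"
| diff: "x \<in> row_span S act M \<Longrightarrow> y \<in> row_span S act M \<Longrightarrow> (\<lambda>l. x l - y l) \<in> row_span S act M"

lemma row_span_add:
  assumes "x \<in> row_span S act M" "y \<in> row_span S act M"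
  shows "(\<lambda>l. x l + y l) \<in> row_span S act M"
  using row_span.diff [OF assms(1) row_span.diff [OF row_span.zero assms(2)]] by simp

lemma row_span_sum:
  "(\<And>j. j \<in> J \<Longrightarrow> x j \<in> row_span S act M) \<Longrightarrow> (\<lambda>l. \<Sum>j\<in>J. x j l) \<in> row_span S act M"
  by (induction J rule: infinite_finite_induct) (auto intro: row_span.zero row_span_add)

text \<open>Vanishing of homology in coordinates: \<open>a\<close> ranges over the cycles, and
  \<open>M\<close> supplies the boundaries without mention of a basis in the degree above.\<close>

definition exact_at :: "'m::ab_group_add set \<Rightarrow> ('m \<Rightarrow> 'r \<Rightarrow> 'm) \<Rightarrow> 'i set \<Rightarrow> 'i set \<Rightarrow> ('i \<Rightarrow> 'i \<Rightarrow> 'r) \<Rightarrow> ('i \<Rightarrow> 'r) set \<Rightarrow> bool" where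
  "exact_at S act L L' D M \<longleftrightarrow>
     (\<forall>a. (\<forall>l. a l \<in> S) \<longrightarrow> (\<forall>l. l \<notin> L \<longrightarrow> a l = 0) \<longrightarrow> (\<forall>m\<in>L'. (\<Sum>l\<in>L. act (a l) (D l m)) = 0) \<longrightarrow>
       a \<in> row_span S act M)"

section \<open>Elements of negative support, and truncation\<close>

context novikov
begin

definition negative :: "('g \<Rightarrow> int) set" where
  "negative = {a \<in> N. \<forall>g. a g \<noteq> 0 \<longrightarrow> \<psi> g < 0}"

lemma negative_0: "0 \<in> negative"
  by (simp add: negative_def)

lemma negative_diff: "a \<in> negative \<Longrightarrow> b \<in> negative \<Longrightarrow> a - b \<in> negative"
  unfolding negative_def using N_diff by (auto simp: ; metis)

lemma negative_add: "a \<in> negative \<Longrightarrow> b \<in> negative \<Longrightarrow> a + b \<in> negative"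
  using negative_diff [OF _ negative_diff [OF negative_0], of a b] by simp

lemma negative_sum: "(\<And>i. i \<in> J \<Longrightarrow> f i \<in> negative) \<Longrightarrow> sum f J \<in> negative"
  by (induction J rule: infinite_finite_induct) (auto intro: negative_add simp: negative_0)

lemma negative_conv:
  assumes "a \<in> negative" "b \<in> negative" shows "a \<star> b \<in> negative"
proof -
  have "\<psi> g < 0" if g: "(a \<star> b) g \<noteq> 0" for g
  proof -
    obtain h k where "h \<in> carrier G" "k \<in> carrier G" "g = h \<otimes> k" "a h \<noteq> 0" "b k \<noteq> 0"
      using conv_nonzero [OF g] by blast
    then show ?thesis using assms psi_mult [of h k] by (force simp: negative_def)
  qed
  then show ?thesis using assms conv_N by (simp add: negative_def)
qed

text \<open>Both one-sided products are required: coefficients of boundaries multiply from the left,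
  entries of the homotopy from the right.\<close>

lemma truncation:
  assumes n: "n \<in> N" and Q: "finite Q" "Q \<subseteq> R"
  obtains n' where "n' \<in> R" "\<And>r. r \<in> Q \<Longrightarrow> r \<star> (n - n') \<in> negative" "\<And>r. r \<in> Q \<Longrightarrow> (n - n') \<star> r \<in> negative"
proof -
  have "finite (\<Union>r\<in>Q. \<psi> ` {g. r g \<noteq> 0})" using Q by (auto simp: R_iff)
  then obtain b where b: "\<And>r g. r \<in> Q \<Longrightarrow> r g \<noteq> 0 \<Longrightarrow> \<psi> g \<le> b"
    using Max_ge [of "\<Union>r\<in>Q. \<psi> ` {g. r g \<noteq> 0}"] by (metis (mono_tags, lifting) UN_I imageI mem_Collect_eq)
  \<comment> \<open>On the supports of \<open>Q\<close> the character is at most \<open>b\<close>,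
    so a remainder living strictly below \<open>- b\<close> becomes negative in every
    product.\<close>
  define n' where "n' = (\<lambda>g. if \<psi> g \<ge> - b then n g else 0)"
  have n'R: "n' \<in> R"
    using n unfolding R_iff N_iff n'_def by (auto elim!: finite_subset [rotated])
  have d: "n - n' \<in> N" using n n'R R_subset_N by (auto intro: N_diff)
  have dneg: "\<psi> g < - b" if "(n - n') g \<noteq> 0" for g
    using that by (auto simp: n'_def split: if_splits)
  show ?thesis
  proof (rule that [OF n'R])
    fix r assume r: "r \<in> Q"
    then have rN: "r \<in> N" using Q R_subset_N by auto
    have "\<psi> g < 0" if g: "(r \<star> (n - n')) g \<noteq> 0" for g
    proof -
      obtain h k where *: "h \<in> carrier G" "k \<in> carrier G" "g = h \<otimes> k" "r h \<noteq> 0" "(n - n') k \<noteq> 0"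
        using conv_nonzero [OF g] by blast
      show ?thesis using b [OF r *(4)] dneg [OF *(5)] psi_mult [OF *(1,2)] *(3) by simp
    qed
    then show "r \<star> (n - n') \<in> negative" using conv_N [OF rN d] by (simp add: negative_def)
    have "\<psi> g < 0" if g: "((n - n') \<star> r) g \<noteq> 0" for g
    proof -
      obtain h k where *: "h \<in> carrier G" "k \<in> carrier G" "g = h \<otimes> k" "(n - n') h \<noteq> 0" "r k \<noteq> 0"
        using conv_nonzero [OF g] by blast
      show ?thesis using b [OF r *(5)] dneg [OF *(4)] psi_mult [OF *(1,2)] *(3) by simp
    qed
    then show "(n - n') \<star> r \<in> negative" using conv_N [OF d rN] by (simp add: negative_def)
  qed
qed

end

section \<open>Evaluation of group ring elements at a character\<close>

locale novikov_character = novikov G \<psi> for G :: "('g, 'z) monoid_scheme" (structure) and \<psi> +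
  fixes \<rho> :: "'g \<Rightarrow> 'k::field"
  assumes rho: "\<rho> \<in> hom G unit_group"
begin

abbreviation "ev \<equiv> eval_character \<rho>"

lemma rho_mult: "g \<in> carrier G \<Longrightarrow> h \<in> carrier G \<Longrightarrow> \<rho> (g \<otimes> h) = \<rho> g * \<rho> h"
  using hom_mult [OF rho] by (simp add: unit_group_def)

lemma rho_nonzero: "g \<in> carrier G \<Longrightarrow> \<rho> g \<noteq> 0"
  using hom_in_carrier [OF rho] by (simp add: unit_group_def)

lemma rho_one: "\<rho> \<one> = 1"
  using rho_mult [of \<one> \<one>] rho_nonzero [of \<one>] by simp

lemma ev_superset: "finite F \<Longrightarrow> {g. r g \<noteq> 0} \<subseteq> F \<Longrightarrow> ev r = (\<Sum>g\<in>F. of_int (r g) * \<rho> g)"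
  unfolding eval_character_def by (rule sum.mono_neutral_left) auto

lemma ev_diff:
  assumes "r \<in> R" "s \<in> R" shows "ev (r - s) = ev r - ev s"
proof -
  let ?F = "{g. r g \<noteq> 0} \<union> {g. s g \<noteq> 0}"
  have F: "finite ?F" using assms by (simp add: R_iff)
  have "{g. (r - s) g \<noteq> 0} \<subseteq> ?F" by auto
  then have "ev (r - s) = (\<Sum>g\<in>?F. of_int ((r - s) g) * \<rho> g)" by (rule ev_superset [OF F])
  moreover have "ev r = (\<Sum>g\<in>?F. of_int (r g) * \<rho> g)" by (rule ev_superset [OF F]) auto
  moreover have "ev s = (\<Sum>g\<in>?F. of_int (s g) * \<rho> g)" by (rule ev_superset [OF F]) auto
  ultimately show ?thesis by (simp add: algebra_simps sum_subtractf)
qed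

lemma ev_0: "ev 0 = 0"
  by (simp add: eval_character_def)

lemma ev_add: "r \<in> R \<Longrightarrow> s \<in> R \<Longrightarrow> ev (r + s) = ev r + ev s"
  using ev_diff [OF _ R_uminus, of r s] ev_diff [OF R_0, of s] by (simp add: ev_0)

lemma ev_sum: "(\<And>j. j \<in> J \<Longrightarrow> f j \<in> R) \<Longrightarrow> ev (sum f J) = (\<Sum>j\<in>J. ev (f j))"
  by (induction J rule: infinite_finite_induct) (auto simp: ev_0 ev_add R_sum)

lemma ev_unit: "ev unit_sum = 1"
  by (subst ev_superset [of "{\<one>}"]) (auto simp: unit_sum_eq rho_one)

text \<open>The double sum is reindexed by g = h k; \<open>F\<close> collects all products so that
  one finite set serves for every h.\<close>

lemma ev_conv:
  assumes r: "r \<in> R" and s: "s \<in> R" shows "ev (r \<star> s) = ev r * ev s"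
proof -
  let ?A = "{g. r g \<noteq> 0}" and ?B = "{g. s g \<noteq> 0}"
  have fin: "finite ?A" "finite ?B" and sub: "?A \<subseteq> carrier G" "?B \<subseteq> carrier G"
    using r s by (auto simp: R_iff)
  define F where "F = (\<lambda>(h, k). h \<otimes> k) ` (?A \<times> ?B)"
  have F: "finite F" "F \<subseteq> carrier G" using fin sub by (auto simp: F_def)
  have "{g. (r \<star> s) g \<noteq> 0} \<subseteq> F"
    unfolding F_def by (force elim: conv_nonzero)
  then have "ev (r \<star> s) = (\<Sum>g\<in>F. of_int ((r \<star> s) g) * \<rho> g)" by (rule ev_superset [OF F(1)])
  also have "\<dots> = (\<Sum>g\<in>F. \<Sum>h\<in>?A. of_int (r h) * (of_int (s (inv h \<otimes> g)) * \<rho> g))"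
  proof (intro sum.cong refl)
    fix g assume "g \<in> F"
    then have "(r \<star> s) g = (\<Sum>h\<in>?A. r h * s (inv h \<otimes> g))"
      using F sub by (intro conv_sum fin) auto
    then show "of_int ((r \<star> s) g) * \<rho> g = (\<Sum>h\<in>?A. of_int (r h) * (of_int (s (inv h \<otimes> g)) * \<rho> g))"
      by (simp add: sum_distrib_right mult.assoc)
  qed
  also have "\<dots> = (\<Sum>h\<in>?A. \<Sum>g\<in>F. of_int (r h) * (of_int (s (inv h \<otimes> g)) * \<rho> g))"
    by (rule sum.swap)
  also have "\<dots> = (\<Sum>h\<in>?A. of_int (r h) * \<rho> h * ev s)"
  proof (intro sum.cong refl)
    fix h assume h: "h \<in> ?A"
    then have hG: "h \<in> carrier G" using sub by blast
    have inj: "inj_on (\<lambda>k. h \<otimes> k) ?B" using hG sub by (auto simp: inj_on_def subset_iff)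
    have im: "(\<lambda>k. h \<otimes> k) ` ?B \<subseteq> F" using h by (auto simp: F_def)
    have "(\<Sum>g\<in>F. of_int (r h) * (of_int (s (inv h \<otimes> g)) * \<rho> g))
      = (\<Sum>g\<in>(\<lambda>k. h \<otimes> k) ` ?B. of_int (r h) * (of_int (s (inv h \<otimes> g)) * \<rho> g))"
    proof (rule sum.mono_neutral_right [OF F(1) im], intro ballI)
      fix g assume g: "g \<in> F - (\<lambda>k. h \<otimes> k) ` ?B"
      then have "g = h \<otimes> (inv h \<otimes> g)" using hG F by (auto simp: m_assoc [symmetric])
      then have "inv h \<otimes> g \<notin> ?B" using g by blast
      then show "of_int (r h) * (of_int (s (inv h \<otimes> g)) * \<rho> g) = 0" by simp
    qed
    also have "\<dots> = (\<Sum>k\<in>?B. of_int (r h) * (of_int (s (inv h \<otimes> (h \<otimes> k))) * \<rho> (h \<otimes> k)))"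
      by (simp add: sum.reindex [OF inj])
    also have "\<dots> = (\<Sum>k\<in>?B. of_int (r h) * \<rho> h * (of_int (s k) * \<rho> k))"
    proof (intro sum.cong refl)
      fix k assume "k \<in> ?B"
      then have "k \<in> carrier G" using sub by blast
      then show "of_int (r h) * (of_int (s (inv h \<otimes> (h \<otimes> k))) * \<rho> (h \<otimes> k)) = of_int (r h) * \<rho> h * (of_int (s k) * \<rho> k)"
        using hG by (simp add: m_assoc [symmetric] rho_mult)
    qed
    finally show "(\<Sum>g\<in>F. of_int (r h) * (of_int (s (inv h \<otimes> g)) * \<rho> g)) = of_int (r h) * \<rho> h * ev s"
      by (simp add: sum_distrib_left eval_character_def)
  qed
  finally show ?thesis by (simp add: eval_character_def [of \<rho> r] sum_distrib_right)
qed

end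

text \<open>\<open>L i\<close> is a basis of the chain module in degree \<open>i\<close>, \<open>L' i\<close> one in degree \<open>i - 1\<close>, \<open>D i\<close> is
  the matrix of the boundary map, acting on row vectors from the right, and \<open>M i\<close> is the module of
  boundaries in degree \<open>i\<close>.\<close>

locale free_complex = novikov_character G \<psi> \<rho>
  for G :: "('g, 'z) monoid_scheme" (structure) and \<psi> and \<rho> :: "'g \<Rightarrow> 'k::field" +
  fixes q :: nat and L L' :: "nat \<Rightarrow> 'i set" and D :: "nat \<Rightarrow> 'i \<Rightarrow> 'i \<Rightarrow> 'g \<Rightarrow> int"
    and M :: "nat \<Rightarrow> ('i \<Rightarrow> 'g \<Rightarrow> int) set"
  assumes fin: "\<And>i. i \<le> q \<Longrightarrow> finite (L i)"
    and L'_0: "L' 0 = {}" and L'_Suc: "\<And>i. L' (Suc i) = L i"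
    and D_R: "\<And>i l m. i \<le> q \<Longrightarrow> l \<in> L i \<Longrightarrow> m \<in> L' i \<Longrightarrow> D i l m \<in> R"
    and M_R: "\<And>i \<mu> l. i \<le> q \<Longrightarrow> \<mu> \<in> M i \<Longrightarrow> \<mu> l \<in> R"
    and M_support: "\<And>i \<mu> l. i \<le> q \<Longrightarrow> \<mu> \<in> M i \<Longrightarrow> l \<notin> L i \<Longrightarrow> \<mu> l = 0"
    and M_0: "\<And>i. i \<le> q \<Longrightarrow> (\<lambda>l. 0) \<in> M i"
    and M_diff: "\<And>i \<mu> \<nu>. i \<le> q \<Longrightarrow> \<mu> \<in> M i \<Longrightarrow> \<nu> \<in> M i \<Longrightarrow> (\<lambda>l. \<mu> l - \<nu> l) \<in> M i"
    and M_act: "\<And>i \<mu> r. i \<le> q \<Longrightarrow> \<mu> \<in> M i \<Longrightarrow> r \<in> R \<Longrightarrow> (\<lambda>l. r \<star> \<mu> l) \<in> M i"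
    and M_D: "\<And>i \<mu> m. i \<le> q \<Longrightarrow> \<mu> \<in> M i \<Longrightarrow> m \<in> L' i \<Longrightarrow> (\<Sum>l\<in>L i. \<mu> l \<star> D i l m) = 0"
    and D_in_M: "\<And>i j. i < q \<Longrightarrow> j \<in> L (Suc i) \<Longrightarrow> D (Suc i) j \<in> M i"
    and M_span: "\<And>i \<mu>. i < q \<Longrightarrow> \<mu> \<in> M i \<Longrightarrow>
        \<exists>r. (\<forall>j. r j \<in> R) \<and> (\<forall>l\<in>L i. \<mu> l = (\<Sum>j\<in>L (Suc i). r j \<star> D (Suc i) j l))"
    and exact: "\<And>i. i \<le> q \<Longrightarrow> exact_at N (conv G) (L i) (L' i) (D i) (M i)"
begin

text \<open>Ring elements are functions, and equations between them are to be kept whole instead of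
  being evaluated at a group element.\<close>

declare zero_fun_apply [simp del] plus_fun_apply [simp del] minus_apply [simp del]

lemma D_N: "i \<le> q \<Longrightarrow> l \<in> L i \<Longrightarrow> m \<in> L' i \<Longrightarrow> D i l m \<in> N"
  using D_R R_subset_N by blast

lemma M_N: "i \<le> q \<Longrightarrow> \<mu> \<in> M i \<Longrightarrow> \<mu> l \<in> N"
  using M_R R_subset_N by blast

lemma unit_N: "unit_sum \<in> N"
  using unit_sum_R R_subset_N by blast

text \<open>\<open>residue i S l\<close> is row l of the matrix 1 - D S in degree i.\<close>

definition residue :: "nat \<Rightarrow> ('i \<Rightarrow> 'i \<Rightarrow> 'g \<Rightarrow> int) \<Rightarrow> 'i \<Rightarrow> 'i \<Rightarrow> 'g \<Rightarrow> int" where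
  "residue i S l l' = (if l' = l then unit_sum else 0) - (\<Sum>m\<in>L' i. D i l m \<star> S m l')"

text \<open>Below degree q, a combination of boundaries over the completion is a combination of rows
  of the next matrix. Its coefficients become the next stage of the homotopy.\<close>

lemma row_span_rows:
  assumes i: "i < q" and x: "x \<in> row_span N (conv G) (M i)"
  shows "\<exists>n. (\<forall>j. n j \<in> N) \<and> (\<forall>l\<in>L i. x l = (\<Sum>j\<in>L (Suc i). n j \<star> D (Suc i) j l))"
  using x
proof induction
  case zero
  show ?case by (rule exI [of _ "\<lambda>j. 0"]) simp
next
  case (gen a \<mu>)
  obtain r where r: "\<And>j. r j \<in> R" "\<And>l. l \<in> L i \<Longrightarrow> \<mu> l = (\<Sum>j\<in>L (Suc i). r j \<star> D (Suc i) j l)"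
    using M_span [OF i gen(2)] by blast
  have rN: "r j \<in> N" for j using r(1) R_subset_N by blast
  have DN: "D (Suc i) j l \<in> N" if "j \<in> L (Suc i)" "l \<in> L i" for j l
    using D_N [of "Suc i" j l] that i L'_Suc by simp
  have "a \<star> \<mu> l = (\<Sum>j\<in>L (Suc i). (a \<star> r j) \<star> D (Suc i) j l)" if l: "l \<in> L i" for l
  proof -
    have "a \<star> \<mu> l = (\<Sum>j\<in>L (Suc i). a \<star> (r j \<star> D (Suc i) j l))"
      unfolding r(2) [OF l] using gen(1) rN DN l by (intro conv_sum_right conv_N) auto
    also have "\<dots> = (\<Sum>j\<in>L (Suc i). (a \<star> r j) \<star> D (Suc i) j l)"
      using gen(1) rN DN l by (intro sum.cong refl conv_assoc [symmetric]) auto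
    finally show ?thesis .
  qed
  then show ?case using gen(1) rN conv_N by (intro exI [of _ "\<lambda>j. a \<star> r j"]) auto
next
  case (diff x y)
  then obtain n n' where n: "\<And>j. n j \<in> N" "\<And>l. l \<in> L i \<Longrightarrow> x l = (\<Sum>j\<in>L (Suc i). n j \<star> D (Suc i) j l)"
    and n': "\<And>j. n' j \<in> N" "\<And>l. l \<in> L i \<Longrightarrow> y l = (\<Sum>j\<in>L (Suc i). n' j \<star> D (Suc i) j l)"
    by blast
  have DN: "D (Suc i) j l \<in> N" if "j \<in> L (Suc i)" "l \<in> L i" for j l
    using D_N [of "Suc i" j l] that i L'_Suc by simp
  have "x l - y l = (\<Sum>j\<in>L (Suc i). (n j - n' j) \<star> D (Suc i) j l)" if l: "l \<in> L i" for l
    unfolding n(2) [OF l] n'(2) [OF l] sum_subtractf [symmetric]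
    using n(1) n'(1) DN l by (intro sum.cong refl conv_diff_left [symmetric]) auto
  then show ?case using n(1) n'(1) N_diff by (intro exI [of _ "\<lambda>j. n j - n' j"]) auto
qed

lemma residue_N:
  assumes "i \<le> q" "l \<in> L i" "\<And>m l'. S m l' \<in> N"
  shows "residue i S l l' \<in> N"
  unfolding residue_def using assms by (intro N_diff N_sum conv_N D_N) (auto simp: unit_N)

text \<open>A contracting homotopy over the Novikov ring, one degree at a time.\<close>

lemma contraction:
  assumes "i \<le> q"
  shows "\<exists>S. (\<forall>m l. S m l \<in> N) \<and> (\<forall>m l. l \<notin> L i \<longrightarrow> S m l = 0) \<and>
    (\<forall>l\<in>L i. residue i S l \<in> row_span N (conv G) (M i))"
  using assms
proof (induction i)
  case 0
  \<comment> \<open>In degree 0 every row is a cycle, in particular each row of the unit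
    matrix.\<close>
  have "residue 0 (\<lambda>m l. 0) l \<in> row_span N (conv G) (M 0)" if l: "l \<in> L 0" for l
  proof -
    have "residue 0 (\<lambda>m l. 0) l l' = (if l' = l then unit_sum else 0)" for l'
      by (simp add: residue_def L'_0)
    then have "\<forall>l'. residue 0 (\<lambda>m l. 0) l l' \<in> N" "\<forall>l'. l' \<notin> L 0 \<longrightarrow> residue 0 (\<lambda>m l. 0) l l' = 0"
      using l unit_N by auto
    then show ?thesis
      using exact [of 0] unfolding exact_at_def L'_0 by simp
  qed
  then show ?case by (intro exI [of _ "\<lambda>m l. 0"]) simp
next
  case (Suc i)
  then have "i \<le> q" by simp
  then obtain S where S: "\<And>m l. S m l \<in> N" "\<And>m l. l \<notin> L i \<Longrightarrow> S m l = 0"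
    "\<And>l. l \<in> L i \<Longrightarrow> residue i S l \<in> row_span N (conv G) (M i)"
    using Suc.IH by blast
  have i: "i < q" "i \<le> q" using Suc.prems by auto
  have "\<exists>n. (\<forall>j. n j \<in> N) \<and> (\<forall>l'\<in>L i. residue i S l l' = (\<Sum>j\<in>L (Suc i). n j \<star> D (Suc i) j l'))" if "l \<in> L i" for l
    by (rule row_span_rows [OF i(1) S(3) [OF that]])
  then obtain n where n: "\<And>l j. l \<in> L i \<Longrightarrow> n l j \<in> N"
    "\<And>l l'. l \<in> L i \<Longrightarrow> l' \<in> L i \<Longrightarrow> residue i S l l' = (\<Sum>j\<in>L (Suc i). n l j \<star> D (Suc i) j l')"
    by metis
  \<comment> \<open>Chosen so that S' D = 1 - D S, with D on the left side the matrix one degree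
    higher.\<close>
  define S' where "S' = (\<lambda>l j. if l \<in> L i \<and> j \<in> L (Suc i) then n l j else 0)"
  have S'N: "S' l j \<in> N" for l j using n(1) by (auto simp: S'_def)
  have DN: "D (Suc i) j l \<in> N" if "j \<in> L (Suc i)" "l \<in> L i" for j l
    using D_N [of "Suc i" j l] that Suc.prems L'_Suc by simp
  have "residue (Suc i) S' j \<in> row_span N (conv G) (M (Suc i))" if j: "j \<in> L (Suc i)" for j
  proof -
    \<comment> \<open>The rows of 1 - D S' are cycles: (1 - D S') D = D - D (1 - D S) = (D D) S = 0,
      after which exactness in degree \<open>Suc i\<close> applies.\<close>
    have "(\<Sum>j'\<in>L (Suc i). residue (Suc i) S' j j' \<star> D (Suc i) j' l') = 0" if l': "l' \<in> L i" for l'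
    proof -
      have SN: "(\<Sum>m\<in>L i. D (Suc i) j m \<star> S' m j') \<in> N" for j'
        using DN [OF j] S'N by (intro N_sum conv_N) auto
      have "residue (Suc i) S' j j' \<star> D (Suc i) j' l'
        = (if j' = j then D (Suc i) j l' else 0) - (\<Sum>m\<in>L i. D (Suc i) j m \<star> (S' m j' \<star> D (Suc i) j' l'))"
        if j': "j' \<in> L (Suc i)" for j'
      proof -
        have "residue (Suc i) S' j j' \<star> D (Suc i) j' l'
          = (if j' = j then unit_sum else 0) \<star> D (Suc i) j' l' - (\<Sum>m\<in>L i. D (Suc i) j m \<star> S' m j') \<star> D (Suc i) j' l'"
          unfolding residue_def L'_Suc
          by (rule conv_diff_left) (use SN DN [OF j' l'] unit_N in auto)
        also have "(if j' = j then unit_sum else 0) \<star> D (Suc i) j' l' = (if j' = j then D (Suc i) j l' else 0)"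
          using conv_unit_left [OF DN [OF j' l']] by auto
        also have "(\<Sum>m\<in>L i. D (Suc i) j m \<star> S' m j') \<star> D (Suc i) j' l' = (\<Sum>m\<in>L i. (D (Suc i) j m \<star> S' m j') \<star> D (Suc i) j' l')"
          using DN [OF j] DN [OF j' l'] S'N by (intro conv_sum_left conv_N) auto
        also have "\<dots> = (\<Sum>m\<in>L i. D (Suc i) j m \<star> (S' m j' \<star> D (Suc i) j' l'))"
          using DN [OF j] DN [OF j' l'] S'N by (intro sum.cong refl conv_assoc) auto
        finally show ?thesis .
      qed
      then have "(\<Sum>j'\<in>L (Suc i). residue (Suc i) S' j j' \<star> D (Suc i) j' l')
        = (\<Sum>j'\<in>L (Suc i). (if j' = j then D (Suc i) j l' else 0)) - (\<Sum>j'\<in>L (Suc i). \<Sum>m\<in>L i. D (Suc i) j m \<star> (S' m j' \<star> D (Suc i) j' l'))"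
        by (simp add: sum_subtractf)
      also have "(\<Sum>j'\<in>L (Suc i). (if j' = j then D (Suc i) j l' else 0)) = D (Suc i) j l'"
        using fin [OF Suc.prems] j by simp
      also have "(\<Sum>j'\<in>L (Suc i). \<Sum>m\<in>L i. D (Suc i) j m \<star> (S' m j' \<star> D (Suc i) j' l'))
        = (\<Sum>m\<in>L i. \<Sum>j'\<in>L (Suc i). D (Suc i) j m \<star> (S' m j' \<star> D (Suc i) j' l'))"
        by (rule sum.swap)
      also have "\<dots> = (\<Sum>m\<in>L i. D (Suc i) j m \<star> residue i S m l')"
      proof (intro sum.cong refl)
        fix m assume m: "m \<in> L i"
        have "(\<Sum>j'\<in>L (Suc i). D (Suc i) j m \<star> (S' m j' \<star> D (Suc i) j' l')) = D (Suc i) j m \<star> (\<Sum>j'\<in>L (Suc i). S' m j' \<star> D (Suc i) j' l')"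
          using DN [OF j m] DN [OF _ l'] S'N by (intro conv_sum_right [symmetric] conv_N) auto
        also have "(\<Sum>j'\<in>L (Suc i). S' m j' \<star> D (Suc i) j' l') = residue i S m l'"
          unfolding n(2) [OF m l'] using m by (intro sum.cong) (auto simp: S'_def)
        finally show "(\<Sum>j'\<in>L (Suc i). D (Suc i) j m \<star> (S' m j' \<star> D (Suc i) j' l')) = D (Suc i) j m \<star> residue i S m l'" .
      qed
      also have "\<dots> = (\<Sum>m\<in>L i. (if l' = m then D (Suc i) j m else 0) - (\<Sum>m'\<in>L' i. (D (Suc i) j m \<star> D i m m') \<star> S m' l'))"
      proof (intro sum.cong refl)
        fix m assume m: "m \<in> L i"
        have "D (Suc i) j m \<star> residue i S m l' = D (Suc i) j m \<star> (if l' = m then unit_sum else 0) - D (Suc i) j m \<star> (\<Sum>m'\<in>L' i. D i m m' \<star> S m' l')"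
          unfolding residue_def using DN [OF j m] D_N [OF i(2) m] S(1) unit_N
          by (intro conv_diff_right N_sum conv_N) auto
        also have "D (Suc i) j m \<star> (if l' = m then unit_sum else 0) = (if l' = m then D (Suc i) j m else 0)"
          using conv_unit_right [OF DN [OF j m]] by auto
        also have "D (Suc i) j m \<star> (\<Sum>m'\<in>L' i. D i m m' \<star> S m' l') = (\<Sum>m'\<in>L' i. D (Suc i) j m \<star> (D i m m' \<star> S m' l'))"
          using DN [OF j m] D_N [OF i(2) m] S(1) by (intro conv_sum_right conv_N) auto
        also have "\<dots> = (\<Sum>m'\<in>L' i. (D (Suc i) j m \<star> D i m m') \<star> S m' l')"
          using DN [OF j m] D_N [OF i(2) m] S(1) by (intro sum.cong refl conv_assoc [symmetric]) auto
        finally show "D (Suc i) j m \<star> residue i S m l' = (if l' = m then D (Suc i) j m else 0) - (\<Sum>m'\<in>L' i. (D (Suc i) j m \<star> D i m m') \<star> S m' l')" .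
      qed
      also have "\<dots> = D (Suc i) j l' - (\<Sum>m\<in>L i. \<Sum>m'\<in>L' i. (D (Suc i) j m \<star> D i m m') \<star> S m' l')"
        using fin [OF i(2)] l' by (simp add: sum_subtractf)
      also have "(\<Sum>m\<in>L i. \<Sum>m'\<in>L' i. (D (Suc i) j m \<star> D i m m') \<star> S m' l')
        = (\<Sum>m'\<in>L' i. \<Sum>m\<in>L i. (D (Suc i) j m \<star> D i m m') \<star> S m' l')"
        by (rule sum.swap)
      also have "\<dots> = (\<Sum>m'\<in>L' i. (\<Sum>m\<in>L i. D (Suc i) j m \<star> D i m m') \<star> S m' l')"
        using DN [OF j] D_N [OF i(2)] S(1) by (intro sum.cong refl conv_sum_left [symmetric] conv_N) auto
      also have "\<dots> = 0"
        using M_D [OF i(2) D_in_M [OF i(1) j]] by simp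
      finally show ?thesis by simp
    qed
    moreover have "residue (Suc i) S' j j' \<in> N" for j'
      using residue_N [OF Suc.prems j S'N] .
    moreover have "residue (Suc i) S' j j' = 0" if "j' \<notin> L (Suc i)" for j'
    proof -
      have "S' m j' = 0" for m using that by (simp add: S'_def)
      then show ?thesis using that j by (auto simp: residue_def)
    qed
    ultimately show ?thesis
      using exact [OF Suc.prems] unfolding exact_at_def L'_Suc by simp
  qed
  moreover have "S' l j = 0" if "j \<notin> L (Suc i)" for l j using that by (simp add: S'_def)
  ultimately show ?case using S'N by (intro exI [of _ S']) auto
qed

text \<open>Each coefficient is cut off so far down that the loss, multiplied by the finitely many
  entries of the boundary row, is negative.\<close>

lemma row_span_truncation:
  assumes i: "i \<le> q" and x: "x \<in> row_span N (conv G) (M i)"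
  shows "\<exists>\<mu>\<in>M i. \<forall>l. x l - \<mu> l \<in> negative"
  using x
proof induction
  case zero
  show ?case using M_0 [OF i] negative_0 by (intro bexI [of _ "\<lambda>l. 0"]) simp_all
next
  case (gen a \<mu>)
  have Q: "finite (\<mu> ` L i)" "\<mu> ` L i \<subseteq> R" using fin [OF i] M_R [OF i gen(2)] by auto
  obtain a' where a': "a' \<in> R" "\<And>r. r \<in> \<mu> ` L i \<Longrightarrow> r \<star> (a - a') \<in> negative" "\<And>r. r \<in> \<mu> ` L i \<Longrightarrow> (a - a') \<star> r \<in> negative"
    by (rule truncation [OF gen(1) Q]) (rule that)
  have "a \<star> \<mu> l - a' \<star> \<mu> l \<in> negative" for l
  proof (cases "l \<in> L i")
    case True
    have "a \<star> \<mu> l - a' \<star> \<mu> l = (a - a') \<star> \<mu> l"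
      using gen(1) a'(1) R_subset_N M_N [OF i gen(2)] by (intro conv_diff_left [symmetric]) auto
    then show ?thesis using a'(3) True by simp
  next
    case False
    then show ?thesis using M_support [OF i gen(2)] negative_0 by simp
  qed
  then show ?case using M_act [OF i gen(2) a'(1)] by (intro bexI [of _ "\<lambda>l. a' \<star> \<mu> l"]) auto
next
  case (diff x y)
  then obtain \<mu> \<nu> where *: "\<mu> \<in> M i" "\<And>l. x l - \<mu> l \<in> negative" "\<nu> \<in> M i" "\<And>l. y l - \<nu> l \<in> negative" by blast
  have "(x l - y l) - (\<mu> l - \<nu> l) \<in> negative" for l
    using negative_diff [OF *(2) [of l] *(4) [of l]] by (simp add: algebra_simps)
  then show ?case using M_diff [OF i *(1,3)] by (intro bexI [of _ "\<lambda>l. \<mu> l - \<nu> l"]) auto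
qed

text \<open>Two truncations are made, one of the homotopy and one of the boundary rows. Each costs a
  negative error, and the sum of the errors lies in the group ring because everything else
  does.\<close>

lemma approximate_contraction:
  assumes i: "i \<le> q"
  obtains S \<mu> where "\<And>m l. S m l \<in> R" "\<And>m l. l \<notin> L i \<Longrightarrow> S m l = 0" "\<And>l. l \<in> L i \<Longrightarrow> \<mu> l \<in> M i"
    "\<And>l l'. l \<in> L i \<Longrightarrow> residue i S l l' - \<mu> l l' \<in> negative \<inter> R"
proof -
  obtain S where S: "\<And>m l. S m l \<in> N" "\<And>m l. l \<notin> L i \<Longrightarrow> S m l = 0"
    "\<And>l. l \<in> L i \<Longrightarrow> residue i S l \<in> row_span N (conv G) (M i)"
    using contraction [OF i] by blast
  obtain \<mu> where \<mu>: "\<And>l. l \<in> L i \<Longrightarrow> \<mu> l \<in> M i" "\<And>l l'. l \<in> L i \<Longrightarrow> residue i S l l' - \<mu> l l' \<in> negative"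
    using row_span_truncation [OF i S(3)] by metis
  \<comment> \<open>An entry in row m of S meets only column m of D, so its cutoff is adapted to
    that column.\<close>
  have "\<exists>s. s \<in> R \<and> (\<forall>l\<in>L i. D i l m \<star> (S m l' - s) \<in> negative)" if m: "m \<in> L' i" for m l'
  proof -
    have Q: "finite ((\<lambda>l. D i l m) ` L i)" "(\<lambda>l. D i l m) ` L i \<subseteq> R"
      using fin [OF i] D_R [OF i _ m] by auto
    obtain s where "s \<in> R" "\<And>r. r \<in> (\<lambda>l. D i l m) ` L i \<Longrightarrow> r \<star> (S m l' - s) \<in> negative"
      by (rule truncation [OF S(1) Q]) (rule that)
    then show ?thesis by blast
  qed
  then obtain s where s: "\<And>m l'. m \<in> L' i \<Longrightarrow> s m l' \<in> R"
    "\<And>m l l'. m \<in> L' i \<Longrightarrow> l \<in> L i \<Longrightarrow> D i l m \<star> (S m l' - s m l') \<in> negative"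
    by metis
  define S' where "S' = (\<lambda>m l. if m \<in> L' i \<and> l \<in> L i then s m l else 0)"
  have S'R: "S' m l \<in> R" for m l using s(1) by (auto simp: S'_def)
  then have S'N: "S' m l \<in> N" for m l using R_subset_N by blast
  have neg: "D i l m \<star> (S m l' - S' m l') \<in> negative" if "l \<in> L i" "m \<in> L' i" for l m l'
    using s(2) [OF that(2,1)] S(2) that negative_0 by (auto simp: S'_def)
  have "residue i S' l l' - \<mu> l l' \<in> negative \<inter> R" if l: "l \<in> L i" for l l'
  proof
    have "residue i S' l l' - \<mu> l l' = (residue i S l l' - \<mu> l l') + ((\<Sum>m\<in>L' i. D i l m \<star> S m l') - (\<Sum>m\<in>L' i. D i l m \<star> S' m l'))"
      by (simp add: residue_def)
    also have "(\<Sum>m\<in>L' i. D i l m \<star> S m l') - (\<Sum>m\<in>L' i. D i l m \<star> S' m l') = (\<Sum>m\<in>L' i. D i l m \<star> (S m l' - S' m l'))"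
      unfolding sum_subtractf [symmetric] using D_N [OF i l] S(1) S'N
      by (intro sum.cong refl conv_diff_right [symmetric]) auto
    finally have "residue i S' l l' - \<mu> l l'
        = (residue i S l l' - \<mu> l l') + (\<Sum>m\<in>L' i. D i l m \<star> (S m l' - S' m l'))" .
    also have "\<dots> \<in> negative"
      using \<mu>(2) [OF l] neg [OF l] by (intro negative_add negative_sum) auto
    finally show "residue i S' l l' - \<mu> l l' \<in> negative" .
    show "residue i S' l l' - \<mu> l l' \<in> R"
      unfolding residue_def using D_R [OF i l] S'R M_R [OF i \<mu>(1) [OF l]] unit_sum_R
      by (intro R_diff R_sum conv_R) auto
  qed
  moreover have "S' m l = 0" if "l \<notin> L i" for m l using that by (simp add: S'_def)
  ultimately show ?thesis using that [of S' \<mu>] S'R \<mu>(1) by blast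
qed

theorem exact_at_field:
  assumes i: "i \<le> q" and no_unit: "\<And>r. r \<in> negative \<inter> R \<Longrightarrow> ev r \<noteq> 1"
  shows "exact_at UNIV (\<lambda>a r. a * ev r) (L i) (L' i) (D i) (M i)"
proof -
  let ?L = "L i" and ?L' = "L' i"
  obtain S \<mu> where S: "\<And>m l. S m l \<in> R" "\<And>m l. l \<notin> ?L \<Longrightarrow> S m l = 0" and \<mu>: "\<And>l. l \<in> ?L \<Longrightarrow> \<mu> l \<in> M i"
    and neg: "\<And>l l'. l \<in> ?L \<Longrightarrow> residue i S l l' - \<mu> l l' \<in> negative \<inter> R"
    by (rule approximate_contraction [OF i]) (rule that)
  define e where "e = (\<lambda>l l'. ev (residue i S l l' - \<mu> l l'))"
  \<comment> \<open>The ring without unit to which \<open>fixed_vector_zero\<close> is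
    applied.\<close>
  define I where "I = ev ` (negative \<inter> R)"
  have e: "e l l' = (if l' = l then 1 else 0) - (\<Sum>m\<in>?L'. ev (D i l m) * ev (S m l')) - ev (\<mu> l l')" if l: "l \<in> ?L" for l l'
  proof -
    have DS: "D i l m \<star> S m l' \<in> R" if "m \<in> ?L'" for m
      using D_R [OF i l that] S(1) by (rule conv_R)
    have "e l l' = ev (if l' = l then unit_sum else 0) - ev (\<Sum>m\<in>?L'. D i l m \<star> S m l') - ev (\<mu> l l')"
      unfolding e_def residue_def using DS unit_sum_R M_R [OF i \<mu> [OF l]]
      by (simp add: ev_diff R_diff R_sum)
    also have "ev (\<Sum>m\<in>?L'. D i l m \<star> S m l') = (\<Sum>m\<in>?L'. ev (D i l m) * ev (S m l'))"
      using DS D_R [OF i l] S(1) by (simp add: ev_sum ev_conv)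
    finally show ?thesis by (simp add: ev_unit ev_0)
  qed
  have e_out: "e l l' = 0" if "l \<in> ?L" "l' \<notin> ?L" for l l'
    using that S(2) M_support [OF i \<mu>] by (auto simp: e ev_0)
  let ?B = "row_span UNIV (\<lambda>a r. a * ev r) (M i)"
  define Z where "Z = {z. (\<forall>l. l \<notin> ?L \<longrightarrow> z l = 0) \<and> (\<forall>m\<in>?L'. (\<Sum>l\<in>?L. z l * ev (D i l m)) = 0)}"
  define T where "T = (\<lambda>z l'. z l' - (\<Sum>l\<in>?L. z l * e l l'))"
  have scale: "(\<lambda>l. c * x l) \<in> ?B" if "x \<in> ?B" for c x
    using that
  proof induction
    case (gen a m)
    have "(\<lambda>l. c * (a * ev (m l))) = (\<lambda>l. (c * a) * ev (m l))" by (simp add: mult.assoc)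
    then show ?case using row_span.gen [of "c * a" UNIV m "M i" "\<lambda>a r. a * ev r"] gen(2) by simp
  next
    case (diff x y)
    then show ?case using row_span.diff by (simp add: right_diff_distrib) 
  qed (simp add: row_span.zero)
  have BZ: "x \<in> Z" if "x \<in> ?B" for x
    using that
  proof induction
    case zero
    show ?case by (simp add: Z_def)
  next
    case (gen a \<nu>)
    have "(\<Sum>l\<in>?L. a * ev (\<nu> l) * ev (D i l m)) = 0" if m: "m \<in> ?L'" for m
    proof -
      have "(\<Sum>l\<in>?L. a * ev (\<nu> l) * ev (D i l m)) = a * ev (\<Sum>l\<in>?L. \<nu> l \<star> D i l m)"
        using M_R [OF i gen(2)] D_R [OF i _ m] by (simp add: ev_sum conv_R ev_conv sum_distrib_left mult.assoc)
      then show ?thesis using M_D [OF i gen(2) m] by (simp add: ev_0)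
    qed
    then show ?case using M_support [OF i gen(2)] by (simp add: Z_def ev_0)
  next
    case (diff x y)
    then show ?case by (simp add: Z_def left_diff_distrib sum_subtractf)
  qed
  have TB: "T z \<in> ?B" if z: "z \<in> Z" for z
  proof -
    \<comment> \<open>Since e = 1 - D S - \<mu>, the row T z equals z D S + z \<mu>, and z D = 0 for
      a cycle z.\<close>
    have "T z l' = (\<Sum>l\<in>?L. z l * ev (\<mu> l l'))" for l'
    proof -
      have "(\<Sum>l\<in>?L. z l * e l l') = (\<Sum>l\<in>?L. (if l' = l then z l else 0) - (\<Sum>m\<in>?L'. z l * ev (D i l m) * ev (S m l')) - z l * ev (\<mu> l l'))"
        by (intro sum.cong refl) (auto simp: e algebra_simps sum_distrib_left)
      also have "\<dots> = (\<Sum>l\<in>?L. (if l' = l then z l else 0)) - (\<Sum>l\<in>?L. \<Sum>m\<in>?L'. z l * ev (D i l m) * ev (S m l')) - (\<Sum>l\<in>?L. z l * ev (\<mu> l l'))"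
        by (simp add: sum_subtractf)
      also have "(\<Sum>l\<in>?L. (if l' = l then z l else 0)) = z l'"
        using fin [OF i] z by (auto simp: Z_def)
      also have "(\<Sum>l\<in>?L. \<Sum>m\<in>?L'. z l * ev (D i l m) * ev (S m l')) = (\<Sum>m\<in>?L'. (\<Sum>l\<in>?L. z l * ev (D i l m)) * ev (S m l'))"
        by (subst sum.swap) (simp add: sum_distrib_right)
      also have "\<dots> = 0" using z by (simp add: Z_def)
      finally show ?thesis by (simp add: T_def)
    qed
    then have "T z = (\<lambda>l'. \<Sum>l\<in>?L. z l * ev (\<mu> l l'))" by auto
    also have "\<dots> \<in> ?B"
      using \<mu> by (intro row_span_sum row_span.gen) auto
    finally show ?thesis .
  qed
  have inj: "x = (\<lambda>l. 0)" if x: "\<And>l. l \<notin> ?L \<Longrightarrow> x l = 0" "T x = (\<lambda>l. 0)" for x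
  proof -
    have "\<forall>m\<in>?L. x m = 0"
    \<comment> \<open>The matrix is transposed because T multiplies rows from the right.\<close>
    proof (rule fixed_vector_zero [of I ?L "\<lambda>m l. e l m"])
      show "0 \<in> I" unfolding I_def using negative_0 R_0 ev_0 by (metis IntI imageI)
      show "a - b \<in> I" if ab: "a \<in> I" "b \<in> I" for a b
      proof -
        obtain r s where rs: "r \<in> negative \<inter> R" "s \<in> negative \<inter> R" "a = ev r" "b = ev s"
          using ab unfolding I_def by blast
        then have "a - b = ev (r - s)" "r - s \<in> negative \<inter> R" using ev_diff negative_diff R_diff by auto
        then show ?thesis unfolding I_def by blast
      qed
      show "a * b \<in> I" if ab: "a \<in> I" "b \<in> I" for a b
      proof -
        obtain r s where rs: "r \<in> negative \<inter> R" "s \<in> negative \<inter> R" "a = ev r" "b = ev s"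
          using ab unfolding I_def by blast
        then have "a * b = ev (r \<star> s)" "r \<star> s \<in> negative \<inter> R" using ev_conv negative_conv conv_R by auto
        then show ?thesis unfolding I_def by blast
      qed
      show "1 \<notin> I" using no_unit by (auto simp: I_def)
      show "finite ?L" by (rule fin [OF i])
      show "e l m \<in> I" if "m \<in> ?L" "l \<in> ?L" for m l
        using neg [OF that(2)] by (auto simp: I_def e_def)
      show "x m = (\<Sum>l\<in>?L. e l m * x l)" if "m \<in> ?L" for m
        using fun_cong [OF x(2), of m] by (simp add: T_def mult.commute)
    qed
    then show ?thesis using x(1) by fastforce
  qed
  have lin: "T (\<lambda>l. \<Sum>n\<le>(k::nat). c n * v n l) = (\<lambda>l. \<Sum>n\<le>k. c n * T (v n) l)" for k c v
  proof
    fix l'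
    have "(\<Sum>l\<in>?L. (\<Sum>n\<le>k. c n * v n l) * e l l') = (\<Sum>n\<le>k. c n * (\<Sum>l\<in>?L. v n l * e l l'))"
      unfolding sum_distrib_right sum_distrib_left by (subst sum.swap) (simp add: mult.assoc)
    then show "T (\<lambda>l. \<Sum>n\<le>k. c n * v n l) l' = (\<Sum>n\<le>k. c n * T (v n) l')"
      by (simp add: T_def right_diff_distrib sum_subtractf)
  qed
  have "Z \<subseteq> ?B"
  proof (rule injective_endomorphism_absorbs [OF fin [OF i], where T = T])
    show "z l = 0" if "z \<in> Z" "l \<notin> ?L" for z l using that by (simp add: Z_def)
    show "?B \<subseteq> Z" using BZ by blast
  qed (use TB lin inj scale row_span.zero row_span_add in blast)+
  then show ?thesis unfolding exact_at_def Z_def by blast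
qed

end

section \<open>Tensor products with complexes of free modules\<close>

lemma trivial_FactGroup_iff:
  assumes G: "comm_group G" and H: "subgroup H G"
  shows "trivial_group (G Mod H) \<longleftrightarrow> carrier G \<subseteq> H"
proof -
  interpret comm_group G by (rule G)
  interpret normal H G using H by (rule subgroup_imp_normal)
  show ?thesis
  proof
    assume "trivial_group (G Mod H)"
    then have "rcosets\<^bsub>G\<^esub> H = {H}" by (simp add: trivial_group_def FactGroup_def)
    then have "H #>\<^bsub>G\<^esub> x = H" if "x \<in> carrier G" for x
      using that rcosetsI [OF subset] by blast
    then show "carrier G \<subseteq> H" using coset_join1 H by blast
  next
    assume sub: "carrier G \<subseteq> H"
    have "rcosets\<^bsub>G\<^esub> H = {H}"
    proof
      show "rcosets\<^bsub>G\<^esub> H \<subseteq> {H}" using sub coset_join2 H by (auto simp: RCOSETS_def)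
      show "{H} \<subseteq> rcosets\<^bsub>G\<^esub> H" using subgroup_in_rcosets by blast
    qed
    then show "trivial_group (G Mod H)"
      using factorgroup_is_group by (simp add: trivial_group_def FactGroup_def)
  qed
qed

lemma trivial_chain_homology_iff:
  assumes comm: "\<And>m. comm_group (C m)"
    and hom: "\<And>m. d m \<in> hom (C m) (C (m - 1))"
    and dd: "\<And>x. x \<in> carrier (C (m + 1)) \<Longrightarrow> d m (d (m + 1) x) = \<one>\<^bsub>C (m - 1)\<^esub>"
  shows "trivial_group (chain_homology C d m) \<longleftrightarrow>
    (\<forall>x \<in> carrier (C m). d m x = \<one>\<^bsub>C (m - 1)\<^esub> \<longrightarrow> x \<in> d (m + 1) ` carrier (C (m + 1)))"
proof -
  let ?Z = "kernel (C m) (C (m - 1)) (d m)" and ?B = "d (m + 1) ` carrier (C (m + 1))"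
  have grp: "group (C m)" for m using comm by (simp add: comm_group_def)
  interpret Cm: comm_group "C m" by (rule comm)
  interpret d: group_hom "C m" "C (m - 1)" "d m"
    using grp hom by (simp add: group_hom_def group_hom_axioms_def)
  have "d (m + 1) \<in> hom (C (m + 1)) (C m)" using hom [of "m + 1"] by simp
  then interpret d': group_hom "C (m + 1)" "C m" "d (m + 1)"
    using grp by (simp add: group_hom_def group_hom_axioms_def)
  have Z: "subgroup ?Z (C m)" by (rule d.subgroup_kernel)
  have B: "subgroup ?B (C m)" by (rule d'.img_is_subgroup)
  have "?B \<subseteq> ?Z" using dd d'.hom_closed by (auto simp: kernel_def)
  then have BZ: "subgroup ?B ((C m)\<lparr>carrier := ?Z\<rparr>)"
    by (rule Cm.subgroup_incl [OF B Z])
  have "comm_group ((C m)\<lparr>carrier := ?Z\<rparr>)"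
    using Cm.m_comm subgroup.subset [OF Z]
    by (intro group.group_comm_groupI [OF Cm.subgroup_imp_group [OF Z]]) auto
  from trivial_FactGroup_iff [OF this BZ] show ?thesis
    unfolding chain_homology_def by (auto simp: kernel_def subset_iff)
qed

lemma hom_finprod:
  assumes "comm_group G" "comm_group H" "h \<in> hom G H" "f \<in> A \<rightarrow> carrier G"
  shows "h (finprod G f A) = finprod H (\<lambda>x. h (f x)) A"
proof -
  interpret G: comm_group G by fact
  interpret H: comm_group H by fact
  have one: "h \<one>\<^bsub>G\<^esub> = \<one>\<^bsub>H\<^esub>"
    using hom_one [OF assms(3)] by blast
  show ?thesis
    using assms(4)
  proof (induction A rule: infinite_finite_induct)
    case (insert x A)
    then have "h (f y) \<in> carrier H" if "y \<in> insert x A" for y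
      using hom_in_carrier [OF assms(3)] that by blast
    then show ?case using insert hom_mult [OF assms(3)] by (simp add: Pi_iff)
  qed (simp_all add: one)
qed

lemma comm_group_additive_group: "comm_group additive_group"
  unfolding additive_group_def by (rule comm_groupI) (auto simp: add.assoc add.commute intro: exI [of _ "- _"] left_minus)

text \<open>A complex of left modules over the group ring that is free of finite rank up to degree
  k: \<open>e m\<close> is the basis and \<open>\<kappa> m\<close> gives the coordinates. Above k
  only the modules themselves are given.\<close>

locale module_complex = group G for G :: "('g, 'z) monoid_scheme" (structure) +
  fixes C :: "int \<Rightarrow> 'c monoid" and act :: "int \<Rightarrow> ('g \<Rightarrow> int) \<Rightarrow> 'c \<Rightarrow> 'c" and d :: "int \<Rightarrow> 'c \<Rightarrow> 'c"
    and k :: int and L :: "int \<Rightarrow> 'i set" and e :: "int \<Rightarrow> 'i \<Rightarrow> 'c"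
    and \<kappa> :: "int \<Rightarrow> 'i \<Rightarrow> 'c \<Rightarrow> 'g \<Rightarrow> int"
  assumes comm: "\<And>m. comm_group (C m)"
    and act_closed: "\<And>m r c. r \<in> carrier (group_ring G) \<Longrightarrow> c \<in> carrier (C m) \<Longrightarrow> act m r c \<in> carrier (C m)"
    and d_hom: "\<And>m. d m \<in> hom (C m) (C (m - 1))"
    and dd: "\<And>m c. c \<in> carrier (C m) \<Longrightarrow> d (m - 1) (d m c) = \<one>\<^bsub>C (m - 1 - 1)\<^esub>"
    and d_act: "\<And>m r c. r \<in> carrier (group_ring G) \<Longrightarrow> c \<in> carrier (C m) \<Longrightarrow> d m (act m r c) = act (m - 1) r (d m c)"
    and finite_L: "\<And>m. m \<le> k \<Longrightarrow> finite (L m)"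
    and e_in: "\<And>m l. m \<le> k \<Longrightarrow> l \<in> L m \<Longrightarrow> e m l \<in> carrier (C m)"
    and coord_R: "\<And>m l c. m \<le> k \<Longrightarrow> c \<in> carrier (C m) \<Longrightarrow> \<kappa> m l c \<in> carrier (group_ring G)"
    and coord_out: "\<And>m l c. m \<le> k \<Longrightarrow> l \<notin> L m \<Longrightarrow> \<kappa> m l c = 0"
    and coord_mult: "\<And>m l c c'. m \<le> k \<Longrightarrow> c \<in> carrier (C m) \<Longrightarrow> c' \<in> carrier (C m) \<Longrightarrow>
        \<kappa> m l (c \<otimes>\<^bsub>C m\<^esub> c') = \<kappa> m l c + \<kappa> m l c'"
    and coord_act: "\<And>m l r c. m \<le> k \<Longrightarrow> r \<in> carrier (group_ring G) \<Longrightarrow> c \<in> carrier (C m) \<Longrightarrow>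
        \<kappa> m l (act m r c) = conv G r (\<kappa> m l c)"
    and coord_e: "\<And>m l j. m \<le> k \<Longrightarrow> l \<in> L m \<Longrightarrow> j \<in> L m \<Longrightarrow> \<kappa> m l (e m j) = (if l = j then \<one>\<^bsub>group_ring G\<^esub> else 0)"
    and expand: "\<And>m c. m \<le> k \<Longrightarrow> c \<in> carrier (C m) \<Longrightarrow> c = finprod (C m) (\<lambda>l. act m (\<kappa> m l c) (e m l)) (L m)"
begin

abbreviation "R \<equiv> carrier (group_ring G)"

definition boundary_matrix :: "int \<Rightarrow> 'i \<Rightarrow> 'i \<Rightarrow> 'g \<Rightarrow> int" where
  "boundary_matrix m l j = \<kappa> (m - 1) j (d m (e m l))"

text \<open>All of \<open>C (m + 1)\<close> is used, and no basis of it, so this is meaningful for m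
  = k as well.\<close>

definition boundary_rows :: "int \<Rightarrow> ('i \<Rightarrow> 'g \<Rightarrow> int) set" where
  "boundary_rows m = (\<lambda>c l. \<kappa> m l (d (m + 1) c)) ` carrier (C (m + 1))"

lemma d_in: "c \<in> carrier (C m) \<Longrightarrow> d m c \<in> carrier (C (m - 1))"
  by (rule hom_in_carrier [OF d_hom])

lemma d_in': "c \<in> carrier (C (m + 1)) \<Longrightarrow> d (m + 1) c \<in> carrier (C m)"
  using d_in [of c "m + 1"] by simp

lemma coord_one: "m \<le> k \<Longrightarrow> \<kappa> m l \<one>\<^bsub>C m\<^esub> = 0"
  using coord_mult [of m "\<one>\<^bsub>C m\<^esub>" "\<one>\<^bsub>C m\<^esub>" l] comm [of m] by (simp add: comm_group_def group.is_monoid)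

lemma coord_finprod:
  assumes m: "m \<le> k" and f: "f \<in> A \<rightarrow> carrier (C m)"
  shows "\<kappa> m l (finprod (C m) f A) = (\<Sum>x\<in>A. \<kappa> m l (f x))"
proof -
  interpret Cm: comm_group "C m" by (rule comm)
  show ?thesis
    using f
  proof (induction A rule: infinite_finite_induct)
    case (insert x A)
    then show ?case using coord_mult [OF m] by (simp add: Pi_iff)
  qed (simp_all add: coord_one [OF m])
qed

text \<open>The chain is expanded in the basis before d is applied. As the modules are left modules,
  the matrix acts on rows of coordinates from the right.\<close>

lemma coord_d:
  assumes m: "m \<le> k" and c: "c \<in> carrier (C m)"
  shows "\<kappa> (m - 1) j (d m c) = (\<Sum>l\<in>L m. conv G (\<kappa> m l c) (boundary_matrix m l j))"
proof -
  have in_C: "act m (\<kappa> m l c) (e m l) \<in> carrier (C m)" if "l \<in> L m" for l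
    using act_closed coord_R [OF m c] e_in [OF m that] by blast
  have "d m c = finprod (C (m - 1)) (\<lambda>l. d m (act m (\<kappa> m l c) (e m l))) (L m)"
    using expand [OF m c] hom_finprod [OF comm comm d_hom, of "\<lambda>l. act m (\<kappa> m l c) (e m l)" "L m" m] in_C
    by simp
  also have "\<kappa> (m - 1) j \<dots> = (\<Sum>l\<in>L m. \<kappa> (m - 1) j (d m (act m (\<kappa> m l c) (e m l))))"
    using m in_C d_in by (intro coord_finprod) auto
  also have "\<dots> = (\<Sum>l\<in>L m. conv G (\<kappa> m l c) (boundary_matrix m l j))"
    using m coord_R [OF m c] e_in [OF m] d_in
    by (intro sum.cong refl) (simp add: d_act coord_act boundary_matrix_def)
  finally show ?thesis .
qed

end

text \<open>The coefficient module is a subgroup of a type with addition, so that the Novikov ring,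
  a set of functions, and the field are covered by the same argument.\<close>

locale module_complex_coefficients = module_complex +
  fixes A :: "('m::ab_group_add, 'y) monoid_scheme" and ract :: "'m \<Rightarrow> ('a \<Rightarrow> int) \<Rightarrow> 'm"
  assumes A_mult: "\<And>a b. a \<otimes>\<^bsub>A\<^esub> b = a + b"
    and A_0: "0 \<in> carrier A" and A_diff: "\<And>a b. a \<in> carrier A \<Longrightarrow> b \<in> carrier A \<Longrightarrow> a - b \<in> carrier A"
    and ract_closed: "\<And>a r. a \<in> carrier A \<Longrightarrow> r \<in> R \<Longrightarrow> ract a r \<in> carrier A"
    and ract_add_left: "\<And>a b r. a \<in> carrier A \<Longrightarrow> b \<in> carrier A \<Longrightarrow> r \<in> R \<Longrightarrow> ract (a + b) r = ract a r + ract b r"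
    and ract_add_right: "\<And>a r s. a \<in> carrier A \<Longrightarrow> r \<in> R \<Longrightarrow> s \<in> R \<Longrightarrow> ract a (r + s) = ract a r + ract a s"
    and ract_conv: "\<And>a r s. a \<in> carrier A \<Longrightarrow> r \<in> R \<Longrightarrow> s \<in> R \<Longrightarrow> ract a (conv G r s) = ract (ract a r) s"
    and ract_unit: "\<And>a. a \<in> carrier A \<Longrightarrow> ract a \<one>\<^bsub>group_ring G\<^esub> = a"
    and R_0: "0 \<in> R" and R_add: "\<And>r s. r \<in> R \<Longrightarrow> s \<in> R \<Longrightarrow> r + s \<in> R"
    and R_conv: "\<And>r s. r \<in> R \<Longrightarrow> s \<in> R \<Longrightarrow> conv G r s \<in> R"
begin

declare zero_fun_apply [simp del] plus_fun_apply [simp del] minus_apply [simp del]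

abbreviation "S \<equiv> carrier A"
abbreviation "F m \<equiv> free_Abelian_group (S \<times> carrier (C m))"
abbreviation "Ker m \<equiv> tensor_kernel (group_ring G) A ract (C m) (act m)"
abbreviation "Rel m \<equiv> tensor_relations (group_ring G) A ract (C m) (act m)"
abbreviation "T m \<equiv> tensor_product (group_ring G) A ract (C m) (act m)"
abbreviation "dT m \<equiv> tensor_map (group_ring G) A ract (C (m - 1)) (act (m - 1)) (d m)"
abbreviation "dF m \<equiv> frag_extend (\<lambda>(a, c). frag_of (a, d m c))"

lemma A_uminus: "a \<in> S \<Longrightarrow> - a \<in> S"
  using A_diff [OF A_0, of a] by simp

lemma A_add: "a \<in> S \<Longrightarrow> b \<in> S \<Longrightarrow> a + b \<in> S"
  using A_diff [OF _ A_uminus, of a b] by simp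

lemma ract_0_left: "r \<in> R \<Longrightarrow> ract 0 r = 0"
  using ract_add_left [OF A_0 A_0, of r] by simp

lemma ract_0_right: "a \<in> S \<Longrightarrow> ract a 0 = 0"
  using ract_add_right [OF _ R_0 R_0, of a] by simp

lemma ract_diff_left: "a \<in> S \<Longrightarrow> b \<in> S \<Longrightarrow> r \<in> R \<Longrightarrow> ract (a - b) r = ract a r - ract b r"
  using ract_add_left [OF A_diff, of a b b r] by (simp add: algebra_simps)

lemma R_sum: "(\<And>i. i \<in> J \<Longrightarrow> f i \<in> R) \<Longrightarrow> sum f J \<in> R"
  by (induction J rule: infinite_finite_induct) (auto intro: R_0 R_add)

lemma ract_sum_right: "a \<in> S \<Longrightarrow> (\<And>i. i \<in> J \<Longrightarrow> f i \<in> R) \<Longrightarrow> ract a (sum f J) = (\<Sum>i\<in>J. ract a (f i))"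
  by (induction J rule: infinite_finite_induct) (auto simp: ract_0_right ract_add_right R_sum)

lemma one_in_C: "\<one>\<^bsub>C m\<^esub> \<in> carrier (C m)" and mult_in_C: "c \<in> carrier (C m) \<Longrightarrow> c' \<in> carrier (C m) \<Longrightarrow> c \<otimes>\<^bsub>C m\<^esub> c' \<in> carrier (C m)"
  using comm [of m] by (auto simp: comm_group_def group.is_monoid monoid.m_closed)

lemma Rel_cases [consumes 1, case_names left right balanced]:
  assumes "x \<in> Rel m"
  obtains a a' b where "a \<in> S" "a' \<in> S" "b \<in> carrier (C m)" "x = frag_of (a + a', b) - frag_of (a, b) - frag_of (a', b)"
  | a b b' where "a \<in> S" "b \<in> carrier (C m)" "b' \<in> carrier (C m)" "x = frag_of (a, b \<otimes>\<^bsub>C m\<^esub> b') - frag_of (a, b) - frag_of (a, b')"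
  | a r b where "a \<in> S" "r \<in> R" "b \<in> carrier (C m)" "x = frag_of (ract a r, b) - frag_of (a, act m r b)"
  using assms unfolding tensor_relations_def A_mult by auto

lemma Rel_subset: "Rel m \<subseteq> carrier (F m)"
proof
  have diff: "x - y \<in> carrier (F m)" if "x \<in> carrier (F m)" "y \<in> carrier (F m)" for x y
    using that keys_diff [of x y] by auto
  fix x assume "x \<in> Rel m"
  then show "x \<in> carrier (F m)"
    by (cases rule: Rel_cases) (simp_all only: , (intro diff frag_of_in_free_Abelian_group [THEN iffD2] SigmaI A_add mult_in_C ract_closed act_closed; assumption)+)
qed

lemma Ker_subgroup: "subgroup (Ker m) (F m)"
  unfolding tensor_kernel_def by (rule group.generate_is_subgroup [OF group_free_Abelian_group Rel_subset])

lemma Ker_0: "0 \<in> Ker m"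
  using subgroup.one_closed [OF Ker_subgroup] by simp

lemma Ker_in: "x \<in> Ker m \<Longrightarrow> x \<in> carrier (F m)"
  using subgroup.subset [OF Ker_subgroup] by blast

lemma Ker_diff: "x \<in> Ker m \<Longrightarrow> y \<in> Ker m \<Longrightarrow> x - y \<in> Ker m"
  using subgroup.m_closed [OF Ker_subgroup, of x m "- y"] subgroup.m_inv_closed [OF Ker_subgroup, of y m] Ker_in [of y m]
  by simp

lemma Ker_add: "x \<in> Ker m \<Longrightarrow> y \<in> Ker m \<Longrightarrow> x + y \<in> Ker m"
  using subgroup.m_closed [OF Ker_subgroup, of x m y] by simp

lemma Ker_sum: "(\<And>i. i \<in> J \<Longrightarrow> f i \<in> Ker m) \<Longrightarrow> sum f J \<in> Ker m"
  by (induction J rule: infinite_finite_induct) (auto intro: Ker_0 Ker_add)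

lemma Ker_Rel: "x \<in> Rel m \<Longrightarrow> x \<in> Ker m"
  unfolding tensor_kernel_def by (rule generate.incl)

text \<open>Induction over the generated subgroup with the single closure rule of differences, which
  matches linearity of the maps studied below.\<close>

lemma Ker_induct [consumes 1, case_names zero rel diff]:
  assumes "x \<in> Ker m" and "P 0" and "\<And>x. x \<in> Rel m \<Longrightarrow> P x"
    and "\<And>x y. x \<in> Ker m \<Longrightarrow> y \<in> Ker m \<Longrightarrow> P x \<Longrightarrow> P y \<Longrightarrow> P (x - y)"
  shows "P x"
proof -
  have "x \<in> Ker m \<and> P x" using assms(1) unfolding tensor_kernel_def [of _ A]
  proof (induction rule: generate.induct)
    case one
    then show ?case using assms(2) Ker_0 [of m] unfolding tensor_kernel_def by simp
  next
    case (incl h)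
    then show ?case using assms(3) Ker_Rel unfolding tensor_kernel_def by blast
  next
    case (inv h)
    then have h: "h \<in> Ker m" "P h" using assms(3) Ker_Rel by auto
    have "inv\<^bsub>F m\<^esub> h = 0 - h" using Ker_in [OF h(1)] by simp
    then show ?case using assms(4) [OF Ker_0 h(1) assms(2) h(2)] Ker_diff [OF Ker_0 h(1)]
      unfolding tensor_kernel_def by simp
  next
    case (eng x y)
    then have x: "x \<in> Ker m" "P x" and y: "y \<in> Ker m" "P y" unfolding tensor_kernel_def by auto
    have "P (x - (0 - y))"
      by (rule assms(4) [OF x(1) Ker_diff [OF Ker_0 y(1)] x(2) assms(4) [OF Ker_0 y(1) assms(2) y(2)]])
    then show ?case using Ker_add [OF x(1) y(1)] unfolding tensor_kernel_def by simp
  qed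
  then show ?thesis by blast
qed

lemma eq_add_left: "a \<in> S \<Longrightarrow> a' \<in> S \<Longrightarrow> c \<in> carrier (C m) \<Longrightarrow> frag_of (a + a', c) - frag_of (a, c) - frag_of (a', c) \<in> Ker m"
  by (rule Ker_Rel) (auto simp: tensor_relations_def A_mult)

lemma eq_add_right: "a \<in> S \<Longrightarrow> c \<in> carrier (C m) \<Longrightarrow> c' \<in> carrier (C m) \<Longrightarrow> frag_of (a, c \<otimes>\<^bsub>C m\<^esub> c') - frag_of (a, c) - frag_of (a, c') \<in> Ker m"
  by (rule Ker_Rel) (auto simp: tensor_relations_def)

lemma eq_balanced: "a \<in> S \<Longrightarrow> r \<in> R \<Longrightarrow> c \<in> carrier (C m) \<Longrightarrow> frag_of (ract a r, c) - frag_of (a, act m r c) \<in> Ker m"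
  by (rule Ker_Rel) (auto simp: tensor_relations_def)

lemma eq_zero_left: "c \<in> carrier (C m) \<Longrightarrow> frag_of (0, c) \<in> Ker m"
  using Ker_diff [OF Ker_0 eq_add_left [OF A_0 A_0]] by simp

lemma eq_zero_right:
  assumes "a \<in> S"
  shows "frag_of (a, \<one>\<^bsub>C m\<^esub>) \<in> Ker m"
proof -
  have "\<one>\<^bsub>C m\<^esub> \<otimes>\<^bsub>C m\<^esub> \<one>\<^bsub>C m\<^esub> = \<one>\<^bsub>C m\<^esub>"
    using comm [of m] by (simp add: comm_group_def group.is_monoid)
  then show ?thesis
    using Ker_diff [OF Ker_0 eq_add_right [OF assms one_in_C [of m] one_in_C]] by simp
qed

lemma eq_diff_left:
  assumes "a \<in> S" "b \<in> S" "c \<in> carrier (C m)"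
  shows "(frag_of (a, c) - frag_of (b, c)) - frag_of (a - b, c) \<in> Ker m"
  using eq_add_left [OF A_diff [OF assms(1,2)] assms(2,3)] by (simp add: algebra_simps)

lemma eq_finprod:
  assumes a: "a \<in> S" and "finite J" and f: "f \<in> J \<rightarrow> carrier (C m)"
  shows "frag_of (a, finprod (C m) f J) - (\<Sum>j\<in>J. frag_of (a, f j)) \<in> Ker m"
proof -
  interpret Cm: comm_group "C m" by (rule comm)
  show ?thesis
    using assms(2) f
  proof (induction J rule: finite_induct)
    case empty
    then show ?case using eq_zero_right [OF a] by simp
  next
    case (insert j J)
    let ?p = "finprod (C m) f J"
    have p: "?p \<in> carrier (C m)" "f j \<in> carrier (C m)" using insert by auto
    have "(frag_of (a, f j \<otimes>\<^bsub>C m\<^esub> ?p) - frag_of (a, f j) - frag_of (a, ?p)) + (frag_of (a, ?p) - (\<Sum>j\<in>J. frag_of (a, f j))) \<in> Ker m"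
      using insert.IH insert.prems eq_add_right [OF a p(2,1)] by (intro Ker_add) auto
    then show ?case using insert by (simp add: algebra_simps Pi_iff)
  qed
qed

text \<open>The functional that \<kappa> induces on the tensor product, on the level of the free
  abelian group and before the relations are divided out.\<close>

definition coordinate :: "int \<Rightarrow> 'd \<Rightarrow> ('m \<times> 'c \<Rightarrow>\<^sub>0 int) \<Rightarrow> 'm" where
  "coordinate m l = (SOME h. h \<in> hom (F m) additive_group \<and> (\<forall>a\<in>S. \<forall>c\<in>carrier (C m). h (frag_of (a, c)) = ract a (\<kappa> m l c)))"

lemma coordinate:
  shows "coordinate m l \<in> hom (F m) additive_group"
    "a \<in> S \<Longrightarrow> c \<in> carrier (C m) \<Longrightarrow> coordinate m l (frag_of (a, c)) = ract a (\<kappa> m l c)"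
proof -
  obtain h where "h \<in> hom (F m) (additive_group :: 'm monoid)"
    "\<And>x. x \<in> S \<times> carrier (C m) \<Longrightarrow> h (frag_of x) = (\<lambda>(a, c). ract a (\<kappa> m l c)) x"
    by (rule comm_group.free_Abelian_group_universal [OF comm_group_additive_group, of "\<lambda>(a, c). ract a (\<kappa> m l c)" "S \<times> carrier (C m)"])
      (auto simp: additive_group_def)
  then have "h \<in> hom (F m) additive_group \<and> (\<forall>a\<in>S. \<forall>c\<in>carrier (C m). h (frag_of (a, c)) = ract a (\<kappa> m l c))"
    by auto
  then have "coordinate m l \<in> hom (F m) additive_group \<and> (\<forall>a\<in>S. \<forall>c\<in>carrier (C m). coordinate m l (frag_of (a, c)) = ract a (\<kappa> m l c))"
    unfolding coordinate_def
    by (rule someI [where P = "\<lambda>h. h \<in> hom (F m) additive_group \<and> (\<forall>a\<in>S. \<forall>c\<in>carrier (C m). h (frag_of (a, c)) = ract a (\<kappa> m l c))"])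
  then show "coordinate m l \<in> hom (F m) additive_group"
    "a \<in> S \<Longrightarrow> c \<in> carrier (C m) \<Longrightarrow> coordinate m l (frag_of (a, c)) = ract a (\<kappa> m l c)"
    by auto
qed

lemma F_0: "0 \<in> carrier (F m)" by simp

lemma F_diff: "x \<in> carrier (F m) \<Longrightarrow> y \<in> carrier (F m) \<Longrightarrow> x - y \<in> carrier (F m)"
  using keys_diff [of x y] by auto

lemma F_sum: "(\<And>i. i \<in> J \<Longrightarrow> f i \<in> carrier (F m)) \<Longrightarrow> sum f J \<in> carrier (F m)"
  by (rule sum_closed_free_Abelian_group)

lemma F_frag_of: "a \<in> S \<Longrightarrow> c \<in> carrier (C m) \<Longrightarrow> frag_of (a, c) \<in> carrier (F m)"
  by simp

lemma coordinate_add: "x \<in> carrier (F m) \<Longrightarrow> y \<in> carrier (F m) \<Longrightarrow> coordinate m l (x + y) = coordinate m l x + coordinate m l y"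
  using hom_mult [OF coordinate(1), of x m y l] by (simp add: additive_group_def)

lemma coordinate_0: "coordinate m l 0 = 0"
  using coordinate_add [OF F_0 F_0, of m l] by simp

lemma coordinate_diff: "x \<in> carrier (F m) \<Longrightarrow> y \<in> carrier (F m) \<Longrightarrow> coordinate m l (x - y) = coordinate m l x - coordinate m l y"
  using coordinate_add [OF F_diff, of x m y y l] by (simp add: algebra_simps)

lemma coordinate_sum: "(\<And>i. i \<in> J \<Longrightarrow> f i \<in> carrier (F m)) \<Longrightarrow> coordinate m l (sum f J) = (\<Sum>i\<in>J. coordinate m l (f i))"
proof (induction J rule: infinite_finite_induct)
  case (insert j J)
  have "coordinate m l (f j + sum f J) = coordinate m l (f j) + coordinate m l (sum f J)"
    using insert.prems by (intro coordinate_add F_sum) auto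
  then show ?case using insert by simp
qed (simp_all add: coordinate_0)

lemma F_induct [consumes 1, case_names zero frag diff]:
  assumes "x \<in> carrier (F m)" and "P 0"
    and "\<And>a c. a \<in> S \<Longrightarrow> c \<in> carrier (C m) \<Longrightarrow> P (frag_of (a, c))"
    and "\<And>x y. x \<in> carrier (F m) \<Longrightarrow> y \<in> carrier (F m) \<Longrightarrow> P x \<Longrightarrow> P y \<Longrightarrow> P (x - y)"
  shows "P x"
proof -
  have "Poly_Mapping.keys x \<subseteq> S \<times> carrier (C m)" using assms(1) by simp
  then show ?thesis
    by (rule free_Abelian_group_induct) (use assms(2-4) in auto)
qed

lemma dF_in: "x \<in> carrier (F m) \<Longrightarrow> dF m x \<in> carrier (F (m - 1))"
proof (induction x rule: F_induct)
  case (diff x y)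
  then show ?case unfolding frag_extend_diff by (intro F_diff)
qed (use d_in in simp_all)

lemma dF_Ker: "x \<in> Ker m \<Longrightarrow> dF m x \<in> Ker (m - 1)"
proof (induction x rule: Ker_induct)
  case (rel x)
  then show ?case
  proof (cases rule: Rel_cases)
    case (left a a' b)
    then show ?thesis using eq_add_left d_in by (simp add: frag_extend_diff)
  next
    case (right a b b')
    then show ?thesis using eq_add_right d_in hom_mult [OF d_hom] by (simp add: frag_extend_diff)
  next
    case (balanced a r b)
    then show ?thesis using eq_balanced d_in d_act by (simp add: frag_extend_diff)
  qed
next
  case (diff x y)
  then show ?case unfolding frag_extend_diff by (intro Ker_diff)
qed (simp add: Ker_0)

text \<open>On the free abelian group the composite is not zero: a generator paired with the neutral
  chain is a nonzero element there and vanishes only modulo the relations.\<close>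

lemma dF_dF: "x \<in> carrier (F (m + 1)) \<Longrightarrow> dF m (dF (m + 1) x) \<in> Ker (m - 1)"
proof (induction x rule: F_induct)
  case (frag a c)
  then show ?case using dd [of c "m + 1"] eq_zero_right by simp
next
  case (diff x y)
  then show ?case unfolding frag_extend_diff by (intro Ker_diff)
qed (simp add: Ker_0)

abbreviation "cls m x \<equiv> Ker m #>\<^bsub>F m\<^esub> x"

lemma cls_eq_iff: "cls m x = cls m y \<longleftrightarrow> x - y \<in> Ker m"
proof -
  have cls: "cls m x = (\<lambda>h. h + x) ` Ker m" for x unfolding r_coset_def by auto
  show ?thesis
  proof
    assume "cls m x = cls m y"
    moreover have "0 + x \<in> cls m x" unfolding cls using Ker_0 by blast
    ultimately show "x - y \<in> Ker m" unfolding cls by auto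
  next
    assume xy: "x - y \<in> Ker m"
    have "h + x \<in> (\<lambda>h. h + y) ` Ker m" if "h \<in> Ker m" for h
      using Ker_add [OF that xy] by (intro image_eqI [of _ _ "h + (x - y)"]) auto
    moreover have "h + y \<in> (\<lambda>h. h + x) ` Ker m" if "h \<in> Ker m" for h
      using Ker_diff [OF that xy] by (intro image_eqI [of _ _ "h - (x - y)"]) auto
    ultimately show "cls m x = cls m y" unfolding cls by blast
  qed
qed

lemma T_comm_group: "comm_group (T m)"
  unfolding tensor_product_def by (rule comm_group.abelian_FactGroup [OF abelian_free_Abelian_group Ker_subgroup])

lemma T_carrier: "carrier (T m) = cls m ` carrier (F m)"
  unfolding tensor_product_def FactGroup_def RCOSETS_def by auto

lemma T_one: "\<one>\<^bsub>T m\<^esub> = cls m 0"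
  using group.coset_join2 [OF group_free_Abelian_group _ Ker_subgroup Ker_0] unfolding tensor_product_def FactGroup_def by simp

lemma T_mult: "x \<in> carrier (F m) \<Longrightarrow> y \<in> carrier (F m) \<Longrightarrow> cls m x \<otimes>\<^bsub>T m\<^esub> cls m y = cls m (x + y)"
  using normal.rcos_sum [OF comm_group.subgroup_imp_normal [OF abelian_free_Abelian_group Ker_subgroup], of x m y]
  unfolding tensor_product_def FactGroup_def by simp

text \<open>The image of a coset under \<open>tensor_map\<close> is extracted by
  \<open>the_elem\<close>; all representatives of the coset give one and the same class since
  relations go to relations.\<close>

lemma dT_cls: "x \<in> carrier (F m) \<Longrightarrow> dT m (cls m x) = cls (m - 1) (dF m x)"
proof -
  assume x: "x \<in> carrier (F m)"
  have "cls (m - 1) (dF m y) = cls (m - 1) (dF m x)" if "y \<in> cls m x" for y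
  proof -
    have "y - x \<in> Ker m" using that unfolding r_coset_def by auto
    from dF_Ker [OF this] show ?thesis unfolding cls_eq_iff frag_extend_diff .
  qed
  moreover have "x \<in> cls m x" using Ker_0 unfolding r_coset_def by force
  ultimately have "(\<lambda>x. cls (m - 1) (dF m x)) ` cls m x = {cls (m - 1) (dF m x)}" by blast
  then show ?thesis unfolding tensor_map_def by simp
qed

lemma dT_hom: "dT m \<in> hom (T m) (T (m - 1))"
proof (rule homI)
  fix X Y assume "X \<in> carrier (T m)" "Y \<in> carrier (T m)"
  then obtain x y where "x \<in> carrier (F m)" "X = cls m x" "y \<in> carrier (F m)" "Y = cls m y"
    unfolding T_carrier by blast
  then show "dT m (X \<otimes>\<^bsub>T m\<^esub> Y) = dT m X \<otimes>\<^bsub>T (m - 1)\<^esub> dT m Y"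
    using F_diff [of x m "- y"] F_diff [OF F_0, of y] by (simp only: T_mult dT_cls dF_in frag_extend_add) (simp add: dT_cls frag_extend_add)
qed (use dT_cls dF_in in \<open>auto simp: T_carrier\<close>)

text \<open>From here on representatives in the free abelian group replace the classes of the tensor
  product.\<close>

lemma trivial_chain_homology_T:
  "trivial_group (chain_homology T dT m) \<longleftrightarrow>
    (\<forall>x\<in>carrier (F m). dF m x \<in> Ker (m - 1) \<longrightarrow> (\<exists>y\<in>carrier (F (m + 1)). x - dF (m + 1) y \<in> Ker m))"
proof -
  have image: "dT (m + 1) ` carrier (T (m + 1)) = (\<lambda>y. cls m (dF (m + 1) y)) ` carrier (F (m + 1))" for m
    using dT_cls [of _ "m + 1"] unfolding T_carrier by (simp add: image_image)
  have dd_T: "dT m (dT (m + 1) X) = \<one>\<^bsub>T (m - 1)\<^esub>" if X: "X \<in> carrier (T (m + 1))" for X m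
  proof -
    obtain x where x: "x \<in> carrier (F (m + 1))" "X = cls (m + 1) x"
      using X unfolding T_carrier by (rule imageE) (rule that)
    have F: "dF (m + 1) x \<in> carrier (F m)" using dF_in [OF x(1)] by simp
    have "dT m (dT (m + 1) X) = dT m (cls m (dF (m + 1) x))" using dT_cls [OF x(1)] x(2) by simp
    also have "\<dots> = cls (m - 1) (dF m (dF (m + 1) x))" by (rule dT_cls [OF F])
    also have "\<dots> = cls (m - 1) 0" unfolding cls_eq_iff using dF_dF [OF x(1)] by simp
    finally show ?thesis unfolding T_one .
  qed
  have "trivial_group (chain_homology T dT m) \<longleftrightarrow>
    (\<forall>X\<in>carrier (T m). dT m X = \<one>\<^bsub>T (m - 1)\<^esub> \<longrightarrow> X \<in> dT (m + 1) ` carrier (T (m + 1)))"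
    using trivial_chain_homology_iff [of "\<lambda>m. T m" "\<lambda>m. dT m" m] T_comm_group dT_hom dd_T [of _ m] by simp
  also have "\<dots> \<longleftrightarrow> (\<forall>x\<in>carrier (F m). cls (m - 1) (dF m x) = cls (m - 1) 0 \<longrightarrow>
      (\<exists>y\<in>carrier (F (m + 1)). cls m x = cls m (dF (m + 1) y)))"
    unfolding image T_one unfolding T_carrier by (simp add: dT_cls image_iff)
  finally show ?thesis unfolding cls_eq_iff by simp
qed

section \<open>Coordinates on the tensor product\<close>

context
  fixes m assumes m: "m \<le> k"
begin

lemma coordinate_in: "x \<in> carrier (F m) \<Longrightarrow> coordinate m l x \<in> S"
  by (induction x rule: F_induct) (auto simp: coordinate_0 coordinate_diff coordinate(2) A_0 intro!: A_diff ract_closed coord_R [OF m])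

lemma coordinate_out: "x \<in> carrier (F m) \<Longrightarrow> l \<notin> L m \<Longrightarrow> coordinate m l x = 0"
  by (induction x rule: F_induct) (auto simp: coordinate_0 coordinate_diff coordinate(2) coord_out [OF m] ract_0_right)

text \<open>The balanced relations are respected because \<kappa> is linear over the group ring, and
  a (r s) = (a r) s with s the coordinate of the chain.\<close>

lemma coordinate_Ker: "x \<in> Ker m \<Longrightarrow> coordinate m l x = 0"
proof (induction x rule: Ker_induct)
  case (rel x)
  then show ?case
  proof (cases rule: Rel_cases)
    case (left a a' b)
    have "coordinate m l x = coordinate m l (frag_of (a + a', b)) - coordinate m l (frag_of (a, b)) - coordinate m l (frag_of (a', b))"
      unfolding left(4) using left(1-3) A_add by (simp only: coordinate_diff F_diff F_frag_of)
    then show ?thesis using left(1-3) A_add coord_R [OF m left(3)] by (simp add: coordinate(2) ract_add_left)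
  next
    case (right a b b')
    have "coordinate m l x = coordinate m l (frag_of (a, b \<otimes>\<^bsub>C m\<^esub> b')) - coordinate m l (frag_of (a, b)) - coordinate m l (frag_of (a, b'))"
      unfolding right(4) using right(1-3) mult_in_C by (simp only: coordinate_diff F_diff F_frag_of)
    then show ?thesis using right(1-3) mult_in_C coord_R [OF m] by (simp add: coordinate(2) coord_mult [OF m] ract_add_right)
  next
    case (balanced a r b)
    have "coordinate m l x = coordinate m l (frag_of (ract a r, b)) - coordinate m l (frag_of (a, act m r b))"
      unfolding balanced(4) using balanced(1-3) ract_closed act_closed by (simp only: coordinate_diff F_frag_of)
    then show ?thesis using balanced(1-3) ract_closed act_closed coord_R [OF m] by (simp add: coordinate(2) coord_act [OF m] ract_conv)
  qed
next
  case (diff x y)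
  then show ?case using Ker_in by (simp only: coordinate_diff) simp
qed (simp add: coordinate_0)

text \<open>A chain is expanded in the basis, and its group ring coefficients are moved across the
  tensor sign to the left factor.\<close>

lemma decomposition:
  "x \<in> carrier (F m) \<Longrightarrow> x - (\<Sum>l\<in>L m. frag_of (coordinate m l x, e m l)) \<in> Ker m"
proof (induction x rule: F_induct)
  case zero
  have "(\<Sum>l\<in>L m. frag_of (coordinate m l 0, e m l)) \<in> Ker m"
    unfolding coordinate_0 using eq_zero_left e_in [OF m] finite_L [OF m]
    by (intro Ker_sum) auto
  then show ?case using Ker_diff [OF Ker_0] by simp
next
  case (frag a c)
  have r: "\<kappa> m l c \<in> R" for l using coord_R [OF m frag(2)] .
  let ?f = "\<lambda>l. act m (\<kappa> m l c) (e m l)"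
  have f: "?f \<in> L m \<rightarrow> carrier (C m)" using act_closed r e_in [OF m] by blast
  have "frag_of (a, c) - (\<Sum>l\<in>L m. frag_of (a, ?f l)) \<in> Ker m"
    using eq_finprod [OF frag(1) finite_L [OF m] f] expand [OF m frag(2)] by simp
  moreover have "(\<Sum>l\<in>L m. frag_of (ract a (\<kappa> m l c), e m l) - frag_of (a, ?f l)) \<in> Ker m"
    using eq_balanced [OF frag(1) r] e_in [OF m] by (intro Ker_sum) auto
  ultimately have "(frag_of (a, c) - (\<Sum>l\<in>L m. frag_of (a, ?f l)))
      - (\<Sum>l\<in>L m. frag_of (ract a (\<kappa> m l c), e m l) - frag_of (a, ?f l)) \<in> Ker m"
    by (rule Ker_diff)
  then show ?case
    by (simp add: coordinate(2) [OF frag] sum_subtractf)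
next
  case (diff x y)
  let ?u = "\<lambda>x l. frag_of (coordinate m l x, e m l)"
  \<comment> \<open>\<open>frag_of\<close> is not additive in its first argument, so the coordinates
    may be subtracted only modulo the relations.\<close>
  have "(\<Sum>l\<in>L m. (?u x l - ?u y l) - ?u (x - y) l) \<in> Ker m"
    using diff(1,2) coordinate_in e_in [OF m] coordinate_diff [of x m y]
    by (intro Ker_sum) (simp add: eq_diff_left)
  then have "((x - (\<Sum>l\<in>L m. ?u x l)) - (y - (\<Sum>l\<in>L m. ?u y l))) + (\<Sum>l\<in>L m. (?u x l - ?u y l) - ?u (x - y) l) \<in> Ker m"
    by (intro Ker_add Ker_diff diff)
  moreover have "(p - a) - (q - b) + (a - b - c) = p - q - c" for p q a b c :: "'d \<times> 'c \<Rightarrow>\<^sub>0 int"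
    by simp
  ultimately show ?case unfolding sum_subtractf by simp
qed

text \<open>With \<open>decomposition\<close> this says that the coordinates identify the tensor
  product with the rows over A indexed by the basis.\<close>

lemma Ker_iff: "x \<in> carrier (F m) \<Longrightarrow> x \<in> Ker m \<longleftrightarrow> (\<forall>l\<in>L m. coordinate m l x = 0)"
proof
  assume x: "x \<in> carrier (F m)" "\<forall>l\<in>L m. coordinate m l x = 0"
  then have "(\<Sum>l\<in>L m. frag_of (coordinate m l x, e m l)) \<in> Ker m"
    using eq_zero_left e_in [OF m] by (intro Ker_sum) auto
  from Ker_add [OF decomposition [OF x(1)] this] show "x \<in> Ker m" by simp
qed (use coordinate_Ker in blast)

end

context
  fixes m assumes m: "m \<le> k"
begin

lemma boundary_matrix_R: "l \<in> L m \<Longrightarrow> boundary_matrix m l j \<in> R"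
  unfolding boundary_matrix_def using d_in [OF e_in [OF m]] m by (intro coord_R) auto

text \<open>Under the identification with rows, the differential of the tensor complex is right
  multiplication by the boundary matrix.\<close>

lemma coordinate_dF:
  "x \<in> carrier (F m) \<Longrightarrow>
    coordinate (m - 1) j (dF m x) = (\<Sum>l\<in>L m. ract (coordinate m l x) (boundary_matrix m l j))"
proof (induction x rule: F_induct)
  case zero
  then show ?case using boundary_matrix_R by (simp add: coordinate_0 ract_0_left)
next
  case (frag a c)
  have "ract a (\<kappa> (m - 1) j (d m c)) = (\<Sum>l\<in>L m. ract a (conv G (\<kappa> m l c) (boundary_matrix m l j)))"
    unfolding coord_d [OF m frag(2)]
    by (intro ract_sum_right frag R_conv coord_R [OF m] boundary_matrix_R)
  also have "\<dots> = (\<Sum>l\<in>L m. ract (ract a (\<kappa> m l c)) (boundary_matrix m l j))"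
    by (intro sum.cong refl ract_conv frag coord_R [OF m] boundary_matrix_R)
  finally show ?case using frag d_in by (simp add: coordinate(2))
next
  case (diff x y)
  then show ?case
    using boundary_matrix_R coordinate_in [OF m]
    by (simp only: frag_extend_diff coordinate_diff dF_in) (simp add: ract_diff_left sum_subtractf)
qed

text \<open>Reads the image of the differential from degree m + 1 in coordinates. Only the additive
  generators a \<otimes> c enter, so that m = k is allowed although degree k + 1 has no given
  basis.\<close>

lemma row_span_coordinate:
  "y \<in> carrier (F (m + 1)) \<Longrightarrow> (\<lambda>l. coordinate m l (dF (m + 1) y)) \<in> row_span S ract (boundary_rows m)"
proof (induction y rule: F_induct)
  case zero
  then show ?case using row_span.zero by (simp add: coordinate_0)
next
  case (frag a c)
  then have "(\<lambda>l. \<kappa> m l (d (m + 1) c)) \<in> boundary_rows m" unfolding boundary_rows_def by blast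
  from row_span.gen [OF frag(1) this, of ract] show ?case using frag d_in' by (simp add: coordinate(2))
next
  case (diff x y)
  then show ?case
    using row_span.diff [OF diff(3,4)] dF_in [of x "m + 1"] dF_in [of y "m + 1"]
    by (simp only: frag_extend_diff coordinate_diff add_diff_cancel_right')
qed

lemma row_span_obtain:
  "z \<in> row_span S ract (boundary_rows m) \<Longrightarrow> \<exists>y\<in>carrier (F (m + 1)). z = (\<lambda>l. coordinate m l (dF (m + 1) y))"
proof (induction z rule: row_span.induct)
  case zero
  show ?case using F_0 by (intro bexI [of _ 0]) (simp_all add: coordinate_0)
next
  case (gen a \<mu>)
  then obtain c where c: "c \<in> carrier (C (m + 1))" "\<mu> = (\<lambda>l. \<kappa> m l (d (m + 1) c))"
    unfolding boundary_rows_def by blast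
  show ?case using gen(1) c d_in' by (intro bexI [of _ "frag_of (a, c)"]) (simp_all add: coordinate(2))
next
  case (diff x y)
  then obtain u v where uv: "u \<in> carrier (F (m + 1))" "x = (\<lambda>l. coordinate m l (dF (m + 1) u))"
    "v \<in> carrier (F (m + 1))" "y = (\<lambda>l. coordinate m l (dF (m + 1) v))" by blast
  have "dF (m + 1) u \<in> carrier (F m)" "dF (m + 1) v \<in> carrier (F m)"
    using dF_in [OF uv(1)] dF_in [OF uv(3)] by simp_all
  then have "(\<lambda>l. x l - y l) = (\<lambda>l. coordinate m l (dF (m + 1) (u - v)))"
    unfolding uv(2,4) by (simp only: frag_extend_diff coordinate_diff)
  then show ?case using F_diff [OF uv(1,3)] by blast
qed

theorem trivial_tensor_homology_iff:
  "trivial_group (chain_homology T dT m) \<longleftrightarrow>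
    exact_at S ract (L m) (L (m - 1)) (boundary_matrix m) (boundary_rows m)"
proof -
  have m': "m - 1 \<le> k" using m by simp
  show ?thesis unfolding trivial_chain_homology_T
  proof
    assume H: "\<forall>x\<in>carrier (F m). dF m x \<in> Ker (m - 1) \<longrightarrow> (\<exists>y\<in>carrier (F (m + 1)). x - dF (m + 1) y \<in> Ker m)"
    show "exact_at S ract (L m) (L (m - 1)) (boundary_matrix m) (boundary_rows m)"
      unfolding exact_at_def
    proof (intro allI impI)
      fix a assume a: "\<forall>l. a l \<in> S" "\<forall>l. l \<notin> L m \<longrightarrow> a l = 0"
        and cycle: "\<forall>j\<in>L (m - 1). (\<Sum>l\<in>L m. ract (a l) (boundary_matrix m l j)) = 0"
      \<comment> \<open>The row \<open>a\<close>, realised as an element of the tensor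
        product.\<close>
      define x where "x = (\<Sum>l\<in>L m. frag_of (a l, e m l))"
      have in_F: "frag_of (a l, e m l) \<in> carrier (F m)" if "l \<in> L m" for l
        using a(1) e_in [OF m that] by simp
      then have x: "x \<in> carrier (F m)" unfolding x_def by (rule F_sum)
      have coord: "coordinate m j x = a j" for j
      proof (cases "j \<in> L m")
        case True
        have "coordinate m j x = (\<Sum>l\<in>L m. coordinate m j (frag_of (a l, e m l)))"
          unfolding x_def by (rule coordinate_sum [OF in_F])
        also have "\<dots> = (\<Sum>l\<in>L m. if l = j then a l else 0)"
          using a(1) e_in [OF m] coord_e [OF m True]
          by (intro sum.cong refl) (auto simp: coordinate(2) ract_unit ract_0_right)
        finally show ?thesis using True finite_L [OF m] by simp
      next
        case False
        then show ?thesis using coordinate_out [OF m x] a(2) by simp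
      qed
      have "dF m x \<in> Ker (m - 1)"
        using cycle by (simp add: Ker_iff [OF m' dF_in [OF x]] coordinate_dF [OF x] coord)
      then obtain y where y: "y \<in> carrier (F (m + 1))" "x - dF (m + 1) y \<in> Ker m" using H x by blast
      have "dF (m + 1) y \<in> carrier (F m)" using dF_in [OF y(1)] by simp
      then have "a = (\<lambda>l. coordinate m l (dF (m + 1) y))"
        using coordinate_Ker [OF m y(2)] coordinate_diff [OF x, of "dF (m + 1) y"] coord by auto
      then show "a \<in> row_span S ract (boundary_rows m)" using row_span_coordinate [OF y(1)] by simp
    qed
  next
    assume E: "exact_at S ract (L m) (L (m - 1)) (boundary_matrix m) (boundary_rows m)"
    show "\<forall>x\<in>carrier (F m). dF m x \<in> Ker (m - 1) \<longrightarrow> (\<exists>y\<in>carrier (F (m + 1)). x - dF (m + 1) y \<in> Ker m)"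
    proof (intro ballI impI)
      fix x assume x: "x \<in> carrier (F m)" "dF m x \<in> Ker (m - 1)"
      have "(\<lambda>l. coordinate m l x) \<in> row_span S ract (boundary_rows m)"
        using E coordinate_in [OF m x(1)] coordinate_out [OF m x(1)] coordinate_Ker [OF m' x(2)] coordinate_dF [OF x(1)]
        unfolding exact_at_def by simp
      then obtain y where y: "y \<in> carrier (F (m + 1))" "(\<lambda>l. coordinate m l x) = (\<lambda>l. coordinate m l (dF (m + 1) y))"
        using row_span_obtain by blast
      have "dF (m + 1) y \<in> carrier (F m)" using dF_in [OF y(1)] by simp
      then have "x - dF (m + 1) y \<in> Ker m"
        using fun_cong [OF y(2)] F_diff [OF x(1)] by (simp only: Ker_iff [OF m] coordinate_diff [OF x(1)]) simp
      then show "\<exists>y\<in>carrier (F (m + 1)). x - dF (m + 1) y \<in> Ker m" using y(1) by blast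
    qed
  qed
qed

end

end

section \<open>The cellular chain complex is free over the group ring\<close>

context cw_covering
begin

sublocale group G by (rule group_G)

abbreviation "gact \<equiv> cellular_group_act K U"

lemma comm_cellular: "comm_group (cellular_group K U m)"
  by (simp add: cellular_group_def)

lemma gact_hom: "gact m g \<in> hom (cellular_group K U m) (cellular_group K U m)"
  unfolding cellular_group_act_def cellular_group_def by (rule hom_induced_hom)

lemma gact_in: "c \<in> carrier (cellular_group K U m) \<Longrightarrow> gact m g c \<in> carrier (cellular_group K U m)"
  by (rule hom_in_carrier [OF gact_hom])

lemma gact_mult:
  assumes g: "g \<in> carrier G" and h: "h \<in> carrier G"
  shows "gact m (g \<otimes>\<^bsub>G\<^esub> h) c = gact m g (gact m h c)"
proof -
  let ?E = "cover_skeleton_space K U m" and ?A = "cover_skeleton K U (m - 1)"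
  have "gact m g (gact m h c) = hom_induced m ?E ?A ?E ?A (deck_action U g \<circ> deck_action U h) c"
    unfolding cellular_group_act_def
    by (rule hom_induced_compose' [OF deck_action_skeleton [OF h] deck_action_skeleton [OF g]])
  also have "hom_induced m ?E ?A ?E ?A (deck_action U g \<circ> deck_action U h)
    = hom_induced m ?E ?A ?E ?A (deck_action U (g \<otimes>\<^bsub>G\<^esub> h))"
    by (rule hom_induced_eq) (simp add: deck_action_mult [OF g h])
  finally show ?thesis by (simp add: cellular_group_act_def)
qed

text \<open>The composite of two boundaries contains the map from absolute to relative homology
  followed by the connecting map, and these compose to zero by exactness.\<close>

lemma cellular_boundary_hom:
  "cellular_boundary K U m \<in> hom (cellular_group K U m) (cellular_group K U (m - 1))"
  and cellular_boundary_gact: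
  "g \<in> carrier G \<Longrightarrow> cellular_boundary K U m (gact m g c) = gact (m - 1) g (cellular_boundary K U m c)"
  and cellular_boundary_boundary:
  "c \<in> carrier (cellular_group K U m) \<Longrightarrow>
    cellular_boundary K U (m - 1) (cellular_boundary K U m c) = \<one>\<^bsub>cellular_group K U (m - 1 - 1)\<^esub>"
proof -
  have sub: "subtopology (cover_skeleton_space K U m) (cover_skeleton K U (m - 1)) = cover_skeleton_space K U (m - 1)" for m
    using skeleton_mono [of "m - 1" m] by (auto simp: subtopology_subtopology in_cover_skeleton intro!: arg_cong [of _ _ "subtopology E"])
  have m2: "m - 2 = m - 1 - 1" for m :: int by simp
  have hom: "cellular_boundary K U m \<in> hom (cellular_group K U m) (cellular_group K U (m - 1))" for m
    using group_homomorphism_hom_relboundary [of m "cover_skeleton_space K U m" "cover_skeleton K U (m - 1)" "cover_skeleton K U (m - 2)"]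
    unfolding cellular_boundary_def cellular_group_def sub m2 .
  then show "cellular_boundary K U m \<in> hom (cellular_group K U m) (cellular_group K U (m - 1))" .
  show "cellular_boundary K U m (gact m g c) = gact (m - 1) g (cellular_boundary K U m c)" if g: "g \<in> carrier G"
    using fun_cong [OF naturality_hom_induced_relboundary [OF deck_action_skeleton(1) [OF g, of m]
        deck_action_skeleton(2) [OF g, of "m - 1"] deck_action_skeleton(2) [OF g, of "m - 2"], of m], of c]
    unfolding cellular_boundary_def cellular_group_act_def sub m2 by simp
  show "cellular_boundary K U (m - 1) (cellular_boundary K U m c) = \<one>\<^bsub>cellular_group K U (m - 1 - 1)\<^esub>"
    if c: "c \<in> carrier (cellular_group K U m)"
  proof -
    let ?X = "cover_skeleton_space K U m" and ?Y = "cover_skeleton_space K U (m - 1)"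
    let ?A = "cover_skeleton K U (m - 1 - 1)" and ?Z = "cover_skeleton_space K U (m - 1 - 1)"
    let ?b = "hom_boundary m ?X (cover_skeleton K U (m - 1)) c"
    have b: "?b \<in> carrier (homology_group (m - 1) ?Y)"
      using hom_boundary_carrier [of m ?X "cover_skeleton K U (m - 1)" c] unfolding sub .
    \<comment> \<open>The image of an absolute class lies in the kernel of the connecting map of the
      pair one degree lower.\<close>
    have "hom_induced (m - 1) ?Y {} ?Y ?A id ?b
      \<in> kernel (relative_homology_group (m - 1) ?Y ?A) (homology_group (m - 1 - 1) (subtopology ?Y ?A)) (hom_boundary (m - 1) ?Y ?A)"
      using homology_exactness_axiom_1 [of "m - 1" ?Y ?A] b by (auto simp: image_def)
    then have 1: "hom_boundary (m - 1) ?Y ?A (hom_induced (m - 1) ?Y {} ?Y ?A id ?b) = \<one>\<^bsub>homology_group (m - 1 - 1) (subtopology ?Y ?A)\<^esub>"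
      by (simp add: kernel_def)
    have "cellular_boundary K U (m - 1) (cellular_boundary K U m c)
      = hom_induced (m - 1 - 1) ?Z {} ?Z (cover_skeleton K U (m - 1 - 1 - 1)) id
          (hom_boundary (m - 1) ?Y ?A (hom_induced (m - 1) ?Y {} ?Y ?A id ?b))"
      unfolding cellular_boundary_def hom_relboundary_def sub m2 by simp
    also have "\<dots> = \<one>\<^bsub>cellular_group K U (m - 1 - 1)\<^esub>"
      unfolding 1 unfolding sub cellular_group_def by (rule hom_one [OF hom_induced_hom]) simp_all
    finally show ?thesis .
  qed
qed

lemma act_superset:
  assumes "finite F" "{g. r g \<noteq> 0} \<subseteq> F" and c: "c \<in> carrier (cellular_group K U m)"
  shows "cellular_act K U m r c = finprod (cellular_group K U m) (\<lambda>g. gact m g c [^]\<^bsub>cellular_group K U m\<^esub> r g) F"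
proof -
  interpret C: comm_group "cellular_group K U m" by (rule comm_cellular)
  show ?thesis
    unfolding cellular_act_def using assms gact_in [OF c]
    by (intro C.finprod_mono_neutral_cong_left) auto
qed

lemma act_in: "c \<in> carrier (cellular_group K U m) \<Longrightarrow> cellular_act K U m r c \<in> carrier (cellular_group K U m)"
proof -
  interpret C: comm_group "cellular_group K U m" by (rule comm_cellular)
  assume "c \<in> carrier (cellular_group K U m)"
  then show ?thesis unfolding cellular_act_def by (intro C.finprod_closed) (simp add: gact_in)
qed

lemma act_add:
  assumes "finite {g. r g \<noteq> 0}" "finite {g. s g \<noteq> 0}" and c: "c \<in> carrier (cellular_group K U m)"
  shows "cellular_act K U m (r + s) c = cellular_act K U m r c \<otimes>\<^bsub>cellular_group K U m\<^esub> cellular_act K U m s c"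
proof -
  interpret C: comm_group "cellular_group K U m" by (rule comm_cellular)
  let ?F = "{g. r g \<noteq> 0} \<union> {g. s g \<noteq> 0}"
  have F: "finite ?F" using assms by simp
  have "cellular_act K U m (r + s) c = finprod (cellular_group K U m) (\<lambda>g. gact m g c [^]\<^bsub>cellular_group K U m\<^esub> (r g + s g)) ?F"
  proof -
    have "{g. (r + s) g \<noteq> 0} \<subseteq> ?F" by auto
    from act_superset [OF F this c] show ?thesis unfolding plus_fun_def by simp
  qed
  also have "\<dots> = finprod (cellular_group K U m) (\<lambda>g. gact m g c [^]\<^bsub>cellular_group K U m\<^esub> r g) ?F
      \<otimes>\<^bsub>cellular_group K U m\<^esub> finprod (cellular_group K U m) (\<lambda>g. gact m g c [^]\<^bsub>cellular_group K U m\<^esub> s g) ?F"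
    using gact_in [OF c] by (simp add: C.int_pow_mult C.finprod_multf)
  finally show ?thesis using act_superset [OF F _ c, of r] act_superset [OF F _ c, of s] by simp
qed

lemma act_0: "cellular_act K U m 0 c = \<one>\<^bsub>cellular_group K U m\<^esub>"
  unfolding cellular_act_def zero_fun_def using comm_monoid.finprod_empty [OF comm_group.axioms(1) [OF comm_cellular]] by simp

text \<open>Serves both for the boundary map and for coordinate functionals with integer
  values.\<close>

lemma hom_act:
  assumes r: "finite {g. r g \<noteq> 0}" and h: "h \<in> hom (cellular_group K U m) H" and H: "comm_group H"
    and c: "c \<in> carrier (cellular_group K U m)"
  shows "h (cellular_act K U m r c) = finprod H (\<lambda>g. h (gact m g c) [^]\<^bsub>H\<^esub> r g) {g. r g \<noteq> 0}"
proof -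
  interpret C: comm_group "cellular_group K U m" by (rule comm_cellular)
  interpret H: comm_group H by (rule H)
  have in_C: "gact m g c [^]\<^bsub>cellular_group K U m\<^esub> r g \<in> carrier (cellular_group K U m)" for g
    using gact_in [OF c] by simp
  have "h (cellular_act K U m r c) = finprod H (\<lambda>g. h (gact m g c [^]\<^bsub>cellular_group K U m\<^esub> r g)) {g. r g \<noteq> 0}"
    unfolding cellular_act_def using in_C by (intro hom_finprod [OF comm_cellular H h]) auto
  then show ?thesis
    using hom_int_pow [OF h gact_in [OF c] C.is_group H.is_group] by simp
qed

lemma cellular_boundary_act:
  assumes r: "r \<in> carrier (group_ring G)" and c: "c \<in> carrier (cellular_group K U m)"
  shows "cellular_boundary K U m (cellular_act K U m r c) = cellular_act K U (m - 1) r (cellular_boundary K U m c)"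
proof -
  interpret C: comm_group "cellular_group K U (m - 1)" by (rule comm_cellular)
  have r': "finite {g. r g \<noteq> 0}" "\<And>g. r g \<noteq> 0 \<Longrightarrow> g \<in> carrier G"
    using r by (auto simp: group_ring_def formal_sum_ring_def formal_sums_def)
  have "gact (m - 1) g (cellular_boundary K U m c) \<in> carrier (cellular_group K U (m - 1))" for g
    by (intro gact_in hom_in_carrier [OF cellular_boundary_hom] c)
  then have "finprod (cellular_group K U (m - 1)) (\<lambda>g. cellular_boundary K U m (gact m g c) [^]\<^bsub>cellular_group K U (m - 1)\<^esub> r g) {g. r g \<noteq> 0}
    = cellular_act K U (m - 1) r (cellular_boundary K U m c)"
    unfolding cellular_act_def using r'(2) cellular_boundary_gact by (intro C.finprod_cong') auto
  then show ?thesis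
    using hom_act [OF r'(1) cellular_boundary_hom comm_cellular c] by simp
qed

end

text \<open>The freeness assumptions of \<open>module_complex\<close> in a single degree, as a
  predicate, so that bases can be found degree by degree and chosen afterwards.\<close>

definition free_coordinates ::
    "('g, 'z) monoid_scheme \<Rightarrow> 'c monoid \<Rightarrow> (('g \<Rightarrow> int) \<Rightarrow> 'c \<Rightarrow> 'c) \<Rightarrow> 'i set \<Rightarrow>
     ('i \<Rightarrow> 'c) \<Rightarrow> ('i \<Rightarrow> 'c \<Rightarrow> 'g \<Rightarrow> int) \<Rightarrow> bool" where
  "free_coordinates G C act L e \<kappa> \<longleftrightarrow>
     (\<forall>l\<in>L. e l \<in> carrier C) \<and>
     (\<forall>l. \<forall>c\<in>carrier C. \<kappa> l c \<in> carrier (group_ring G)) \<and>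
     (\<forall>l c. l \<notin> L \<longrightarrow> \<kappa> l c = 0) \<and>
     (\<forall>l. \<forall>c\<in>carrier C. \<forall>c'\<in>carrier C. \<kappa> l (c \<otimes>\<^bsub>C\<^esub> c') = \<kappa> l c + \<kappa> l c') \<and>
     (\<forall>l. \<forall>r\<in>carrier (group_ring G). \<forall>c\<in>carrier C. \<kappa> l (act r c) = conv G r (\<kappa> l c)) \<and>
     (\<forall>l\<in>L. \<forall>j\<in>L. \<kappa> l (e j) = (if l = j then \<one>\<^bsub>group_ring G\<^esub> else 0)) \<and>
     (\<forall>c\<in>carrier C. c = finprod C (\<lambda>l. act (\<kappa> l c) (e l)) L)"

section \<open>The lifted cells as a basis over the group ring\<close>

context skeleton_covering
begin

declare one_relative_homology_group [simp del]

lemma cell_class_induct [consumes 3, case_names one cell div]: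
  assumes c: "c \<in> carrier Hn"
    and gen: "\<forall>a\<in>carrier Hd. \<exists>m::int. a = \<omega> [^]\<^bsub>Hd\<^esub> m" and \<omega>: "\<omega> \<in> carrier Hd"
    and one: "P \<one>\<^bsub>Hn\<^esub>" and cell: "\<And>g j. g \<in> carrier G \<Longrightarrow> j \<in> cells K n \<Longrightarrow> P (cell_class \<omega> g j)"
    and div: "\<And>x y. x \<in> carrier Hn \<Longrightarrow> y \<in> carrier Hn \<Longrightarrow> P x \<Longrightarrow> P y \<Longrightarrow> P (x \<otimes>\<^bsub>Hn\<^esub> inv\<^bsub>Hn\<^esub> y)"
  shows "P c"
proof -
  interpret Hn: comm_group Hn by simp
  have "c \<in> generate Hn {cell_class \<omega> g j | g j. g \<in> carrier G \<and> j \<in> cells K n}"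
    using c cell_class_generate [OF bspec [OF gen] \<omega>] by blast
  then have "c \<in> carrier Hn \<and> P c"
  proof (induction rule: generate.induct)
    case (incl h)
    then show ?case using cell cell_class_in by blast
  next
    case (inv h)
    then have h: "h \<in> carrier Hn" "P h" using cell cell_class_in by blast+
    have "P (\<one>\<^bsub>Hn\<^esub> \<otimes>\<^bsub>Hn\<^esub> inv\<^bsub>Hn\<^esub> h)" by (rule div [OF Hn.one_closed h(1) one h(2)])
    then show ?case unfolding Hn.l_one [OF Hn.inv_closed [OF h(1)]] using h(1) by simp
  next
    case (eng x y)
    then have x: "x \<in> carrier Hn" "P x" and y: "y \<in> carrier Hn" "P y" by auto
    have "P (\<one>\<^bsub>Hn\<^esub> \<otimes>\<^bsub>Hn\<^esub> inv\<^bsub>Hn\<^esub> y)" by (rule div [OF Hn.one_closed y(1) one y(2)])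
    then have "P (inv\<^bsub>Hn\<^esub> y)" unfolding Hn.l_one [OF Hn.inv_closed [OF y(1)]] .
    from div [OF x(1) Hn.inv_closed [OF y(1)] x(2) this] show ?case using x(1) y(1) by simp
  qed (use one in simp)
  then show ?thesis by blast
qed

text \<open>One functional per cell, the one that singles out the chosen lift, suffices: translating
  the chain by the inverse of g first makes it read the coefficient at g.\<close>

theorem free_coordinates_cellular:
  "\<exists>e \<kappa>. free_coordinates G (cellular_group K U (int n)) (cellular_act K U (int n)) (cells K n) e \<kappa>"
proof -
  \<comment> \<open>For the zero character the Novikov ring is the group ring, and the calculus of
    convolution becomes available without any choice.\<close>
  interpret nv: novikov G "\<lambda>g. 0" by unfold_locales simp
  have C: "cellular_group K U (int n) = Hn" by (simp add: cellular_group_def)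
  interpret Hn: comm_group Hn by simp
  let ?act = "cellular_act K U (int n)" and ?gact = "gact (int n)"
  obtain \<theta> \<omega> where \<theta>: "\<theta> \<in> iso Hd integer_group" and \<omega>: "\<omega> \<in> carrier Hd" "\<theta> \<omega> = 1"
    and "\<And>a. a \<in> carrier Hd \<Longrightarrow> \<exists>m::int. a = \<omega> [^]\<^bsub>Hd\<^esub> m"
    by (rule disc_generator [of n]) (rule that)
  then have gen: "\<forall>a\<in>carrier Hd. \<exists>m::int. a = \<omega> [^]\<^bsub>Hd\<^esub> m" by blast
  have "\<exists>k. k \<in> hom Hn integer_group \<and> (\<forall>g i. g \<in> carrier G \<longrightarrow> i \<in> cells K n \<longrightarrow>
      k (cell_class \<omega> g i) = (if g = \<one>\<^bsub>G\<^esub> \<and> i = j then 1 else 0))" if "j \<in> cells K n" for j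
    by (rule cell_class_dual [OF \<theta> \<omega> that]) blast
  then obtain k where k: "\<And>j. j \<in> cells K n \<Longrightarrow> k j \<in> hom Hn integer_group"
    and k_cell: "\<And>j g i. j \<in> cells K n \<Longrightarrow> g \<in> carrier G \<Longrightarrow> i \<in> cells K n \<Longrightarrow>
      k j (cell_class \<omega> g i) = (if g = \<one>\<^bsub>G\<^esub> \<and> i = j then 1 else 0)"
    by metis
  define e where "e = cell_class \<omega> \<one>\<^bsub>G\<^esub>"
  \<comment> \<open>The coefficient of g in coordinate l is the multiplicity of the chosen lift of l
    in the translate of c by the inverse of g.\<close>
  define \<kappa> where "\<kappa> = (\<lambda>l c g. if l \<in> cells K n \<and> g \<in> carrier G then k l (?gact (inv\<^bsub>G\<^esub> g) c) else 0)"
  have gact_hom': "?gact g \<in> hom Hn Hn" for g using gact_hom [of "int n" g] unfolding C .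
  have gact_in': "c \<in> carrier Hn \<Longrightarrow> ?gact g c \<in> carrier Hn" for g c using gact_in [of c "int n" g] unfolding C .
  have mult: "\<kappa> l (c \<otimes>\<^bsub>Hn\<^esub> c') = \<kappa> l c + \<kappa> l c'" if "c \<in> carrier Hn" "c' \<in> carrier Hn" for l c c'
    using that hom_mult [OF k] gact_in' by (auto simp: \<kappa>_def hom_mult [OF gact_hom'])
  have \<kappa>_one: "\<kappa> l \<one>\<^bsub>Hn\<^esub> = 0" for l
    using mult [OF Hn.one_closed Hn.one_closed, of l] unfolding Hn.l_one [OF Hn.one_closed] by simp
  have \<kappa>_div: "\<kappa> l (c \<otimes>\<^bsub>Hn\<^esub> inv\<^bsub>Hn\<^esub> c') = \<kappa> l c - \<kappa> l c'" if "c \<in> carrier Hn" "c' \<in> carrier Hn" for l c c'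
  proof -
    have "0 = \<kappa> l c' + \<kappa> l (inv\<^bsub>Hn\<^esub> c')" using mult [of c' "inv\<^bsub>Hn\<^esub> c'" l] that(2) \<kappa>_one by simp
    then show ?thesis using mult [of c "inv\<^bsub>Hn\<^esub> c'" l] that by (simp add: add_eq_0_iff)
  qed
  have \<kappa>_cell: "\<kappa> l (cell_class \<omega> h j) = (if l = j then (\<lambda>g. if g = h then 1 else 0) else 0)"
    if l: "l \<in> cells K n" and h: "h \<in> carrier G" and j: "j \<in> cells K n" for l h j
  proof
    fix g
    show "\<kappa> l (cell_class \<omega> h j) g = (if l = j then (\<lambda>g. if g = h then 1 else 0) else 0) g"
    proof (cases "g \<in> carrier G")
      case True
      have "inv\<^bsub>G\<^esub> g \<otimes>\<^bsub>G\<^esub> h = \<one>\<^bsub>G\<^esub> \<longleftrightarrow> g = h"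
        using True h inv_equality [of "inv\<^bsub>G\<^esub> g" h] by (auto simp: l_inv)
      then show ?thesis
        using True l h j by (auto simp: \<kappa>_def act_cell_class k_cell)
    qed (use h in \<open>auto simp: \<kappa>_def\<close>)
  qed
  \<comment> \<open>Finiteness of the support is inherited from the generators, whose coordinates
    are single group elements or 0.\<close>
  have R: "\<kappa> l c \<in> carrier (group_ring G)" if c: "c \<in> carrier Hn" for l c
    using c gen \<omega>(1)
  proof (induction rule: cell_class_induct)
    case one
    then show ?case unfolding \<kappa>_one by (rule nv.R_0)
  next
    case (cell g j)
    show ?case
    proof (cases "l \<in> cells K n")
      case True
      have "finite {h. (if h = g then 1 else 0::int) \<noteq> 0}" by simp
      then show ?thesis
        using cell(1) nv.R_0 by (auto simp only: \<kappa>_cell [OF True cell] nv.R_iff split: if_splits)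
    next
      case False
      then have "\<kappa> l (cell_class \<omega> g j) = 0" by (auto simp: \<kappa>_def)
      then show ?thesis using nv.R_0 by (simp only:)
    qed
  next
    case (div x y)
    then show ?case unfolding \<kappa>_div [OF div(1,2)] by (intro nv.R_diff)
  qed
  have act: "\<kappa> l (?act r c) = conv G r (\<kappa> l c)" if r: "r \<in> carrier (group_ring G)" and c: "c \<in> carrier Hn" for l r c
  proof
    fix g
    show "\<kappa> l (?act r c) g = conv G r (\<kappa> l c) g"
    proof (cases "l \<in> cells K n \<and> g \<in> carrier G")
      case True
      then have l: "l \<in> cells K n" and g: "g \<in> carrier G" by auto
      have r': "finite {h. r h \<noteq> 0}" "{h. r h \<noteq> 0} \<subseteq> carrier G" using r by (auto simp: nv.R_iff)
      let ?h = "\<lambda>c. k l (?gact (inv\<^bsub>G\<^esub> g) c)"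
      have h: "?h \<in> hom (cellular_group K U (int n)) integer_group"
        using Group.hom_compose [OF gact_hom' k [OF l]] unfolding C o_def .
      have "\<kappa> l (?act r c) g = ?h (?act r c)" using l g by (simp add: \<kappa>_def)
      also have "\<dots> = finprod integer_group (\<lambda>x. r x * ?h (?gact x c)) {h. r h \<noteq> 0}"
        using hom_act [OF r'(1) h abelian_integer_group] c unfolding C by simp
      also have "\<dots> = (\<Sum>x | r x \<noteq> 0. r x * ?h (?gact x c))"
        using r'(1)
      proof (induction rule: finite_induct)
        case (insert x F)
        interpret Z: comm_group integer_group by (rule abelian_integer_group)
        show ?case using insert by simp
      qed (simp add: comm_monoid.finprod_empty [OF comm_group.axioms(1) [OF abelian_integer_group]])
      also have "\<dots> = (\<Sum>x | r x \<noteq> 0. r x * \<kappa> l c (inv\<^bsub>G\<^esub> x \<otimes>\<^bsub>G\<^esub> g))"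
      proof (intro sum.cong refl)
        fix x assume "x \<in> {x. r x \<noteq> 0}"
        then have x: "x \<in> carrier G" using r'(2) by blast
        \<comment> \<open>inv g times x is the inverse of inv x times g, the argument that occurs in
          the convolution.\<close>
        then have "?gact (inv\<^bsub>G\<^esub> g) (?gact x c) = ?gact (inv\<^bsub>G\<^esub> (inv\<^bsub>G\<^esub> x \<otimes>\<^bsub>G\<^esub> g)) c"
          using g by (simp add: gact_mult [symmetric] inv_mult_group)
        then show "r x * ?h (?gact x c) = r x * \<kappa> l c (inv\<^bsub>G\<^esub> x \<otimes>\<^bsub>G\<^esub> g)" using x g l by (simp add: \<kappa>_def)
      qed
      also have "\<dots> = conv G r (\<kappa> l c) g"
        using nv.conv_sum [OF r' g, of r "\<kappa> l c"] by simp
      finally show ?thesis .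
    next
      case False
      have *: "conv G r 0 g = 0" using nv.conv_zero(2) [of r] by simp
      show ?thesis
      proof (cases "l \<in> cells K n")
        case True
        then show ?thesis using False nv.conv_outside by (simp add: \<kappa>_def)
      next
        case False
        then have "\<kappa> l x = 0" for x by (auto simp: \<kappa>_def)
        then show ?thesis using * by (simp only: zero_fun_apply)
      qed
    qed
  qed
  \<comment> \<open>Expansion of a chain in the basis. It is an endomorphism that fixes all cell
    classes, hence the identity.\<close>
  let ?\<Phi> = "\<lambda>c. finprod Hn (\<lambda>l. ?act (\<kappa> l c) (e l)) (cells K n)"
  have fin: "finite (cells K n)" by (rule finite_cells) simp
  have e: "e l \<in> carrier Hn" for l unfolding e_def by (rule cell_class_in)
  have act_e: "?act r (e l) \<in> carrier Hn" for r l using act_in [of "e l" "int n" r] e unfolding C by blast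
  have \<Phi>_hom: "?\<Phi> \<in> hom Hn Hn"
  proof (rule homI)
    fix x y assume x: "x \<in> carrier Hn" and y: "y \<in> carrier Hn"
    have "?act (\<kappa> l x + \<kappa> l y) (e l) = ?act (\<kappa> l x) (e l) \<otimes>\<^bsub>Hn\<^esub> ?act (\<kappa> l y) (e l)" for l
      using act_add [of "\<kappa> l x" "\<kappa> l y" "e l" "int n"] R [OF x, of l] R [OF y, of l] e unfolding C nv.R_iff by blast
    then show "?\<Phi> (x \<otimes>\<^bsub>Hn\<^esub> y) = ?\<Phi> x \<otimes>\<^bsub>Hn\<^esub> ?\<Phi> y"
      using act_e by (simp add: mult [OF x y] Hn.finprod_multf)
  qed (use act_e in \<open>auto intro: Hn.finprod_closed\<close>)
  interpret \<Phi>: group_hom Hn Hn ?\<Phi>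
    using \<Phi>_hom by (simp add: group_hom_def group_hom_axioms_def)
  have \<Phi>: "c = ?\<Phi> c" if c: "c \<in> carrier Hn" for c
    using c gen \<omega>(1)
  proof (induction rule: cell_class_induct)
    case one
    show ?case using \<Phi>.hom_one by simp
  next
    case (cell g j)
    have supp: "{h. (if h = g then 1 else 0::int) \<noteq> 0} = {g}" by auto
    have "?act (\<lambda>h. if h = g then 1 else 0) (e j) = cell_class \<omega> g j"
      using gact_in' [OF e, of g j] cell act_cell_class [OF cell(1) one_G(1) cell(2)]
      unfolding cellular_act_def supp C by (simp add: e_def)
    then have "?act (\<kappa> l (cell_class \<omega> g j)) (e l) = (if l = j then cell_class \<omega> g j else \<one>\<^bsub>Hn\<^esub>)" if "l \<in> cells K n" for l
      using \<kappa>_cell [OF that cell] act_0 [of "int n" "e l"]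
      unfolding C by auto
    then have "?\<Phi> (cell_class \<omega> g j) = finprod Hn (\<lambda>l. if l = j then cell_class \<omega> g j else \<one>\<^bsub>Hn\<^esub>) (cells K n)"
      using cell_class_in by (intro Hn.finprod_cong') auto
    also have "\<dots> = cell_class \<omega> g j"
      using Hn.finprod_singleton_swap [OF cell(2) fin, of "\<lambda>l. cell_class \<omega> g j"] cell_class_in by simp
    finally show ?case by simp
  next
    case (div x y)
    have "?\<Phi> (x \<otimes>\<^bsub>Hn\<^esub> inv\<^bsub>Hn\<^esub> y) = ?\<Phi> x \<otimes>\<^bsub>Hn\<^esub> inv\<^bsub>Hn\<^esub> ?\<Phi> y"
      using div(1,2) by (simp add: \<Phi>.hom_inv)
    then show ?case using div(3,4) by simp
  qed
  have \<kappa>_e: "\<kappa> l (e j) = (if l = j then \<one>\<^bsub>group_ring G\<^esub> else 0)" if "l \<in> cells K n" "j \<in> cells K n" for l j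
    using \<kappa>_cell [OF that(1) one_G(1) that(2)] by (simp add: e_def nv.unit_sum_eq)
  have \<kappa>_out: "\<kappa> l c = 0" if "l \<notin> cells K n" for l c using that by (auto simp: \<kappa>_def)
  have "free_coordinates G Hn ?act (cells K n) e \<kappa>"
    unfolding free_coordinates_def
    by (intro conjI ballI allI impI; (rule e | rule R | rule \<kappa>_out | rule mult | rule act | rule \<kappa>_e | rule \<Phi>); assumption)
  then show ?thesis unfolding C by blast
qed

end

section \<open>Homology with coefficients in a character\<close>

context module_complex
begin

lemma coord_div:
  assumes "m \<le> k" "c \<in> carrier (C m)" "c' \<in> carrier (C m)"
  shows "\<kappa> m l (c \<otimes>\<^bsub>C m\<^esub> inv\<^bsub>C m\<^esub> c') = \<kappa> m l c - \<kappa> m l c'"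
proof -
  interpret Cm: comm_group "C m" by (rule comm)
  have "0 = \<kappa> m l c' + \<kappa> m l (inv\<^bsub>C m\<^esub> c')"
    using coord_mult [OF assms(1,3), of "inv\<^bsub>C m\<^esub> c'" l] coord_one [OF assms(1), of l] assms(3) by simp
  then show ?thesis
    using coord_mult [OF assms(1,2), of "inv\<^bsub>C m\<^esub> c'" l] assms(3) by (simp add: add_eq_0_iff)
qed

text \<open>Passes from integer to natural degrees: the basis one degree below becomes
  \<open>L (int i - 1)\<close>, and emptiness of \<open>L (- 1)\<close> starts the induction over
  degrees.\<close>

lemma free_complex_boundary:
  assumes nc: "novikov_character G \<psi> \<rho>" and q: "int q \<le> k" and empty: "L (- 1) = {}"
    and exact: "\<And>i. i \<le> q \<Longrightarrow> exact_at (carrier (novikov_ring G \<psi>)) (conv G)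
      (L (int i)) (L (int i - 1)) (boundary_matrix (int i)) (boundary_rows (int i))"
  shows "free_complex G \<psi> \<rho> q (\<lambda>i. L (int i)) (\<lambda>i. L (int i - 1))
    (\<lambda>i. boundary_matrix (int i)) (\<lambda>i. boundary_rows (int i))"
proof -
  interpret nc: novikov_character G \<psi> \<rho> by (rule nc)
  have le: "int i \<le> k" "int i - 1 \<le> k" if "i \<le> q" for i using that q by auto
  have rows: "\<exists>c\<in>carrier (C (int i + 1)). \<mu> = (\<lambda>l. \<kappa> (int i) l (d (int i + 1) c))"
    if "\<mu> \<in> boundary_rows (int i)" for \<mu> i
    using that unfolding boundary_rows_def by blast
  have rowsI: "(\<lambda>l. \<kappa> (int i) l (d (int i + 1) c)) \<in> boundary_rows (int i)"
    if "c \<in> carrier (C (int i + 1))" for c i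
    using that unfolding boundary_rows_def by blast
  have hom: "d (int i + 1) \<in> hom (C (int i + 1)) (C (int i))" for i
    using d_hom [of "int i + 1"] by simp
  have grp: "group (C m)" for m using comm by (simp add: comm_group_def)
  show ?thesis
  proof unfold_locales
    show "finite (L (int i))" if "i \<le> q" for i by (rule finite_L [OF le(1) [OF that]])
    show "L (int 0 - 1) = {}" using empty by simp
    show "L (int (Suc i) - 1) = L (int i)" for i by simp
    show "boundary_matrix (int i) l m \<in> R" if "i \<le> q" "l \<in> L (int i)" for i l m
      unfolding boundary_matrix_def using le [OF that(1)] that(2) by (intro coord_R d_in e_in) auto
    show "\<mu> l \<in> R" if "i \<le> q" "\<mu> \<in> boundary_rows (int i)" for i \<mu> l
      using rows [OF that(2)] coord_R [OF le(1) [OF that(1)]] d_in' by blast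
    show "\<mu> l = 0" if "i \<le> q" "\<mu> \<in> boundary_rows (int i)" "l \<notin> L (int i)" for i \<mu> l
      using rows [OF that(2)] coord_out [OF le(1) [OF that(1)] that(3)] by auto
    show "(\<lambda>l. 0) \<in> boundary_rows (int i)" if "i \<le> q" for i
      using rowsI [OF monoid.one_closed [OF group.is_monoid [OF grp]], of i]
      unfolding hom_one [OF hom grp grp] coord_one [OF le(1) [OF that]] .
    show "(\<lambda>l. \<mu> l - \<nu> l) \<in> boundary_rows (int i)"
      if asm: "i \<le> q" "\<mu> \<in> boundary_rows (int i)" "\<nu> \<in> boundary_rows (int i)" for i \<mu> \<nu>
    proof -
      interpret dh: group_hom "C (int i + 1)" "C (int i)" "d (int i + 1)"
        using hom grp by (simp add: group_hom_def group_hom_axioms_def)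
      obtain c c' where c: "c \<in> carrier (C (int i + 1))" "\<mu> = (\<lambda>l. \<kappa> (int i) l (d (int i + 1) c))"
        and c': "c' \<in> carrier (C (int i + 1))" "\<nu> = (\<lambda>l. \<kappa> (int i) l (d (int i + 1) c'))"
        using rows [OF asm(2)] rows [OF asm(3)] by blast
      have "(\<lambda>l. \<mu> l - \<nu> l) = (\<lambda>l. \<kappa> (int i) l (d (int i + 1) (c \<otimes>\<^bsub>C (int i + 1)\<^esub> inv\<^bsub>C (int i + 1)\<^esub> c')))"
        using c c' by (simp add: coord_div [OF le(1) [OF asm(1)]])
      moreover have "c \<otimes>\<^bsub>C (int i + 1)\<^esub> inv\<^bsub>C (int i + 1)\<^esub> c' \<in> carrier (C (int i + 1))"
        using c(1) c'(1) by simp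
      ultimately show ?thesis using rowsI by (simp only:)
    qed
    show "(\<lambda>l. conv G r (\<mu> l)) \<in> boundary_rows (int i)"
      if asm: "i \<le> q" "\<mu> \<in> boundary_rows (int i)" "r \<in> R" for i \<mu> r
    proof -
      obtain c where c: "c \<in> carrier (C (int i + 1))" "\<mu> = (\<lambda>l. \<kappa> (int i) l (d (int i + 1) c))"
        using rows [OF asm(2)] by blast
      have "(\<lambda>l. conv G r (\<mu> l)) = (\<lambda>l. \<kappa> (int i) l (d (int i + 1) (act (int i + 1) r c)))"
        using d_act [OF asm(3) c(1)] coord_act [OF le(1) [OF asm(1)] asm(3) d_in' [OF c(1)]] c(2) by simp
      then show ?thesis using rowsI [OF act_closed [OF asm(3) c(1)]] by (simp only:)
    qed
    show "(\<Sum>l\<in>L (int i). conv G (\<mu> l) (boundary_matrix (int i) l m)) = 0"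
      if asm: "i \<le> q" "\<mu> \<in> boundary_rows (int i)" for i \<mu> m
    proof -
      obtain c where c: "c \<in> carrier (C (int i + 1))" "\<mu> = (\<lambda>l. \<kappa> (int i) l (d (int i + 1) c))"
        using rows [OF asm(2)] by blast
      have "d (int i) (d (int i + 1) c) = \<one>\<^bsub>C (int i - 1)\<^esub>" using dd [OF c(1)] by simp
      then show ?thesis
        using coord_d [OF le(1) [OF asm(1)] d_in' [OF c(1)], of m] coord_one [OF le(2) [OF asm(1)], of m] c(2) by simp
    qed
    show "boundary_matrix (int (Suc i)) j \<in> boundary_rows (int i)" if "i < q" "j \<in> L (int (Suc i))" for i j
      using rowsI [OF e_in, of i j] that le [of "Suc i"] by (simp add: boundary_matrix_def [abs_def] add.commute)
    show "\<exists>r. (\<forall>j. r j \<in> R) \<and>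
        (\<forall>l\<in>L (int i). \<mu> l = (\<Sum>j\<in>L (int (Suc i)). conv G (r j) (boundary_matrix (int (Suc i)) j l)))"
      if asm: "i < q" "\<mu> \<in> boundary_rows (int i)" for i \<mu>
    proof -
      obtain c where c: "c \<in> carrier (C (int i + 1))" "\<mu> = (\<lambda>l. \<kappa> (int i) l (d (int i + 1) c))"
        using rows [OF asm(2)] by blast
      \<comment> \<open>The strict bound i < q secures coordinates one degree higher; at i = q = k
        there are none.\<close>
      have m: "int i + 1 \<le> k" using asm(1) le [of "Suc i"] by simp
      show ?thesis
        using coord_R [OF m c(1)] coord_d [OF m c(1)] c(2)
        by (intro exI [of _ "\<lambda>j. \<kappa> (int i + 1) j c"]) (simp add: add.commute)
    qed
  qed (rule exact)
qed

text \<open>One free complex is read with two coefficient modules. The coordinate criterion is used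
  in one direction for the Novikov ring and in the other for the field.\<close>

theorem trivial_homology_character:
  fixes \<rho> :: "'g \<Rightarrow> 'k::field"
  assumes nc: "novikov_character G \<psi> \<rho>" and q: "int q \<le> k" and empty: "L (- 1) = {}"
    and trivial: "\<And>i. i \<le> q \<Longrightarrow> trivial_group (chain_homology
        (\<lambda>m. tensor_product (group_ring G) (add_monoid (novikov_ring G \<psi>)) (mult (novikov_ring G \<psi>)) (C m) (act m))
        (\<lambda>m. tensor_map (group_ring G) (add_monoid (novikov_ring G \<psi>)) (mult (novikov_ring G \<psi>)) (C (m - 1)) (act (m - 1)) (d m))
        (int i))"
    and no_unit: "\<And>r. r \<in> carrier (group_ring G) \<Longrightarrow> (\<And>g. r g \<noteq> 0 \<Longrightarrow> \<psi> g < 0) \<Longrightarrow> eval_character \<rho> r \<noteq> 1"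
    and i: "i \<le> q"
  shows "trivial_group (chain_homology
        (\<lambda>m. tensor_product (group_ring G) additive_group (\<lambda>a r. a * eval_character \<rho> r) (C m) (act m))
        (\<lambda>m. tensor_map (group_ring G) additive_group (\<lambda>a r. a * eval_character \<rho> r) (C (m - 1)) (act (m - 1)) (d m))
        (int i))"
proof -
  interpret nc: novikov_character G \<psi> \<rho> by (rule nc)
  have mult: "mult (novikov_ring G \<psi>) = conv G" by (simp add: novikov_ring_def formal_sum_ring_def)
  interpret Nov: module_complex_coefficients G C act d k L e \<kappa> "add_monoid (novikov_ring G \<psi>)" "mult (novikov_ring G \<psi>)"
  proof unfold_locales
    show "a \<otimes>\<^bsub>add_monoid (novikov_ring G \<psi>)\<^esub> b = a + b" for a b
      by (simp add: novikov_ring_def formal_sum_ring_def plus_fun_def)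
    show "a - b \<in> carrier (add_monoid (novikov_ring G \<psi>))"
      if "a \<in> carrier (add_monoid (novikov_ring G \<psi>))" "b \<in> carrier (add_monoid (novikov_ring G \<psi>))" for a b
      using nc.N_diff that by (simp only: monoid.select_convs partial_object.select_convs)
  qed (use nc.R_subset_N nc.N_0 nc.R_0 nc.R_add nc.conv_R in \<open>auto simp only: mult monoid.select_convs partial_object.select_convs
        intro!: nc.conv_N nc.conv_add_left nc.conv_add_right nc.conv_assoc [symmetric] nc.conv_unit_right\<close>)
  interpret Fld: module_complex_coefficients G C act d k L e \<kappa> additive_group "\<lambda>a r. a * eval_character \<rho> r"
    by unfold_locales (use nc.R_0 nc.R_add nc.conv_R in \<open>auto simp only: additive_group_def monoid.select_convs partial_object.select_convs
        UNIV_I distrib_right distrib_left nc.ev_add nc.ev_conv nc.ev_unit mult.assoc mult_1_right\<close>)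
  have le: "int i \<le> k" if "i \<le> q" for i using that q by simp
  interpret fc: free_complex G \<psi> \<rho> q "\<lambda>i. L (int i)" "\<lambda>i. L (int i - 1)" "\<lambda>i. boundary_matrix (int i)" "\<lambda>i. boundary_rows (int i)"
  proof (rule free_complex_boundary [OF nc q empty])
    show "exact_at nc.N (conv G) (L (int i)) (L (int i - 1)) (boundary_matrix (int i)) (boundary_rows (int i))" if "i \<le> q" for i
      using trivial [OF that] unfolding Nov.trivial_tensor_homology_iff [OF le [OF that]] by (simp add: mult)
  qed
  have "exact_at UNIV (\<lambda>a r. a * eval_character \<rho> r) (L (int i)) (L (int i - 1)) (boundary_matrix (int i)) (boundary_rows (int i))"
    using no_unit by (intro fc.exact_at_field [OF i]) (auto simp: nc.negative_def)
  then show ?thesis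
    unfolding Fld.trivial_tensor_homology_iff [OF le [OF i]] by (simp add: additive_group_def)
qed

end

section \<open>Application to the cellular complex of the universal cover\<close>

context cw_covering
begin

text \<open>The common core of both parts: they differ only in the choice of \<psi> and in the
  reason for \<open>no_unit\<close>.\<close>

theorem trivial_twisted_homology:
  fixes \<rho> :: "(real \<Rightarrow> 'a) set \<Rightarrow> 'k::field"
  assumes fin: "\<And>n. n \<le> q \<Longrightarrow> finite (cells K n)"
    and \<psi>: "\<psi> \<in> hom G additive_group" and \<rho>: "\<rho> \<in> hom G unit_group"
    and trivial: "\<And>i. i \<le> q \<Longrightarrow> trivial_group (twisted_homology K U
        (add_monoid (novikov_ring G \<psi>)) (mult (novikov_ring G \<psi>)) (int i))"
    and no_unit: "\<And>r. r \<in> carrier (group_ring G) \<Longrightarrow> (\<And>g. r g \<noteq> 0 \<Longrightarrow> \<psi> g < 0) \<Longrightarrow> eval_character \<rho> r \<noteq> 1"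
    and i: "i \<le> q"
  shows "trivial_group (twisted_homology K U (additive_group :: 'k monoid) (\<lambda>a r. a * eval_character \<rho> r) (int i))"
proof -
  have nc: "novikov_character G \<psi> \<rho>"
    using hom_mult [OF \<psi>] \<rho> by unfold_locales (auto simp: additive_group_def)
  interpret nc: novikov_character G \<psi> \<rho> by (rule nc)
  let ?C = "cellular_group K U" and ?act = "cellular_act K U"
  \<comment> \<open>In negative degrees the chain groups vanish and the empty family is a
    basis.\<close>
  define L where "L = (\<lambda>m::int. if m < 0 then {} else cells K (nat m))"
  have "\<exists>e \<kappa>. free_coordinates G (?C m) (?act m) (L m) e \<kappa>" if m: "m \<le> int q" for m
  proof (cases "m < 0")
    case True
    interpret Cm: comm_group "?C m" by (rule comm_cellular)
    have "carrier (?C m) = {\<one>\<^bsub>?C m\<^esub>}"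
      using trivial_relative_homology_group [OF True] unfolding cellular_group_def trivial_group_def by blast
    then have "free_coordinates G (?C m) (?act m) (L m) (\<lambda>l. undefined) (\<lambda>l c. 0)"
      using True nc.R_0 by (simp add: free_coordinates_def L_def nc.conv_zero del: zero_fun_apply)
    then show ?thesis by blast
  next
    case False
    interpret skeleton_covering K U "nat m"
      using fin m False by unfold_locales auto
    show ?thesis using free_coordinates_cellular False by (simp add: L_def)
  qed
  \<comment> \<open>Basis and coordinates are packed into a pair, so that one choice function serves
    all degrees.\<close>
  then have "\<forall>m. \<exists>c. m \<le> int q \<longrightarrow> free_coordinates G (?C m) (?act m) (L m) (fst c) (snd c)"
    by (metis fst_conv snd_conv)
  from choice [OF this] obtain c
    where "\<forall>m. m \<le> int q \<longrightarrow> free_coordinates G (?C m) (?act m) (L m) (fst (c m)) (snd (c m))" ..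
  then have "free_coordinates G (?C m) (?act m) (L m) (fst (c m)) (snd (c m))" if "m \<le> int q" for m
    using that by simp
  note coords = this [unfolded free_coordinates_def]
  note rest = coords [THEN conjunct2] coords [THEN conjunct2, THEN conjunct2]
    coords [THEN conjunct2, THEN conjunct2, THEN conjunct2]
    coords [THEN conjunct2, THEN conjunct2, THEN conjunct2, THEN conjunct2]
    coords [THEN conjunct2, THEN conjunct2, THEN conjunct2, THEN conjunct2, THEN conjunct2]
  note basis = coords [THEN conjunct1, rule_format] rest [THEN conjunct1, rule_format]
    rest(5) [THEN conjunct2, rule_format]
  interpret module_complex G ?C ?act "cellular_boundary K U" "int q" L "\<lambda>m. fst (c m)" "\<lambda>m. snd (c m)"
  proof (intro module_complex.intro module_complex_axioms.intro)
    show "Group.group G" by (rule group_G)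
    show "comm_group (?C m)" for m by (rule comm_cellular)
    show "?act m r c \<in> carrier (?C m)" if "c \<in> carrier (?C m)" for m r c using that by (rule act_in)
    show "cellular_boundary K U m \<in> hom (?C m) (?C (m - 1))" for m by (rule cellular_boundary_hom)
    show "cellular_boundary K U (m - 1) (cellular_boundary K U m c) = \<one>\<^bsub>?C (m - 1 - 1)\<^esub>"
      if "c \<in> carrier (?C m)" for m c using that by (rule cellular_boundary_boundary)
    show "cellular_boundary K U m (?act m r c) = ?act (m - 1) r (cellular_boundary K U m c)"
      if "r \<in> carrier (group_ring G)" "c \<in> carrier (?C m)" for m r c using that by (rule cellular_boundary_act)
    show "finite (L m)" if "m \<le> int q" for m using fin [of "nat m"] that by (simp add: L_def)
  qed (rule basis; assumption)+
  show ?thesis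
    unfolding twisted_homology_def
    by (rule trivial_homology_character [OF nc _ _ trivial [unfolded twisted_homology_def] no_unit i])
      (simp_all add: L_def)
qed

end

section \<open>Valuations and algebraic integers\<close>

text \<open>The alternative of being 0 is carried along because the value of \<open>v\<close> at 0
  has no meaning.\<close>

lemma valuation_sum_positive:
  fixes v :: "'k::field \<Rightarrow> real"
  assumes v: "valuation v" and "\<And>j. j \<in> J \<Longrightarrow> f j = 0 \<or> v (f j) > 0"
  shows "sum f J = 0 \<or> v (sum f J) > 0"
  using assms(2)
proof (induction J rule: infinite_finite_induct)
  case (insert j J)
  then have 1: "f j = 0 \<or> v (f j) > 0" and 2: "sum f J = 0 \<or> v (sum f J) > 0" by auto
  have "v (f j + sum f J) \<ge> min (v (f j)) (v (sum f J))" if "f j \<noteq> 0" "sum f J \<noteq> 0" "f j + sum f J \<noteq> 0"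
    using v that unfolding valuation_def by blast
  then show ?case using 1 2 insert(1,2) by (cases "f j = 0"; cases "sum f J = 0"; cases "f j + sum f J = 0") auto
qed auto

lemma valuation_mult: "valuation v \<Longrightarrow> a \<noteq> 0 \<Longrightarrow> b \<noteq> 0 \<Longrightarrow> v (a * b) = v a + v b"
  using hom_mult [of v unit_group additive_group a b] by (simp add: valuation_def unit_group_def additive_group_def)

text \<open>Both 1 and -1 have valuation 0, since their squares are 1. Natural numbers follow by
  adding 1 repeatedly, negative integers by multiplicativity.\<close>

lemma valuation_of_int:
  fixes v :: "'k::field \<Rightarrow> real"
  assumes v: "valuation v" and n: "(of_int n :: 'k) \<noteq> 0"
  shows "v (of_int n) \<ge> 0"
proof -
  have one: "v 1 = 0" using valuation_mult [OF v, of 1 1] by simp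
  have minus_one: "v (- 1) = 0" using valuation_mult [OF v, of "- 1" "- 1"] one by simp
  have nat: "(of_nat m :: 'k) = 0 \<or> v (of_nat m) \<ge> 0" for m
  proof (induction m)
    case (Suc m)
    have "v (1 + of_nat m) \<ge> min (v 1) (v (of_nat m))" if "(of_nat m :: 'k) \<noteq> 0" "1 + (of_nat m :: 'k) \<noteq> 0"
      using v that unfolding valuation_def by (metis zero_neq_one)
    then show ?case using Suc one by (cases "(of_nat m :: 'k) = 0") auto
  qed simp
  show ?thesis
  proof (cases n rule: int_cases2)
    case (nonneg m)
    then show ?thesis using nat [of m] n by simp
  next
    case (nonpos m)
    then have "(of_int n :: 'k) = - 1 * of_nat m" "(of_nat m :: 'k) \<noteq> 0" using n by auto
    then show ?thesis using valuation_mult [OF v, of "- 1" "of_nat m"] minus_one nat [of m] by simp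
  qed
qed

text \<open>Integer coefficients do not lower the valuation, so the value is 0 or of positive
  valuation, whereas 1 has valuation 0.\<close>

lemma valuation_eval_character:
  fixes v :: "'k::field \<Rightarrow> real"
  assumes v: "valuation v" and r: "\<And>g. r g \<noteq> 0 \<Longrightarrow> \<rho> g \<noteq> 0 \<and> v (\<rho> g) > 0"
  shows "eval_character \<rho> r \<noteq> 1"
proof -
  have "of_int (r g) * \<rho> g = 0 \<or> v (of_int (r g) * \<rho> g) > 0" if "r g \<noteq> 0" for g
    using r [OF that] valuation_mult [OF v, of "of_int (r g)" "\<rho> g"] valuation_of_int [OF v, of "r g"]
    by (cases "(of_int (r g) :: 'k) = 0") auto
  then have "eval_character \<rho> r = 0 \<or> v (eval_character \<rho> r) > 0"
    unfolding eval_character_def by (intro valuation_sum_positive [OF v]) blast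
  moreover have "v 1 = 0" using valuation_mult [OF v, of 1 1] by simp
  ultimately show ?thesis by auto
qed

text \<open>The element is pushed forward along \<open>chi\<close> before it is subtracted from 1.
  The leading exponent is then 0, where the pushforward contributes nothing because
  \<open>chi\<close> is negative on the support of \<open>r\<close>.\<close>

lemma algebraic_integerI:
  fixes \<rho> :: "real \<Rightarrow> 'k::field" and chi :: "'g \<Rightarrow> real"
  assumes G: "group G" and chi: "chi \<in> hom G additive_group" and \<rho>: "\<rho> \<in> hom (image_group G chi) unit_group"
    and r: "r \<in> carrier (group_ring G)" "\<And>g. r g \<noteq> 0 \<Longrightarrow> chi g < 0" "eval_character (\<rho> \<circ> chi) r = 1"
  shows "algebraic_integer (image_group G chi) (\<lambda>\<gamma>. \<gamma>) \<rho>"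
proof -
  interpret group G by (rule G)
  have "chi \<one>\<^bsub>G\<^esub> = 0"
    using hom_mult [OF chi, of "\<one>\<^bsub>G\<^esub>" "\<one>\<^bsub>G\<^esub>"] by (simp add: additive_group_def)
  then have 0: "0 \<in> chi ` carrier G" using one_closed by (metis imageI)
  have \<rho>0: "\<rho> 0 = 1"
    using hom_mult [OF \<rho>, of 0 0] hom_in_carrier [OF \<rho>, of 0] 0
    by (simp add: image_group_def additive_group_def unit_group_def)
  have fin: "finite {g. r g \<noteq> 0}" and supp: "\<And>g. r g \<noteq> 0 \<Longrightarrow> g \<in> carrier G"
    using r(1) by (auto simp: group_ring_def formal_sum_ring_def formal_sums_def)
  \<comment> \<open>The image of \<open>r\<close> in the group ring of the value group; coefficients
    of group elements with the same value are added and may cancel.\<close>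
  define s where "s = (\<lambda>\<gamma>. \<Sum>g | r g \<noteq> 0 \<and> chi g = \<gamma>. r g)"
  define \<Delta> where "\<Delta> = (\<lambda>\<gamma>. (if \<gamma> = 0 then 1 else 0) - s \<gamma>)"
  have s: "\<exists>g. r g \<noteq> 0 \<and> chi g = \<gamma>" if "s \<gamma> \<noteq> 0" for \<gamma>
    using that unfolding s_def by (metis (mono_tags, lifting) mem_Collect_eq sum.not_neutral_contains_not_neutral)
  let ?F = "insert 0 (chi ` {g. r g \<noteq> 0})"
  have F: "finite ?F" using fin by simp
  have \<Delta>: "{\<gamma>. \<Delta> \<gamma> \<noteq> 0} \<subseteq> ?F" using s by (force simp: \<Delta>_def split: if_splits)
  have s0: "s 0 = 0" using s r(2) by fastforce
  have "?F \<subseteq> chi ` carrier G" using 0 supp by auto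
  then have "\<Delta> \<in> carrier (group_ring (image_group G chi))"
    using \<Delta> finite_subset [OF \<Delta> F]
    by (auto simp: group_ring_def formal_sum_ring_def formal_sums_def image_group_def)
  moreover have "eval_character \<rho> \<Delta> = 0"
  proof -
    have "eval_character \<rho> \<Delta> = (\<Sum>\<gamma>\<in>?F. of_int (\<Delta> \<gamma>) * \<rho> \<gamma>)"
      unfolding eval_character_def using F \<Delta> by (intro sum.mono_neutral_left) auto
    also have "\<dots> = (\<Sum>\<gamma>\<in>?F. (if \<gamma> = 0 then 1 else 0) * \<rho> \<gamma>) - (\<Sum>\<gamma>\<in>?F. of_int (s \<gamma>) * \<rho> \<gamma>)"
      unfolding sum_subtractf [symmetric] by (intro sum.cong) (auto simp: \<Delta>_def algebra_simps)
    also have "(\<Sum>\<gamma>\<in>?F. (if \<gamma> = 0 then 1 else 0) * \<rho> \<gamma>) = 1"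
      using \<rho>0 F by (simp add: if_distrib [of "\<lambda>x. x * _"] cong: if_cong)
    also have "(\<Sum>\<gamma>\<in>?F. of_int (s \<gamma>) * \<rho> \<gamma>)
        = (\<Sum>\<gamma>\<in>?F. \<Sum>g\<in>{g \<in> {g. r g \<noteq> 0}. chi g = \<gamma>}. of_int (r g) * \<rho> (chi g))"
      by (intro sum.cong refl) (simp add: s_def sum_distrib_right)
    also have "\<dots> = eval_character (\<rho> \<circ> chi) r"
      unfolding eval_character_def o_apply by (rule sum.group [OF fin F]) auto
    finally show ?thesis using r(3) by simp
  qed
  moreover have "\<Delta> 0 = 1" using s0 by (simp add: \<Delta>_def)
  moreover have "\<gamma> \<le> 0" if "\<Delta> \<gamma> \<noteq> 0" for \<gamma>
    using \<Delta> that r(2) by fastforce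
  ultimately show ?thesis
    unfolding algebraic_integer_def by (intro bexI [of _ \<Delta>] conjI exI [of _ 0]) auto
qed

theorem theorem1p2:
  fixes K :: "('a, 'i) cell_structure"
    and U :: "('a, 'b) pointed_cover"
    and k :: nat
  assumes "cw_complex K"
    and "connected_space (cw_space K)"
    and "k \<ge> 1"
    and "\<And>n. n \<le> k \<Longrightarrow> finite (cells K n)"
    and "universal_cover (cw_space K) U"
  shows
    "(\<forall>q (\<rho> :: (real \<Rightarrow> 'a) set \<Rightarrow> 'k::field) (v :: 'k \<Rightarrow> real).
        q \<le> k \<longrightarrow>
        \<rho> \<in> hom (cw_pi1 K U) unit_group \<longrightarrow>
        \<rho> \<in> (\<Union>i\<le>q. char_variety K U i) \<longrightarrow>
        valuation v \<longrightarrow>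
        (\<exists>g \<in> carrier (cw_pi1 K U). v (\<rho> g) \<noteq> 0) \<longrightarrow>
        v \<circ> \<rho> \<notin> Sigma_inv K U q)
     \<and>
     (\<forall>q (chi :: (real \<Rightarrow> 'a) set \<Rightarrow> real) (\<rho> :: real \<Rightarrow> 'k).
        q \<le> k \<longrightarrow>
        chi \<in> hom (cw_pi1 K U) additive_group \<longrightarrow>
        (\<lambda>g. - chi g) \<in> Sigma_inv K U q \<longrightarrow>
        \<rho> \<in> hom (image_group (cw_pi1 K U) chi) unit_group \<longrightarrow>
        \<not> algebraic_integer (image_group (cw_pi1 K U) chi) (\<lambda>\<gamma>. \<gamma>) \<rho> \<longrightarrow>
        \<rho> \<circ> chi \<notin> (\<Union>i\<le>q. char_variety K U i))"
proof (intro conjI allI impI)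
  interpret cw_covering K U
    using assms(1,5) by (simp add: cw_covering_def universal_covering_def)
  show "v \<circ> \<rho> \<notin> Sigma_inv K U q"
    if q: "q \<le> k" and \<rho>: "\<rho> \<in> hom (cw_pi1 K U) unit_group" "\<rho> \<in> (\<Union>i\<le>q. char_variety K U i)"
      and v: "valuation v"
    for q and \<rho> :: "(real \<Rightarrow> 'a) set \<Rightarrow> 'k" and v
  proof
    assume S: "v \<circ> \<rho> \<in> Sigma_inv K U q"
    \<comment> \<open>\<open>Sigma_inv\<close> negates its character. With this sign, \<psi> < 0
      means that \<rho> takes a value of positive valuation.\<close>
    let ?\<psi> = "\<lambda>g. - (v \<circ> \<rho>) g"
    have "v \<circ> \<rho> \<in> hom G additive_group" using S by (simp add: Sigma_inv_def)
    then have \<psi>: "?\<psi> \<in> hom G additive_group" by (auto simp: hom_def additive_group_def)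
    have no_unit: "eval_character \<rho> r \<noteq> 1"
      if r: "r \<in> carrier (group_ring G)" and neg: "\<And>g. r g \<noteq> 0 \<Longrightarrow> ?\<psi> g < 0" for r
    proof (rule valuation_eval_character [OF v])
      fix g assume g: "r g \<noteq> 0"
      then have "g \<in> carrier G" using r by (auto simp: group_ring_def formal_sum_ring_def formal_sums_def)
      then show "\<rho> g \<noteq> 0 \<and> v (\<rho> g) > 0"
        using hom_in_carrier [OF \<rho>(1)] neg [OF g] by (simp add: unit_group_def)
    qed
    obtain i where i: "i \<le> q" "\<rho> \<in> char_variety K U i" using \<rho>(2) by blast
    have "trivial_group (twisted_homology K U (additive_group :: 'k monoid) (\<lambda>a r. a * eval_character \<rho> r) (int i))"
    proof (rule trivial_twisted_homology [OF _ \<psi> \<rho>(1) _ _ i(1)])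
      show "finite (cells K n)" if "n \<le> q" for n using assms(4) q that by simp
      show "trivial_group (twisted_homology K U (add_monoid (novikov_ring G ?\<psi>)) (mult (novikov_ring G ?\<psi>)) (int i))"
        if "i \<le> q" for i using S that unfolding Sigma_inv_def by blast
    qed (rule no_unit)
    then show False using i(2) by (simp add: char_variety_def)
  qed
  show "\<rho> \<circ> chi \<notin> (\<Union>i\<le>q. char_variety K U i)"
    if q: "q \<le> k" and chi: "chi \<in> hom (cw_pi1 K U) additive_group" and S: "(\<lambda>g. - chi g) \<in> Sigma_inv K U q"
      and \<rho>: "\<rho> \<in> hom (image_group (cw_pi1 K U) chi) unit_group"
      and not_integer: "\<not> algebraic_integer (image_group (cw_pi1 K U) chi) (\<lambda>\<gamma>. \<gamma>) \<rho>"
    for q chi and \<rho> :: "real \<Rightarrow> 'k"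
  proof
    assume "\<rho> \<circ> chi \<in> (\<Union>i\<le>q. char_variety K U i)"
    then obtain i where i: "i \<le> q" "\<rho> \<circ> chi \<in> char_variety K U i" by blast
    have \<rho>chi: "\<rho> \<circ> chi \<in> hom G unit_group" using i(2) by (simp add: char_variety_def)
    have "eval_character (\<rho> \<circ> chi) r \<noteq> 1" if "r \<in> carrier (group_ring G)" "\<And>g. r g \<noteq> 0 \<Longrightarrow> chi g < 0" for r
      using algebraic_integerI [OF group_G chi \<rho> that] not_integer by blast
    note no_unit = this
    have "trivial_group (twisted_homology K U (additive_group :: 'k monoid) (\<lambda>a r. a * eval_character (\<rho> \<circ> chi) r) (int i))"
    proof (rule trivial_twisted_homology [OF _ chi \<rho>chi _ _ i(1)])
      show "finite (cells K n)" if "n \<le> q" for n using assms(4) q that by simp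
      \<comment> \<open>The two signs cancel: \<open>Sigma_inv\<close> at the negative of
        \<open>chi\<close> refers to the Novikov ring of \<open>chi\<close> itself.\<close>
      show "trivial_group (twisted_homology K U (add_monoid (novikov_ring G chi)) (mult (novikov_ring G chi)) (int i))"
        if "i \<le> q" for i using S that unfolding Sigma_inv_def by simp
    qed (rule no_unit)
    then show False using i(2) by (simp add: char_variety_def)
  qed
qed

end
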